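(* For any field $\mathbf{k}$ (a subfield of $\mathbb{C}$), the assignment $$(W,V_6,V_5,L,\mu,\mathbf{q},\varepsilon)\longmapsto(V_6,V_5,A)$$ described in the context is a functor from the groupoid of lci GM data to the groupoid of Lagrangian data. It induces a bijection between the set of isomorphism classes of ordinary GM data and the set of isomorphism classes of Lagrangian data. If $\mathbf{k}$ is quadratically closed ($\mathbf{k}=\mathbf{k}^{1/2}$), the functor extends (by adding $A_1$ as described in the context) to a bijection between the set of isomorphism classes of lci GM data and the set of isomorphism classes of extended Lagrangian data with $A_1\ne\infty$.
   Context: GM data. A GM data $(W,V_6,V_5,L,\mu,\mathbf{q},\varepsilon)$ of dimension $n$ consists of $\mathbf{k}$-vector spaces $W,V_6,L$ of dimensions $n+5,6,1$, a hyperplane $V_5\subset V_6$, linear maps $\mu:L\otimes W\to\bigwedge^2V_5$ and $\mathbf{q}:V_6\to\mathrm{S}^2W^\vee$, and an isomorphism $\varepsilon:\det(V_5)\to L^{\otimes2}$, such that $\mathbf{q}(v)(w_1,w_2)\,l_1\otimes l_2=\varepsilon(v\wedge\mu(l_1\otimes w_1)\wedge\mu(l_2\otimes w_2))$ for all $v\in V_5$, $w_i\in W$, $l_i\in L$. An isomorphism to $(W',V_6',V_5',L',\mu',\mathbf{q}',\varepsilon')$ is a triple of linear isomorphisms $\varphi_W:W\to W'$, $\varphi_V:V_6\to V_6'$, $\varphi_L:L\to L'$ with $\varphi_V(V_5)=V_5'$, $\varepsilon'\circ\bigwedge^5\varphi_V=\varphi_L^{\otimes2}\circ\varepsilon$,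 $\mathrm{S}^2\varphi_W^\vee\circ\mathbf{q}'\circ\varphi_V=\mathbf{q}$, $\bigwedge^2\varphi_V\circ\mu=\mu'\circ(\varphi_L\otimes\varphi_W)$. Since $L$ is one-dimensional, $\mathrm{Ker}(\mu)$ is regarded as a subspace $W_1\subset W$. A GM data is lci if either $W_1=0$ (the data is then called ordinary), or $\dim W_1=1$ and the point $\mathbb{P}(W_1)$ of $\mathbb{P}(W)$ does not lie on the quadric $Q(v)=\{\mathbf{q}(v)=0\}$ for any $v\in V_6\smallsetminus V_5$ (the data is then called special). For an lci GM data there is a unique complement $W_0$ of $W_1$ in $W$ such that $\mathbf{q}=\mathbf{q}_0+\mathbf{q}_1$ with $\mathbf{q}_i:V_6\to\mathrm{S}^2W_i^\vee$. Lagrangian data. A Lagrangian data $(V_6,V_5,A)$ consists of a $6$-dimensional $\mathbf{k}$-vector space $V_6$, a hyperplane $V_5\subset V_6$, and a Lagrangian subspace $A\subset\bigwedge^3V_6$ for the $\det(V_6)$-valued symplectic form given by wedge product. An isomorphism to $(V_6',V_5',A')$ is a linear isomorphism $\varphi:V_6\to V_6'$ with $\varphi(V_5)=V_5'$ and $(\bigwedge^3\varphi)(A)=A'$. Extended Lagrangian data. Given $(V_6,V_5)$ write $L:=(V_6/V_5)^\vee$ and endow $\mathbf{k}\oplus L$ with its canonical $L$-valued symplectic form. An extended Lagrangian data is $(V_6,V_5,A,A_1)$ with $(V_6,V_5,A)$ a Lagrangian data and $A_1\subset\mathbf{k}\oplus L$ a Lagrangian subspace (a line). An isomorphism is an isomorphism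 of Lagrangian data together with $t\in\mathbb{G}_{\mathrm m}=\mathrm{GL}(L)$ such that $t(A_1)=A_1'$ (with $L$ and $L'$ identified by the isomorphism). One writes $A_1=0$ if $A_1=L$, $A_1=\infty$ if $A_1=\mathbf{k}$, and $A_1=1$ if $A_1\ne\mathbf{k},L$; these are the three $\mathrm{GL}(L)$-orbits. The functor. Given an lci GM data, pick $v_0\in V_6\smallsetminus V_5$ and $0\ne l\in L$. Then $$A:=\{\xi+v_0\wedge\mu(l\otimes w)\mid \xi\in\textstyle\bigwedge^3V_5,\ w\in W_0,\ \varepsilon(\xi\wedge\mu(l\otimes w'))+\mathbf{q}_0(v_0)(w,w')\,l^{\otimes2}=0\ \ \forall w'\in W_0\}\subset\textstyle\bigwedge^3V_6;$$ this does not depend on the choices of $v_0$ and $l$. An isomorphism of GM data is sent to $\varphi_V$. In the extended version, the isomorphism class of $(V_6,V_5,A,A_1)$ is obtained by taking $A_1=0$ if the GM data is ordinary and $A_1=1$ if it is special. *)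

theory Defs
  imports
    "Jordan_Normal_Form.VS_Connect"
    "HOL-Algebra.AbelCoset"
    "HOL-Library.Equipollence"
    "HOL-Library.FuncSet"
begin

section \<open>Linear algebra over a field given as a type\<close>

text \<open>Vector spaces over \<open>'k\<close> are arbitrary records \<open>V :: ('k, 'v) module\<close> with
  \<open>vectorspace class_ring V\<close>. The components \<open>mult\<close> and \<open>one\<close> that module records inherit from
  ring records carry no meaning.\<close>

definition has_dim :: "('k::field, 'v) module \<Rightarrow> nat \<Rightarrow> bool" where
  "has_dim V d \<longleftrightarrow> vectorspace class_ring V \<and> vectorspace.fin_dim class_ring V
     \<and> vectorspace.dim class_ring V = d"

definition hyperplane :: "'v set \<Rightarrow> ('k::field, 'v) module \<Rightarrow> bool" where
  "hyperplane U V \<longleftrightarrow> VectorSpace.subspace class_ring U V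
     \<and> (\<exists>d. has_dim (V\<lparr>carrier := U\<rparr>) d \<and> has_dim V (Suc d))"

definition lin_iso :: "('k::field, 'v) module \<Rightarrow> ('k, 'w) module \<Rightarrow> ('v \<Rightarrow> 'w) \<Rightarrow> bool" where
  "lin_iso V W f \<longleftrightarrow> linear_map class_ring V W f \<and> bij_betw f (carrier V) (carrier W)"

definition scalar_vs :: "('k::field, 'k) module" where
  "scalar_vs = \<lparr>carrier = UNIV, mult = (*), one = 1, zero = 0, add = (+), smult = (*)\<rparr>"

text \<open>Functionals and forms are normalised to vanish outside the carrier, so that equality of
  elements of these spaces is equality of functions.\<close>

definition dual_vs :: "('k::field, 'v) module \<Rightarrow> ('k, 'v \<Rightarrow> 'k) module" where
  "dual_vs V = \<lparr>carrier = {f \<in> LinearCombinations.module_hom class_ring V scalar_vs. \<forall>v. v \<notin> carrier V \<longrightarrow> f v = 0},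
     mult = (\<lambda>f g v. 0), one = (\<lambda>v. 0), zero = (\<lambda>v. 0),
     add = (\<lambda>f g v. f v + g v), smult = (\<lambda>c f v. c * f v)\<rparr>"

text \<open>The space \<open>S\<^sup>2 W\<^sup>\<or>\<close> of symmetric bilinear forms on \<open>W\<close>
  (linearity in the first argument follows by symmetry).\<close>

definition sym_forms :: "('k::field, 'w) module \<Rightarrow> ('k, 'w \<Rightarrow> 'w \<Rightarrow> 'k) module" where
  "sym_forms W = \<lparr>carrier = {b. (\<forall>w. b w \<in> carrier (dual_vs W)) \<and> (\<forall>w w'. b w w' = b w' w)},
     mult = (\<lambda>b c v w. 0), one = (\<lambda>v w. 0), zero = (\<lambda>v w. 0),
     add = (\<lambda>b c v w. b v w + c v w), smult = (\<lambda>a b v w. a * b v w)\<rparr>"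

definition quotient_vs :: "('k::field, 'v) module \<Rightarrow> 'v set \<Rightarrow> ('k, 'v set) module" where
  "quotient_vs V U = \<lparr>carrier = a_rcosets\<^bsub>V\<^esub> U, mult = (\<lambda>A B. U), one = U, zero = U,
     add = set_add V, smult = (\<lambda>c A. \<Union>a\<in>A. U +>\<^bsub>V\<^esub> (c \<odot>\<^bsub>V\<^esub> a))\<rparr>"

definition free_vs :: "'a set \<Rightarrow> ('k::field, 'a \<Rightarrow> 'k) module" where
  "free_vs X = \<lparr>carrier = {f. finite {x. f x \<noteq> 0} \<and> (\<forall>x. x \<notin> X \<longrightarrow> f x = 0)},
     mult = (\<lambda>f g x. 0), one = (\<lambda>x. 0), zero = (\<lambda>x. 0),
     add = (\<lambda>f g x. f x + g x), smult = (\<lambda>c f x. c * f x)\<rparr>"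

definition basis_fun :: "'a \<Rightarrow> 'a \<Rightarrow> 'k::field" where
  "basis_fun x = (\<lambda>y. if y = x then 1 else 0)"

text \<open>The linear map between free vector spaces induced by a map \<open>h\<close> of their bases.\<close>

definition pushforward :: "('a \<Rightarrow> 'b) \<Rightarrow> ('a \<Rightarrow> 'k::field) \<Rightarrow> 'b \<Rightarrow> 'k" where
  "pushforward h f = (\<lambda>y. \<Sum>x | f x \<noteq> 0 \<and> h x = y. f x)"

text \<open>A subspace is Lagrangian if it is its own orthogonal; \<open>z\<close> is the zero of the space in which
  the symplectic form \<open>\<omega>\<close> takes its values.\<close>

definition lagrangian :: "('k::field, 'v) module \<Rightarrow> ('v \<Rightarrow> 'v \<Rightarrow> 'z) \<Rightarrow> 'z \<Rightarrow> 'v set \<Rightarrow> bool" where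
  "lagrangian V \<omega> z A \<longleftrightarrow> VectorSpace.subspace class_ring A V
     \<and> A = {x \<in> carrier V. \<forall>a\<in>A. \<omega> x a = z}"


section \<open>Tensor products\<close>

definition tensor_rels :: "('k::field, 'v) module \<Rightarrow> ('k, 'w) module \<Rightarrow> ('v \<times> 'w \<Rightarrow> 'k) set" where
  "tensor_rels V W =
     {(\<lambda>z. basis_fun (v \<oplus>\<^bsub>V\<^esub> v', w) z - basis_fun (v, w) z - basis_fun (v', w) z) | v v' w.
        v \<in> carrier V \<and> v' \<in> carrier V \<and> w \<in> carrier W}
   \<union> {(\<lambda>z. basis_fun (v, w \<oplus>\<^bsub>W\<^esub> w') z - basis_fun (v, w) z - basis_fun (v, w') z) | v w w'.
        v \<in> carrier V \<and> w \<in> carrier W \<and> w' \<in> carrier W}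
   \<union> {(\<lambda>z. basis_fun (c \<odot>\<^bsub>V\<^esub> v, w) z - c * basis_fun (v, w) z) | c v w.
        v \<in> carrier V \<and> w \<in> carrier W}
   \<union> {(\<lambda>z. basis_fun (v, c \<odot>\<^bsub>W\<^esub> w) z - c * basis_fun (v, w) z) | c v w.
        v \<in> carrier V \<and> w \<in> carrier W}"

definition tensor_null :: "('k::field, 'v) module \<Rightarrow> ('k, 'w) module \<Rightarrow> ('v \<times> 'w \<Rightarrow> 'k) set" where
  "tensor_null V W = LinearCombinations.module.span class_ring
     (free_vs (carrier V \<times> carrier W)) (tensor_rels V W)"

definition tensor_vs ::
  "('k::field, 'v) module \<Rightarrow> ('k, 'w) module \<Rightarrow> ('k, ('v \<times> 'w \<Rightarrow> 'k) set) module" where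
  "tensor_vs V W = quotient_vs (free_vs (carrier V \<times> carrier W)) (tensor_null V W)"

definition tensor_class ::
  "('k::field, 'v) module \<Rightarrow> ('k, 'w) module \<Rightarrow> ('v \<times> 'w \<Rightarrow> 'k) \<Rightarrow> ('v \<times> 'w \<Rightarrow> 'k) set" where
  "tensor_class V W f = tensor_null V W +>\<^bsub>free_vs (carrier V \<times> carrier W)\<^esub> f"

definition pure_tensor ::
  "('k::field, 'v) module \<Rightarrow> ('k, 'w) module \<Rightarrow> 'v \<Rightarrow> 'w \<Rightarrow> ('v \<times> 'w \<Rightarrow> 'k) set" where
  "pure_tensor V W v w = tensor_class V W (basis_fun (v, w))"

text \<open>\<open>f \<otimes> g\<close> with codomain \<open>V' \<otimes> W'\<close>. All representatives of a class have images in the same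
  class, so the union is that class.\<close>

definition tensor_map ::
  "('k::field, 'v2) module \<Rightarrow> ('k, 'w2) module \<Rightarrow> ('v \<Rightarrow> 'v2) \<Rightarrow> ('w \<Rightarrow> 'w2)
    \<Rightarrow> ('v \<times> 'w \<Rightarrow> 'k) set \<Rightarrow> ('v2 \<times> 'w2 \<Rightarrow> 'k) set" where
  "tensor_map V' W' f g X = (\<Union>F\<in>X. tensor_class V' W' (pushforward (map_prod f g) F))"


section \<open>The exterior algebra\<close>

text \<open>The exterior algebra of \<open>V\<close> is the free vector space on the words in \<open>V\<close>, with concatenation
  as product, modulo the ideal generated by the relations that make letters linear and by the words
  \<open>vv\<close>. Since the relations below are taken in the context of arbitrary words \<open>xs\<close>, \<open>ys\<close>, their
  linear span is already a two-sided ideal.\<close>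

definition ext_rels :: "('k::field, 'v) module \<Rightarrow> ('v list \<Rightarrow> 'k) set" where
  "ext_rels V =
     {(\<lambda>z. basis_fun (xs @ (v \<oplus>\<^bsub>V\<^esub> v') # ys) z
            - basis_fun (xs @ v # ys) z - basis_fun (xs @ v' # ys) z) | xs v v' ys.
        xs \<in> lists (carrier V) \<and> v \<in> carrier V \<and> v' \<in> carrier V \<and> ys \<in> lists (carrier V)}
   \<union> {(\<lambda>z. basis_fun (xs @ (c \<odot>\<^bsub>V\<^esub> v) # ys) z - c * basis_fun (xs @ v # ys) z) | xs c v ys.
        xs \<in> lists (carrier V) \<and> v \<in> carrier V \<and> ys \<in> lists (carrier V)}
   \<union> {basis_fun (xs @ v # v # ys) | xs v ys.
        xs \<in> lists (carrier V) \<and> v \<in> carrier V \<and> ys \<in> lists (carrier V)}"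

definition ext_ideal :: "('k::field, 'v) module \<Rightarrow> ('v list \<Rightarrow> 'k) set" where
  "ext_ideal V = LinearCombinations.module.span class_ring
     (free_vs (lists (carrier V))) (ext_rels V)"

definition ext_alg :: "('k::field, 'v) module \<Rightarrow> ('k, ('v list \<Rightarrow> 'k) set) module" where
  "ext_alg V = quotient_vs (free_vs (lists (carrier V))) (ext_ideal V)"

definition ext_class :: "('k::field, 'v) module \<Rightarrow> ('v list \<Rightarrow> 'k) \<Rightarrow> ('v list \<Rightarrow> 'k) set" where
  "ext_class V f = ext_ideal V +>\<^bsub>free_vs (lists (carrier V))\<^esub> f"

definition ext_vec :: "('k::field, 'v) module \<Rightarrow> 'v \<Rightarrow> ('v list \<Rightarrow> 'k) set" where
  "ext_vec V v = ext_class V (basis_fun [v])"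

text \<open>For a subspace \<open>U\<close> of \<open>V\<close>, \<open>ext_pow V U p\<close> is the exterior power \<open>\<And>\<^sup>p U\<close> regarded as a
  subspace of the exterior algebra of \<open>V\<close>; \<open>\<And>\<^sup>p V\<close> itself is the case \<open>U = carrier V\<close>.\<close>

definition ext_pow :: "('k::field, 'v) module \<Rightarrow> 'v set \<Rightarrow> nat \<Rightarrow> ('k, ('v list \<Rightarrow> 'k) set) module" where
  "ext_pow V U p = (ext_alg V)
     \<lparr>carrier := ext_class V ` carrier (free_vs {xs. set xs \<subseteq> U \<and> length xs = p})\<rparr>"

definition word_product :: "('v list \<Rightarrow> 'k::field) \<Rightarrow> ('v list \<Rightarrow> 'k) \<Rightarrow> 'v list \<Rightarrow> 'k" where
  "word_product F G = (\<lambda>zs. \<Sum>i\<le>length zs. F (take i zs) * G (drop i zs))"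

definition wedge :: "('k::field, 'v) module
    \<Rightarrow> ('v list \<Rightarrow> 'k) set \<Rightarrow> ('v list \<Rightarrow> 'k) set \<Rightarrow> ('v list \<Rightarrow> 'k) set" where
  "wedge V X Y = (\<Union>F\<in>X. \<Union>G\<in>Y. ext_class V (word_product F G))"

text \<open>The map of exterior algebras induced by a linear map \<open>f\<close> into \<open>V'\<close>; on the subspace
  \<open>\<And>\<^sup>p U\<close> it is \<open>\<And>\<^sup>p f\<close>.\<close>

definition ext_map :: "('k::field, 'v2) module \<Rightarrow> ('v \<Rightarrow> 'v2)
    \<Rightarrow> ('v list \<Rightarrow> 'k) set \<Rightarrow> ('v2 list \<Rightarrow> 'k) set" where
  "ext_map V' f X = (\<Union>F\<in>X. ext_class V' (pushforward (map f) F))"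


section \<open>Groupoids\<close>

text \<open>\<open>gpd_comp G X Y Z g f\<close> is the composite of \<open>f : X \<rightarrow> Y\<close> and \<open>g : Y \<rightarrow> Z\<close>.\<close>

record ('o, 'm) gpd =
  gpd_obj :: "'o set"
  gpd_hom :: "'o \<Rightarrow> 'o \<Rightarrow> 'm set"
  gpd_id :: "'o \<Rightarrow> 'm"
  gpd_comp :: "'o \<Rightarrow> 'o \<Rightarrow> 'o \<Rightarrow> 'm \<Rightarrow> 'm \<Rightarrow> 'm"

locale groupoid =
  fixes G :: "('o, 'm) gpd"
  assumes id_hom: "X \<in> gpd_obj G \<Longrightarrow> gpd_id G X \<in> gpd_hom G X X"
    and comp_hom:
      "\<lbrakk>X \<in> gpd_obj G; Y \<in> gpd_obj G; Z \<in> gpd_obj G; f \<in> gpd_hom G X Y; g \<in> gpd_hom G Y Z\<rbrakk>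
        \<Longrightarrow> gpd_comp G X Y Z g f \<in> gpd_hom G X Z"
    and comp_id_right:
      "\<lbrakk>X \<in> gpd_obj G; Y \<in> gpd_obj G; f \<in> gpd_hom G X Y\<rbrakk> \<Longrightarrow> gpd_comp G X X Y f (gpd_id G X) = f"
    and comp_id_left:
      "\<lbrakk>X \<in> gpd_obj G; Y \<in> gpd_obj G; f \<in> gpd_hom G X Y\<rbrakk> \<Longrightarrow> gpd_comp G X Y Y (gpd_id G Y) f = f"
    and comp_assoc:
      "\<lbrakk>X \<in> gpd_obj G; Y \<in> gpd_obj G; Z \<in> gpd_obj G; T \<in> gpd_obj G;
        f \<in> gpd_hom G X Y; g \<in> gpd_hom G Y Z; h \<in> gpd_hom G Z T\<rbrakk>
        \<Longrightarrow> gpd_comp G X Z T h (gpd_comp G X Y Z g f) = gpd_comp G X Y T (gpd_comp G Y Z T h g) f"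
    and inverse:
      "\<lbrakk>X \<in> gpd_obj G; Y \<in> gpd_obj G; f \<in> gpd_hom G X Y\<rbrakk>
        \<Longrightarrow> \<exists>g\<in>gpd_hom G Y X. gpd_comp G X Y X g f = gpd_id G X \<and> gpd_comp G Y X Y f g = gpd_id G Y"

locale groupoid_functor = source: groupoid G + target: groupoid H
  for G :: "('o, 'm) gpd" and H :: "('p, 'n) gpd" +
  fixes Fobj :: "'o \<Rightarrow> 'p" and Fhom :: "'o \<Rightarrow> 'o \<Rightarrow> 'm \<Rightarrow> 'n"
  assumes obj: "X \<in> gpd_obj G \<Longrightarrow> Fobj X \<in> gpd_obj H"
    and hom: "\<lbrakk>X \<in> gpd_obj G; Y \<in> gpd_obj G; f \<in> gpd_hom G X Y\<rbrakk>
        \<Longrightarrow> Fhom X Y f \<in> gpd_hom H (Fobj X) (Fobj Y)"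
    and ident: "X \<in> gpd_obj G \<Longrightarrow> Fhom X X (gpd_id G X) = gpd_id H (Fobj X)"
    and comp: "\<lbrakk>X \<in> gpd_obj G; Y \<in> gpd_obj G; Z \<in> gpd_obj G; f \<in> gpd_hom G X Y; g \<in> gpd_hom G Y Z\<rbrakk>
        \<Longrightarrow> Fhom X Z (gpd_comp G X Y Z g f)
          = gpd_comp H (Fobj X) (Fobj Y) (Fobj Z) (Fhom Y Z g) (Fhom X Y f)"

definition gpd_iso_rel :: "('o, 'm) gpd \<Rightarrow> ('o \<times> 'o) set" where
  "gpd_iso_rel G = {(X, Y). X \<in> gpd_obj G \<and> Y \<in> gpd_obj G \<and> gpd_hom G X Y \<noteq> {}}"

definition iso_classes :: "('o, 'm) gpd \<Rightarrow> 'o set set" where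
  "iso_classes G = gpd_obj G // gpd_iso_rel G"

text \<open>The map on isomorphism classes induced by an assignment \<open>Fobj\<close> on objects that respects
  isomorphism.\<close>

definition on_iso_classes :: "('p, 'n) gpd \<Rightarrow> ('o \<Rightarrow> 'p) \<Rightarrow> 'o set \<Rightarrow> 'p set" where
  "on_iso_classes H Fobj C = (\<Union>X\<in>C. gpd_iso_rel H `` {Fobj X})"


section \<open>GM data\<close>

record ('k, 'w, 'v, 'l) gm_data =
  gm_W :: "('k, 'w) module"
  gm_V6 :: "('k, 'v) module"
  gm_V5 :: "'v set"
  gm_L :: "('k, 'l) module"
  gm_mu :: "('l \<times> 'w \<Rightarrow> 'k) set \<Rightarrow> ('v list \<Rightarrow> 'k) set"
  gm_q :: "'v \<Rightarrow> 'w \<Rightarrow> 'w \<Rightarrow> 'k"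
  gm_eps :: "('v list \<Rightarrow> 'k) set \<Rightarrow> ('l \<times> 'l \<Rightarrow> 'k) set"

text \<open>\<open>\<mu>(l \<otimes> w)\<close>\<close>

definition gm_mu_pure :: "('k::field, 'w, 'v, 'l) gm_data \<Rightarrow> 'l \<Rightarrow> 'w \<Rightarrow> ('v list \<Rightarrow> 'k) set" where
  "gm_mu_pure D l w = gm_mu D (pure_tensor (gm_L D) (gm_W D) l w)"

definition is_gm_data_of_dim :: "int \<Rightarrow> ('k::field, 'w, 'v, 'l) gm_data \<Rightarrow> bool" where
  "is_gm_data_of_dim n D \<longleftrightarrow>
     (\<exists>d. has_dim (gm_W D) d \<and> int d = n + 5)
   \<and> has_dim (gm_V6 D) 6 \<and> hyperplane (gm_V5 D) (gm_V6 D) \<and> has_dim (gm_L D) 1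
   \<and> linear_map class_ring (tensor_vs (gm_L D) (gm_W D)) (ext_pow (gm_V6 D) (gm_V5 D) 2) (gm_mu D)
   \<and> linear_map class_ring (gm_V6 D) (sym_forms (gm_W D)) (gm_q D)
   \<and> lin_iso (ext_pow (gm_V6 D) (gm_V5 D) 5) (tensor_vs (gm_L D) (gm_L D)) (gm_eps D)
   \<and> (\<forall>v\<in>gm_V5 D. \<forall>w1\<in>carrier (gm_W D). \<forall>w2\<in>carrier (gm_W D).
        \<forall>l1\<in>carrier (gm_L D). \<forall>l2\<in>carrier (gm_L D).
        gm_q D v w1 w2 \<odot>\<^bsub>tensor_vs (gm_L D) (gm_L D)\<^esub> pure_tensor (gm_L D) (gm_L D) l1 l2
        = gm_eps D (wedge (gm_V6 D) (ext_vec (gm_V6 D) v)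
            (wedge (gm_V6 D) (gm_mu_pure D l1 w1) (gm_mu_pure D l2 w2))))"

definition is_gm_data :: "('k::field, 'w, 'v, 'l) gm_data \<Rightarrow> bool" where
  "is_gm_data D \<longleftrightarrow> (\<exists>n. is_gm_data_of_dim n D)"

text \<open>Morphisms are triples \<open>(\<phi>\<^sub>W, \<phi>\<^sub>V, \<phi>\<^sub>L)\<close>. Linear maps occurring as morphisms are
  extensional functions on the carriers, so that composition is associative and unital on the nose.\<close>

definition gm_iso :: "('k::field, 'w, 'v, 'l) gm_data \<Rightarrow> ('k, 'w, 'v, 'l) gm_data
    \<Rightarrow> (('w \<Rightarrow> 'w) \<times> ('v \<Rightarrow> 'v) \<times> ('l \<Rightarrow> 'l)) set" where
  "gm_iso D D' = {(f, g, h).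
     f \<in> extensional (carrier (gm_W D)) \<and> lin_iso (gm_W D) (gm_W D') f
   \<and> g \<in> extensional (carrier (gm_V6 D)) \<and> lin_iso (gm_V6 D) (gm_V6 D') g
   \<and> h \<in> extensional (carrier (gm_L D)) \<and> lin_iso (gm_L D) (gm_L D') h
   \<and> g ` gm_V5 D = gm_V5 D'
   \<and> (\<forall>x\<in>carrier (ext_pow (gm_V6 D) (gm_V5 D) 5).
        gm_eps D' (ext_map (gm_V6 D') g x) = tensor_map (gm_L D') (gm_L D') h h (gm_eps D x))
   \<and> (\<forall>v\<in>carrier (gm_V6 D). \<forall>w\<in>carrier (gm_W D). \<forall>w'\<in>carrier (gm_W D).
        gm_q D' (g v) (f w) (f w') = gm_q D v w w')
   \<and> (\<forall>x\<in>carrier (tensor_vs (gm_L D) (gm_W D)).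
        ext_map (gm_V6 D') g (gm_mu D x) = gm_mu D' (tensor_map (gm_L D') (gm_W D') h f x))}"

definition gm_W1 :: "('k::field, 'w, 'v, 'l) gm_data \<Rightarrow> 'w set" where
  "gm_W1 D = {w \<in> carrier (gm_W D). \<forall>l\<in>carrier (gm_L D). gm_mu_pure D l w = \<zero>\<^bsub>ext_alg (gm_V6 D)\<^esub>}"

definition gm_ordinary :: "('k::field, 'w, 'v, 'l) gm_data \<Rightarrow> bool" where
  "gm_ordinary D \<longleftrightarrow> gm_W1 D = {\<zero>\<^bsub>gm_W D\<^esub>}"

text \<open>For a line \<open>U\<close> in \<open>W\<close>, the condition \<open>\<forall>w\<in>U. q(v)(w, w) = 0\<close> says that the point \<open>P(U)\<close> of
  \<open>P(W)\<close> lies on the quadric \<open>Q(v)\<close>.\<close>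

definition gm_special :: "('k::field, 'w, 'v, 'l) gm_data \<Rightarrow> bool" where
  "gm_special D \<longleftrightarrow> has_dim ((gm_W D)\<lparr>carrier := gm_W1 D\<rparr>) 1
     \<and> (\<forall>v \<in> carrier (gm_V6 D) - gm_V5 D. \<not> (\<forall>w\<in>gm_W1 D. gm_q D v w w = 0))"

definition gm_lci :: "('k::field, 'w, 'v, 'l) gm_data \<Rightarrow> bool" where
  "gm_lci D \<longleftrightarrow> gm_ordinary D \<or> gm_special D"

definition gm_splitting :: "('k::field, 'w, 'v, 'l) gm_data \<Rightarrow> 'w set \<Rightarrow> bool" where
  "gm_splitting D W0 \<longleftrightarrow>
     VectorSpace.subspace class_ring W0 (gm_W D)
   \<and> W0 \<inter> gm_W1 D = {\<zero>\<^bsub>gm_W D\<^esub>} \<and> W0 <+>\<^bsub>gm_W D\<^esub> gm_W1 D = carrier (gm_W D)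
   \<and> (\<exists>q0 q1. linear_map class_ring (gm_V6 D) (sym_forms ((gm_W D)\<lparr>carrier := W0\<rparr>)) q0
        \<and> linear_map class_ring (gm_V6 D) (sym_forms ((gm_W D)\<lparr>carrier := gm_W1 D\<rparr>)) q1
        \<and> (\<forall>v\<in>carrier (gm_V6 D). \<forall>a\<in>W0. \<forall>b\<in>gm_W1 D. \<forall>a'\<in>W0. \<forall>b'\<in>gm_W1 D.
             gm_q D v (a \<oplus>\<^bsub>gm_W D\<^esub> b) (a' \<oplus>\<^bsub>gm_W D\<^esub> b') = q0 v a a' + q1 v b b'))"

text \<open>For lci GM data there is exactly one such complement.\<close>

definition gm_W0 :: "('k::field, 'w, 'v, 'l) gm_data \<Rightarrow> 'w set" where
  "gm_W0 D = (THE W0. gm_splitting D W0)"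

text \<open>The objects of the groupoids below have carriers in fixed types \<open>'w\<close>, \<open>'v\<close>, \<open>'l\<close>, which play the
  role of universes. Every finite-dimensional space over an infinite field \<open>'k\<close> has an isomorphic copy
  with carrier in a given type as soon as \<open>'k\<close> injects into that type.\<close>

definition id_on :: "('k, 'a) module \<Rightarrow> 'a \<Rightarrow> 'a" where
  "id_on V = (\<lambda>x\<in>carrier V. x)"

definition gm_groupoid :: "(('k::field, 'w, 'v, 'l) gm_data \<Rightarrow> bool) \<Rightarrow>
    (('k, 'w, 'v, 'l) gm_data, ('w \<Rightarrow> 'w) \<times> ('v \<Rightarrow> 'v) \<times> ('l \<Rightarrow> 'l)) gpd" where
  "gm_groupoid P = \<lparr>gpd_obj = {D. is_gm_data D \<and> P D}, gpd_hom = gm_iso,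
     gpd_id = (\<lambda>D. (id_on (gm_W D), id_on (gm_V6 D), id_on (gm_L D))),
     gpd_comp = (\<lambda>D D' D'' (f', g', h') (f, g, h).
       (compose (carrier (gm_W D)) f' f, compose (carrier (gm_V6 D)) g' g,
        compose (carrier (gm_L D)) h' h))\<rparr>"


section \<open>Lagrangian data\<close>

record ('k, 'v) lag_data =
  lag_V6 :: "('k, 'v) module"
  lag_V5 :: "'v set"
  lag_A :: "('v list \<Rightarrow> 'k) set set"

definition is_lag_data :: "('k::field, 'v) lag_data \<Rightarrow> bool" where
  "is_lag_data \<Lambda> \<longleftrightarrow> has_dim (lag_V6 \<Lambda>) 6 \<and> hyperplane (lag_V5 \<Lambda>) (lag_V6 \<Lambda>)
     \<and> lagrangian (ext_pow (lag_V6 \<Lambda>) (carrier (lag_V6 \<Lambda>)) 3) (wedge (lag_V6 \<Lambda>))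
         \<zero>\<^bsub>ext_alg (lag_V6 \<Lambda>)\<^esub> (lag_A \<Lambda>)"

definition lag_iso :: "('k::field, 'v) lag_data \<Rightarrow> ('k, 'v) lag_data \<Rightarrow> ('v \<Rightarrow> 'v) set" where
  "lag_iso \<Lambda> \<Lambda>' = {g \<in> extensional (carrier (lag_V6 \<Lambda>)). lin_iso (lag_V6 \<Lambda>) (lag_V6 \<Lambda>') g
     \<and> g ` lag_V5 \<Lambda> = lag_V5 \<Lambda>' \<and> ext_map (lag_V6 \<Lambda>') g ` lag_A \<Lambda> = lag_A \<Lambda>'}"

definition lag_groupoid :: "(('k::field, 'v) lag_data, 'v \<Rightarrow> 'v) gpd" where
  "lag_groupoid = \<lparr>gpd_obj = {\<Lambda>. is_lag_data \<Lambda>}, gpd_hom = lag_iso,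
     gpd_id = (\<lambda>\<Lambda>. id_on (lag_V6 \<Lambda>)),
     gpd_comp = (\<lambda>\<Lambda> \<Lambda>' \<Lambda>'' g' g. compose (carrier (lag_V6 \<Lambda>)) g' g)\<rparr>"


section \<open>From lci GM data to Lagrangian data\<close>

text \<open>On \<open>W\<^sub>0\<close> the form \<open>q\<^sub>0(v\<^sub>0)\<close> is the restriction of \<open>q(v\<^sub>0)\<close>.\<close>

definition gm_A_of :: "('k::field, 'w, 'v, 'l) gm_data \<Rightarrow> 'v \<Rightarrow> 'l \<Rightarrow> ('v list \<Rightarrow> 'k) set set" where
  "gm_A_of D v0 l =
     {\<xi> \<oplus>\<^bsub>ext_alg (gm_V6 D)\<^esub> wedge (gm_V6 D) (ext_vec (gm_V6 D) v0) (gm_mu_pure D l w) | \<xi> w.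
        \<xi> \<in> carrier (ext_pow (gm_V6 D) (gm_V5 D) 3) \<and> w \<in> gm_W0 D
      \<and> (\<forall>w'\<in>gm_W0 D.
           gm_eps D (wedge (gm_V6 D) \<xi> (gm_mu_pure D l w'))
           \<oplus>\<^bsub>tensor_vs (gm_L D) (gm_L D)\<^esub>
           gm_q D v0 w w' \<odot>\<^bsub>tensor_vs (gm_L D) (gm_L D)\<^esub> pure_tensor (gm_L D) (gm_L D) l l
           = \<zero>\<^bsub>tensor_vs (gm_L D) (gm_L D)\<^esub>)}"

definition gm_choice :: "('k::field, 'w, 'v, 'l) gm_data \<Rightarrow> 'v \<Rightarrow> 'l \<Rightarrow> bool" where
  "gm_choice D v0 l \<longleftrightarrow> v0 \<in> carrier (gm_V6 D) - gm_V5 D \<and> l \<in> carrier (gm_L D) - {\<zero>\<^bsub>gm_L D\<^esub>}"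

definition gm_A :: "('k::field, 'w, 'v, 'l) gm_data \<Rightarrow> ('v list \<Rightarrow> 'k) set set" where
  "gm_A D = (case (SOME (v0, l). gm_choice D v0 l) of (v0, l) \<Rightarrow> gm_A_of D v0 l)"

definition gm_to_lag :: "('k::field, 'w, 'v, 'l) gm_data \<Rightarrow> ('k, 'v) lag_data" where
  "gm_to_lag D = \<lparr>lag_V6 = gm_V6 D, lag_V5 = gm_V5 D, lag_A = gm_A D\<rparr>"

definition gm_iso_to_lag :: "('k::field, 'w, 'v, 'l) gm_data \<Rightarrow> ('k, 'w, 'v, 'l) gm_data
    \<Rightarrow> ('w \<Rightarrow> 'w) \<times> ('v \<Rightarrow> 'v) \<times> ('l \<Rightarrow> 'l) \<Rightarrow> 'v \<Rightarrow> 'v" where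
  "gm_iso_to_lag D D' = (\<lambda>(f, g, h). g)"


section \<open>Extended Lagrangian data\<close>

text \<open>\<open>L = (V\<^sub>6/V\<^sub>5)\<^sup>\<or>\<close> and \<open>k \<oplus> L\<close> with the \<open>L\<close>-valued form
  \<open>((a, x), (b, y)) \<mapsto> a y - b x\<close>. An extended Lagrangian data is a pair of a Lagrangian data and \<open>A\<^sub>1\<close>.\<close>

type_synonym ('k, 'v) ext_lag_data = "('k, 'v) lag_data \<times> ('k \<times> ('v set \<Rightarrow> 'k)) set"

definition lag_L :: "('k::field, 'v) lag_data \<Rightarrow> ('k, 'v set \<Rightarrow> 'k) module" where
  "lag_L \<Lambda> = dual_vs (quotient_vs (lag_V6 \<Lambda>) (lag_V5 \<Lambda>))"

definition lag_kL :: "('k::field, 'v) lag_data \<Rightarrow> ('k, 'k \<times> ('v set \<Rightarrow> 'k)) module" where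
  "lag_kL \<Lambda> = direct_sum scalar_vs (lag_L \<Lambda>)"

definition kL_form :: "'k::field \<times> ('v set \<Rightarrow> 'k) \<Rightarrow> 'k \<times> ('v set \<Rightarrow> 'k) \<Rightarrow> 'v set \<Rightarrow> 'k" where
  "kL_form = (\<lambda>(a, x) (b, y). (\<lambda>C. a * y C - b * x C))"

definition is_ext_lag_data :: "('k::field, 'v) ext_lag_data \<Rightarrow> bool" where
  "is_ext_lag_data E \<longleftrightarrow> is_lag_data (fst E)
     \<and> lagrangian (lag_kL (fst E)) kL_form \<zero>\<^bsub>lag_L (fst E)\<^esub> (snd E)"

text \<open>The identification of \<open>L\<close> with \<open>L'\<close> given by an isomorphism \<open>g\<close>: the inverse transpose of the map
  \<open>V\<^sub>6/V\<^sub>5 \<rightarrow> V'\<^sub>6/V'\<^sub>5\<close> induced by \<open>g\<close>, under which a coset \<open>C\<close> has preimage \<open>{v. g v \<in> C}\<close>.\<close>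

definition lag_L_map :: "('k::field, 'v) lag_data \<Rightarrow> ('k, 'v) lag_data \<Rightarrow> ('v \<Rightarrow> 'v)
    \<Rightarrow> ('v set \<Rightarrow> 'k) \<Rightarrow> 'v set \<Rightarrow> 'k" where
  "lag_L_map \<Lambda> \<Lambda>' g x = (\<lambda>C. if C \<in> carrier (quotient_vs (lag_V6 \<Lambda>') (lag_V5 \<Lambda>'))
     then x {v \<in> carrier (lag_V6 \<Lambda>). g v \<in> C} else 0)"

text \<open>The group \<open>GL(L)\<close> is the multiplicative group of the field; \<open>t\<close> acts on \<open>k \<oplus> L\<close> through \<open>L\<close>.\<close>

definition ext_lag_iso :: "('k::field, 'v) ext_lag_data \<Rightarrow> ('k, 'v) ext_lag_data
    \<Rightarrow> (('v \<Rightarrow> 'v) \<times> 'k) set" where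
  "ext_lag_iso E E' = {(g, t). g \<in> lag_iso (fst E) (fst E') \<and> t \<noteq> 0
     \<and> (\<lambda>(a, x). (a, t \<odot>\<^bsub>lag_L (fst E')\<^esub> lag_L_map (fst E) (fst E') g x)) ` snd E = snd E'}"

text \<open>The cases \<open>A\<^sub>1 = L\<close>, \<open>A\<^sub>1 = k\<close> and \<open>A\<^sub>1 \<noteq> k, L\<close>, written \<open>A\<^sub>1 = 0\<close>, \<open>A\<^sub>1 = \<infinity>\<close> and \<open>A\<^sub>1 = 1\<close>.\<close>

definition A1_zero :: "('k::field, 'v) ext_lag_data \<Rightarrow> bool" where
  "A1_zero E \<longleftrightarrow> snd E = {0} \<times> carrier (lag_L (fst E))"

definition A1_infinity :: "('k::field, 'v) ext_lag_data \<Rightarrow> bool" where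
  "A1_infinity E \<longleftrightarrow> snd E = UNIV \<times> {\<zero>\<^bsub>lag_L (fst E)\<^esub>}"

definition A1_one :: "('k::field, 'v) ext_lag_data \<Rightarrow> bool" where
  "A1_one E \<longleftrightarrow> \<not> A1_zero E \<and> \<not> A1_infinity E"

definition ext_lag_groupoid :: "(('k::field, 'v) ext_lag_data \<Rightarrow> bool)
    \<Rightarrow> (('k, 'v) ext_lag_data, ('v \<Rightarrow> 'v) \<times> 'k) gpd" where
  "ext_lag_groupoid P = \<lparr>gpd_obj = {E. is_ext_lag_data E \<and> P E}, gpd_hom = ext_lag_iso,
     gpd_id = (\<lambda>E. (id_on (lag_V6 (fst E)), 1)),
     gpd_comp = (\<lambda>E E' E'' (g', t') (g, t). (compose (carrier (lag_V6 (fst E))) g' g, t' * t))\<rparr>"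

text \<open>In the special case only the isomorphism class of \<open>(V\<^sub>6, V\<^sub>5, A, A\<^sub>1)\<close> is determined, so the
  extension is defined on isomorphism classes.\<close>

definition gm_ext_lag :: "('k::field, 'w, 'v, 'l) gm_data \<Rightarrow> ('k, 'v) ext_lag_data \<Rightarrow> bool" where
  "gm_ext_lag D E \<longleftrightarrow> is_ext_lag_data E \<and> fst E = gm_to_lag D
     \<and> (gm_ordinary D \<longrightarrow> A1_zero E) \<and> (gm_special D \<longrightarrow> A1_one E)"

definition gm_ext_on_classes :: "('k::field, 'w, 'v, 'l) gm_data set \<Rightarrow> ('k, 'v) ext_lag_data set" where
  "gm_ext_on_classes C =
     (\<Union>D\<in>C. gpd_iso_rel (ext_lag_groupoid (\<lambda>E. True)) `` {E. gm_ext_lag D E})"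

end

theory Submission
  imports Defs
begin

text \<open>Fix \<open>v\<^sub>0 \<in> V\<^sub>6 - V\<^sub>5\<close>. Since \<open>\<And>\<^sup>3V\<^sub>6 = \<And>\<^sup>3V\<^sub>5 \<oplus> v\<^sub>0 \<and> \<And>\<^sup>2V\<^sub>5\<close> is a decomposition into Lagrangian subspaces
  paired perfectly by the wedge product into \<open>\<And>\<^sup>5V\<^sub>5\<close>, a Lagrangian subspace \<open>A\<close> is the same thing as
  its projection \<open>M \<subseteq> \<And>\<^sup>2V\<^sub>5\<close> together with a quadratic form on \<open>M\<close>. For an lci GM data \<open>W\<^sub>0\<close> is the
  orthogonal of \<open>W\<^sub>1\<close> under \<open>q(v\<^sub>0)\<close>, the map \<open>\<mu>\<close> identifies it with \<open>M\<close> and \<open>q(v\<^sub>0)\<close> with the quadratic form,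
  and \<open>q\<close> on \<open>V\<^sub>5\<close> is determined by \<open>\<mu>\<close> and \<open>\<epsilon>\<close>; so the Lagrangian data recovers \<open>W\<^sub>0\<close>, \<open>\<mu>\<close> and \<open>q\<^sub>0\<close>.
  An isomorphism of Lagrangian data lifts once it is rescaled to respect \<open>\<epsilon>\<close>. In the special case there
  remains the line \<open>W\<^sub>1\<close> with a nonzero quadratic form, which is unique up to isomorphism when every
  scalar is a square.\<close>

section \<open>Linear algebra\<close>

text \<open>Once a generator l of L is chosen, l \<otimes> l is a basis of the line L \<otimes> L,
  so \<epsilon> becomes a linear form and the axioms and isomorphism conditions become identities of
  scalars; the argument runs in that form. Tensor products and exterior algebras are quotients of
  free spaces on pairs and on words. Generating sets are easy there; the obstacle is to show that
  the quotient has not collapsed. For tensor products this is done with products of functionals. For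
  the exterior algebra a single functional, the determinant of words of length six, does it: it
  shows that the product of v0 with a basis of V5 is nonzero, and the perfect pairing of the second
  and third exterior powers of V5 follows by multiplying basis monomials with their complements.
  Surjectivity also has to place W and L in prescribed types. A finite-dimensional space over an
  infinite field has at most as many vectors as the field has elements, so an injection of the field
  into the type suffices; that the field is infinite is what its embedding into the complex numbers
  contributes.\<close>

abbreviation lin :: "('k::field, 'v) module \<Rightarrow> ('k, 'w) module \<Rightarrow> ('v \<Rightarrow> 'w) \<Rightarrow> bool" where
  "lin \<equiv> linear_map class_ring"

abbreviation subsp :: "'v set \<Rightarrow> ('k::field, 'v) module \<Rightarrow> bool" where
  "subsp \<equiv> VectorSpace.subspace class_ring"

text \<open>The laws of \<open>vectorspace class_ring V\<close> are stated with the operations of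
  the record \<open>class_ring\<close>. They are restated here with the operations of the type
  \<open>'k\<close>, so that scalar arithmetic is left to the simplifier.\<close>

locale kspace =
  fixes V :: "('k::field, 'v) module" (structure)
  assumes vs: "vectorspace class_ring V"
begin

interpretation V: vectorspace class_ring V by (rule vs)

lemma zeroC[simp]: "\<zero> \<in> carrier V" by simp
lemma addC[simp]: "x \<in> carrier V \<Longrightarrow> y \<in> carrier V \<Longrightarrow> x \<oplus> y \<in> carrier V" by simp
lemma smultC[simp]: "x \<in> carrier V \<Longrightarrow> c \<odot> x \<in> carrier V"
  using V.smult_closed[of c x] by simp
lemma assoc: "x \<in> carrier V \<Longrightarrow> y \<in> carrier V \<Longrightarrow> z \<in> carrier V \<Longrightarrow> x \<oplus> y \<oplus> z = x \<oplus> (y \<oplus> z)"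
  by (rule V.a_assoc)
lemma comm: "x \<in> carrier V \<Longrightarrow> y \<in> carrier V \<Longrightarrow> x \<oplus> y = y \<oplus> x"
  by (rule V.a_comm)
lemma lcomm: "x \<in> carrier V \<Longrightarrow> y \<in> carrier V \<Longrightarrow> z \<in> carrier V \<Longrightarrow> x \<oplus> (y \<oplus> z) = y \<oplus> (x \<oplus> z)"
  by (rule V.a_lcomm)
lemmas ac = assoc comm lcomm
lemma add0[simp]: "x \<in> carrier V \<Longrightarrow> x \<oplus> \<zero> = x" by simp
lemma zero_add[simp]: "x \<in> carrier V \<Longrightarrow> \<zero> \<oplus> x = x" by simp
lemma smult_add: "x \<in> carrier V \<Longrightarrow> y \<in> carrier V \<Longrightarrow> c \<odot> (x \<oplus> y) = c \<odot> x \<oplus> c \<odot> y"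
  using V.smult_r_distr[of c x y] by simp
lemma add_smult: "x \<in> carrier V \<Longrightarrow> (a + b) \<odot> x = a \<odot> x \<oplus> b \<odot> x"
  using V.smult_l_distr[of a b x] by simp
lemma smult_smult[simp]: "x \<in> carrier V \<Longrightarrow> a \<odot> (b \<odot> x) = (a * b) \<odot> x"
  using V.smult_assoc1[of a b x] by simp
lemma one_smult[simp]: "x \<in> carrier V \<Longrightarrow> 1 \<odot> x = x"
  using V.smult_one[of x] by simp
lemma zero_smult[simp]: "x \<in> carrier V \<Longrightarrow> 0 \<odot> x = \<zero>"
  using V.smult_l_null[of x] by simp
lemma smult_zero[simp]: "c \<odot> \<zero> = \<zero>"
  using V.smult_r_null[of c] by simp
lemma add_neg[simp]: "x \<in> carrier V \<Longrightarrow> x \<oplus> (- 1) \<odot> x = \<zero>"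
  using add_smult[of x 1 "-1"] by simp
lemma cancel[simp]: "x \<in> carrier V \<Longrightarrow> y \<in> carrier V \<Longrightarrow> z \<in> carrier V \<Longrightarrow> x \<oplus> y = x \<oplus> z \<longleftrightarrow> y = z"
  using V.add.l_cancel_one V.add.inv_solve_left' V.a_assoc V.l_neg by (metis V.a_inv_closed V.l_zero)
lemma eq_iff_diff: "x \<in> carrier V \<Longrightarrow> y \<in> carrier V \<Longrightarrow> x = y \<longleftrightarrow> x \<oplus> (- 1) \<odot> y = \<zero>"
  by (metis add_neg comm cancel smultC)
lemma smult_eq_0_iff: "x \<in> carrier V \<Longrightarrow> c \<odot> x = \<zero> \<longleftrightarrow> c = 0 \<or> x = \<zero>"
proof
  assume x: "x \<in> carrier V" and "c \<odot> x = \<zero>"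
  then have "inverse c \<odot> (c \<odot> x) = \<zero>" by simp
  with x show "c = 0 \<or> x = \<zero>" by (cases "c = 0") auto
qed auto
lemma smult_cancel: "x \<in> carrier V \<Longrightarrow> x \<noteq> \<zero> \<Longrightarrow> c \<odot> x = d \<odot> x \<longleftrightarrow> c = d"
proof
  assume x: "x \<in> carrier V" "x \<noteq> \<zero>" and "c \<odot> x = d \<odot> x"
  then have "c \<odot> x \<oplus> (- d) \<odot> x = \<zero>" using add_smult[of x d "-d"] by simp
  then have "(c - d) \<odot> x = \<zero>" using add_smult[of x c "-d"] x by simp
  then show "c = d" using smult_eq_0_iff[of x "c - d"] x by simp
qed auto

lemma subspace_iff: "subsp U V \<longleftrightarrow>
   U \<subseteq> carrier V \<and> \<zero> \<in> U \<and> (\<forall>x\<in>U. \<forall>y\<in>U. x \<oplus> y \<in> U) \<and> (\<forall>c. \<forall>x\<in>U. c \<odot> x \<in> U)"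
  using vs V.module_axioms
  unfolding VectorSpace.subspace_def submodule_def by auto

lemma carrier_subspace: "subsp (carrier V) V"
  by (simp add: subspace_iff)

lemma subspace_kspace: "subsp U V \<Longrightarrow> kspace (V\<lparr>carrier := U\<rparr>)"
  by (simp add: kspace_def V.subspace_is_vs)

lemma zero_subspace: "subsp {\<zero>} V"
  by (simp add: subspace_iff)

end

text \<open>Additive inverses are not among the premises: \<open>(- 1) \<odot> x\<close> is one, by
  distributivity and the laws for the scalars 0 and 1.\<close>

lemma kspaceI:
  assumes "\<zero>\<^bsub>V\<^esub> \<in> carrier V"
    and "\<And>x y. x \<in> carrier V \<Longrightarrow> y \<in> carrier V \<Longrightarrow> x \<oplus>\<^bsub>V\<^esub> y \<in> carrier V"
    and "\<And>c x. x \<in> carrier V \<Longrightarrow> c \<odot>\<^bsub>V\<^esub> x \<in> carrier V"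
    and "\<And>x y z. x \<in> carrier V \<Longrightarrow> y \<in> carrier V \<Longrightarrow> z \<in> carrier V \<Longrightarrow>
      x \<oplus>\<^bsub>V\<^esub> y \<oplus>\<^bsub>V\<^esub> z = x \<oplus>\<^bsub>V\<^esub> (y \<oplus>\<^bsub>V\<^esub> z)"
    and "\<And>x y. x \<in> carrier V \<Longrightarrow> y \<in> carrier V \<Longrightarrow> x \<oplus>\<^bsub>V\<^esub> y = y \<oplus>\<^bsub>V\<^esub> x"
    and "\<And>x. x \<in> carrier V \<Longrightarrow> x \<oplus>\<^bsub>V\<^esub> \<zero>\<^bsub>V\<^esub> = x"
    and "\<And>x. x \<in> carrier V \<Longrightarrow> 0 \<odot>\<^bsub>V\<^esub> x = \<zero>\<^bsub>V\<^esub>"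
    and "\<And>x. x \<in> carrier V \<Longrightarrow> 1 \<odot>\<^bsub>V\<^esub> x = x"
    and "\<And>a b x. x \<in> carrier V \<Longrightarrow> (a * b) \<odot>\<^bsub>V\<^esub> x = a \<odot>\<^bsub>V\<^esub> (b \<odot>\<^bsub>V\<^esub> x)"
    and d: "\<And>a b x. x \<in> carrier V \<Longrightarrow> (a + b) \<odot>\<^bsub>V\<^esub> x = a \<odot>\<^bsub>V\<^esub> x \<oplus>\<^bsub>V\<^esub> b \<odot>\<^bsub>V\<^esub> x"
    and "\<And>a x y. x \<in> carrier V \<Longrightarrow> y \<in> carrier V \<Longrightarrow> a \<odot>\<^bsub>V\<^esub> (x \<oplus>\<^bsub>V\<^esub> y) = a \<odot>\<^bsub>V\<^esub> x \<oplus>\<^bsub>V\<^esub> a \<odot>\<^bsub>V\<^esub> y"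
  shows "kspace (V :: ('k::field, 'v) module)"
proof (rule kspace.intro)
  have "\<exists>y\<in>carrier V. x \<oplus>\<^bsub>V\<^esub> y = \<zero>\<^bsub>V\<^esub>" if "x \<in> carrier V" for x
    by (rule bexI[of _ "(- 1) \<odot>\<^bsub>V\<^esub> x"]) (use that assms d[of x 1 "-1"] in auto)
  then show "vectorspace class_ring V"
    using assms by (intro vs_criteria class_field) (auto simp: class_ring_simps)
qed

section \<open>Linear maps and isomorphisms\<close>

lemma linear_map_iff: "lin V W f \<longleftrightarrow> kspace V \<and> kspace W \<and>
   (\<forall>x\<in>carrier V. f x \<in> carrier W) \<and>
   (\<forall>x\<in>carrier V. \<forall>y\<in>carrier V. f (x \<oplus>\<^bsub>V\<^esub> y) = f x \<oplus>\<^bsub>W\<^esub> f y) \<and>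
   (\<forall>c. \<forall>x\<in>carrier V. f (c \<odot>\<^bsub>V\<^esub> x) = c \<odot>\<^bsub>W\<^esub> f x)"
  unfolding linear_map_def kspace_def mod_hom_def mod_hom_axioms_def LinearCombinations.module_hom_def
  by (auto simp: vectorspace_def Pi_iff)

lemma
  assumes "lin V W f"
  shows linear_map_closed: "x \<in> carrier V \<Longrightarrow> f x \<in> carrier W"
    and linear_map_add: "x \<in> carrier V \<Longrightarrow> y \<in> carrier V \<Longrightarrow> f (x \<oplus>\<^bsub>V\<^esub> y) = f x \<oplus>\<^bsub>W\<^esub> f y"
    and linear_map_smult: "x \<in> carrier V \<Longrightarrow> f (c \<odot>\<^bsub>V\<^esub> x) = c \<odot>\<^bsub>W\<^esub> f x"
    and linear_map_dom: "kspace V"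
    and linear_map_cod: "kspace W"
  using assms unfolding linear_map_iff by auto

lemma linear_map_zero: "lin V W f \<Longrightarrow> f \<zero>\<^bsub>V\<^esub> = \<zero>\<^bsub>W\<^esub>"
  using linear_map_smult[of V W f "\<zero>\<^bsub>V\<^esub>" 0] linear_map_closed[of V W f "\<zero>\<^bsub>V\<^esub>"]
  by (simp add: kspace.zeroC kspace.zero_smult linear_map_dom linear_map_cod)

lemma linear_map_compose:
  assumes "lin V W f" "lin W X g"
  shows "lin V X (\<lambda>x. g (f x))"
  using assms unfolding linear_map_iff by auto

lemma linear_map_cong:
  assumes "lin V W f" "\<And>x. x \<in> carrier V \<Longrightarrow> f x = g x"
  shows "lin V W g"
  using assms unfolding linear_map_iff
  by (auto simp: kspace.addC kspace.smultC)

lemma linear_map_preimage_subspace: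
  assumes "lin V W f" "subsp U W"
  shows "subsp {x \<in> carrier V. f x \<in> U} V"
proof -
  interpret V: kspace V using assms(1) by (rule linear_map_dom)
  interpret W: kspace W using assms(1) by (rule linear_map_cod)
  show ?thesis using assms linear_map_zero[OF assms(1)]
    unfolding V.subspace_iff W.subspace_iff by (auto simp: linear_map_add linear_map_smult)
qed

lemma linear_map_image_subspace:
  assumes f: "lin V W f" and U: "subsp U V"
  shows "subsp (f ` U) W"
proof -
  interpret V: kspace V using assms(1) by (rule linear_map_dom)
  interpret W: kspace W using assms(1) by (rule linear_map_cod)
  have U': "U \<subseteq> carrier V" "\<zero>\<^bsub>V\<^esub> \<in> U" "\<And>x y. x \<in> U \<Longrightarrow> y \<in> U \<Longrightarrow> x \<oplus>\<^bsub>V\<^esub> y \<in> U" "\<And>c x. x \<in> U \<Longrightarrow> c \<odot>\<^bsub>V\<^esub> x \<in> U"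
    using U unfolding V.subspace_iff by auto
  show ?thesis unfolding W.subspace_iff
  proof (intro conjI ballI allI)
    show "f ` U \<subseteq> carrier W" using U' f by (auto simp: linear_map_closed)
    show "\<zero>\<^bsub>W\<^esub> \<in> f ` U" using U' linear_map_zero[OF f] by force
    fix x y assume "x \<in> f ` U" "y \<in> f ` U"
    then show "x \<oplus>\<^bsub>W\<^esub> y \<in> f ` U"
      using U' linear_map_add[OF f] by (smt (verit) imageE imageI subsetD)
  next
    fix c x assume "x \<in> f ` U"
    then show "c \<odot>\<^bsub>W\<^esub> x \<in> f ` U"
      using U' linear_map_smult[OF f] by (smt (verit) imageE imageI subsetD)
  qed
qed

lemma linear_map_injI:
  assumes f: "lin V W f" and "\<And>x. x \<in> carrier V \<Longrightarrow> f x = \<zero>\<^bsub>W\<^esub> \<Longrightarrow> x = \<zero>\<^bsub>V\<^esub>"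
  shows "inj_on f (carrier V)"
proof (rule inj_onI)
  interpret V: kspace V using f by (rule linear_map_dom)
  interpret W: kspace W using f by (rule linear_map_cod)
  fix x y assume xy: "x \<in> carrier V" "y \<in> carrier V" "f x = f y"
  then have "f (x \<oplus>\<^bsub>V\<^esub> (- 1) \<odot>\<^bsub>V\<^esub> y) = \<zero>\<^bsub>W\<^esub>"
    using linear_map_closed[OF f] by (simp add: linear_map_add[OF f] linear_map_smult[OF f])
  then show "x = y" using assms(2)[of "x \<oplus>\<^bsub>V\<^esub> (- 1) \<odot>\<^bsub>V\<^esub> y"] xy V.eq_iff_diff[of x y] by simp
qed

lemma lin_iso_linear: "lin_iso V W f \<Longrightarrow> lin V W f"
  by (simp add: lin_iso_def)

lemma lin_iso_bij: "lin_iso V W f \<Longrightarrow> bij_betw f (carrier V) (carrier W)"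
  by (simp add: lin_iso_def)

lemma lin_iso_inv:
  assumes "lin_iso V W f"
  shows "lin_iso W V (inv_into (carrier V) f)"
proof -
  note f = lin_iso_linear[OF assms] lin_iso_bij[OF assms]
  interpret V: kspace V using f by (blast intro: linear_map_dom)
  interpret W: kspace W using f by (blast intro: linear_map_cod)
  let ?g = "inv_into (carrier V) f"
  have g: "?g y \<in> carrier V" "f (?g y) = y" if "y \<in> carrier W" for y
    using that f(2) by (auto simp: bij_betw_def inv_into_into f_inv_into_f)
  have gf: "?g (f x) = x" if "x \<in> carrier V" for x
    using that f(2) by (auto simp: bij_betw_def inv_into_f_f)
  have "?g (x \<oplus>\<^bsub>W\<^esub> y) = ?g x \<oplus>\<^bsub>V\<^esub> ?g y" if "x \<in> carrier W" "y \<in> carrier W" for x y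
    using gf[of "?g x \<oplus>\<^bsub>V\<^esub> ?g y"] that g by (simp add: linear_map_add[OF f(1)])
  moreover have "?g (c \<odot>\<^bsub>W\<^esub> x) = c \<odot>\<^bsub>V\<^esub> ?g x" if "x \<in> carrier W" for c x
    using gf[of "c \<odot>\<^bsub>V\<^esub> ?g x"] that g by (simp add: linear_map_smult[OF f(1)])
  ultimately show ?thesis
    using g V.kspace_axioms W.kspace_axioms f(2)
    by (auto simp: lin_iso_def linear_map_iff intro: bij_betw_inv_into)
qed

lemma lin_iso_compose:
  "lin_iso V W f \<Longrightarrow> lin_iso W X g \<Longrightarrow> lin_iso V X (\<lambda>x. g (f x))"
  using bij_betw_trans[of f "carrier V" "carrier W" g "carrier X"]
  by (auto simp: lin_iso_def comp_def intro: linear_map_compose)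

lemma lin_iso_cong:
  assumes "lin_iso V W f" "\<And>x. x \<in> carrier V \<Longrightarrow> f x = g x"
  shows "lin_iso V W g"
  using assms linear_map_cong[of V W f g] bij_betw_cong[of "carrier V" f g "carrier W"]
  by (auto simp: lin_iso_def)

lemma lin_iso_ident: "kspace V \<Longrightarrow> lin_iso V V (\<lambda>x. x)"
  using bij_betw_id[of "carrier V"] by (auto simp: lin_iso_def linear_map_iff id_def)

text \<open>Unlike the elements of \<open>dual_vs\<close>, these carry no condition outside the
  carrier, so a functional restricts to a smaller carrier as the same function.\<close>

definition functional :: "('k::field, 'v) module \<Rightarrow> ('v \<Rightarrow> 'k) \<Rightarrow> bool" where
  "functional V f \<longleftrightarrow> (\<forall>x\<in>carrier V. \<forall>y\<in>carrier V. f (x \<oplus>\<^bsub>V\<^esub> y) = f x + f y)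
     \<and> (\<forall>c. \<forall>x\<in>carrier V. f (c \<odot>\<^bsub>V\<^esub> x) = c * f x)"

lemma
  assumes "functional V f"
  shows functional_add: "x \<in> carrier V \<Longrightarrow> y \<in> carrier V \<Longrightarrow> f (x \<oplus>\<^bsub>V\<^esub> y) = f x + f y"
    and functional_smult: "x \<in> carrier V \<Longrightarrow> f (c \<odot>\<^bsub>V\<^esub> x) = c * f x"
  using assms unfolding functional_def by auto

lemma functional_zero: "functional V f \<Longrightarrow> kspace V \<Longrightarrow> f \<zero>\<^bsub>V\<^esub> = 0"
  using functional_smult[of V f "\<zero>\<^bsub>V\<^esub>" 0] by (simp add: kspace.zeroC kspace.zero_smult)

lemma functional_subspace: "functional V f \<Longrightarrow> U \<subseteq> carrier V \<Longrightarrow> functional (V\<lparr>carrier := U\<rparr>) f"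
  unfolding functional_def by (auto simp: subset_iff)

lemma functional_comp:
  "lin V W g \<Longrightarrow> functional W f \<Longrightarrow> functional V (\<lambda>x. f (g x))"
  unfolding functional_def linear_map_iff by auto

section \<open>Bases with dual coordinates\<close>

primrec comb :: "('k::field, 'v) module \<Rightarrow> (nat \<Rightarrow> 'v) \<Rightarrow> (nat \<Rightarrow> 'k) \<Rightarrow> nat \<Rightarrow> 'v" where
  "comb V e c 0 = \<zero>\<^bsub>V\<^esub>"
| "comb V e c (Suc n) = comb V e c n \<oplus>\<^bsub>V\<^esub> c n \<odot>\<^bsub>V\<^esub> e n"

lemma comb_in_subspace:
  assumes "kspace V" "subsp U V" "\<forall>i<n. e i \<in> U"
  shows "comb V e c n \<in> U"
  using assms(3) assms(2)[unfolded kspace.subspace_iff[OF assms(1)]] by (induct n) auto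

lemma comb_closed: "kspace V \<Longrightarrow> \<forall>i<n. e i \<in> carrier V \<Longrightarrow> comb V e c n \<in> carrier V"
  by (rule comb_in_subspace) (auto intro: kspace.carrier_subspace)

lemma functional_comb:
  assumes "kspace V" "functional V f" "\<forall>i<n. e i \<in> carrier V"
  shows "f (comb V e c n) = (\<Sum>i<n. c i * f (e i))"
  using assms(3)
proof (induct n)
  case (Suc n)
  interpret kspace V by fact
  have "comb V e c n \<in> carrier V" using Suc comb_closed[OF assms(1)] by auto
  with Suc show ?case by (simp add: functional_add[OF assms(2)] functional_smult[OF assms(2)])
qed (simp add: functional_zero[OF assms(2,1)])

text \<open>A basis together with its dual basis. That the coordinates separate vectors stands in
  for spanning; \<open>frame_expand\<close> recovers the expansion from it.\<close>

definition frame :: "('k::field, 'v) module \<Rightarrow> nat \<Rightarrow> (nat \<Rightarrow> 'v) \<Rightarrow> (nat \<Rightarrow> 'v \<Rightarrow> 'k) \<Rightarrow> bool" where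
  "frame V n e \<phi> \<longleftrightarrow> kspace V \<and> (\<forall>i<n. e i \<in> carrier V \<and> functional V (\<phi> i))
     \<and> (\<forall>i<n. \<forall>j<n. \<phi> i (e j) = (if i = j then 1 else 0))
     \<and> (\<forall>x\<in>carrier V. \<forall>y\<in>carrier V. (\<forall>i<n. \<phi> i x = \<phi> i y) \<longrightarrow> x = y)"

lemma frame_coord_comb:
  assumes "frame V n e \<phi>" "i < n"
  shows "\<phi> i (comb V e c n) = c i"
proof -
  have "\<phi> i (comb V e c n) = (\<Sum>j<n. c j * \<phi> i (e j))"
    using assms by (intro functional_comb) (auto simp: frame_def)
  also have "\<dots> = (\<Sum>j<n. if j = i then c j else 0)"
    using assms by (intro sum.cong) (auto simp: frame_def)
  finally show ?thesis using assms by simp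
qed

lemma frame_expand:
  assumes "frame V n e \<phi>" "x \<in> carrier V"
  shows "comb V e (\<lambda>i. \<phi> i x) n = x"
  using assms frame_coord_comb[OF assms(1)] comb_closed[of V n e]
  unfolding frame_def by metis

lemma frame_ext:
  "frame V n e \<phi> \<Longrightarrow> x \<in> carrier V \<Longrightarrow> y \<in> carrier V \<Longrightarrow> (\<And>i. i < n \<Longrightarrow> \<phi> i x = \<phi> i y) \<Longrightarrow> x = y"
  unfolding frame_def by blast

lemma frame_subspace:
  assumes "frame V n e \<phi>" "subsp U V" "\<forall>i<n. e i \<in> U"
  shows "U = carrier V"
  using assms frame_expand[OF assms(1)] comb_in_subspace[of V U n e]
  unfolding frame_def by (metis kspace.subspace_iff subsetI subset_antisym)

lemma frame_functional_eq:
  assumes "frame V n e \<phi>" "functional V f" "x \<in> carrier V"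
  shows "f x = (\<Sum>i<n. \<phi> i x * f (e i))"
  using frame_expand[OF assms(1,3)] functional_comb[OF _ assms(2), of n e "\<lambda>i. \<phi> i x"] assms(1)
  by (auto simp: frame_def)

text \<open>Spanning is asked in the form that generators and relations provide: a subspace
  containing all \<open>e i\<close> is everything. The linear combinations form such a subspace, so
  every vector is a combination, and the functionals read off its coefficients.\<close>

lemma frameI:
  assumes V: "kspace V" and e: "\<forall>i<n. e i \<in> carrier V \<and> functional V (\<phi> i)"
    and d: "\<forall>i<n. \<forall>j<n. \<phi> i (e j) = (if i = j then 1 else 0)"
    and g: "\<And>U. subsp U V \<Longrightarrow> \<forall>i<n. e i \<in> U \<Longrightarrow> carrier V \<subseteq> U"
  shows "frame V n e \<phi>"
proof -
  interpret kspace V by fact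
  let ?U = "{x \<in> carrier V. \<exists>c. x = comb V e c n}"
  have cl: "comb V e c m \<in> carrier V" if "m \<le> n" for c m using that e V by (intro comb_closed) auto
  have 0: "comb V e (\<lambda>i. 0) m = \<zero>\<^bsub>V\<^esub>" if "m \<le> n" for m
    using that e by (induct m) auto
  have a: "comb V e c m \<oplus>\<^bsub>V\<^esub> comb V e c' m = comb V e (\<lambda>i. c i + c' i) m" if "m \<le> n" for c c' m
    using that
  proof (induct m)
    case (Suc m)
    then have "comb V e (\<lambda>i. c i + c' i) (Suc m) = (comb V e c m \<oplus>\<^bsub>V\<^esub> comb V e c' m) \<oplus>\<^bsub>V\<^esub> (c m \<odot>\<^bsub>V\<^esub> e m \<oplus>\<^bsub>V\<^esub> c' m \<odot>\<^bsub>V\<^esub> e m)"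
      using e by (simp add: add_smult)
    then show ?case using e Suc.prems cl[of m c] cl[of m c'] by (simp add: ac)
  qed auto
  have s: "b \<odot>\<^bsub>V\<^esub> comb V e c m = comb V e (\<lambda>i. b * c i) m" if "m \<le> n" for c b m
    using that
  proof (induct m)
    case (Suc m)
    then show ?case using e cl[of m c] by (simp add: smult_add)
  qed auto
  have one: "comb V e (\<lambda>j. if j = i then 1 else 0) m = (if i < m then e i else \<zero>\<^bsub>V\<^esub>)" if "m \<le> n" "i < n" for m i
    using that e by (induct m) (auto simp: less_Suc_eq)
  have "subsp ?U V"
    unfolding subspace_iff
  proof (intro conjI ballI allI)
    show "\<zero>\<^bsub>V\<^esub> \<in> ?U" using 0[of n] by (auto intro!: exI[of _ "\<lambda>i. 0"])
    fix x y assume "x \<in> ?U" "y \<in> ?U"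
    then obtain c c' where "x = comb V e c n" "y = comb V e c' n" by auto
    then show "x \<oplus>\<^bsub>V\<^esub> y \<in> ?U" using a[of n c c'] cl[of n] by auto
  next
    fix b x assume "x \<in> ?U"
    then obtain c where "x = comb V e c n" by auto
    then show "b \<odot>\<^bsub>V\<^esub> x \<in> ?U" using s[of n b c] cl[of n] by auto
  qed auto
  moreover have "\<forall>i<n. e i \<in> ?U"
  proof (intro allI impI)
    fix i assume i: "i < n"
    have "e i = comb V e (\<lambda>j. if j = i then 1 else 0) n" using one[of n i] i by simp
    then show "e i \<in> ?U" using e i by blast
  qed
  ultimately have U: "carrier V \<subseteq> ?U" by (rule g)
  have co: "\<phi> i (comb V e c n) = c i" if "i < n" for i c
  proof -
    have "\<phi> i (comb V e c n) = (\<Sum>j<n. c j * \<phi> i (e j))" using e V that by (intro functional_comb) auto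
    also have "\<dots> = (\<Sum>j<n. if j = i then c j else 0)" using d that by (intro sum.cong) auto
    finally show ?thesis using that by simp
  qed
  have ce: "comb V e c m = comb V e c' m" if "m \<le> n" "\<forall>i<m. c i = c' i" for c c' m
    using that by (induct m) auto
  have "x = y" if "x \<in> carrier V" "y \<in> carrier V" "\<forall>i<n. \<phi> i x = \<phi> i y" for x y
  proof -
    from that(1,2) U obtain c c' where xy: "x = comb V e c n" "y = comb V e c' n" by blast
    then have "\<forall>i<n. c i = c' i" using that(3) co by simp
    with xy ce[of n c c'] show ?thesis by simp
  qed
  with assms show ?thesis unfolding frame_def by blast
qed

lemma frame_iso:
  assumes fr: "frame V n e \<phi>" and f: "lin_iso V W f"
  shows "frame W n (\<lambda>i. f (e i)) (\<lambda>i y. \<phi> i (inv_into (carrier V) f y))"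
proof -
  let ?g = "inv_into (carrier V) f"
  note g = lin_iso_linear[OF lin_iso_inv[OF f]]
  have gf: "?g (f x) = x" if "x \<in> carrier V" for x
    using that lin_iso_bij[OF f] by (auto simp: bij_betw_def inv_into_f_f)
  have gi: "x = y" if "?g x = ?g y" "x \<in> carrier W" "y \<in> carrier W" for x y
    using that lin_iso_bij[OF f] by (metis bij_betw_def f_inv_into_f)
  show ?thesis
    using fr functional_comp[OF g] gf linear_map_closed[OF lin_iso_linear[OF f]] linear_map_closed[OF g] gi
    unfolding frame_def by (auto intro: linear_map_cod lin_iso_linear[OF f])
qed

lemma basis_frame:
  assumes V: "kspace V" and B: "vectorspace.basis class_ring V B" "finite B" and e: "bij_betw e {..<n} B"
  shows "\<exists>\<phi>. frame V n e \<phi>"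
proof -
  interpret kspace V by fact
  interpret V: vectorspace class_ring V by (rule vs)
  have BV: "B \<subseteq> carrier V" using B by (auto simp: V.basis_def)
  have ex1: "\<exists>!a. a \<in> B \<rightarrow>\<^sub>E UNIV \<and> V.lincomb a B = v" if "v \<in> carrier V" for v
    using V.basis_criterion[OF B(2) BV] B(1) that by auto
  define co where "co v = (THE a. a \<in> B \<rightarrow>\<^sub>E UNIV \<and> V.lincomb a B = v)" for v
  have co: "co v \<in> B \<rightarrow>\<^sub>E UNIV" "V.lincomb (co v) B = v" if "v \<in> carrier V" for v
    using theI'[OF ex1[OF that]] unfolding co_def by auto
  have cou: "co v b = a b" if "v \<in> carrier V" "V.lincomb a B = v" "b \<in> B" for v a b
  proof -
    \<comment> \<open>Coefficient functions are unique only among those extensional on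
      \<open>B\<close>, so \<open>a\<close> is first cut off outside \<open>B\<close>.\<close>
    have "V.lincomb (restrict a B) B = v" using that BV by (subst V.lincomb_cong[where b=a and B=B]) auto
    then have "co v = restrict a B" using ex1[OF that(1)] co[OF that(1)] by (metis restrict_PiE_iff UNIV_I)
    then show ?thesis using that by simp
  qed
  have eB: "e i \<in> B" if "i < n" for i using e that by (auto simp: bij_betw_def)
  have fn: "functional V (\<lambda>v. co v b)" if b: "b \<in> B" for b
    unfolding functional_def
  proof (intro conjI ballI allI)
    fix x y assume xy: "x \<in> carrier V" "y \<in> carrier V"
    have "V.lincomb (\<lambda>b. co x b + co y b) B = x \<oplus>\<^bsub>V\<^esub> y"
      using V.lincomb_sum[OF B(2) BV, of "co x" "co y"] co xy by (simp add: class_ring_simps)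
    then show "co (x \<oplus>\<^bsub>V\<^esub> y) b = co x b + co y b" using cou b xy by simp
  next
    fix c x assume x: "x \<in> carrier V"
    have "V.lincomb (\<lambda>b. c * co x b) B = c \<odot>\<^bsub>V\<^esub> x"
      using V.lincomb_smult[OF BV, of "co x" c] co x by simp
    then show "co (c \<odot>\<^bsub>V\<^esub> x) b = c * co x b" using cou b x by simp
  qed
  have ce: "co b b' = (if b' = b then 1 else 0)" if "b \<in> B" "b' \<in> B" for b b'
  proof -
    have "V.lincomb (\<lambda>x. if x = b then 1 else 0) B = (\<lambda>x. if x = b then 1 else 0) b \<odot>\<^bsub>V\<^esub> b \<oplus>\<^bsub>V\<^esub> V.lincomb (\<lambda>x. if x = b then 1 else 0) (B - {b})"
      using V.lincomb_del2[OF B(2) BV, of "\<lambda>x. if x = b then 1 else 0" b] that by auto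
    also have "V.lincomb (\<lambda>x. if x = b then 1 else 0) (B - {b}) = \<zero>\<^bsub>V\<^esub>"
      using BV by (intro V.lincomb_zero) auto
    finally have "V.lincomb (\<lambda>x. if x = b then 1 else 0) B = b" using that BV by auto
    then show ?thesis using cou[of b "\<lambda>x. if x = b then 1 else 0" b'] that BV by auto
  qed
  have "frame V n e (\<lambda>i v. co v (e i))"
    unfolding frame_def
  proof (intro conjI allI impI ballI)
    show "kspace V" by fact
    fix i assume i: "i < n"
    show "e i \<in> carrier V" using eB i BV by auto
    show "functional V (\<lambda>v. co v (e i))" using fn eB i by auto
    fix j assume j: "j < n"
    show "co (e j) (e i) = (if i = j then 1 else 0)"
      using ce[OF eB[OF j] eB[OF i]] e i j by (auto simp: bij_betw_def inj_on_def)
  next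
    fix x y assume xy: "x \<in> carrier V" "y \<in> carrier V" "\<forall>i<n. co x (e i) = co y (e i)"
    then have "\<forall>b\<in>B. co x b = co y b" using e by (auto simp: bij_betw_def)
    then have "V.lincomb (co x) B = V.lincomb (co y) B" using BV by (intro V.lincomb_cong) auto
    then show "x = y" using co xy by simp
  qed
  then show ?thesis by blast
qed

lemma has_dim_frame:
  assumes "has_dim V n"
  obtains e \<phi> where "frame V n e \<phi>"
proof -
  interpret V: vectorspace class_ring V using assms by (simp add: has_dim_def)
  obtain B where B: "finite B" "V.basis B" using V.finite_basis_exists assms by (auto simp: has_dim_def)
  then have "card B = n" using V.dim_basis assms by (auto simp: has_dim_def)
  then obtain e where "bij_betw e {..<n} B" using B(1) ex_bij_betw_nat_finite[of B] by (auto simp: atLeast0LessThan)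
  then show ?thesis using basis_frame[of V B e n] B that V.vectorspace_axioms by (auto simp: kspace_def)
qed

lemma frame_basis:
  assumes fr: "frame V n e \<phi>"
  shows "vectorspace.basis class_ring V (e ` {..<n})" "card (e ` {..<n}) = n"
proof -
  interpret kspace V using fr by (simp add: frame_def)
  interpret V: vectorspace class_ring V by (rule vs)
  let ?B = "e ` {..<n}"
  have inj: "inj_on e {..<n}" using fr unfolding frame_def inj_on_def
    by (metis lessThan_iff zero_neq_one)
  show "card ?B = n" using card_image[OF inj] by simp
  have BV: "?B \<subseteq> carrier V" using fr by (auto simp: frame_def)
  have "V.span ?B = carrier V"
    by (rule frame_subspace[OF fr]) (use V.span_is_subspace[OF BV] V.in_own_span[OF BV] in auto)
  moreover have "V.lin_indpt ?B"
  proof (rule V.finite_lin_indpt2[OF _ BV])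
    fix a assume a: "V.lincomb a ?B = \<zero>\<^bsub>V\<^esub>"
    have *: "f (V.lincomb a A) = (\<Sum>b\<in>A. a b * f b)" if "functional V f" "finite A" "A \<subseteq> carrier V" for f A
      using that(2,3)
    proof (induct A)
      case (insert b A)
      then have "V.lincomb a A \<in> carrier V" by (intro V.lincomb_closed) auto
      with insert show ?case
        using V.lincomb_insert[of A a b] by (simp add: functional_add[OF that(1)] functional_smult[OF that(1)])
    qed (simp add: functional_zero[OF that(1)] kspace_axioms)
    show "\<forall>v\<in>?B. a v = \<zero>\<^bsub>class_ring\<^esub>"
    proof
      fix v assume "v \<in> ?B"
      then obtain i where i: "i < n" "v = e i" by auto
      have "0 = \<phi> i (V.lincomb a ?B)" using a fr i functional_zero[of V "\<phi> i"] by (auto simp: frame_def)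
      also have "\<dots> = (\<Sum>b\<in>?B. a b * \<phi> i b)" using fr i BV by (intro *) (auto simp: frame_def)
      also have "\<dots> = (\<Sum>j<n. a (e j) * \<phi> i (e j))" by (simp add: sum.reindex[OF inj])
      also have "\<dots> = (\<Sum>j<n. if j = i then a (e j) else 0)" using fr i by (intro sum.cong) (auto simp: frame_def)
      finally show "a v = \<zero>\<^bsub>class_ring\<^esub>" using i by simp
    qed
  qed auto
  ultimately show "V.basis ?B" using BV by (auto simp: V.basis_def)
qed

lemma frame_has_dim:
  assumes fr: "frame V n e \<phi>"
  shows "has_dim V n"
proof -
  interpret kspace V using fr by (simp add: frame_def)
  interpret V: vectorspace class_ring V by (rule vs)
  show ?thesis unfolding has_dim_def
  proof (intro conjI)
    show "V.fin_dim" unfolding V.fin_dim_def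
      by (rule exI[of _ "e ` {..<n}"]) (use frame_basis[OF fr] in \<open>auto simp: V.basis_def\<close>)
    show "V.dim = n" using V.dim_basis[OF _ frame_basis(1)[OF fr]] frame_basis(2)[OF fr] by simp
  qed (rule vs)
qed

section \<open>Dimension, lines and subspaces\<close>

lemma has_dim_kspace: "has_dim V n \<Longrightarrow> kspace V"
  by (simp add: has_dim_def kspace_def)

lemma has_dim_iso: "has_dim V n \<Longrightarrow> lin_iso V W f \<Longrightarrow> has_dim W n"
  by (metis has_dim_frame frame_iso frame_has_dim)

lemma has_dim_unique: "has_dim V n \<Longrightarrow> has_dim V m \<Longrightarrow> n = m"
  by (simp add: has_dim_def)

lemma frame_oneI:
  assumes V: "kspace V" and x: "x \<in> carrier V" "x \<noteq> \<zero>\<^bsub>V\<^esub>"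
    and sp: "\<And>y. y \<in> carrier V \<Longrightarrow> \<exists>c. y = c \<odot>\<^bsub>V\<^esub> x"
  shows "\<exists>\<phi>. frame V 1 (\<lambda>i. x) \<phi>"
proof -
  interpret kspace V by fact
  define f where "f y = (THE c. y = c \<odot>\<^bsub>V\<^esub> x)" for y
  have f: "f (c \<odot>\<^bsub>V\<^esub> x) = c" for c
    unfolding f_def using smult_cancel[OF x] by auto
  have "functional V f" unfolding functional_def
  proof (intro conjI ballI allI)
    fix y z assume "y \<in> carrier V" "z \<in> carrier V"
    then show "f (y \<oplus>\<^bsub>V\<^esub> z) = f y + f z"
      using sp f x by (metis add_smult)
  next
    fix c y assume "y \<in> carrier V"
    then show "f (c \<odot>\<^bsub>V\<^esub> y) = c * f y" using sp f x smult_smult by metis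
  qed
  moreover have "f x = 1" using f[of 1] x by simp
  moreover have "y = z" if "y \<in> carrier V" "z \<in> carrier V" "f y = f z" for y z
    using that sp f by metis
  ultimately show ?thesis
    by (intro exI[of _ "\<lambda>i. f"]) (use V x in \<open>auto simp: frame_def\<close>)
qed

lemma has_dim_1_iff:
  assumes V: "kspace V"
  shows "has_dim V 1 \<longleftrightarrow> (\<exists>x\<in>carrier V. x \<noteq> \<zero>\<^bsub>V\<^esub> \<and> (\<forall>y\<in>carrier V. \<exists>c. y = c \<odot>\<^bsub>V\<^esub> x))"
proof
  interpret kspace V by fact
  assume "has_dim V 1"
  then obtain e \<phi> where fr: "frame V 1 e \<phi>" by (rule has_dim_frame)
  have "e 0 \<noteq> \<zero>\<^bsub>V\<^esub>" using fr functional_zero[of V "\<phi> 0"] by (auto simp: frame_def)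
  moreover have "\<exists>c. y = c \<odot>\<^bsub>V\<^esub> e 0" if "y \<in> carrier V" for y
  proof
    have "e 0 \<in> carrier V" using fr by (simp add: frame_def)
    then show "y = \<phi> 0 y \<odot>\<^bsub>V\<^esub> e 0" using frame_expand[OF fr that, symmetric] by simp
  qed
  ultimately show "\<exists>x\<in>carrier V. x \<noteq> \<zero>\<^bsub>V\<^esub> \<and> (\<forall>y\<in>carrier V. \<exists>c. y = c \<odot>\<^bsub>V\<^esub> x)"
    using fr by (auto simp: frame_def)
next
  assume "\<exists>x\<in>carrier V. x \<noteq> \<zero>\<^bsub>V\<^esub> \<and> (\<forall>y\<in>carrier V. \<exists>c. y = c \<odot>\<^bsub>V\<^esub> x)"
  then obtain x where "x\<in>carrier V" "x \<noteq> \<zero>\<^bsub>V\<^esub>" "\<And>y. y\<in>carrier V \<Longrightarrow> \<exists>c. y = c \<odot>\<^bsub>V\<^esub> x" by auto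
  then show "has_dim V 1" using frame_oneI[OF V] frame_has_dim by blast
qed

lemma has_dim_1_span:
  assumes "has_dim V 1" "x \<in> carrier V" "x \<noteq> \<zero>\<^bsub>V\<^esub>" "y \<in> carrier V"
  shows "\<exists>c. y = c \<odot>\<^bsub>V\<^esub> x"
proof -
  interpret kspace V using assms(1) by (rule has_dim_kspace)
  obtain z where z: "z \<in> carrier V" "\<And>y. y\<in>carrier V \<Longrightarrow> \<exists>c. y = c \<odot>\<^bsub>V\<^esub> z"
    using assms(1) has_dim_1_iff[OF kspace_axioms] by auto
  obtain a b where ab: "x = a \<odot>\<^bsub>V\<^esub> z" "y = b \<odot>\<^bsub>V\<^esub> z" using z assms by metis
  with assms(3) z have "a \<noteq> 0" by auto
  with ab z have "y = (b / a) \<odot>\<^bsub>V\<^esub> x" by simp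
  then show ?thesis by blast
qed

text \<open>A set independent in \<open>U\<close> is independent in \<open>V\<close>, so its size is
  at most the dimension of \<open>V\<close>; a maximal independent set of \<open>U\<close> therefore
  exists and is a basis.\<close>

lemma subspace_has_dim:
  assumes V: "has_dim V n" and U: "subsp U V"
  shows "\<exists>d. has_dim (V\<lparr>carrier := U\<rparr>) d"
proof -
  interpret kspace V using V by (rule has_dim_kspace)
  interpret V: vectorspace class_ring V by (rule vs)
  let ?U = "V\<lparr>carrier := U\<rparr>"
  interpret U: vectorspace class_ring ?U using V.subspace_is_vs[OF U] .
  have UV: "U \<subseteq> carrier V" using U by (simp add: subspace_iff)
  have sm: "submodule class_ring U V" using U by simp
  have "\<exists>A. finite A \<and> maximal A (\<lambda>S. S \<subseteq> carrier ?U \<and> U.lin_indpt S)"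
  proof (rule maximal_exists)
    fix A assume A: "A \<subseteq> carrier ?U \<and> U.lin_indpt A"
    then have "V.lin_indpt A" using V.span_li_not_depend(2)[OF _ sm, of A] by auto
    then show "finite A \<and> card A \<le> V.dim"
      using A UV V V.li_le_dim[of A] by (auto simp: has_dim_def)
    next
    show "{} \<subseteq> carrier ?U \<and> U.lin_indpt {}" by (auto simp: U.lin_dep_def)
  qed
  then obtain A where A: "finite A" "U.basis A" using U.max_li_is_basis by blast
  then have "has_dim ?U (card A)" unfolding has_dim_def
    using U.dim_basis[OF A] U.vectorspace_axioms by (auto simp: U.fin_dim_def U.basis_def)
  then show ?thesis ..
qed

section \<open>Hyperplanes\<close>

lemma hyperplane_proper:
  assumes "hyperplane U V"
  obtains v where "v \<in> carrier V" "v \<notin> U"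
proof -
  obtain d where d: "subsp U V" "has_dim (V\<lparr>carrier := U\<rparr>) d" "has_dim V (Suc d)" using assms by (auto simp: hyperplane_def)
  have "U \<noteq> carrier V"
  proof
    assume "U = carrier V"
    then have "has_dim V d" using d(2) by simp
    then show False using has_dim_unique[OF _ d(3)] by force
  qed
  moreover have "U \<subseteq> carrier V" using d(1) unfolding kspace.subspace_iff[OF has_dim_kspace[OF d(3)]] by (rule conjunct1)
  ultimately show ?thesis using that by blast
qed

text \<open>A basis of \<open>U\<close> enlarged by \<open>v0\<close> is independent and has as many
  elements as the dimension of \<open>V\<close>, hence is a basis. Its last coordinate vanishes on
  the other basis vectors, so it is an equation of \<open>U\<close>.\<close>

lemma hyperplane_frame:
  assumes h: "hyperplane U V" and V: "has_dim V (Suc n)" and v0: "v0 \<in> carrier V" "v0 \<notin> U"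
  obtains e \<phi> where "frame V (Suc n) e \<phi>" "e n = v0" "\<And>i. i < n \<Longrightarrow> e i \<in> U"
    "\<And>x. x \<in> carrier V \<Longrightarrow> x \<in> U \<longleftrightarrow> \<phi> n x = 0"
proof -
  interpret kspace V using V by (rule has_dim_kspace)
  interpret V: vectorspace class_ring V by (rule vs)
  let ?U = "V\<lparr>carrier := U\<rparr>"
  have U: "subsp U V" using h by (simp add: hyperplane_def)
  interpret U: vectorspace class_ring ?U using V.subspace_is_vs[OF U] .
  have UV: "U \<subseteq> carrier V" using U by (simp add: subspace_iff)
  have sm: "submodule class_ring U V" using U by simp
  have dU: "has_dim ?U n" using h V has_dim_unique by (auto simp: hyperplane_def)
  obtain B where B: "finite B" "U.basis B" using U.finite_basis_exists dU by (auto simp: has_dim_def)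
  then have cB: "card B = n" using U.dim_basis dU by (auto simp: has_dim_def)
  have BU: "B \<subseteq> U" "U.lin_indpt B" "U.span B = U" using B by (auto simp: U.basis_def)
  have sB: "V.span B = U" "V.lin_indpt B" using V.span_li_not_depend[OF BU(1) sm] BU by auto
  have v0B: "v0 \<notin> B" using v0 BU by auto
  have "V.lin_indpt (B \<union> {v0})"
    using V.lin_dep_iff_in_span[of B v0] sB v0B v0 BU UV by auto
  then have ba: "V.basis (insert v0 B)"
    using B cB v0B v0 BU UV V by (intro V.dim_li_is_basis) (auto simp: has_dim_def)
  obtain e where e: "bij_betw e {..<n} B" using B(1) cB ex_bij_betw_nat_finite[of B] by (auto simp: atLeast0LessThan)
  have e': "bij_betw (e(n := v0)) {..<Suc n} (insert v0 B)"
    using e v0B by (auto simp: bij_betw_def lessThan_Suc inj_on_def)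
  obtain \<phi> where fr: "frame V (Suc n) (e(n := v0)) \<phi>" using basis_frame[OF kspace_axioms ba _ e'] B by auto
  have fn: "functional V (\<phi> n)" using fr by (auto simp: frame_def)
  have eU: "e i \<in> U" if "i < n" for i using e BU that by (auto simp: bij_betw_def)
  have "\<phi> n x = 0" if "x \<in> U" for x
  proof -
    have "subsp {x \<in> carrier V. \<phi> n x = 0} V"
      using functional_zero[OF fn kspace_axioms] by (auto simp: subspace_iff functional_add[OF fn] functional_smult[OF fn])
    moreover have "B \<subseteq> {x \<in> carrier V. \<phi> n x = 0}"
    proof
      fix b assume "b \<in> B"
      then obtain i where "i < n" "b = e i" using e by (auto simp: bij_betw_def)
      moreover have "(e(n := v0)) i \<in> carrier V" "\<phi> n ((e(n := v0)) i) = 0" if "i < n" for i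
        using fr that unfolding frame_def by (metis less_Suc_eq, metis less_Suc_eq nat_neq_iff)
      ultimately show "b \<in> {x \<in> carrier V. \<phi> n x = 0}" by auto
    qed
    ultimately have "V.span B \<subseteq> {x \<in> carrier V. \<phi> n x = 0}"
      using V.span_is_subset[of B "{x \<in> carrier V. \<phi> n x = 0}"] V.is_module by simp
    then show ?thesis using sB that by auto
  qed
  moreover have "x \<in> U" if "x \<in> carrier V" "\<phi> n x = 0" for x
  proof -
    have m: "comb V (e(n := v0)) c n \<in> U" for c
      by (rule comb_in_subspace[OF kspace_axioms U]) (use eU in auto)
    then have "comb V (e(n := v0)) c n \<in> carrier V" for c using UV by auto
    then have "comb V (e(n := v0)) (\<lambda>i. \<phi> i x) (Suc n) = comb V (e(n := v0)) (\<lambda>i. \<phi> i x) n"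
      using that(2) v0 by simp
    then show ?thesis using frame_expand[OF fr that(1)] m by metis
  qed
  ultimately show ?thesis using that[OF fr] eU by fastforce
qed

text \<open>Vectors of the sum of \<open>U\<close> and the line of \<open>v\<close> have the form
  \<open>u \<oplus> c \<odot> v\<close> in exactly one way because \<open>v\<close> lies outside
  \<open>U\<close>; so the value of the extension at \<open>v\<close> may be prescribed
  freely.\<close>

lemma functional_extend_one:
  assumes V: "kspace V" and U: "subsp U V" and v: "v \<in> carrier V" "v \<notin> U"
    and f: "functional (V\<lparr>carrier := U\<rparr>) f"
  obtains U' g where "subsp U' V" "U \<subseteq> U'" "v \<in> U'"
    "functional (V\<lparr>carrier := U'\<rparr>) g" "\<And>x. x \<in> U \<Longrightarrow> g x = f x" "g v = a"
proof -
  interpret kspace V by fact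
  have U': "U \<subseteq> carrier V" "\<zero>\<^bsub>V\<^esub> \<in> U" "\<And>x y. x \<in> U \<Longrightarrow> y \<in> U \<Longrightarrow> x \<oplus>\<^bsub>V\<^esub> y \<in> U" "\<And>c x. x \<in> U \<Longrightarrow> c \<odot>\<^bsub>V\<^esub> x \<in> U"
    using U unfolding subspace_iff by auto
  have f0: "f \<zero>\<^bsub>V\<^esub> = 0" using functional_zero[OF f subspace_kspace[OF U]] by simp
  have uniq: "c = c' \<and> u = u'" if "u \<in> U" "u' \<in> U" "u \<oplus>\<^bsub>V\<^esub> c \<odot>\<^bsub>V\<^esub> v = u' \<oplus>\<^bsub>V\<^esub> c' \<odot>\<^bsub>V\<^esub> v" for u u' c c'
  proof -
    have uC: "u \<in> carrier V" "u' \<in> carrier V" using that U' by auto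
    have "c = c'"
    proof (rule ccontr)
      \<comment> \<open>Otherwise \<open>(c' - c) \<odot> v\<close> is the difference of
        \<open>u\<close> and \<open>u'\<close>, hence in \<open>U\<close>, and dividing by
        \<open>c' - c\<close> puts \<open>v\<close> in \<open>U\<close>.\<close>
      assume ne: "c \<noteq> c'"
      have "(-1) \<odot>\<^bsub>V\<^esub> u' \<oplus>\<^bsub>V\<^esub> (u \<oplus>\<^bsub>V\<^esub> c \<odot>\<^bsub>V\<^esub> v) = c' \<odot>\<^bsub>V\<^esub> v"
      proof -
        have "(-1) \<odot>\<^bsub>V\<^esub> u' \<oplus>\<^bsub>V\<^esub> (u' \<oplus>\<^bsub>V\<^esub> c' \<odot>\<^bsub>V\<^esub> v) = (u' \<oplus>\<^bsub>V\<^esub> (-1) \<odot>\<^bsub>V\<^esub> u') \<oplus>\<^bsub>V\<^esub> c' \<odot>\<^bsub>V\<^esub> v"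
          using uC v by (simp only: ac smultC addC)
        then show ?thesis using uC v that(3) by simp
      qed
      then have "((-1) \<odot>\<^bsub>V\<^esub> u' \<oplus>\<^bsub>V\<^esub> u) \<oplus>\<^bsub>V\<^esub> c \<odot>\<^bsub>V\<^esub> v = c' \<odot>\<^bsub>V\<^esub> v" using uC v by (simp only: ac smultC addC)
      then have "((-1) \<odot>\<^bsub>V\<^esub> u' \<oplus>\<^bsub>V\<^esub> u) \<oplus>\<^bsub>V\<^esub> c \<odot>\<^bsub>V\<^esub> v \<oplus>\<^bsub>V\<^esub> (- c) \<odot>\<^bsub>V\<^esub> v = c' \<odot>\<^bsub>V\<^esub> v \<oplus>\<^bsub>V\<^esub> (- c) \<odot>\<^bsub>V\<^esub> v" by simp
      moreover have "((-1) \<odot>\<^bsub>V\<^esub> u' \<oplus>\<^bsub>V\<^esub> u) \<oplus>\<^bsub>V\<^esub> c \<odot>\<^bsub>V\<^esub> v \<oplus>\<^bsub>V\<^esub> (- c) \<odot>\<^bsub>V\<^esub> v = ((-1) \<odot>\<^bsub>V\<^esub> u' \<oplus>\<^bsub>V\<^esub> u) \<oplus>\<^bsub>V\<^esub> (c + (- c)) \<odot>\<^bsub>V\<^esub> v"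
        using uC v by (simp only: add_smult ac smultC addC)
      ultimately have "(-1) \<odot>\<^bsub>V\<^esub> u' \<oplus>\<^bsub>V\<^esub> u = (c' - c) \<odot>\<^bsub>V\<^esub> v"
        using uC v add_smult[of v c' "-c"] by simp
      moreover have "(-1) \<odot>\<^bsub>V\<^esub> u' \<oplus>\<^bsub>V\<^esub> u \<in> U" using that U' by blast
      ultimately have "inverse (c' - c) \<odot>\<^bsub>V\<^esub> ((c' - c) \<odot>\<^bsub>V\<^esub> v) \<in> U" using U'(4) by metis
      then show False using v ne by simp
    qed
    moreover from this have "u = u'" using that(3) uC v comm[of _ "c \<odot>\<^bsub>V\<^esub> v"] by simp
    ultimately show ?thesis by simp
  qed
  define U2 where "U2 = {u \<oplus>\<^bsub>V\<^esub> c \<odot>\<^bsub>V\<^esub> v | u c. u \<in> U}"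
  define g where "g x = (THE b. \<exists>u c. u \<in> U \<and> x = u \<oplus>\<^bsub>V\<^esub> c \<odot>\<^bsub>V\<^esub> v \<and> b = f u + c * a)" for x
  have g: "g (u \<oplus>\<^bsub>V\<^esub> c \<odot>\<^bsub>V\<^esub> v) = f u + c * a" if "u \<in> U" for u c
    unfolding g_def using that uniq by (intro the_equality) blast+
  have add: "(u \<oplus>\<^bsub>V\<^esub> c \<odot>\<^bsub>V\<^esub> v) \<oplus>\<^bsub>V\<^esub> (u' \<oplus>\<^bsub>V\<^esub> c' \<odot>\<^bsub>V\<^esub> v) = (u \<oplus>\<^bsub>V\<^esub> u') \<oplus>\<^bsub>V\<^esub> (c + c') \<odot>\<^bsub>V\<^esub> v" if "u \<in> U" "u' \<in> U" for u u' c c'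
  proof -
    have uC: "u \<in> carrier V" "u' \<in> carrier V" using that U' by auto
    then show ?thesis using v by (simp add: add_smult ac)
  qed
  have sm: "b \<odot>\<^bsub>V\<^esub> (u \<oplus>\<^bsub>V\<^esub> c \<odot>\<^bsub>V\<^esub> v) = b \<odot>\<^bsub>V\<^esub> u \<oplus>\<^bsub>V\<^esub> (b * c) \<odot>\<^bsub>V\<^esub> v" if "u \<in> U" for u b c
    using that U' v by (subst smult_add) auto
  show ?thesis
  proof (rule that[of U2 g])
    show "subsp U2 V"
      unfolding subspace_iff
    proof (intro conjI allI ballI)
      show "U2 \<subseteq> carrier V" using U' v by (auto simp: U2_def subset_iff)
      have "\<zero>\<^bsub>V\<^esub> = \<zero>\<^bsub>V\<^esub> \<oplus>\<^bsub>V\<^esub> 0 \<odot>\<^bsub>V\<^esub> v" using v by simp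
      then show "\<zero>\<^bsub>V\<^esub> \<in> U2" using U'(2) unfolding U2_def by blast
      fix x y assume "x \<in> U2" "y \<in> U2"
      then show "x \<oplus>\<^bsub>V\<^esub> y \<in> U2" unfolding U2_def using add U'(3) by blast
    next
      fix c x assume "x \<in> U2"
      then show "c \<odot>\<^bsub>V\<^esub> x \<in> U2" unfolding U2_def using sm U'(4) by blast
    qed
    have eu: "u = u \<oplus>\<^bsub>V\<^esub> 0 \<odot>\<^bsub>V\<^esub> v" if "u \<in> U" for u using that U' v by auto
    then show "U \<subseteq> U2" unfolding U2_def by blast
    have ev: "v = \<zero>\<^bsub>V\<^esub> \<oplus>\<^bsub>V\<^esub> 1 \<odot>\<^bsub>V\<^esub> v" using v by simp
    then show "v \<in> U2" unfolding U2_def using U'(2) by blast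
    show "g x = f x" if "x \<in> U" for x using g[OF that, of 0] eu[OF that] by simp
    show "g v = a" using g[OF U'(2), of 1] ev f0 by simp
    have fa: "f (x \<oplus>\<^bsub>V\<^esub> y) = f x + f y" "f (c \<odot>\<^bsub>V\<^esub> x) = c * f x" if "x \<in> U" "y \<in> U" for x y c
      using functional_add[OF f, of x y] functional_smult[OF f, of x c] that by auto
    show "functional (V\<lparr>carrier := U2\<rparr>) g"
      unfolding functional_def
    proof (intro conjI allI ballI; simp)
      fix x y assume "x \<in> U2" "y \<in> U2"
      then obtain u c u' c' where *: "u \<in> U" "u' \<in> U" "x = u \<oplus>\<^bsub>V\<^esub> c \<odot>\<^bsub>V\<^esub> v" "y = u' \<oplus>\<^bsub>V\<^esub> c' \<odot>\<^bsub>V\<^esub> v" unfolding U2_def by blast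
      show "g (x \<oplus>\<^bsub>V\<^esub> y) = g x + g y"
        unfolding *(3,4) add[OF *(1,2)] using * U'(3) fa by (simp add: g algebra_simps)
    next
      fix c x assume "x \<in> U2"
      then obtain u b where *: "u \<in> U" "x = u \<oplus>\<^bsub>V\<^esub> b \<odot>\<^bsub>V\<^esub> v" unfolding U2_def by blast
      show "g (c \<odot>\<^bsub>V\<^esub> x) = c * g x"
        unfolding *(2) sm[OF *(1)] using * U'(4) fa by (simp add: g algebra_simps)
    qed
  qed
qed

text \<open>The basis vectors are adjoined one at a time: after m stages the domain contains the
  first m of them, and a vector already in the domain changes nothing.\<close>

lemma functional_extend:
  assumes fr: "frame V n e \<phi>" and U: "subsp U V"
    and f: "functional (V\<lparr>carrier := U\<rparr>) f"
  obtains g where "functional V g" "\<And>x. x \<in> U \<Longrightarrow> g x = f x"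
proof -
  have V: "kspace V" and e: "\<forall>i<n. e i \<in> carrier V" using fr by (auto simp: frame_def)
  have "\<exists>U' g. subsp U' V \<and> U \<subseteq> U' \<and> (\<forall>i<m. e i \<in> U') \<and>
      functional (V\<lparr>carrier := U'\<rparr>) g \<and> (\<forall>x\<in>U. g x = f x)" if "m \<le> n" for m
    using that
  proof (induct m)
    case 0
    then show ?case using U f by blast
  next
    case (Suc m)
    then obtain U' g where *: "subsp U' V" "U \<subseteq> U'" "\<forall>i<m. e i \<in> U'"
      "functional (V\<lparr>carrier := U'\<rparr>) g" "\<forall>x\<in>U. g x = f x" by auto
    show ?case
    proof (cases "e m \<in> U'")
      case True
      then show ?thesis using * by (intro exI[of _ U'] exI[of _ g]) (auto simp: less_Suc_eq)
    next
      case False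
      have "e m \<in> carrier V" using e Suc by auto
      from functional_extend_one[OF V *(1) this False *(4)] obtain U2 g2 where
        "subsp U2 V" "U' \<subseteq> U2" "e m \<in> U2"
        "functional (V\<lparr>carrier := U2\<rparr>) g2" "\<And>x. x \<in> U' \<Longrightarrow> g2 x = g x" by metis
      then show ?thesis using * by (intro exI[of _ U2] exI[of _ g2]) (auto simp: less_Suc_eq)
    qed
  qed
  then obtain U' g where *: "subsp U' V" "\<forall>i<n. e i \<in> U'"
      "functional (V\<lparr>carrier := U'\<rparr>) g" "\<forall>x\<in>U. g x = f x" by blast
  have "U' = carrier V" by (rule frame_subspace[OF fr *(1,2)])
  with * show ?thesis using that[of g] by simp
qed

text \<open>Extend the zero functional of \<open>U\<close> by the value 1 at \<open>v\<close>, then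
  to all of \<open>V\<close>.\<close>

lemma functional_separate:
  assumes fr: "frame V n e \<phi>" and U: "subsp U V" and v: "v \<in> carrier V" "v \<notin> U"
  obtains g where "functional V g" "\<And>x. x \<in> U \<Longrightarrow> g x = 0" "g v = 1"
proof -
  have V: "kspace V" using fr by (auto simp: frame_def)
  have "functional (V\<lparr>carrier := U\<rparr>) (\<lambda>x. 0)" by (simp add: functional_def)
  from functional_extend_one[OF V U v this, of 1] obtain U' g where *: "subsp U' V" "U \<subseteq> U'" "v \<in> U'"
    "functional (V\<lparr>carrier := U'\<rparr>) g" "\<And>x. x \<in> U \<Longrightarrow> g x = 0" "g v = 1" by metis
  from functional_extend[OF fr *(1,4)] obtain h where "functional V h" "\<And>x. x \<in> U' \<Longrightarrow> h x = g x" by metis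
  then show ?thesis using that[of h] * by (auto simp: subset_iff)
qed

section \<open>Quotients of free vector spaces\<close>

lemma (in kspace) span_least:
  "S \<subseteq> U \<Longrightarrow> subsp U V \<Longrightarrow> LinearCombinations.module.span class_ring V S \<subseteq> U"
proof -
  interpret V: vectorspace class_ring V by (rule vs)
  show "S \<subseteq> U \<Longrightarrow> subsp U V \<Longrightarrow> V.span S \<subseteq> U" using V.span_is_subset V.is_module by blast
qed

lemma (in kspace) span_subsp:
  assumes "S \<subseteq> carrier V"
  shows "subsp (LinearCombinations.module.span class_ring V S) V"
    "S \<subseteq> LinearCombinations.module.span class_ring V S"
proof -
  interpret V: vectorspace class_ring V by (rule vs)
  show "subsp (V.span S) V" "S \<subseteq> V.span S" using V.span_is_subspace[OF assms] V.in_own_span[OF assms] by auto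
qed

locale kquot = kspace V for V :: "('k::field, 'v) module" (structure) +
  fixes U :: "'v set"
  assumes U: "subsp U V"
begin

abbreviation "Q \<equiv> quotient_vs V U"
abbreviation "cl v \<equiv> U +>\<^bsub>V\<^esub> v"

lemma UD: "x \<in> U \<Longrightarrow> x \<in> carrier V" "\<zero> \<in> U" "x \<in> U \<Longrightarrow> y \<in> U \<Longrightarrow> x \<oplus> y \<in> U" "x \<in> U \<Longrightarrow> c \<odot> x \<in> U"
  using U unfolding subspace_iff by auto

lemma shift_cancel[simp]:
  assumes "x \<in> carrier V" "v \<in> carrier V"
  shows "(x \<oplus> v) \<oplus> (- 1) \<odot> v = x" "(x \<oplus> (- 1) \<odot> v) \<oplus> v = x"
  using assms add_neg[of v] comm[of "(-1) \<odot> v" v] by (simp_all add: assoc)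

lemma cl_mem: "v \<in> carrier V \<Longrightarrow> w \<in> cl v \<longleftrightarrow> w \<in> carrier V \<and> w \<oplus> (- 1) \<odot> v \<in> U"
proof
  assume v: "v \<in> carrier V"
  {
    assume "w \<in> cl v"
    then obtain u where "u \<in> U" "w = u \<oplus> v" by (auto simp: a_r_coset_def')
    then show "w \<in> carrier V \<and> w \<oplus> (- 1) \<odot> v \<in> U" using v UD by simp
  }
  assume "w \<in> carrier V \<and> w \<oplus> (- 1) \<odot> v \<in> U"
  moreover from this have "w = (w \<oplus> (- 1) \<odot> v) \<oplus> v" using v by simp
  ultimately show "w \<in> cl v" unfolding a_r_coset_def' by blast
qed

lemma cl_self: "v \<in> carrier V \<Longrightarrow> v \<in> cl v"
  using UD by (simp add: cl_mem)

lemma cl_eq: 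
  assumes v: "v \<in> carrier V" and w: "w \<in> carrier V"
  shows "cl v = cl w \<longleftrightarrow> v \<oplus> (- 1) \<odot> w \<in> U"
proof
  assume "cl v = cl w"
  then show "v \<oplus> (- 1) \<odot> w \<in> U" using cl_self[OF v] cl_mem[OF w] by auto
next
  assume *: "v \<oplus> (- 1) \<odot> w \<in> U"
  have "x \<oplus> (- 1) \<odot> w = (x \<oplus> (- 1) \<odot> v) \<oplus> (v \<oplus> (- 1) \<odot> w)" if "x \<in> carrier V" for x
  proof -
    have "(x \<oplus> (- 1) \<odot> v) \<oplus> (v \<oplus> (- 1) \<odot> w) = ((x \<oplus> (- 1) \<odot> v) \<oplus> v) \<oplus> (- 1) \<odot> w"
      using that v w by (simp only: assoc addC smultC)
    then show ?thesis using that v by simp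
  qed
  moreover have "x \<oplus> (- 1) \<odot> v = (x \<oplus> (- 1) \<odot> w) \<oplus> (- 1) \<odot> (v \<oplus> (- 1) \<odot> w)" if "x \<in> carrier V" for x
  proof -
    have "(x \<oplus> (- 1) \<odot> w) \<oplus> (- 1) \<odot> (v \<oplus> (- 1) \<odot> w) = ((x \<oplus> (- 1) \<odot> w) \<oplus> w) \<oplus> (- 1) \<odot> v"
      using that v w by (simp add: smult_add ac)
    then show ?thesis using that w by simp
  qed
  ultimately show "cl v = cl w" using * UD(3,4) cl_mem[OF v] cl_mem[OF w] by (metis subsetI subset_antisym)
qed

lemma cl_zero: "cl \<zero> = U"
  using UD by (auto simp: cl_mem)

lemma cl_eq_zero: "v \<in> carrier V \<Longrightarrow> cl v = \<zero>\<^bsub>Q\<^esub> \<longleftrightarrow> v \<in> U"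
  using cl_eq[of v \<zero>] cl_zero by (simp add: quotient_vs_def)

lemma carrier_Q: "carrier Q = cl ` carrier V"
  by (auto simp: quotient_vs_def A_RCOSETS_def')

lemma zero_Q: "\<zero>\<^bsub>Q\<^esub> = cl \<zero>"
  by (simp add: quotient_vs_def cl_zero)

lemma add_Q:
  assumes v: "v \<in> carrier V" and w: "w \<in> carrier V"
  shows "cl v \<oplus>\<^bsub>Q\<^esub> cl w = cl (v \<oplus> w)"
proof -
  have "x \<oplus> y \<in> cl (v \<oplus> w)" if "x \<in> cl v" "y \<in> cl w" for x y
  proof -
    have *: "x \<in> carrier V" "y \<in> carrier V" "x \<oplus> (- 1) \<odot> v \<in> U" "y \<oplus> (- 1) \<odot> w \<in> U" using that v w by (auto simp: cl_mem)
    have "(x \<oplus> y) \<oplus> (- 1) \<odot> (v \<oplus> w) = (x \<oplus> (- 1) \<odot> v) \<oplus> (y \<oplus> (- 1) \<odot> w)"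
      using * v w by (simp add: smult_add ac)
    then show ?thesis using * v w UD(3) by (simp add: cl_mem)
  qed
  moreover have "\<exists>x\<in>cl v. \<exists>y\<in>cl w. z = x \<oplus> y" if "z \<in> cl (v \<oplus> w)" for z
  proof (intro bexI)
    have z: "z \<in> carrier V" "z \<oplus> (- 1) \<odot> (v \<oplus> w) \<in> U" using that v w by (auto simp: cl_mem)
    show "z = (z \<oplus> (- 1) \<odot> w) \<oplus> w" using z w by simp
    show "w \<in> cl w" by (rule cl_self[OF w])
    show "z \<oplus> (- 1) \<odot> w \<in> cl v" using z v w by (simp add: cl_mem smult_add ac)
  qed
  ultimately show ?thesis unfolding quotient_vs_def by (auto simp: set_add_def')
qed

text \<open>The scalar action on a coset is defined as a union over its representatives; all members
  of that union coincide.\<close>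

lemma smult_Q:
  assumes v: "v \<in> carrier V"
  shows "c \<odot>\<^bsub>Q\<^esub> cl v = cl (c \<odot> v)"
proof -
  have "cl (c \<odot> x) = cl (c \<odot> v)" if "x \<in> cl v" for x
  proof -
    have *: "x \<in> carrier V" "x \<oplus> (- 1) \<odot> v \<in> U" using that v by (auto simp: cl_mem)
    have "c \<odot> x \<oplus> (- 1) \<odot> (c \<odot> v) = c \<odot> (x \<oplus> (- 1) \<odot> v)" using * v by (simp add: smult_add mult.commute)
    then show ?thesis using * v UD(4) by (simp only: cl_eq smultC)
  qed
  then have "(\<Union>x\<in>cl v. cl (c \<odot> x)) = (\<Union>x\<in>cl v. cl (c \<odot> v))" by (intro SUP_cong refl)
  moreover have "cl v \<noteq> {}" using cl_self[OF v] by blast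
  ultimately show ?thesis by (simp add: quotient_vs_def)
qed

lemma kspace_Q: "kspace Q"
  by (rule kspaceI) (auto simp: carrier_Q add_Q smult_Q zero_Q ac add_smult smult_add)

lemma lin_cl: "lin V Q (\<lambda>v. cl v)"
  using kspace_axioms kspace_Q by (auto simp: linear_map_iff carrier_Q add_Q smult_Q)

lemma functional_Q:
  assumes f: "functional V f" and "\<And>u. u \<in> U \<Longrightarrow> f u = 0"
  obtains g where "functional Q g" "\<And>v. v \<in> carrier V \<Longrightarrow> g (cl v) = f v"
proof -
  define g where "g X = f (SOME v. v \<in> carrier V \<and> X = cl v)" for X
  have g: "g (cl v) = f v" if v: "v \<in> carrier V" for v
  proof -
    let ?w = "SOME w. w \<in> carrier V \<and> cl v = cl w"
    have w: "?w \<in> carrier V \<and> cl v = cl ?w" by (rule someI[of _ v]) (use v in simp)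
    then have "f (v \<oplus> (- 1) \<odot> ?w) = 0" using assms(2) cl_eq v by blast
    then show ?thesis using w v by (simp add: g_def functional_add[OF f] functional_smult[OF f])
  qed
  moreover have "functional Q g"
    using g by (auto simp: functional_def carrier_Q add_Q smult_Q functional_add[OF f] functional_smult[OF f])
  ultimately show ?thesis using that by blast
qed

end

section \<open>Free vector spaces and linear extension\<close>

lemma free_simps[simp]:
  "\<zero>\<^bsub>free_vs X\<^esub> = (\<lambda>x. 0)" "f \<oplus>\<^bsub>free_vs X\<^esub> g = (\<lambda>x. f x + g x)" "c \<odot>\<^bsub>free_vs X\<^esub> f = (\<lambda>x. c * f x)"
  by (simp_all add: free_vs_def)

text \<open>Finite support without reference to an index set, so that the linearity rules below
  apply in \<open>free_vs X\<close> for every \<open>X\<close>.\<close>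

definition fsupp :: "('a \<Rightarrow> 'k::field) \<Rightarrow> bool" where
  "fsupp f \<longleftrightarrow> finite {x. f x \<noteq> 0}"

lemma mem_free: "f \<in> carrier (free_vs X) \<longleftrightarrow> fsupp f \<and> (\<forall>x. x \<notin> X \<longrightarrow> f x = 0)"
  by (simp add: free_vs_def fsupp_def)

lemma fsupp_zero[simp]: "fsupp (\<lambda>x. 0)" by (simp add: fsupp_def)
lemma fsupp_basis[simp]: "fsupp (basis_fun x)" by (simp add: fsupp_def basis_fun_def)
lemma fsupp_add[simp]: "fsupp f \<Longrightarrow> fsupp g \<Longrightarrow> fsupp (\<lambda>x. f x + g x)"
  unfolding fsupp_def by (rule finite_subset[of _ "{x. f x \<noteq> 0} \<union> {x. g x \<noteq> 0}"]) auto
lemma fsupp_diff[simp]: "fsupp f \<Longrightarrow> fsupp g \<Longrightarrow> fsupp (\<lambda>x. f x - g x)"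
  unfolding fsupp_def by (rule finite_subset[of _ "{x. f x \<noteq> 0} \<union> {x. g x \<noteq> 0}"]) auto
lemma fsupp_smult[simp]: "fsupp f \<Longrightarrow> fsupp (\<lambda>x. c * f x)"
  unfolding fsupp_def by (rule finite_subset[of _ "{x. f x \<noteq> 0}"]) auto

lemma kspace_free: "kspace (free_vs X)"
  by (rule kspaceI) (auto simp: mem_free algebra_simps)

lemma basis_fun_free: "x \<in> X \<Longrightarrow> basis_fun x \<in> carrier (free_vs X)"
  by (auto simp: mem_free) (auto simp: basis_fun_def)

lemma free_induct:
  assumes "f \<in> carrier (free_vs X)" and "P (\<lambda>x. 0)"
    and "\<And>c x g. x \<in> X \<Longrightarrow> g \<in> carrier (free_vs X) \<Longrightarrow> P g \<Longrightarrow> P (\<lambda>y. c * basis_fun x y + g y)"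
  shows "P f"
proof -
  have "finite {x. f x \<noteq> 0}" using assms(1) by (simp add: mem_free fsupp_def)
  then show ?thesis using assms(1)
  proof (induct "{x. f x \<noteq> 0}" arbitrary: f)
    case empty
    then have "f = (\<lambda>x. 0)" by auto
    with assms(2) show ?case by simp
  next
    case (insert x A)
    let ?g = "f(x := 0)"
    have A: "A = {x. ?g x \<noteq> 0}" using insert(2,4) by auto
    then have g: "?g \<in> carrier (free_vs X)" using insert by (auto simp: mem_free fsupp_def)
    have "x \<in> X" using insert(4,5) by (force simp: mem_free)
    then have "P (\<lambda>y. f x * basis_fun x y + ?g y)" using assms(3) g insert(3)[OF A g] by blast
    moreover have "(\<lambda>y. f x * basis_fun x y + ?g y) = f" by (auto simp: basis_fun_def)
    ultimately show ?case by simp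
  qed
qed

text \<open>The subspace lives in a free space on \<open>Y\<close>, which may be larger than the one
  on \<open>X\<close>; in the exterior algebra, for instance, \<open>X\<close> consists of words of
  one length and \<open>Y\<close> of all words.\<close>

lemma free_subspace:
  fixes U :: "('a \<Rightarrow> 'k::field) set"
  assumes "subsp U (free_vs Y)" "\<And>x. x \<in> X \<Longrightarrow> basis_fun x \<in> U"
  shows "carrier (free_vs X :: ('k, 'a \<Rightarrow> 'k) module) \<subseteq> U"
proof
  fix f :: "'a \<Rightarrow> 'k" assume "f \<in> carrier (free_vs X)"
  then show "f \<in> U"
    by (rule free_induct) (use assms in \<open>auto simp: kspace.subspace_iff[OF kspace_free]\<close>)
qed

text \<open>The linear extension of a function given on the basis. The sum runs over the support of
  \<open>f\<close>, so linearity holds among functions of finite support.\<close>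

definition lext :: "('a \<Rightarrow> 'k::field) \<Rightarrow> ('a \<Rightarrow> 'k) \<Rightarrow> 'k" where
  "lext h f = (\<Sum>x | f x \<noteq> 0. f x * h x)"

lemma lext_superset: "finite A \<Longrightarrow> {x. f x \<noteq> 0} \<subseteq> A \<Longrightarrow> lext h f = (\<Sum>x\<in>A. f x * h x)"
  unfolding lext_def by (rule sum.mono_neutral_left) auto

lemma lext_basis[simp]: "lext h (basis_fun x) = h x" "lext h (\<lambda>y. basis_fun x y) = h x"
  using lext_superset[of "{x}" "basis_fun x" h] by (auto simp: basis_fun_def)

lemma lext_add[simp]:
  assumes "fsupp f" "fsupp g"
  shows "lext h (\<lambda>x. f x + g x) = lext h f + lext h g"
proof -
  let ?A = "{x. f x \<noteq> 0} \<union> {x. g x \<noteq> 0}"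
  have A: "finite ?A" using assms by (simp add: fsupp_def)
  have "{x. f x + g x \<noteq> 0} \<subseteq> ?A" by auto
  then show ?thesis
    using lext_superset[OF A, of f h] lext_superset[OF A, of g h] lext_superset[OF A, of "\<lambda>x. f x + g x" h]
    by (auto simp: sum.distrib algebra_simps)
qed

lemma lext_smult[simp]: "fsupp f \<Longrightarrow> lext h (\<lambda>x. c * f x) = c * lext h f"
  using lext_superset[of "{x. f x \<noteq> 0}" "\<lambda>x. c * f x" h]
  by (auto simp: fsupp_def lext_def sum_distrib_left mult.assoc)

lemma lext_diff[simp]: "fsupp f \<Longrightarrow> fsupp g \<Longrightarrow> lext h (\<lambda>x. f x - g x) = lext h f - lext h g"
  using lext_add[of f "\<lambda>x. (-1) * g x" h] lext_smult[of g h "-1"] fsupp_smult[of g "-1"] by simp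

lemma functional_lext: "functional (free_vs X) (lext h)"
  by (auto simp: functional_def mem_free)

text \<open>Each value of a pushforward is the linear extension of an indicator function, which
  makes its linearity an instance of the rules for \<open>lext\<close>.\<close>

lemma pushforward_lext: "pushforward h f = (\<lambda>y. lext (\<lambda>x. if h x = y then 1 else 0) f)" if "fsupp f"
proof
  fix y
  have "lext (\<lambda>x. if h x = y then 1 else 0) f = (\<Sum>x | f x \<noteq> 0. if h x = y then f x else 0)"
    unfolding lext_def by (intro sum.cong) auto
  also have "\<dots> = (\<Sum>x \<in> {x \<in> {x. f x \<noteq> 0}. h x = y}. f x)"
    using that unfolding fsupp_def by (subst sum.inter_filter) auto
  finally show "pushforward h f y = lext (\<lambda>x. if h x = y then 1 else 0) f"
    by (simp add: pushforward_def)
qed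

lemma pushforward_basis[simp]: "pushforward h (basis_fun x) = basis_fun (h x)"
  by (rule ext) (auto simp: pushforward_lext, auto simp: basis_fun_def)

lemma pushforward_add: "fsupp f \<Longrightarrow> fsupp g \<Longrightarrow> pushforward h (\<lambda>x. f x + g x) = (\<lambda>y. pushforward h f y + pushforward h g y)"
  by (simp add: pushforward_lext)

lemma pushforward_smult: "fsupp f \<Longrightarrow> pushforward h (\<lambda>x. c * f x) = (\<lambda>y. c * pushforward h f y)"
  by (simp add: pushforward_lext)

lemma pushforward_diff: "fsupp f \<Longrightarrow> fsupp g \<Longrightarrow> pushforward h (\<lambda>x. f x - g x) = (\<lambda>y. pushforward h f y - pushforward h g y)"
  by (simp add: pushforward_lext)

lemma pushforward_zero: "pushforward h (\<lambda>x. 0) = (\<lambda>y. 0)"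
  by (simp add: pushforward_lext lext_def)

lemma pushforward_closed:
  assumes "\<And>x. x \<in> X \<Longrightarrow> h x \<in> Y" "f \<in> carrier (free_vs X)"
  shows "pushforward h f \<in> carrier (free_vs Y)"
  using assms(2)
proof (rule free_induct)
  show "pushforward h (\<lambda>x. 0) \<in> carrier (free_vs Y)" by (simp add: pushforward_zero mem_free)
  fix c x g assume *: "x \<in> X" "g \<in> carrier (free_vs X)" "pushforward h g \<in> carrier (free_vs Y)"
  then show "pushforward h (\<lambda>y. c * basis_fun x y + g y) \<in> carrier (free_vs Y)"
    using basis_fun_free[of "h x" Y] assms(1)[of x]
    by (auto simp: mem_free pushforward_add pushforward_smult)
qed

lemma lin_pushforward:
  assumes "\<And>x. x \<in> X \<Longrightarrow> h x \<in> Y"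
  shows "lin (free_vs X :: ('k::field, 'a \<Rightarrow> 'k) module) (free_vs Y) (pushforward h)"
proof -
  have "pushforward h f \<in> carrier (free_vs Y)" if "f \<in> carrier (free_vs X)" for f :: "'a \<Rightarrow> 'k"
    using pushforward_closed that assms by metis
  then show ?thesis by (simp add: linear_map_iff kspace_free pushforward_add pushforward_smult) (simp add: mem_free pushforward_add pushforward_smult)
qed

text \<open>The space with generators \<open>X\<close> and relations \<open>R\<close>. Tensor
  products and exterior algebras are both of this kind.\<close>

locale presented =
  fixes X :: "'a set" and R :: "('a \<Rightarrow> 'k::field) set"
  assumes R: "R \<subseteq> carrier (free_vs X)"
begin

abbreviation "N \<equiv> LinearCombinations.module.span class_ring (free_vs X) R"

sublocale kspace "free_vs X :: ('k, 'a \<Rightarrow> 'k) module" by (rule kspace_free)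
sublocale kquot "free_vs X :: ('k, 'a \<Rightarrow> 'k) module" N
  by (intro kquot.intro kquot_axioms.intro kspace_free span_subsp(1)[OF R])

lemma generator_subspace:
  assumes W: "subsp W Q" and S: "S \<subseteq> X" "\<And>x. x \<in> S \<Longrightarrow> cl (basis_fun x) \<in> W"
  shows "(\<lambda>f. cl f) ` carrier (free_vs S) \<subseteq> W"
proof -
  have "carrier (free_vs S) \<subseteq> {f \<in> carrier (free_vs X). cl f \<in> W}"
    using linear_map_preimage_subspace[OF lin_cl W] S by (intro free_subspace) (auto simp: basis_fun_free)
  then show ?thesis by auto
qed

lemma generator_part:
  assumes S: "S \<subseteq> X"
  shows "subsp ((\<lambda>f. cl f) ` carrier (free_vs S)) Q"
proof (rule linear_map_image_subspace[OF lin_cl])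
  show "subsp (carrier (free_vs S)) (free_vs X :: ('k, 'a \<Rightarrow> 'k) module)"
    using S by (auto simp: subspace_iff mem_free subset_iff)
qed

text \<open>This is how vectors of a quotient are shown to be nonzero: values on generators that
  kill the relations define a functional on the quotient.\<close>

lemma functional_presented:
  assumes "\<And>r. r \<in> R \<Longrightarrow> lext h r = 0"
  obtains g where "functional Q g" "\<And>x. x \<in> X \<Longrightarrow> g (cl (basis_fun x)) = h x"
proof -
  have "lext h (\<lambda>x. 0) = 0" by (simp add: lext_def)
  then have "subsp {f \<in> carrier (free_vs X). lext h f = 0} (free_vs X)"
    by (auto simp: subspace_iff mem_free)
  then have "N \<subseteq> {f \<in> carrier (free_vs X). lext h f = 0}"
    using R assms by (intro span_least) auto
  then have "\<And>u. u \<in> N \<Longrightarrow> lext h u = 0" by auto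
  from functional_Q[OF functional_lext this]
  obtain g where "functional Q g" "\<And>v. v \<in> carrier (free_vs X) \<Longrightarrow> g (cl v) = lext h v" by metis
  then show ?thesis using that basis_fun_free[of _ X] lext_basis(1)[of h] by metis
qed

end

text \<open>The induced maps \<open>tensor_map\<close> and \<open>ext_map\<close> are unions over
  all representatives of a class. A linear map that sends relations into the span of the relations
  sends the whole class into one class, so the union is that class.\<close>

lemma presented_map:
  assumes "presented X R" "presented Y R'"
    and T: "lin (free_vs X) (free_vs Y) T"
    and r: "\<And>r. r \<in> R \<Longrightarrow> T r \<in> LinearCombinations.module.span class_ring (free_vs Y) R'"
    and f: "f \<in> carrier (free_vs X)"
  shows "(\<Union>F\<in>LinearCombinations.module.span class_ring (free_vs X) R +>\<^bsub>free_vs X\<^esub> f.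
      LinearCombinations.module.span class_ring (free_vs Y) R' +>\<^bsub>free_vs Y\<^esub> T F)
    = LinearCombinations.module.span class_ring (free_vs Y) R' +>\<^bsub>free_vs Y\<^esub> T f"
proof -
  interpret X: presented X R by fact
  interpret Y: presented Y R' by fact
  have "X.N \<subseteq> {f \<in> carrier (free_vs X). T f \<in> Y.N}"
    using X.R r linear_map_preimage_subspace[OF T Y.U] by (intro X.span_least) auto
  then have N: "T n \<in> Y.N" if "n \<in> X.N" for n using that by auto
  have "Y.cl (T F) = Y.cl (T f)" if "F \<in> X.cl f" for F
  proof -
    have *: "F \<in> carrier (free_vs X)" "F \<oplus>\<^bsub>free_vs X\<^esub> (- 1) \<odot>\<^bsub>free_vs X\<^esub> f \<in> X.N" using that X.cl_mem[OF f] by auto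
    then have "T F \<oplus>\<^bsub>free_vs Y\<^esub> (- 1) \<odot>\<^bsub>free_vs Y\<^esub> T f \<in> Y.N"
      using N[OF *(2)] linear_map_add[OF T *(1), of "(- 1) \<odot>\<^bsub>free_vs X\<^esub> f"] linear_map_smult[OF T f, of "-1"] X.smultC[OF f, of "-1"] by simp
    then show ?thesis using * linear_map_closed[OF T] f by (subst Y.cl_eq) auto
  qed
  then have "(\<Union>F\<in>X.cl f. Y.cl (T F)) = (\<Union>F\<in>X.cl f. Y.cl (T f))" by (intro SUP_cong refl)
  moreover have "X.cl f \<noteq> {}" using X.cl_self[OF f] by blast
  ultimately show ?thesis by simp
qed

section \<open>Tensor products\<close>

lemma tensor_rels_cases:
  assumes "r \<in> tensor_rels V W"
  obtains (add_left) v v' w where "r = (\<lambda>z. basis_fun (v \<oplus>\<^bsub>V\<^esub> v', w) z - basis_fun (v, w) z - basis_fun (v', w) z)"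
      "v \<in> carrier V" "v' \<in> carrier V" "w \<in> carrier W"
  | (add_right) v w w' where "r = (\<lambda>z. basis_fun (v, w \<oplus>\<^bsub>W\<^esub> w') z - basis_fun (v, w) z - basis_fun (v, w') z)"
      "v \<in> carrier V" "w \<in> carrier W" "w' \<in> carrier W"
  | (smult_left) c v w where "r = (\<lambda>z. basis_fun (c \<odot>\<^bsub>V\<^esub> v, w) z - c * basis_fun (v, w) z)"
      "v \<in> carrier V" "w \<in> carrier W"
  | (smult_right) c v w where "r = (\<lambda>z. basis_fun (v, c \<odot>\<^bsub>W\<^esub> w) z - c * basis_fun (v, w) z)"
      "v \<in> carrier V" "w \<in> carrier W"
  using assms unfolding tensor_rels_def by blast

lemma tensor_rels_intros:
  "v \<in> carrier V \<Longrightarrow> v' \<in> carrier V \<Longrightarrow> w \<in> carrier W \<Longrightarrow>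
    (\<lambda>z. basis_fun (v \<oplus>\<^bsub>V\<^esub> v', w) z - basis_fun (v, w) z - basis_fun (v', w) z) \<in> tensor_rels V W"
  "v \<in> carrier V \<Longrightarrow> w \<in> carrier W \<Longrightarrow> w' \<in> carrier W \<Longrightarrow>
    (\<lambda>z. basis_fun (v, w \<oplus>\<^bsub>W\<^esub> w') z - basis_fun (v, w) z - basis_fun (v, w') z) \<in> tensor_rels V W"
  "v \<in> carrier V \<Longrightarrow> w \<in> carrier W \<Longrightarrow>
    (\<lambda>z. basis_fun (c \<odot>\<^bsub>V\<^esub> v, w) z - c * basis_fun (v, w) z) \<in> tensor_rels V W"
  "v \<in> carrier V \<Longrightarrow> w \<in> carrier W \<Longrightarrow>
    (\<lambda>z. basis_fun (v, c \<odot>\<^bsub>W\<^esub> w) z - c * basis_fun (v, w) z) \<in> tensor_rels V W"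
  unfolding tensor_rels_def by blast+

lemma tensor_presented: "kspace V \<Longrightarrow> kspace W \<Longrightarrow> presented (carrier V \<times> carrier W) (tensor_rels V W)"
  by (rule presented.intro)
    (auto simp: tensor_rels_def mem_free kspace.addC kspace.smultC, auto simp: basis_fun_def kspace.addC kspace.smultC)

locale tensor = V: kspace V + W: kspace W for V :: "('k::field, 'v) module" and W :: "('k, 'w) module"
begin

interpretation T: presented "carrier V \<times> carrier W" "tensor_rels V W"
  by (rule tensor_presented[OF V.kspace_axioms W.kspace_axioms])

lemma kspace_tensor: "kspace (tensor_vs V W)"
  unfolding tensor_vs_def tensor_null_def by (rule T.kspace_Q)

lemma pure_eq: "pure_tensor V W v w = T.cl (basis_fun (v, w))"
  by (simp add: pure_tensor_def tensor_class_def tensor_null_def)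

lemma pure_closed: "v \<in> carrier V \<Longrightarrow> w \<in> carrier W \<Longrightarrow> pure_tensor V W v w \<in> carrier (tensor_vs V W)"
  unfolding tensor_vs_def tensor_null_def pure_eq T.carrier_Q by (auto intro: basis_fun_free)

lemma rel_cl3:
  assumes "(\<lambda>z. basis_fun a z - basis_fun b z - basis_fun c z) \<in> tensor_rels V W"
    and "a \<in> carrier V \<times> carrier W" "b \<in> carrier V \<times> carrier W" "c \<in> carrier V \<times> carrier W"
  shows "T.cl (basis_fun a) = T.cl (basis_fun b) \<oplus>\<^bsub>T.Q\<^esub> T.cl (basis_fun c)"
proof -
  have "(\<lambda>z. basis_fun a z - basis_fun b z - basis_fun c z) \<in> T.N" using T.span_subsp(2)[OF T.R] assms(1) by auto
  then show ?thesis using assms(2-4) T.addC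
    by (simp add: T.add_Q basis_fun_free T.cl_eq T.addC[unfolded free_simps] algebra_simps)
qed

lemma rel_cl2:
  assumes "(\<lambda>z. basis_fun a z - d * basis_fun b z) \<in> tensor_rels V W"
    and "a \<in> carrier V \<times> carrier W" "b \<in> carrier V \<times> carrier W"
  shows "T.cl (basis_fun a) = d \<odot>\<^bsub>T.Q\<^esub> T.cl (basis_fun b)"
proof -
  have "(\<lambda>z. basis_fun a z - d * basis_fun b z) \<in> T.N" using T.span_subsp(2)[OF T.R] assms(1) by auto
  then show ?thesis using assms(2-3)
    by (simp add: T.smult_Q basis_fun_free T.cl_eq T.smultC[unfolded free_simps] algebra_simps)
qed

lemma
  assumes "v \<in> carrier V" "w \<in> carrier W"
  shows pure_add_left: "v' \<in> carrier V \<Longrightarrow> pure_tensor V W (v \<oplus>\<^bsub>V\<^esub> v') w = pure_tensor V W v w \<oplus>\<^bsub>tensor_vs V W\<^esub> pure_tensor V W v' w"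
    and pure_add_right: "w' \<in> carrier W \<Longrightarrow> pure_tensor V W v (w \<oplus>\<^bsub>W\<^esub> w') = pure_tensor V W v w \<oplus>\<^bsub>tensor_vs V W\<^esub> pure_tensor V W v w'"
    and pure_smult_left: "pure_tensor V W (c \<odot>\<^bsub>V\<^esub> v) w = c \<odot>\<^bsub>tensor_vs V W\<^esub> pure_tensor V W v w"
    and pure_smult_right: "pure_tensor V W v (c \<odot>\<^bsub>W\<^esub> w) = c \<odot>\<^bsub>tensor_vs V W\<^esub> pure_tensor V W v w"
  unfolding pure_eq tensor_vs_def tensor_null_def
  using assms by (intro rel_cl3 rel_cl2 tensor_rels_intros; simp)+

text \<open>A product of two functionals is bilinear, so it kills the relations. These functionals
  detect nonzero pure tensors in \<open>pure_iso\<close>.\<close>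

lemma pure_functional:
  assumes "functional V f" "functional W g"
  obtains h where "functional (tensor_vs V W) h"
    "\<And>v w. v \<in> carrier V \<Longrightarrow> w \<in> carrier W \<Longrightarrow> h (pure_tensor V W v w) = f v * g w"
proof -
  have "lext (\<lambda>(v, w). f v * g w) r = 0" if "r \<in> tensor_rels V W" for r
    using that
    by (cases rule: tensor_rels_cases) (simp_all add: functional_add[OF assms(1)] functional_add[OF assms(2)]
        functional_smult[OF assms(1)] functional_smult[OF assms(2)] algebra_simps)
  from T.functional_presented[OF this] obtain h where "functional T.Q h"
    "\<And>x. x \<in> carrier V \<times> carrier W \<Longrightarrow> h (T.cl (basis_fun x)) = (case x of (v, w) \<Rightarrow> f v * g w)" by metis
  then show ?thesis using that[of h] by (simp add: pure_eq tensor_vs_def tensor_null_def)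
qed

lemma pure_generate:
  assumes "subsp S (tensor_vs V W)" "\<And>v w. v \<in> carrier V \<Longrightarrow> w \<in> carrier W \<Longrightarrow> pure_tensor V W v w \<in> S"
  shows "carrier (tensor_vs V W) \<subseteq> S"
  using T.generator_subspace[of S "carrier V \<times> carrier W"] assms
  by (auto simp: pure_eq tensor_vs_def tensor_null_def T.carrier_Q)

end

lemma tensorI: "kspace V \<Longrightarrow> kspace W \<Longrightarrow> tensor V W"
  by (simp add: tensor_def)

lemma tensor_map_pure:
  assumes f: "lin V V' f" and g: "lin W W' g" and vw: "v \<in> carrier V" "w \<in> carrier W"
  shows "tensor_map V' W' f g (pure_tensor V W v w) = pure_tensor V' W' (f v) (g w)"
proof -
  have k: "kspace V" "kspace V'" "kspace W" "kspace W'" using f g by (auto simp: linear_map_iff)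
  interpret A: presented "carrier V \<times> carrier W" "tensor_rels V W" using k by (intro tensor_presented)
  interpret B: presented "carrier V' \<times> carrier W'" "tensor_rels V' W'" using k by (intro tensor_presented)
  let ?T = "pushforward (map_prod f g)"
  have T: "lin (free_vs (carrier V \<times> carrier W)) (free_vs (carrier V' \<times> carrier W')) ?T"
    using linear_map_closed[OF f] linear_map_closed[OF g] by (intro lin_pushforward) auto
  have "?T r \<in> tensor_rels V' W'" if "r \<in> tensor_rels V W" for r
    using that
    by (cases rule: tensor_rels_cases) (simp_all add: pushforward_diff pushforward_smult linear_map_add[OF f] linear_map_add[OF g]
      linear_map_smult[OF f] linear_map_smult[OF g] tensor_rels_intros linear_map_closed[OF f] linear_map_closed[OF g])
  then have "?T r \<in> B.N" if "r \<in> tensor_rels V W" for r using that B.span_subsp(2)[OF B.R] by auto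
  from presented_map[OF A.presented_axioms B.presented_axioms T this basis_fun_free, of "(v, w)"]
  show ?thesis using vw by (simp add: tensor_map_def pure_tensor_def tensor_class_def tensor_null_def)
qed

text \<open>Surjectivity: every element of \<open>L\<close> is a multiple of \<open>l\<close>, and
  the scalar can be moved to the other factor. Injectivity: products of the coordinate of the line
  with the coordinates of \<open>W\<close> recover w from l \<otimes> w. Through this lemma L
  \<otimes> W is handled as a copy of W.\<close>

lemma pure_iso:
  assumes L: "has_dim L 1" and l: "l \<in> carrier L" "l \<noteq> \<zero>\<^bsub>L\<^esub>" and W: "has_dim W d"
  shows "lin_iso W (tensor_vs L W) (pure_tensor L W l)"
proof -
  interpret tensor L W using L W by (intro tensorI has_dim_kspace)
  interpret T: kspace "tensor_vs L W" by (rule kspace_tensor)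
  let ?p = "pure_tensor L W l"
  have p: "lin W (tensor_vs L W) ?p"
    using l W.kspace_axioms T.kspace_axioms by (auto simp: linear_map_iff pure_closed pure_add_right pure_smult_right)
  have s: "carrier (tensor_vs L W) \<subseteq> ?p ` carrier W"
  proof (rule pure_generate[OF linear_map_image_subspace[OF p W.carrier_subspace]])
    fix l' w assume lw: "l' \<in> carrier L" "w \<in> carrier W"
    obtain c where "l' = c \<odot>\<^bsub>L\<^esub> l" using has_dim_1_span[OF L l lw(1)] by auto
    then have "pure_tensor L W l' w = ?p (c \<odot>\<^bsub>W\<^esub> w)" using lw l by (simp add: pure_smult_left pure_smult_right)
    then show "pure_tensor L W l' w \<in> ?p ` carrier W" using lw by auto
  qed
  have "inj_on ?p (carrier W)"
  proof (rule linear_map_injI[OF p])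
    fix w assume w: "w \<in> carrier W" "?p w = \<zero>\<^bsub>tensor_vs L W\<^esub>"
    obtain e \<phi> where fr: "frame W d e \<phi>" using has_dim_frame[OF W] .
    obtain \<chi> where ch: "frame L 1 (\<lambda>i. l) \<chi>"
      using frame_oneI[OF V.kspace_axioms l] has_dim_1_span[OF L l] by blast
    have "\<phi> i w = 0" if "i < d" for i
    proof -
      have "functional L (\<chi> 0)" "functional W (\<phi> i)" using ch fr that by (auto simp: frame_def)
      from pure_functional[OF this] obtain h where h: "functional (tensor_vs L W) h"
        "\<And>v w. v \<in> carrier L \<Longrightarrow> w \<in> carrier W \<Longrightarrow> h (pure_tensor L W v w) = \<chi> 0 v * \<phi> i w" by metis
      have "\<chi> 0 l * \<phi> i w = 0" using h(2)[OF l(1) w(1)] w(2) functional_zero[OF h(1) T.kspace_axioms] by simp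
      then show ?thesis using ch by (simp add: frame_def)
    qed
    then show "w = \<zero>\<^bsub>W\<^esub>"
      using fr functional_zero[of W] by (intro frame_ext[OF fr]) (auto simp: w frame_def)
  qed
  then show ?thesis using p s linear_map_closed[OF p] by (auto simp: lin_iso_def bij_betw_def)
qed

section \<open>The exterior algebra\<close>

lemma ext_rels_cases:
  assumes "r \<in> ext_rels V"
  obtains (add) xs v v' ys where "r = (\<lambda>z. basis_fun (xs @ (v \<oplus>\<^bsub>V\<^esub> v') # ys) z
        - basis_fun (xs @ v # ys) z - basis_fun (xs @ v' # ys) z)"
      "xs \<in> lists (carrier V)" "v \<in> carrier V" "v' \<in> carrier V" "ys \<in> lists (carrier V)"
  | (smult) xs c v ys where "r = (\<lambda>z. basis_fun (xs @ (c \<odot>\<^bsub>V\<^esub> v) # ys) z - c * basis_fun (xs @ v # ys) z)"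
      "xs \<in> lists (carrier V)" "v \<in> carrier V" "ys \<in> lists (carrier V)"
  | (dup) xs v ys where "r = basis_fun (xs @ v # v # ys)"
      "xs \<in> lists (carrier V)" "v \<in> carrier V" "ys \<in> lists (carrier V)"
  using assms unfolding ext_rels_def by blast

lemma ext_rels_intros:
  "xs \<in> lists (carrier V) \<Longrightarrow> v \<in> carrier V \<Longrightarrow> v' \<in> carrier V \<Longrightarrow> ys \<in> lists (carrier V) \<Longrightarrow>
    (\<lambda>z. basis_fun (xs @ (v \<oplus>\<^bsub>V\<^esub> v') # ys) z - basis_fun (xs @ v # ys) z - basis_fun (xs @ v' # ys) z) \<in> ext_rels V"
  "xs \<in> lists (carrier V) \<Longrightarrow> v \<in> carrier V \<Longrightarrow> ys \<in> lists (carrier V) \<Longrightarrow>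
    (\<lambda>z. basis_fun (xs @ (c \<odot>\<^bsub>V\<^esub> v) # ys) z - c * basis_fun (xs @ v # ys) z) \<in> ext_rels V"
  "xs \<in> lists (carrier V) \<Longrightarrow> v \<in> carrier V \<Longrightarrow> ys \<in> lists (carrier V) \<Longrightarrow>
    basis_fun (xs @ v # v # ys) \<in> ext_rels V"
  unfolding ext_rels_def by blast+

text \<open>A term of the sum survives only if \<open>zs\<close> is cut exactly after
  \<open>length xs\<close> letters.\<close>

lemma word_product_basis: "word_product (basis_fun xs) (basis_fun ys) = (basis_fun (xs @ ys) :: 'v list \<Rightarrow> 'k::field)"
proof
  fix zs
  have "word_product (basis_fun xs) (basis_fun ys) zs
    = (\<Sum>i\<le>length zs. if i = length xs then (if zs = xs @ ys then 1 else 0) else (0::'k))"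
    unfolding word_product_def
  proof (intro sum.cong refl)
    fix i assume "i \<in> {..length zs}"
    then have "take i zs = xs \<and> drop i zs = ys \<longleftrightarrow> i = length xs \<and> zs = xs @ ys"
      by (auto simp: append_eq_conv_conj)
    then show "basis_fun xs (take i zs) * basis_fun ys (drop i zs)
        = (if i = length xs then (if zs = xs @ ys then 1 else 0) else (0::'k))"
      unfolding basis_fun_def by (smt (verit) mult_1 mult_zero_left mult_zero_right)
  qed
  also have "\<dots> = basis_fun (xs @ ys) zs" by (auto simp: basis_fun_def)
  finally show "word_product (basis_fun xs) (basis_fun ys) zs = (basis_fun (xs @ ys) zs :: 'k)" .
qed

lemma word_product_add_left: "word_product (\<lambda>x. f x + g x) h = (\<lambda>x. word_product f h x + word_product g h x)"
  and word_product_diff_left: "word_product (\<lambda>x. f x - g x) h = (\<lambda>x. word_product f h x - word_product g h x)"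
  and word_product_smult_left: "word_product (\<lambda>x. c * f x) h = (\<lambda>x. c * word_product f h x)"
  and word_product_add_right: "word_product h (\<lambda>x. f x + g x) = (\<lambda>x. word_product h f x + word_product h g x)"
  and word_product_diff_right: "word_product h (\<lambda>x. f x - g x) = (\<lambda>x. word_product h f x - word_product h g x)"
  and word_product_smult_right: "word_product h (\<lambda>x. c * f x) = (\<lambda>x. c * word_product h f x)"
  and word_product_zero_left: "word_product (\<lambda>x. 0) h = (\<lambda>x. 0)"
  and word_product_zero_right: "word_product h (\<lambda>x. 0) = (\<lambda>x. 0)"
  by (auto simp: word_product_def sum.distrib sum_subtractf sum_distrib_left algebra_simps)

lemmas word_product_linear = word_product_add_left word_product_diff_left word_product_smult_left
  word_product_add_right word_product_diff_right word_product_smult_right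
  word_product_zero_left word_product_zero_right

lemma word_product_closed:
  fixes f g :: "'v list \<Rightarrow> 'k::field"
  assumes f: "f \<in> carrier (free_vs A)" and g: "g \<in> carrier (free_vs B)"
    and AB: "\<And>xs ys. xs \<in> A \<Longrightarrow> ys \<in> B \<Longrightarrow> xs @ ys \<in> C"
  shows "word_product f g \<in> carrier (free_vs C)"
proof -
  have 1: "word_product (basis_fun xs) h \<in> carrier (free_vs C)" if "xs \<in> A" "h \<in> carrier (free_vs B)" for xs and h :: "'v list \<Rightarrow> 'k"
    using that(2)
  proof (rule free_induct)
    show "word_product (basis_fun xs) (\<lambda>x. 0) \<in> carrier (free_vs C)" by (simp add: word_product_linear mem_free)
    fix c ys and h :: "'v list \<Rightarrow> 'k"
    assume "ys \<in> B" "word_product (basis_fun xs) h \<in> carrier (free_vs C)"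
    then show "word_product (basis_fun xs) (\<lambda>y. c * basis_fun ys y + h y) \<in> carrier (free_vs C)"
      using basis_fun_free[OF AB[OF that(1)], of ys] by (auto simp: word_product_linear word_product_basis mem_free)
  qed
  show ?thesis using f
  proof (rule free_induct)
    show "word_product (\<lambda>x. 0) g \<in> carrier (free_vs C)" by (simp add: word_product_linear mem_free)
    fix c xs and h :: "'v list \<Rightarrow> 'k"
    assume "xs \<in> A" "word_product h g \<in> carrier (free_vs C)"
    then show "word_product (\<lambda>y. c * basis_fun xs y + h y) g \<in> carrier (free_vs C)"
      using 1[OF _ g, of xs] by (simp add: word_product_linear mem_free)
  qed
qed

text \<open>The product of the letters of a word in the exterior algebra.\<close>

definition word_class :: "('k::field, 'v) module \<Rightarrow> 'v list \<Rightarrow> ('v list \<Rightarrow> 'k) set" where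
  "word_class V xs = ext_class V (basis_fun xs)"

text \<open>The span of the products of the words in \<open>S\<close>; the carriers of all exterior
  powers are of this form (\<open>ext_pow_carrier\<close>).\<close>

definition ext_part :: "('k::field, 'v) module \<Rightarrow> 'v list set \<Rightarrow> ('v list \<Rightarrow> 'k) set set" where
  "ext_part V S = ext_class V ` carrier (free_vs S)"

definition words :: "'v set \<Rightarrow> nat \<Rightarrow> 'v list set" where
  "words U p = {xs. set xs \<subseteq> U \<and> length xs = p}"

lemma words_lists: "U \<subseteq> A \<Longrightarrow> words U p \<subseteq> lists A"
  by (auto simp: words_def)

lemma ext_pow_carrier: "carrier (ext_pow V U p) = ext_part V (words U p)"
  by (simp add: ext_pow_def ext_part_def words_def)

lemma ext_pow_ops[simp]: "zero (ext_pow V U p) = zero (ext_alg V)"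
  "add (ext_pow V U p) = add (ext_alg V)" "smult (ext_pow V U p) = smult (ext_alg V)"
  by (simp_all add: ext_pow_def)

lemma ext_presented: "kspace (V :: ('k::field, 'v) module) \<Longrightarrow> presented (lists (carrier V)) (ext_rels V)"
proof (rule presented.intro, rule subsetI)
  fix r assume V: "kspace V" "r \<in> ext_rels V"
  have b: "fsupp (basis_fun ws :: 'v list \<Rightarrow> 'k) \<and> (\<forall>x. x \<notin> lists (carrier V) \<longrightarrow> basis_fun ws x = (0::'k))" if "ws \<in> lists (carrier V)" for ws
    using basis_fun_free[OF that] by (simp add: mem_free)
  from V(2) show "r \<in> carrier (free_vs (lists (carrier V)))"
  proof (cases rule: ext_rels_cases)
    case (add xs v v' ys)
    then show ?thesis using b[of "xs @ (v \<oplus>\<^bsub>V\<^esub> v') # ys"] b[of "xs @ v # ys"] b[of "xs @ v' # ys"] kspace.addC[OF V(1), of v v']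
      by (simp add: mem_free)
  next
    case (smult xs c v ys)
    then show ?thesis using b[of "xs @ (c \<odot>\<^bsub>V\<^esub> v) # ys"] b[of "xs @ v # ys"] kspace.smultC[OF V(1), of v c]
      by (simp add: mem_free)
  next
    case (dup xs v ys)
    then show ?thesis using b[of "xs @ v # v # ys"] by (simp add: mem_free)
  qed
qed

context kspace
begin

interpretation E: presented "lists (carrier V)" "ext_rels V"
  by (rule ext_presented[OF kspace_axioms])

lemma ext_alg_eq: "ext_alg V = E.Q"
  by (simp add: ext_alg_def ext_ideal_def)

lemma ext_class_eq: "ext_class V f = E.cl f"
  by (simp add: ext_class_def ext_ideal_def)

lemma kspace_ext: "kspace (ext_alg V)"
  unfolding ext_alg_eq by (rule E.kspace_Q)

interpretation X: kspace "ext_alg V" by (rule kspace_ext)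

lemma ext_alg_carrier: "carrier (ext_alg V) = ext_part V (lists (carrier V))"
  by (simp add: ext_alg_eq E.carrier_Q ext_part_def ext_class_eq)

lemma ext_part_subsp: "S \<subseteq> lists (carrier V) \<Longrightarrow> subsp (ext_part V S) (ext_alg V)"
  using E.generator_part[of S] by (simp add: ext_part_def ext_alg_eq ext_class_eq[abs_def])

lemma ext_part_least: "subsp W (ext_alg V) \<Longrightarrow> S \<subseteq> lists (carrier V) \<Longrightarrow> (\<And>xs. xs \<in> S \<Longrightarrow> word_class V xs \<in> W) \<Longrightarrow> ext_part V S \<subseteq> W"
  using E.generator_subspace[of W S] by (simp add: ext_part_def ext_alg_eq ext_class_eq[abs_def] word_class_def)

lemma word_class_part: "xs \<in> S \<Longrightarrow> word_class V xs \<in> ext_part V S"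
  by (simp add: word_class_def ext_part_def basis_fun_free)

lemma ext_part_mono: "S \<subseteq> T \<Longrightarrow> ext_part V S \<subseteq> ext_part V T"
  unfolding ext_part_def by (rule image_mono) (auto simp: mem_free subset_iff)

lemma ext_part_closed: "S \<subseteq> lists (carrier V) \<Longrightarrow> x \<in> ext_part V S \<Longrightarrow> x \<in> carrier (ext_alg V)"
  using ext_part_mono ext_alg_carrier by blast

lemma word_class_closed[simp]: "xs \<in> lists (carrier V) \<Longrightarrow> word_class V xs \<in> carrier (ext_alg V)"
  by (simp add: ext_alg_carrier word_class_part)

lemma
  assumes "xs \<in> lists (carrier V)" "ys \<in> lists (carrier V)" "v \<in> carrier V"
  shows word_class_add: "v' \<in> carrier V \<Longrightarrow>
      word_class V (xs @ (v \<oplus> v') # ys) = word_class V (xs @ v # ys) \<oplus>\<^bsub>ext_alg V\<^esub> word_class V (xs @ v' # ys)"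
    and word_class_smult: "word_class V (xs @ (c \<odot> v) # ys) = c \<odot>\<^bsub>ext_alg V\<^esub> word_class V (xs @ v # ys)"
    and word_class_dup: "word_class V (xs @ v # v # ys) = \<zero>\<^bsub>ext_alg V\<^esub>"
proof -
  have R: "r \<in> E.N" if "r \<in> ext_rels V" for r using E.span_subsp(2)[OF E.R] that by blast
  note [simp] = word_class_def ext_class_eq ext_alg_eq
  have w: "xs @ u # ys \<in> lists (carrier V)" if "u \<in> carrier V" for u using assms that by auto
  {
    assume v': "v' \<in> carrier V"
    let ?a = "basis_fun (xs @ (v \<oplus> v') # ys)" and ?b = "basis_fun (xs @ v # ys)" and ?c = "basis_fun (xs @ v' # ys)"
    have c: "?a \<in> carrier (free_vs (lists (carrier V)))" "?b \<in> carrier (free_vs (lists (carrier V)))" "?c \<in> carrier (free_vs (lists (carrier V)))"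
      using v' assms w by (auto intro!: basis_fun_free simp del: in_lists_conv_set)
    have "(\<lambda>z. ?a z - ?b z - ?c z) \<in> E.N" using R[OF ext_rels_intros(1)] assms v' by blast
    then have "E.cl ?a = E.cl (?b \<oplus>\<^bsub>free_vs (lists (carrier V))\<^esub> ?c)"
      using c E.addC[OF c(2,3)] by (subst E.cl_eq) (auto simp: algebra_simps)
    then show "word_class V (xs @ (v \<oplus> v') # ys) = word_class V (xs @ v # ys) \<oplus>\<^bsub>ext_alg V\<^esub> word_class V (xs @ v' # ys)"
      using E.add_Q[OF c(2,3)] by simp
  }
  {
    let ?a = "basis_fun (xs @ (c \<odot> v) # ys)" and ?b = "basis_fun (xs @ v # ys)"
    have cc: "?a \<in> carrier (free_vs (lists (carrier V)))" "?b \<in> carrier (free_vs (lists (carrier V)))"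
      using assms w by (auto intro!: basis_fun_free simp del: in_lists_conv_set)
    have "(\<lambda>z. ?a z - c * ?b z) \<in> E.N" using R[OF ext_rels_intros(2)] assms by blast
    then have "E.cl ?a = E.cl (c \<odot>\<^bsub>free_vs (lists (carrier V))\<^esub> ?b)"
      using cc E.smultC[OF cc(2)] by (subst E.cl_eq) (auto simp: algebra_simps)
    then show "word_class V (xs @ (c \<odot> v) # ys) = c \<odot>\<^bsub>ext_alg V\<^esub> word_class V (xs @ v # ys)"
      using E.smult_Q[OF cc(2)] by simp
  }
  have "basis_fun (xs @ v # v # ys) \<in> E.N" using R[OF ext_rels_intros(3)] assms by blast
  then show "word_class V (xs @ v # v # ys) = \<zero>\<^bsub>ext_alg V\<^esub>"
    using assms by (simp, subst E.cl_eq_zero) (auto intro!: basis_fun_free)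
qed

lemma ext_functional:
  assumes "\<And>r. r \<in> ext_rels V \<Longrightarrow> lext h r = 0"
  obtains g where "functional (ext_alg V) g" "\<And>xs. xs \<in> lists (carrier V) \<Longrightarrow> g (word_class V xs) = h xs"
  using E.functional_presented[OF assms] unfolding ext_alg_eq word_class_def ext_class_eq by metis

lemma lin_eq_on_part:
  assumes "lin (ext_alg V) W f" "lin (ext_alg V) W g" and S: "S \<subseteq> lists (carrier V)"
    and eq: "\<And>xs. xs \<in> S \<Longrightarrow> f (word_class V xs) = g (word_class V xs)" and x: "x \<in> ext_part V S"
  shows "f x = g x"
proof -
  have "subsp {x \<in> carrier (ext_alg V). f x = g x} (ext_alg V)"
    using linear_map_zero[OF assms(1)] linear_map_zero[OF assms(2)]
    by (auto simp: X.subspace_iff linear_map_add[OF assms(1)] linear_map_add[OF assms(2)]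
        linear_map_smult[OF assms(1)] linear_map_smult[OF assms(2)])
  from ext_part_least[OF this S] have "ext_part V S \<subseteq> {x \<in> carrier (ext_alg V). f x = g x}"
    using eq subsetD[OF S] by simp
  then show ?thesis using x by blast
qed

text \<open>A word multiplied onto a relation only lengthens the context of the relation, which
  gives a relation again; linearity in both factors does the rest. This makes \<open>wedge\<close>
  well defined on classes.\<close>

lemma ext_ideal_wedge:
  assumes n: "n \<in> E.N" and g: "g \<in> carrier (free_vs (lists (carrier V)))"
  shows "word_product n g \<in> E.N" "word_product g n \<in> E.N"
proof -
  have NS: "subsp E.N (free_vs (lists (carrier V)))" by (rule E.U)
  note ND = E.UD(3)[unfolded free_simps] E.UD(4)[unfolded free_simps] E.UD(2)[unfolded free_simps]
  have R: "r \<in> E.N" if "r \<in> ext_rels V" for r using E.span_subsp(2)[OF E.R] that by blast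
  have nC: "n \<in> carrier (free_vs (lists (carrier V)))" if "n \<in> E.N" for n using that by (rule E.UD(1))
  have wc: "word_product f h \<in> carrier (free_vs (lists (carrier V)))"
    if "f \<in> carrier (free_vs (lists (carrier V)))" "h \<in> carrier (free_vs (lists (carrier V)))" for f h :: "'v list \<Rightarrow> 'k"
    using that by (rule word_product_closed) auto
  have 1: "word_product n (basis_fun zs) \<in> E.N \<and> word_product (basis_fun zs) n \<in> E.N" if zs: "zs \<in> lists (carrier V)" and n: "n \<in> E.N" for zs n
  proof -
    let ?S = "{n \<in> carrier (free_vs (lists (carrier V))). word_product n (basis_fun zs) \<in> E.N \<and> word_product (basis_fun zs) n \<in> E.N}"
    have "subsp ?S (free_vs (lists (carrier V)))"
      unfolding E.subspace_iff by (auto simp: word_product_linear ND E.addC[unfolded free_simps] E.smultC[unfolded free_simps] E.zeroC[unfolded free_simps])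
    moreover have "word_product r (basis_fun zs) \<in> E.N \<and> word_product (basis_fun zs) r \<in> E.N" if "r \<in> ext_rels V" for r
      using that
    proof (cases rule: ext_rels_cases)
      case (add xs v v' ys)
      then show ?thesis using zs R[OF ext_rels_intros(1), of xs v v' "ys @ zs"] R[OF ext_rels_intros(1), of "zs @ xs" v v' ys]
        by (simp add: word_product_linear word_product_basis)
    next
      case (smult xs c v ys)
      then show ?thesis using zs R[OF ext_rels_intros(2), of xs v "ys @ zs" c] R[OF ext_rels_intros(2), of "zs @ xs" v ys c]
        by (simp add: word_product_linear word_product_basis)
    next
      case (dup xs v ys)
      then show ?thesis using zs R[OF ext_rels_intros(3), of xs v "ys @ zs"] R[OF ext_rels_intros(3), of "zs @ xs" v ys]
        by (simp add: word_product_linear word_product_basis)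
    qed
    ultimately have "E.N \<subseteq> ?S" using E.R by (intro E.span_least) auto
    then show ?thesis using n by auto
  qed
  have "word_product n g \<in> E.N \<and> word_product g n \<in> E.N" using g
    by (rule free_induct) (use 1[OF _ n] in \<open>auto simp: word_product_linear ND\<close>)
  then show "word_product n g \<in> E.N" "word_product g n \<in> E.N" by auto
qed

lemma wedge_class:
  assumes f: "f \<in> carrier (free_vs (lists (carrier V)))" and g: "g \<in> carrier (free_vs (lists (carrier V)))"
  shows "wedge V (ext_class V f) (ext_class V g) = ext_class V (word_product f g)"
proof -
  have wc: "word_product f h \<in> carrier (free_vs (lists (carrier V)))"
    if "f \<in> carrier (free_vs (lists (carrier V)))" "h \<in> carrier (free_vs (lists (carrier V)))" for f h :: "'v list \<Rightarrow> 'k"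
    using that by (rule word_product_closed) auto
  have "E.cl (word_product F G) = E.cl (word_product f g)" if "F \<in> E.cl f" "G \<in> E.cl g" for F G
  proof -
    have F: "F \<in> carrier (free_vs (lists (carrier V)))" "(\<lambda>x. F x - f x) \<in> E.N"
      and G: "G \<in> carrier (free_vs (lists (carrier V)))" "(\<lambda>x. G x - g x) \<in> E.N"
      using that E.cl_mem[OF f] E.cl_mem[OF g] by auto
    have "(\<lambda>x. word_product (\<lambda>x. F x - f x) G x + word_product f (\<lambda>x. G x - g x) x) \<in> E.N"
      using E.UD(3)[unfolded free_simps, OF ext_ideal_wedge(1)[OF F(2) G(1)] ext_ideal_wedge(2)[OF G(2) f]] .
    then show ?thesis using wc[OF F(1) G(1)] wc[OF f g]
      by (subst E.cl_eq) (auto simp: word_product_linear)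
  qed
  then have "(\<Union>F\<in>E.cl f. \<Union>G\<in>E.cl g. E.cl (word_product F G)) = (\<Union>F\<in>E.cl f. \<Union>G\<in>E.cl g. E.cl (word_product f g))"
    by (intro SUP_cong refl)
  moreover have "E.cl f \<noteq> {}" "E.cl g \<noteq> {}" using E.cl_self[OF f] E.cl_self[OF g] by blast+
  ultimately show ?thesis unfolding wedge_def ext_class_eq by simp
qed

lemma wedge_word: "xs \<in> lists (carrier V) \<Longrightarrow> ys \<in> lists (carrier V) \<Longrightarrow>
  wedge V (word_class V xs) (word_class V ys) = word_class V (xs @ ys)"
  unfolding word_class_def by (subst wedge_class) (auto intro!: basis_fun_free simp: word_product_basis)

lemma wedge_part:
  assumes S: "S \<subseteq> lists (carrier V)" and T: "T \<subseteq> lists (carrier V)"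
    and x: "x \<in> ext_part V S" and y: "y \<in> ext_part V T" and ST: "\<And>xs ys. xs \<in> S \<Longrightarrow> ys \<in> T \<Longrightarrow> xs @ ys \<in> R"
  shows "wedge V x y \<in> ext_part V R"
proof -
  obtain f g where fg: "f \<in> carrier (free_vs S)" "x = ext_class V f" "g \<in> carrier (free_vs T)" "y = ext_class V g"
    using x y by (auto simp: ext_part_def)
  then have "f \<in> carrier (free_vs (lists (carrier V)))" "g \<in> carrier (free_vs (lists (carrier V)))"
    using S T by (auto simp: mem_free)
  with fg show ?thesis using word_product_closed[OF fg(1,3) ST] by (simp add: wedge_class ext_part_def)
qed

lemma wedge_closed[simp]: "x \<in> carrier (ext_alg V) \<Longrightarrow> y \<in> carrier (ext_alg V) \<Longrightarrow> wedge V x y \<in> carrier (ext_alg V)"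
  unfolding ext_alg_carrier by (rule wedge_part) auto

lemma
  assumes "x \<in> carrier (ext_alg V)" "y \<in> carrier (ext_alg V)"
  shows wedge_add_left: "z \<in> carrier (ext_alg V) \<Longrightarrow> wedge V (x \<oplus>\<^bsub>ext_alg V\<^esub> y) z = wedge V x z \<oplus>\<^bsub>ext_alg V\<^esub> wedge V y z"
    and wedge_add_right: "z \<in> carrier (ext_alg V) \<Longrightarrow> wedge V z (x \<oplus>\<^bsub>ext_alg V\<^esub> y) = wedge V z x \<oplus>\<^bsub>ext_alg V\<^esub> wedge V z y"
    and wedge_smult_left: "wedge V (c \<odot>\<^bsub>ext_alg V\<^esub> x) y = c \<odot>\<^bsub>ext_alg V\<^esub> wedge V x y"
    and wedge_smult_right: "wedge V x (c \<odot>\<^bsub>ext_alg V\<^esub> y) = c \<odot>\<^bsub>ext_alg V\<^esub> wedge V x y"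
proof -
  have wc: "word_product f h \<in> carrier (free_vs (lists (carrier V)))"
    if "f \<in> carrier (free_vs (lists (carrier V)))" "h \<in> carrier (free_vs (lists (carrier V)))" for f h :: "'v list \<Rightarrow> 'k"
    using that by (rule word_product_closed) auto
  obtain f g where fg: "f \<in> carrier (free_vs (lists (carrier V)))" "x = ext_class V f"
    "g \<in> carrier (free_vs (lists (carrier V)))" "y = ext_class V g"
    using assms by (auto simp: ext_alg_carrier ext_part_def)
  have a: "ext_class V f \<oplus>\<^bsub>ext_alg V\<^esub> ext_class V g = ext_class V (\<lambda>x. f x + g x)"
    if "f \<in> carrier (free_vs (lists (carrier V)))" "g \<in> carrier (free_vs (lists (carrier V)))" for f g
    using E.add_Q[OF that] by (simp add: ext_class_eq ext_alg_eq)
  have s: "c \<odot>\<^bsub>ext_alg V\<^esub> ext_class V f = ext_class V (\<lambda>x. c * f x)"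
    if "f \<in> carrier (free_vs (lists (carrier V)))" for f c
    using E.smult_Q[OF that] by (simp add: ext_class_eq ext_alg_eq)
  note cl = E.addC[unfolded free_simps] E.smultC[unfolded free_simps]
  {
    assume "z \<in> carrier (ext_alg V)"
    then obtain h where h: "h \<in> carrier (free_vs (lists (carrier V)))" "z = ext_class V h"
      by (auto simp: ext_alg_carrier ext_part_def)
    show "wedge V (x \<oplus>\<^bsub>ext_alg V\<^esub> y) z = wedge V x z \<oplus>\<^bsub>ext_alg V\<^esub> wedge V y z"
      using fg h by (simp add: a cl wedge_class wc word_product_linear)
    show "wedge V z (x \<oplus>\<^bsub>ext_alg V\<^esub> y) = wedge V z x \<oplus>\<^bsub>ext_alg V\<^esub> wedge V z y"
      using fg h by (simp add: a cl wedge_class wc word_product_linear)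
  }
  show "wedge V (c \<odot>\<^bsub>ext_alg V\<^esub> x) y = c \<odot>\<^bsub>ext_alg V\<^esub> wedge V x y"
    using fg by (simp add: s cl wedge_class wc word_product_linear)
  show "wedge V x (c \<odot>\<^bsub>ext_alg V\<^esub> y) = c \<odot>\<^bsub>ext_alg V\<^esub> wedge V x y"
    using fg by (simp add: s cl wedge_class wc word_product_linear)
qed

lemma lin_wedge_left: "x \<in> carrier (ext_alg V) \<Longrightarrow> lin (ext_alg V) (ext_alg V) (\<lambda>y. wedge V x y)"
  using kspace_ext by (auto simp: linear_map_iff wedge_add_right wedge_smult_right)

lemma lin_wedge_right: "y \<in> carrier (ext_alg V) \<Longrightarrow> lin (ext_alg V) (ext_alg V) (\<lambda>x. wedge V x y)"
  using kspace_ext by (auto simp: linear_map_iff wedge_add_left wedge_smult_left)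

lemma wedge_zero_left[simp]: "y \<in> carrier (ext_alg V) \<Longrightarrow> wedge V \<zero>\<^bsub>ext_alg V\<^esub> y = \<zero>\<^bsub>ext_alg V\<^esub>"
  using linear_map_zero[OF lin_wedge_right] .

lemma wedge_zero_right[simp]: "y \<in> carrier (ext_alg V) \<Longrightarrow> wedge V y \<zero>\<^bsub>ext_alg V\<^esub> = \<zero>\<^bsub>ext_alg V\<^esub>"
  using linear_map_zero[OF lin_wedge_left] .

text \<open>Reduces an identity between bilinear maps to words, where the product is concatenation.
  Associativity, graded commutativity and the compatibility of \<open>ext_map\<close> with products
  are proved this way.\<close>

lemma bilinear_on_parts:
  assumes "\<And>y. y \<in> carrier (ext_alg V) \<Longrightarrow> lin (ext_alg V) W (\<lambda>x. f x y)" "\<And>y. y \<in> carrier (ext_alg V) \<Longrightarrow> lin (ext_alg V) W (\<lambda>x. g x y)"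
    and "\<And>x. x \<in> carrier (ext_alg V) \<Longrightarrow> lin (ext_alg V) W (f x)" "\<And>x. x \<in> carrier (ext_alg V) \<Longrightarrow> lin (ext_alg V) W (g x)"
    and S: "S \<subseteq> lists (carrier V)" and T: "T \<subseteq> lists (carrier V)"
    and eq: "\<And>xs ys. xs \<in> S \<Longrightarrow> ys \<in> T \<Longrightarrow> f (word_class V xs) (word_class V ys) = g (word_class V xs) (word_class V ys)"
    and x: "x \<in> ext_part V S" and y: "y \<in> ext_part V T"
  shows "f x y = g x y"
proof (rule lin_eq_on_part[OF assms(1,2) S _ x])
  show "y \<in> carrier (ext_alg V)" "y \<in> carrier (ext_alg V)" using ext_part_closed[OF T y] by auto
  fix xs assume xs: "xs \<in> S"
  then have "word_class V xs \<in> carrier (ext_alg V)" using S by (intro word_class_closed) blast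
  then show "f (word_class V xs) y = g (word_class V xs) y"
    using lin_eq_on_part[OF assms(3,4) T eq[OF xs] y] by simp
qed

section \<open>Associativity and signs\<close>

lemma wedge_assoc:
  assumes "x \<in> carrier (ext_alg V)" "y \<in> carrier (ext_alg V)" "z \<in> carrier (ext_alg V)"
  shows "wedge V (wedge V x y) z = wedge V x (wedge V y z)"
proof (rule bilinear_on_parts[where f="\<lambda>x y. wedge V (wedge V x y) z" and g="\<lambda>x y. wedge V x (wedge V y z)"
      and S="lists (carrier V)" and T="lists (carrier V)"])
  note l = lin_wedge_left lin_wedge_right
  fix xs ys assume xs: "xs \<in> lists (carrier V)" "ys \<in> lists (carrier V)"
  have "wedge V (word_class V (xs @ ys)) z = wedge V (word_class V xs) (wedge V (word_class V ys) z)"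
  proof (rule lin_eq_on_part[OF _ _ subset_refl, where x=z and f="wedge V (word_class V (xs @ ys))"
        and g="\<lambda>z. wedge V (word_class V xs) (wedge V (word_class V ys) z)"])
    show "lin (ext_alg V) (ext_alg V) (wedge V (word_class V (xs @ ys)))" using xs by (intro l) auto
    show "lin (ext_alg V) (ext_alg V) (\<lambda>z. wedge V (word_class V xs) (wedge V (word_class V ys) z))"
      using xs by (intro linear_map_compose[OF l(1) l(1)]) auto
    show "z \<in> ext_part V (lists (carrier V))" using assms by (simp add: ext_alg_carrier)
    fix zs assume "zs \<in> lists (carrier V)"
    with xs show "wedge V (word_class V (xs @ ys)) (word_class V zs) = wedge V (word_class V xs) (wedge V (word_class V ys) (word_class V zs))"
      by (simp add: wedge_word)
  qed
  then show "wedge V (wedge V (word_class V xs) (word_class V ys)) z = wedge V (word_class V xs) (wedge V (word_class V ys) z)"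
    using xs by (simp add: wedge_word)
qed (use assms in \<open>auto simp: ext_alg_carrier[symmetric] intro: lin_wedge_left lin_wedge_right
      linear_map_compose[OF lin_wedge_left lin_wedge_right] linear_map_compose[OF lin_wedge_right lin_wedge_left]
      linear_map_compose[OF lin_wedge_right lin_wedge_right] linear_map_compose[OF lin_wedge_left lin_wedge_left]\<close>)

text \<open>Polarization: the word with \<open>a \<oplus> b\<close> repeated vanishes, and so do two
  of the four words in its expansion.\<close>

lemma word_class_swap:
  assumes "xs \<in> lists (carrier V)" "ys \<in> lists (carrier V)" "a \<in> carrier V" "b \<in> carrier V"
  shows "word_class V (xs @ a # b # ys) = (- 1) \<odot>\<^bsub>ext_alg V\<^esub> word_class V (xs @ b # a # ys)"
proof -
  let ?w = "\<lambda>a b. word_class V (xs @ a # b # ys)"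
  have w: "?w a b \<in> carrier (ext_alg V)" if "a \<in> carrier V" "b \<in> carrier V" for a b using assms that by simp
  have l: "?w (a \<oplus> b) c = ?w a c \<oplus>\<^bsub>ext_alg V\<^esub> ?w b c" if "c \<in> carrier V" for c
    using word_class_add[of xs "c # ys" a b] assms that by simp
  have r: "?w c (a \<oplus> b) = ?w c a \<oplus>\<^bsub>ext_alg V\<^esub> ?w c b" if "c \<in> carrier V" for c
    using word_class_add[of "xs @ [c]" ys a b] assms that by simp
  have "\<zero>\<^bsub>ext_alg V\<^esub> = ?w (a \<oplus> b) (a \<oplus> b)" using word_class_dup[of xs ys "a \<oplus> b"] assms by simp
  also have "\<dots> = ?w a b \<oplus>\<^bsub>ext_alg V\<^esub> ?w b a"
    using assms w word_class_dup[of xs ys a] word_class_dup[of xs ys b] by (simp add: l r X.comm)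
  finally have "?w a b \<oplus>\<^bsub>ext_alg V\<^esub> ?w b a = \<zero>\<^bsub>ext_alg V\<^esub>" by (rule sym)
  then show ?thesis using w assms X.eq_iff_diff[of "?w a b" "(- 1) \<odot>\<^bsub>ext_alg V\<^esub> ?w b a"] by simp
qed

lemma word_class_move:
  assumes "us \<in> lists (carrier V)" "ys \<in> lists (carrier V)" "zs \<in> lists (carrier V)" "x \<in> carrier V"
  shows "word_class V (us @ x # ys @ zs) = (- 1) ^ length ys \<odot>\<^bsub>ext_alg V\<^esub> word_class V (us @ ys @ x # zs)"
  using assms(1,2)
proof (induct ys arbitrary: us)
  case Nil
  then show ?case using assms by simp
next
  case (Cons y ys)
  have "word_class V (us @ x # (y # ys) @ zs) = (- 1) \<odot>\<^bsub>ext_alg V\<^esub> word_class V ((us @ [y]) @ x # ys @ zs)"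
    using word_class_swap[of us "ys @ zs" x y] assms Cons by simp
  also have "\<dots> = (- 1) \<odot>\<^bsub>ext_alg V\<^esub> ((- 1) ^ length ys \<odot>\<^bsub>ext_alg V\<^esub> word_class V ((us @ [y]) @ ys @ x # zs))"
    using Cons by (subst Cons(1)) auto
  finally show ?case using assms Cons by simp
qed

lemma word_class_not_distinct:
  assumes "xs \<in> lists (carrier V)" "\<not> distinct xs"
  shows "word_class V xs = \<zero>\<^bsub>ext_alg V\<^esub>"
proof -
  obtain as x bs cs where xs: "xs = as @ [x] @ bs @ [x] @ cs" using not_distinct_decomp[OF assms(2)] by blast
  then have "word_class V xs = (- 1) ^ length bs \<odot>\<^bsub>ext_alg V\<^esub> word_class V (as @ bs @ x # x # cs)"
    using assms word_class_move[of as bs "x # cs" x] by simp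
  also have "word_class V (as @ bs @ x # x # cs) = \<zero>\<^bsub>ext_alg V\<^esub>"
    using word_class_dup[of "as @ bs" cs x] assms xs by simp
  finally show ?thesis by simp
qed

text \<open>One sign has to serve all prefixes \<open>us\<close>, because the induction moves the
  first letter into the prefix. Which sign it is stays unspecified; being 1 or - 1 is enough to
  correct it in a dual basis.\<close>

lemma word_class_perm:
  assumes "mset xs = mset ys" "xs \<in> lists (carrier V)"
  shows "\<exists>s. (s = 1 \<or> s = - 1) \<and> (\<forall>us\<in>lists (carrier V). word_class V (us @ xs) = s \<odot>\<^bsub>ext_alg V\<^esub> word_class V (us @ ys))"
  using assms
proof (induct xs arbitrary: ys)
  case Nil
  then show ?case by (intro exI[of _ 1]) auto
next
  case (Cons x xs)
  then have "x \<in> set ys" by (metis list.set_intros(1) mset_eq_setD)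
  then obtain y1 y2 where ys: "ys = y1 @ x # y2" by (metis split_list)
  with Cons have m: "mset xs = mset (y1 @ y2)" by simp
  have yC: "set ys \<subseteq> carrier V" using Cons by (metis mset_eq_setD in_listsD subsetI)
  obtain s where s: "s = 1 \<or> s = - 1" "\<And>us. us \<in> lists (carrier V) \<Longrightarrow> word_class V (us @ xs) = s \<odot>\<^bsub>ext_alg V\<^esub> word_class V (us @ y1 @ y2)"
    using Cons(1)[OF m] Cons(3) by (metis Cons_in_lists_iff)
  let ?s = "s * (- 1) ^ length y1"
  have "word_class V (us @ x # xs) = ?s \<odot>\<^bsub>ext_alg V\<^esub> word_class V (us @ ys)" if us: "us \<in> lists (carrier V)" for us
  proof -
    have "word_class V (us @ x # xs) = s \<odot>\<^bsub>ext_alg V\<^esub> word_class V (us @ x # y1 @ y2)"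
      using s(2)[of "us @ [x]"] us Cons by simp
    moreover have "y1 \<in> lists (carrier V)" "y2 \<in> lists (carrier V)" using yC ys by auto
    ultimately show ?thesis using word_class_move[of us y1 y2 x] us Cons(3) ys by simp
  qed
  moreover have "?s = 1 \<or> ?s = - 1" using s by (cases "even (length y1)") auto
  ultimately show ?case by blast
qed

lemma word_class_comm:
  assumes "us \<in> lists (carrier V)" "xs \<in> lists (carrier V)" "ys \<in> lists (carrier V)"
  shows "word_class V (us @ xs @ ys) = (- 1) ^ (length xs * length ys) \<odot>\<^bsub>ext_alg V\<^esub> word_class V (us @ ys @ xs)"
  using assms(1,2)
proof (induct xs arbitrary: us)
  case Nil
  then show ?case using assms by simp
next
  case (Cons x xs)
  have "word_class V (us @ (x # xs) @ ys) = (- 1) ^ (length xs * length ys) \<odot>\<^bsub>ext_alg V\<^esub> word_class V (us @ x # ys @ xs)"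
    using Cons(1)[of "us @ [x]"] Cons(2,3) by simp
  also have "\<dots> = (- 1) ^ (length xs * length ys) \<odot>\<^bsub>ext_alg V\<^esub> ((- 1) ^ length ys \<odot>\<^bsub>ext_alg V\<^esub> word_class V (us @ ys @ x # xs))"
    using word_class_move[of us ys xs x] Cons assms by simp
  finally show ?case using Cons assms by (simp add: power_add mult.commute)
qed

lemma wedge_comm:
  assumes x: "x \<in> ext_part V (words (carrier V) p)" and y: "y \<in> ext_part V (words (carrier V) q)"
  shows "wedge V x y = (- 1) ^ (p * q) \<odot>\<^bsub>ext_alg V\<^esub> wedge V y x"
proof (rule bilinear_on_parts[where g="\<lambda>x y. (- 1) ^ (p * q) \<odot>\<^bsub>ext_alg V\<^esub> wedge V y x", OF _ _ _ _ _ _ _ x y])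
  have l: "lin (ext_alg V) (ext_alg V) (\<lambda>x. c \<odot>\<^bsub>ext_alg V\<^esub> x)" for c
    using kspace_ext by (auto simp: linear_map_iff X.smult_add mult.commute)
  fix z assume z: "z \<in> carrier (ext_alg V)"
  show "lin (ext_alg V) (ext_alg V) (\<lambda>x. wedge V x z)" "lin (ext_alg V) (ext_alg V) (wedge V z)"
    using z by (auto intro: lin_wedge_left lin_wedge_right)
  show "lin (ext_alg V) (ext_alg V) (\<lambda>x. (- 1) ^ (p * q) \<odot>\<^bsub>ext_alg V\<^esub> wedge V z x)"
    "lin (ext_alg V) (ext_alg V) (\<lambda>x. (- 1) ^ (p * q) \<odot>\<^bsub>ext_alg V\<^esub> wedge V x z)"
    using linear_map_compose[OF lin_wedge_left[OF z] l] linear_map_compose[OF lin_wedge_right[OF z] l] by auto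
next
  fix xs ys assume "xs \<in> words (carrier V) p" "ys \<in> words (carrier V) q"
  then have "xs \<in> lists (carrier V)" "ys \<in> lists (carrier V)" "length xs = p" "length ys = q" by (auto simp: words_def)
  then show "wedge V (word_class V xs) (word_class V ys) = (- 1) ^ (p * q) \<odot>\<^bsub>ext_alg V\<^esub> wedge V (word_class V ys) (word_class V xs)"
    using word_class_comm[of "[]" xs ys] by (simp add: wedge_word)
qed (auto simp: words_def)

lemma ext_vec_word: "ext_vec V v = word_class V [v]"
  by (simp add: ext_vec_def word_class_def)

lemma ext_vec_closed[simp]: "v \<in> carrier V \<Longrightarrow> ext_vec V v \<in> carrier (ext_alg V)"
  by (simp add: ext_vec_word)

lemma lin_ext_vec: "lin V (ext_alg V) (ext_vec V)"
  using kspace_ext kspace_axioms word_class_add[of "[]" "[]"] word_class_smult[of "[]" "[]"]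
  by (auto simp: linear_map_iff ext_vec_word)

lemma ext_vec_wedge_word: "v \<in> carrier V \<Longrightarrow> xs \<in> lists (carrier V) \<Longrightarrow> wedge V (ext_vec V v) (word_class V xs) = word_class V (v # xs)"
  by (simp add: ext_vec_word wedge_word)

lemma ext_vec_pow: "v \<in> U \<Longrightarrow> ext_vec V v \<in> ext_part V (words U 1)"
  by (simp add: ext_vec_word word_class_part words_def)

lemma wedge_pow:
  "U \<subseteq> carrier V \<Longrightarrow> x \<in> ext_part V (words U p) \<Longrightarrow> y \<in> ext_part V (words U q) \<Longrightarrow> wedge V x y \<in> ext_part V (words U (p + q))"
  by (rule wedge_part[of "words U p" "words U q"]) (auto simp: words_def)

lemma ext_vec_sq: "v \<in> carrier V \<Longrightarrow> x \<in> carrier (ext_alg V) \<Longrightarrow> wedge V (ext_vec V v) (wedge V (ext_vec V v) x) = \<zero>\<^bsub>ext_alg V\<^esub>"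
  using word_class_dup[of "[]" "[]" v] by (simp add: wedge_assoc[symmetric]) (simp add: ext_vec_word wedge_word)

lemma kspace_pow: "U \<subseteq> carrier V \<Longrightarrow> kspace (ext_pow V U p)"
  using X.subspace_kspace[OF ext_part_subsp[OF words_lists[of U "carrier V" p]]]
  unfolding ext_pow_def ext_part_def words_def by simp

lemma pow_subsp: "U \<subseteq> carrier V \<Longrightarrow> subsp (ext_part V (words U p)) (ext_alg V)"
  by (rule ext_part_subsp) (rule words_lists)

lemma pow_closed: "U \<subseteq> carrier V \<Longrightarrow> x \<in> ext_part V (words U p) \<Longrightarrow> x \<in> carrier (ext_alg V)"
  by (rule ext_part_closed[OF words_lists])

end

section \<open>Functoriality of the exterior algebra\<close>

lemma ext_map_class:
  assumes g: "lin V V' g" and f: "f \<in> carrier (free_vs (lists (carrier V)))"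
  shows "ext_map V' g (ext_class V f) = ext_class V' (pushforward (map g) f)"
proof -
  have k: "kspace V" "kspace V'" using g by (auto simp: linear_map_iff)
  interpret A: presented "lists (carrier V)" "ext_rels V" using k by (intro ext_presented)
  interpret B: presented "lists (carrier V')" "ext_rels V'" using k by (intro ext_presented)
  let ?T = "pushforward (map g)"
  have gl: "map g xs \<in> lists (carrier V')" if "xs \<in> lists (carrier V)" for xs
    using linear_map_closed[OF g] that by auto
  have T: "lin (free_vs (lists (carrier V))) (free_vs (lists (carrier V'))) ?T"
    by (rule lin_pushforward) (rule gl)
  have "?T r \<in> ext_rels V'" if "r \<in> ext_rels V" for r
    using that
  proof (cases rule: ext_rels_cases)
    case (add xs v v' ys)
    then show ?thesis using ext_rels_intros(1)[OF gl[OF add(2)] linear_map_closed[OF g add(3)] linear_map_closed[OF g add(4)] gl[OF add(5)]]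
      by (simp add: pushforward_diff linear_map_add[OF g])
  next
    case (smult xs c v ys)
    then show ?thesis using ext_rels_intros(2)[OF gl[OF smult(2)] linear_map_closed[OF g smult(3)] gl[OF smult(4)]]
      by (simp add: pushforward_diff pushforward_smult linear_map_smult[OF g])
  next
    case (dup xs v ys)
    then show ?thesis using ext_rels_intros(3)[OF gl[OF dup(2)] linear_map_closed[OF g dup(3)] gl[OF dup(4)]] by simp
  qed
  then have "?T r \<in> B.N" if "r \<in> ext_rels V" for r using that B.span_subsp(2)[OF B.R] by auto
  from presented_map[OF A.presented_axioms B.presented_axioms T this f]
  show ?thesis by (simp add: ext_map_def ext_class_def ext_ideal_def)
qed

lemma ext_map_word:
  "lin V V' g \<Longrightarrow> xs \<in> lists (carrier V) \<Longrightarrow> ext_map V' g (word_class V xs) = word_class V' (map g xs)"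
  unfolding word_class_def by (subst ext_map_class) (auto intro: basis_fun_free)

lemma lin_ext_map:
  assumes g: "lin V V' g"
  shows "lin (ext_alg V) (ext_alg V') (ext_map V' g)"
proof -
  have k: "kspace V" "kspace V'" using g by (auto simp: linear_map_iff)
  interpret A: presented "lists (carrier V)" "ext_rels V" using k by (intro ext_presented)
  interpret B: presented "lists (carrier V')" "ext_rels V'" using k by (intro ext_presented)
  interpret VV: kspace V by fact
  interpret VV': kspace V' by fact
  have T: "lin (free_vs (lists (carrier V))) (free_vs (lists (carrier V'))) (pushforward (map g))"
    using linear_map_closed[OF g] by (intro lin_pushforward) auto
  have m: "ext_map V' g (A.cl f) = B.cl (pushforward (map g) f)" if "f \<in> carrier (free_vs (lists (carrier V)))" for f
    using ext_map_class[OF g that] by (simp add: ext_class_def ext_ideal_def)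
  note Tc = linear_map_closed[OF T] linear_map_add[OF T, unfolded free_simps] linear_map_smult[OF T, unfolded free_simps]
  show ?thesis
    unfolding linear_map_iff VV.ext_alg_eq VV'.ext_alg_eq
    using A.kspace_Q B.kspace_Q
    by (auto simp: A.carrier_Q B.carrier_Q A.add_Q A.smult_Q B.add_Q B.smult_Q m Tc A.addC[unfolded free_simps] A.smultC[unfolded free_simps])
qed

lemma ext_map_part:
  assumes g: "lin V V' g" and S: "S \<subseteq> lists (carrier V)" and x: "x \<in> ext_part V S" and ST: "\<And>xs. xs \<in> S \<Longrightarrow> map g xs \<in> T"
    and T: "T \<subseteq> lists (carrier V')"
  shows "ext_map V' g x \<in> ext_part V' T"
proof -
  interpret V: kspace V using g by (rule linear_map_dom)
  interpret V': kspace V' using g by (rule linear_map_cod)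
  have "ext_part V S \<subseteq> {x \<in> carrier (ext_alg V). ext_map V' g x \<in> ext_part V' T}"
    by (rule V.ext_part_least[OF linear_map_preimage_subspace[OF lin_ext_map[OF g] V'.ext_part_subsp[OF T]] S])
      (use S ST subsetD[OF S] in \<open>simp add: ext_map_word[OF g] V'.word_class_part\<close>)
  then show ?thesis using x by auto
qed

lemma ext_map_pow:
  assumes "lin V V' g" "U \<subseteq> carrier V" "x \<in> ext_part V (words U p)"
  shows "ext_map V' g x \<in> ext_part V' (words (g ` U) p)"
proof (rule ext_map_part[OF assms(1) words_lists[OF assms(2)] assms(3)])
  have "g ` U \<subseteq> carrier V'" using assms(2) linear_map_closed[OF assms(1)] by auto
  then show "words (g ` U) p \<subseteq> lists (carrier V')" by (rule words_lists)
qed (auto simp: words_def)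

lemma ext_map_wedge:
  assumes g: "lin V V' g" and x: "x \<in> carrier (ext_alg V)" and y: "y \<in> carrier (ext_alg V)"
  shows "ext_map V' g (wedge V x y) = wedge V' (ext_map V' g x) (ext_map V' g y)"
proof -
  interpret V: kspace V using g by (rule linear_map_dom)
  interpret V': kspace V' using g by (rule linear_map_cod)
  note G = lin_ext_map[OF g]
  have gl: "map g xs \<in> lists (carrier V')" if "xs \<in> lists (carrier V)" for xs
    using linear_map_closed[OF g] that by auto
  show ?thesis
  proof (rule V.bilinear_on_parts[where f="\<lambda>x y. ext_map V' g (wedge V x y)" and g="\<lambda>x y. wedge V' (ext_map V' g x) (ext_map V' g y)"])
    fix z assume z: "z \<in> carrier (ext_alg V)"
    show "lin (ext_alg V) (ext_alg V') (\<lambda>x. ext_map V' g (wedge V x z))" "lin (ext_alg V) (ext_alg V') (\<lambda>x. ext_map V' g (wedge V z x))"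
      by (rule linear_map_compose[OF V.lin_wedge_right[OF z] G] linear_map_compose[OF V.lin_wedge_left[OF z] G])+
    have gz: "ext_map V' g z \<in> carrier (ext_alg V')" by (rule linear_map_closed[OF G z])
    show "lin (ext_alg V) (ext_alg V') (\<lambda>x. wedge V' (ext_map V' g x) (ext_map V' g z))"
      "lin (ext_alg V) (ext_alg V') (\<lambda>x. wedge V' (ext_map V' g z) (ext_map V' g x))"
      by (rule linear_map_compose[OF G V'.lin_wedge_right[OF gz]] linear_map_compose[OF G V'.lin_wedge_left[OF gz]])+
  next
    fix xs ys assume "xs \<in> lists (carrier V)" "ys \<in> lists (carrier V)"
    then show "ext_map V' g (wedge V (word_class V xs) (word_class V ys))
      = wedge V' (ext_map V' g (word_class V xs)) (ext_map V' g (word_class V ys))"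
      using gl[of xs] gl[of ys] by (simp add: V.wedge_word V'.wedge_word ext_map_word[OF g])
  qed (use x y in \<open>auto simp: V.ext_alg_carrier\<close>)
qed

lemma ext_map_vec: "lin V V' g \<Longrightarrow> v \<in> carrier V \<Longrightarrow> ext_map V' g (ext_vec V v) = ext_vec V' (g v)"
  using ext_map_word[of V V' g "[v]"] by (simp add: kspace.ext_vec_word linear_map_dom linear_map_cod)

lemma ext_map_compose:
  assumes g: "lin V V' g" and g': "lin V' V'' g'" and h: "\<And>v. v \<in> carrier V \<Longrightarrow> h v = g' (g v)" and x: "x \<in> carrier (ext_alg V)"
  shows "ext_map V'' h x = ext_map V'' g' (ext_map V' g x)"
proof -
  interpret V: kspace V using g by (rule linear_map_dom)
  have hl: "lin V V'' h" by (rule linear_map_cong[OF linear_map_compose[OF g g']]) (simp add: h)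
  show ?thesis
  proof (rule V.lin_eq_on_part[OF lin_ext_map[OF hl] linear_map_compose[OF lin_ext_map[OF g] lin_ext_map[OF g']] subset_refl])
    fix xs assume xs: "xs \<in> lists (carrier V)"
    then have "map g xs \<in> lists (carrier V')" using linear_map_closed[OF g] by auto
    moreover have *: "map h xs = map g' (map g xs)" using xs h by auto
    ultimately show "ext_map V'' h (word_class V xs) = ext_map V'' g' (ext_map V' g (word_class V xs))"
      using xs by (simp only: ext_map_word[OF hl] ext_map_word[OF g] ext_map_word[OF g'] *)
  qed (use x in \<open>simp add: V.ext_alg_carrier\<close>)
qed

text \<open>Each letter of a word of length p contributes one factor c. This is the computation
  behind rescaling an isomorphism of Lagrangian data.\<close>

lemma ext_map_scale:
  assumes g: "lin V V' g" and h: "\<And>v. v \<in> carrier V \<Longrightarrow> h v = c \<odot>\<^bsub>V'\<^esub> g v" and x: "x \<in> ext_part V (words (carrier V) p)"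
  shows "ext_map V' h x = c ^ p \<odot>\<^bsub>ext_alg V'\<^esub> ext_map V' g x"
proof -
  interpret V: kspace V using g by (rule linear_map_dom)
  interpret V': kspace V' using g by (rule linear_map_cod)
  have s: "lin V' V' (\<lambda>x. c \<odot>\<^bsub>V'\<^esub> x)"
    using V'.kspace_axioms by (auto simp: linear_map_iff V'.smult_add mult.commute)
  interpret VX': kspace "ext_alg V'" by (rule V'.kspace_ext)
  have s': "lin (ext_alg V') (ext_alg V') (\<lambda>x. c ^ p \<odot>\<^bsub>ext_alg V'\<^esub> x)"
    using V'.kspace_ext by (auto simp: linear_map_iff VX'.smult_add mult.commute)
  have hl: "lin V V' h" by (rule linear_map_cong[OF linear_map_compose[OF g s]]) (simp add: h)
  have sw: "word_class V' (us @ map (\<lambda>v. c \<odot>\<^bsub>V'\<^esub> v) xs) = c ^ length xs \<odot>\<^bsub>ext_alg V'\<^esub> word_class V' (us @ xs)"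
    if "us \<in> lists (carrier V')" "xs \<in> lists (carrier V')" for us xs
    using that
  proof (induct xs arbitrary: us)
    case (Cons x xs)
    have "word_class V' (us @ map (\<lambda>v. c \<odot>\<^bsub>V'\<^esub> v) (x # xs)) = word_class V' ((us @ [c \<odot>\<^bsub>V'\<^esub> x]) @ map (\<lambda>v. c \<odot>\<^bsub>V'\<^esub> v) xs)" by simp
    also have "\<dots> = c ^ length xs \<odot>\<^bsub>ext_alg V'\<^esub> word_class V' ((us @ [c \<odot>\<^bsub>V'\<^esub> x]) @ xs)" using Cons by (subst Cons(1)) auto
    also have "word_class V' ((us @ [c \<odot>\<^bsub>V'\<^esub> x]) @ xs) = c \<odot>\<^bsub>ext_alg V'\<^esub> word_class V' (us @ x # xs)"
      using V'.word_class_smult[of us xs x c] Cons by simp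
    finally show ?case using Cons by (simp add: mult.commute)
  qed simp
  show ?thesis
  proof (rule V.lin_eq_on_part[OF lin_ext_map[OF hl] linear_map_compose[OF lin_ext_map[OF g] s'] words_lists[OF subset_refl] _ x])
    fix xs assume xs: "xs \<in> words (carrier V) p"
    then have "map g xs \<in> lists (carrier V')" "xs \<in> lists (carrier V)" using linear_map_closed[OF g] by (auto simp: words_def subset_iff)
    moreover from this have *: "map h xs = map (\<lambda>v. c \<odot>\<^bsub>V'\<^esub> v) (map g xs)" using h by auto
    ultimately show "ext_map V' h (word_class V xs) = c ^ p \<odot>\<^bsub>ext_alg V'\<^esub> ext_map V' g (word_class V xs)"
      using sw[of "[]" "map g xs"] xs
      by (simp only: ext_map_word[OF hl] ext_map_word[OF g] *) (simp add: words_def)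
  qed
qed

lemma ext_map_ident:
  assumes "kspace V" "\<And>v. v \<in> carrier V \<Longrightarrow> h v = v" "x \<in> carrier (ext_alg V)"
  shows "ext_map V h x = x"
proof -
  interpret V: kspace V by fact
  have hl: "lin V V h" by (rule linear_map_cong[OF lin_iso_linear[OF lin_iso_ident[OF assms(1)]]]) (simp add: assms)
  show ?thesis
  proof (rule V.lin_eq_on_part[OF lin_ext_map[OF hl] lin_iso_linear[OF lin_iso_ident[OF V.kspace_ext]] subset_refl])
    fix xs assume xs: "xs \<in> lists (carrier V)"
    then have "map h xs = xs" using assms(2) by (intro map_idI) auto
    with xs show "ext_map V h (word_class V xs) = word_class V xs" by (simp add: ext_map_word[OF hl])
  qed (use assms in \<open>simp add: V.ext_alg_carrier\<close>)
qed

section \<open>Exterior powers of a hyperplane\<close>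

text \<open>The determinant of the coordinates of the letters. Its value 0 on words of any other
  length makes it a functional on the whole exterior algebra, and it is the source of the
  nonvanishing statements there.\<close>

definition det_word :: "nat \<Rightarrow> (nat \<Rightarrow> 'v \<Rightarrow> 'k::field) \<Rightarrow> 'v list \<Rightarrow> 'k" where
  "det_word n \<phi> w = (if length w = n then det (mat n n (\<lambda>(i, j). \<phi> j (w ! i))) else 0)"

text \<open>The Leibniz expansion with the factor of the letter \<open>v\<close> pulled out of each
  term. The remaining product never reads position \<open>length xs\<close>; putting
  \<open>undefined\<close> there shows that it does not depend on \<open>v\<close>, so linearity in
  that letter holds term by term.\<close>

lemma det_word_split:
  assumes "length xs + length ys + 1 = n"
  shows "det_word n \<phi> (xs @ v # ys) = (\<Sum>p | p permutes {0..<n}. \<phi> (p (length xs)) v *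
    (signof p * (\<Prod>i\<in>{0..<n} - {length xs}. \<phi> (p i) ((xs @ undefined # ys) ! i))))"
proof -
  let ?k = "length xs"
  have "(\<Prod>i = 0..<n. mat n n (\<lambda>(i, j). \<phi> j ((xs @ v # ys) ! i)) $$ (i, p i))
      = \<phi> (p ?k) v * (\<Prod>i\<in>{0..<n} - {?k}. \<phi> (p i) ((xs @ undefined # ys) ! i))" (is "?l p = ?r p") if p: "p permutes {0..<n}" for p
  proof -
    have "p i < n" if "i < n" for i using permutes_in_image[OF p, of i] that by simp
    then have "(\<Prod>i = 0..<n. mat n n (\<lambda>(i, j). \<phi> j ((xs @ v # ys) ! i)) $$ (i, p i))
        = (\<Prod>i = 0..<n. \<phi> (p i) ((xs @ v # ys) ! i))" by (intro prod.cong) auto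
    also have "\<dots> = \<phi> (p ?k) ((xs @ v # ys) ! ?k) * (\<Prod>i\<in>{0..<n} - {?k}. \<phi> (p i) ((xs @ v # ys) ! i))"
      using assms by (intro prod.remove) auto
    also have "(\<Prod>i\<in>{0..<n} - {?k}. \<phi> (p i) ((xs @ v # ys) ! i)) = (\<Prod>i\<in>{0..<n} - {?k}. \<phi> (p i) ((xs @ undefined # ys) ! i))"
      by (intro prod.cong) (auto simp: nth_append nth_Cons')
    finally show ?thesis by simp
  qed
  then have 1: "signof p * ?l p = \<phi> (p ?k) v * (signof p * (\<Prod>i\<in>{0..<n} - {?k}. \<phi> (p i) ((xs @ undefined # ys) ! i)))"
    if "p permutes {0..<n}" for p using that by (simp only: mult.left_commute)
  have "det_word n \<phi> (xs @ v # ys) = det (mat n n (\<lambda>(i, j). \<phi> j ((xs @ v # ys) ! i)))"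
    using assms by (simp add: det_word_def)
  also have "\<dots> = (\<Sum>p | p permutes {0..<n}. signof p * ?l p)" by (rule det_def') simp
  also have "\<dots> = (\<Sum>p | p permutes {0..<n}. \<phi> (p ?k) v *
      (signof p * (\<Prod>i\<in>{0..<n} - {?k}. \<phi> (p i) ((xs @ undefined # ys) ! i))))"
    by (rule sum.cong[OF refl], rule 1) simp
  finally show ?thesis .
qed

lemma det_word_rels:
  assumes fr: "frame V n e \<phi>" and r: "r \<in> ext_rels V"
  shows "lext (det_word n \<phi>) r = 0"
  using r
proof (cases rule: ext_rels_cases)
  have p: "p i < n" if "p permutes {0..<n}" "i < n" for p i using permutes_in_image[OF that(1), of i] that by simp
  note fn = fr[unfolded frame_def]
  case (add xs v v' ys)
  show ?thesis
  proof (cases "length xs + length ys + 1 = n")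
    case True
    have "\<phi> (p (length xs)) (v \<oplus>\<^bsub>V\<^esub> v') = \<phi> (p (length xs)) v + \<phi> (p (length xs)) v'" if "p permutes {0..<n}" for p
      using fn p[OF that, of "length xs"] True add by (auto simp: functional_def)
    then have "det_word n \<phi> (xs @ (v \<oplus>\<^bsub>V\<^esub> v') # ys) = det_word n \<phi> (xs @ v # ys) + det_word n \<phi> (xs @ v' # ys)"
      unfolding det_word_split[OF True] sum.distrib[symmetric]
      by (intro sum.cong refl) (simp only: mem_Collect_eq distrib_right)
    then show ?thesis using add by simp
  next
    case False
    then show ?thesis using add by (auto simp: det_word_def)
  qed
next
  have p: "p i < n" if "p permutes {0..<n}" "i < n" for p i using permutes_in_image[OF that(1), of i] that by simp
  note fn = fr[unfolded frame_def]
  case (smult xs c v ys)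
  show ?thesis
  proof (cases "length xs + length ys + 1 = n")
    case True
    have "\<phi> (p (length xs)) (c \<odot>\<^bsub>V\<^esub> v) = c * \<phi> (p (length xs)) v" if "p permutes {0..<n}" for p
      using fn p[OF that, of "length xs"] True smult by (auto simp: functional_def)
    then have "det_word n \<phi> (xs @ (c \<odot>\<^bsub>V\<^esub> v) # ys) = c * det_word n \<phi> (xs @ v # ys)"
      unfolding det_word_split[OF True] sum_distrib_left
      by (intro sum.cong refl) (simp only: mem_Collect_eq mult.assoc)
    then show ?thesis using smult by simp
  next
    case False
    then show ?thesis using smult by (auto simp: det_word_def)
  qed
next
  case (dup xs v ys)
  have "det_word n \<phi> (xs @ v # v # ys) = 0"
  proof (cases "length (xs @ v # v # ys) = n")
    case True
    then show ?thesis unfolding det_word_def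
      by (simp, intro det_identical_rows[where i="length xs" and j="Suc (length xs)" and n=n]) (auto simp: nth_append)
  qed (simp add: det_word_def)
  then show ?thesis using dup by simp
qed

lemma det_word_frame:
  assumes fr: "frame V n e \<phi>"
  shows "det_word n \<phi> (map e [0..<n]) = 1"
proof -
  have "mat n n (\<lambda>(i, j). \<phi> j (map e [0..<n] ! i)) = 1\<^sub>m n"
    using fr by (intro eq_matI) (auto simp: frame_def)
  then show ?thesis by (simp add: det_word_def)
qed

text \<open>A basis of \<open>V\<close> whose members but the last lie in the hyperplane
  \<open>U\<close>, the last coordinate being an equation of \<open>U\<close>. For GM data and
  Lagrangian data n is 5 and \<open>e 5\<close> is the chosen vector outside V5.\<close>

locale adapted = kspace V for V :: "('k::field, 'v) module" (structure) +
  fixes U :: "'v set" and n :: nat and e :: "nat \<Rightarrow> 'v" and \<phi> :: "nat \<Rightarrow> 'v \<Rightarrow> 'k"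
  assumes fr: "frame V (Suc n) e \<phi>"
    and eU: "\<And>i. i < n \<Longrightarrow> e i \<in> U"
    and U_iff: "\<And>x. x \<in> U \<longleftrightarrow> x \<in> carrier V \<and> \<phi> n x = 0"
begin

abbreviation "E \<equiv> ext_alg V"
abbreviation "v0 \<equiv> e n"
abbreviation "ep p \<equiv> ext_part V (words U p)"

interpretation X: kspace "ext_alg V" by (rule kspace_ext)

lemma UV: "U \<subseteq> carrier V" by (auto simp: U_iff)

lemma eV: "i \<le> n \<Longrightarrow> e i \<in> carrier V"
  using fr by (simp add: frame_def)

lemma phi_n: "functional V (\<phi> n)" using fr by (simp add: frame_def)

lemma U_sub: "subsp U V"
  using functional_zero[OF phi_n kspace_axioms]
  by (auto simp: subspace_iff U_iff functional_add[OF phi_n] functional_smult[OF phi_n])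

lemma U_least:
  assumes W: "subsp W V" "\<And>i. i < n \<Longrightarrow> e i \<in> W"
  shows "U \<subseteq> W"
proof
  fix x assume x: "x \<in> U"
  have m: "comb V e (\<lambda>i. \<phi> i x) n \<in> W"
    using comb_in_subspace[OF kspace_axioms W(1)] W(2) by blast
  have "comb V e (\<lambda>i. \<phi> i x) n \<in> carrier V" using eV by (intro comb_closed[OF kspace_axioms]) auto
  then have "comb V e (\<lambda>i. \<phi> i x) (Suc n) = comb V e (\<lambda>i. \<phi> i x) n" using x eV by (simp add: U_iff)
  then show "x \<in> W" using m frame_expand[OF fr, of x] x UV by auto
qed

lemma decomp: 
  assumes "x \<in> carrier V"
  obtains u where "u \<in> U" "x = u \<oplus> \<phi> n x \<odot> v0"
proof -
  have "comb V e (\<lambda>i. \<phi> i x) n \<in> U"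
    using eU by (intro comb_in_subspace[OF kspace_axioms U_sub]) auto
  moreover have "x = comb V e (\<lambda>i. \<phi> i x) n \<oplus> \<phi> n x \<odot> v0"
    using frame_expand[OF fr assms] by simp
  ultimately show ?thesis using that by blast
qed

text \<open>The standard monomials of the exterior algebra of \<open>U\<close>, with increasing
  indices.\<close>

definition eS :: "nat set \<Rightarrow> ('v list \<Rightarrow> 'k) set" where
  "eS S = word_class V (map e (sorted_list_of_set S))"

lemma map_e_lists: "set is \<subseteq> {..<n} \<Longrightarrow> map e is \<in> lists U"
  using eU by (auto simp: subset_iff)

lemma lists_UV: "xs \<in> lists U \<Longrightarrow> xs \<in> lists (carrier V)"
  using UV by (auto simp: subset_iff)

lemma eS_pow: "S \<subseteq> {..<n} \<Longrightarrow> eS S \<in> ep (card S)"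
  unfolding eS_def by (rule word_class_part)
    (use eU in \<open>auto simp: words_def subset_iff sorted_list_of_set.length_sorted_key_list_of_set finite_subset[of S "{..<n}"]\<close>)

lemma pow_le_E: "x \<in> ep p \<Longrightarrow> x \<in> carrier E"
  using pow_closed[OF UV] .

lemma pow_add: "x \<in> ep p \<Longrightarrow> y \<in> ep p \<Longrightarrow> x \<oplus>\<^bsub>E\<^esub> y \<in> ep p"
  and pow_smult: "x \<in> ep p \<Longrightarrow> c \<odot>\<^bsub>E\<^esub> x \<in> ep p"
  and pow_zero: "\<zero>\<^bsub>E\<^esub> \<in> ep p"
  using pow_subsp[OF UV, of p] unfolding X.subspace_iff by auto

text \<open>Letters from \<open>U\<close> are replaced by basis vectors one position after the
  other, the finished part being kept as the prefix \<open>map e is\<close>. A word of basis vectors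
  is a monomial up to sign, or zero if an index repeats.\<close>

lemma pow_span:
  assumes W: "subsp W E" and S: "\<And>S. S \<subseteq> {..<n} \<Longrightarrow> card S = p \<Longrightarrow> eS S \<in> W"
  shows "ep p \<subseteq> W"
proof (rule ext_part_least[OF W words_lists[OF UV]])
  have W': "\<zero>\<^bsub>E\<^esub> \<in> W" "\<And>x y. x \<in> W \<Longrightarrow> y \<in> W \<Longrightarrow> x \<oplus>\<^bsub>E\<^esub> y \<in> W" "\<And>c x. x \<in> W \<Longrightarrow> c \<odot>\<^bsub>E\<^esub> x \<in> W"
    using W unfolding X.subspace_iff by auto
  have *: "word_class V (map e is @ xs) \<in> W"
    if "set is \<subseteq> {..<n}" "set xs \<subseteq> U" "length is + length xs = p" for "is" xs
    using that
  proof (induct xs arbitrary: "is")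
    case Nil
    have L: "map e is \<in> lists (carrier V)" using map_e_lists[OF Nil(1)] by (rule lists_UV)
    show ?case
    proof (cases "distinct is")
      case True
      have m: "mset (map e is) = mset (map e (sorted_list_of_set (set is)))"
        using True by (metis finite_set mset_map mset_set_set sorted_list_of_mset_set mset_sorted_list_of_multiset)
      obtain s where "word_class V ([] @ map e is) = s \<odot>\<^bsub>E\<^esub> word_class V ([] @ map e (sorted_list_of_set (set is)))"
        using word_class_perm[OF m L] by blast
      then show ?thesis using S[of "set is"] Nil True W'(3) by (simp add: distinct_card eS_def)
    next
      case False
      then have "\<not> distinct (map e is)" unfolding distinct_map by blast
      then show ?thesis using word_class_not_distinct[OF L] W' by simp
    qed
  next
    case (Cons v xs)
    have L: "map e is \<in> lists (carrier V)" using map_e_lists[OF Cons(2)] by (rule lists_UV)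
    have Lx: "xs \<in> lists (carrier V)" using Cons UV by auto
    let ?S = "{v \<in> carrier V. word_class V (map e is @ v # xs) \<in> W}"
    have z: "word_class V (map e is @ \<zero> # xs) = \<zero>\<^bsub>E\<^esub>"
      using word_class_smult[OF L Lx, of \<zero> 0] L Lx by simp
    have "subsp ?S V"
      unfolding subspace_iff using W' z by (auto simp: word_class_add[OF L Lx] word_class_smult[OF L Lx])
    then have "U \<subseteq> ?S"
    proof (rule U_least)
      fix i assume i: "i < n"
      have "word_class V (map e (is @ [i]) @ xs) \<in> W" using Cons i by (intro Cons(1)) auto
      then show "e i \<in> ?S" using eV i by simp
    qed
    then show ?case using Cons by auto
  qed
  fix xs assume "xs \<in> words U p"
  then show "word_class V xs \<in> W" using *[of "[]" xs] by (simp add: words_def)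
qed

lemma pow_large: "n < p \<Longrightarrow> x \<in> ep p \<Longrightarrow> x = \<zero>\<^bsub>E\<^esub>"
  using pow_span[OF X.zero_subspace, of p] by (metis card_lessThan card_mono finite_lessThan leD singletonD subsetD)

lemma wedge_eS_inter:
  assumes "S \<subseteq> {..<n}" "T \<subseteq> {..<n}" "S \<inter> T \<noteq> {}"
  shows "wedge V (eS S) (eS T) = \<zero>\<^bsub>E\<^esub>"
proof -
  have f: "finite S" "finite T" using assms finite_subset by auto
  let ?a = "sorted_list_of_set S" and ?b = "sorted_list_of_set T"
  have L: "map e ?a \<in> lists (carrier V)" "map e ?b \<in> lists (carrier V)"
    using f assms by (auto intro!: lists_UV map_e_lists simp del: in_lists_conv_set)
  have "\<not> distinct (?a @ ?b)" using assms f by auto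
  then have "\<not> distinct (map e (?a @ ?b))" unfolding distinct_map by blast
  then have "word_class V (map e ?a @ map e ?b) = \<zero>\<^bsub>E\<^esub>"
    using L by (intro word_class_not_distinct) (simp_all only: append_in_lists_conv map_append simp_thms)
  then show ?thesis unfolding eS_def wedge_word[OF L] .
qed

lemma wedge_eS_compl:
  assumes "S \<subseteq> {..<n}"
  shows "\<exists>s. (s = 1 \<or> s = - 1) \<and> wedge V (eS ({..<n} - S)) (eS S) = s \<odot>\<^bsub>E\<^esub> eS {..<n}"
proof -
  have f: "finite S" using assms finite_subset by auto
  let ?a = "sorted_list_of_set ({..<n} - S)" and ?b = "sorted_list_of_set S"
  have L: "map e ?a \<in> lists (carrier V)" "map e ?b \<in> lists (carrier V)"
    using f assms by (auto intro!: lists_UV map_e_lists simp del: in_lists_conv_set)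
  have d: "distinct (?a @ ?b)" using f by auto
  have st: "set (?a @ ?b) = {..<n}" using f assms by auto
  have "mset (?a @ ?b) = mset (sorted_list_of_set {..<n})"
    using d st by (metis distinct_sorted_list_of_set finite_lessThan set_eq_iff_mset_eq_distinct set_sorted_list_of_set)
  then have m: "mset (map e ?a @ map e ?b) = mset (map e (sorted_list_of_set {..<n}))"
    by (metis map_append mset_map)
  show ?thesis using word_class_perm[OF m] L wedge_word[OF L] unfolding eS_def
    by (metis append_Nil append_in_lists_conv lists.Nil)
qed

text \<open>The determinant sees words of length n + 1, so an element of degree n is completed by
  the factor \<open>v0\<close> before it is evaluated. The last two conclusions together say that
  wedging with \<open>v0\<close> is injective on the top exterior power of \<open>U\<close>.\<close>

lemma top_functional:
  obtains T where "functional E T" "T (eS {..<n}) = 1"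
    "\<And>x. x \<in> ep n \<Longrightarrow> x = T x \<odot>\<^bsub>E\<^esub> eS {..<n}"
    "\<And>x. x \<in> carrier E \<Longrightarrow> wedge V (ext_vec V v0) x = \<zero>\<^bsub>E\<^esub> \<Longrightarrow> T x = 0"
proof -
  obtain D where D: "functional E D" "\<And>xs. xs \<in> lists (carrier V) \<Longrightarrow> D (word_class V xs) = det_word (Suc n) \<phi> xs"
    using ext_functional[OF det_word_rels[OF fr]] by metis
  have sl: "sorted_list_of_set {..<n} = [0..<n]" by (metis atLeast_upt sorted_list_of_set_range lessThan_atLeast0)
  let ?O = "eS {..<n}"
  have OE: "?O \<in> carrier E" using eS_pow[of "{..<n}"] pow_le_E by auto
  have L: "map e [0..<n] \<in> lists (carrier V)" using eV by auto
  have "word_class V (v0 # map e [0..<n]) = (- 1) ^ n \<odot>\<^bsub>E\<^esub> word_class V (map e [0..<Suc n])"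
    using word_class_move[of "[]" "map e [0..<n]" "[]" v0] L eV by simp
  moreover have L': "map e [0..<Suc n] \<in> lists (carrier V)" using eV by auto
  ultimately have D1: "D (wedge V (ext_vec V v0) ?O) = (- 1) ^ n"
    using L eV D(2)[OF L'] functional_smult[OF D(1) word_class_closed[OF L']] det_word_frame[OF fr]
    by (simp add: eS_def sl ext_vec_wedge_word del: upt_Suc)
  \<comment> \<open>Moving \<open>v0\<close> past the n other basis vectors gave the sign
    \<open>(- 1) ^ n\<close>; the same sign here makes the value at the top monomial 1.\<close>
  define T where "T x = (- 1) ^ n * D (wedge V (ext_vec V v0) x)" for x
  have lw: "lin E E (wedge V (ext_vec V v0))" using eV by (intro lin_wedge_left) auto
  have T: "functional E T"
    using functional_comp[OF lw D(1)] unfolding functional_def T_def by (auto simp: algebra_simps)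
  have T1: "T ?O = 1" unfolding T_def D1 by (simp add: power_mult_distrib[symmetric] flip: power_add)
  have "ep n \<subseteq> {x \<in> carrier E. x = T x \<odot>\<^bsub>E\<^esub> ?O}"
  proof (rule pow_span)
    show "subsp {x \<in> carrier E. x = T x \<odot>\<^bsub>E\<^esub> ?O} E"
      unfolding X.subspace_iff using functional_zero[OF T kspace_ext] OE
    proof (intro conjI ballI allI)
      fix x y assume "x \<in> {x \<in> carrier E. x = T x \<odot>\<^bsub>E\<^esub> ?O}" "y \<in> {x \<in> carrier E. x = T x \<odot>\<^bsub>E\<^esub> ?O}"
      then have xy: "x \<in> carrier E" "y \<in> carrier E" "x = T x \<odot>\<^bsub>E\<^esub> ?O" "y = T y \<odot>\<^bsub>E\<^esub> ?O" by auto
      have 1: "x \<oplus>\<^bsub>E\<^esub> y = T x \<odot>\<^bsub>E\<^esub> ?O \<oplus>\<^bsub>E\<^esub> T y \<odot>\<^bsub>E\<^esub> ?O"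
        using arg_cong2[OF xy(3,4), of "add E"] .
      have 2: "T (x \<oplus>\<^bsub>E\<^esub> y) \<odot>\<^bsub>E\<^esub> ?O = T x \<odot>\<^bsub>E\<^esub> ?O \<oplus>\<^bsub>E\<^esub> T y \<odot>\<^bsub>E\<^esub> ?O"
        using OE by (simp add: functional_add[OF T xy(1,2)] X.add_smult)
      show "x \<oplus>\<^bsub>E\<^esub> y \<in> {x \<in> carrier E. x = T x \<odot>\<^bsub>E\<^esub> ?O}"
        using X.addC[OF xy(1,2)] trans[OF 1 2[symmetric]] by blast
    next
      fix c x assume "x \<in> {x \<in> carrier E. x = T x \<odot>\<^bsub>E\<^esub> ?O}"
      then have x: "x \<in> carrier E" "x = T x \<odot>\<^bsub>E\<^esub> ?O" by auto
      have 1: "c \<odot>\<^bsub>E\<^esub> x = c \<odot>\<^bsub>E\<^esub> (T x \<odot>\<^bsub>E\<^esub> ?O)" using arg_cong[OF x(2), of "smult E c"] .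
      have 2: "T (c \<odot>\<^bsub>E\<^esub> x) \<odot>\<^bsub>E\<^esub> ?O = c \<odot>\<^bsub>E\<^esub> (T x \<odot>\<^bsub>E\<^esub> ?O)"
        using OE by (simp add: functional_smult[OF T x(1)])
      show "c \<odot>\<^bsub>E\<^esub> x \<in> {x \<in> carrier E. x = T x \<odot>\<^bsub>E\<^esub> ?O}"
        using X.smultC[OF x(1)] trans[OF 1 2[symmetric]] by blast
    qed auto
    fix S assume "S \<subseteq> {..<n}" "card S = n"
    then have "S = {..<n}" by (metis card_lessThan card_subset_eq finite_lessThan)
    then show "eS S \<in> {x \<in> carrier E. x = T x \<odot>\<^bsub>E\<^esub> ?O}" using OE T1 by simp
  qed
  moreover have "T x = 0" if "wedge V (ext_vec V v0) x = \<zero>\<^bsub>E\<^esub>" for x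
    using that functional_zero[OF D(1) kspace_ext] by (simp add: T_def)
  ultimately show ?thesis using that[OF T T1] by blast
qed

text \<open>The pairing of complementary exterior powers of \<open>U\<close> is perfect: a basis of one is dual, up to
  signs, to a basis of the other.\<close>

lemma pairing_frame:
  assumes T: "functional E T" "T (eS {..<n}) = 1" and p: "p \<le> n"
  obtains N h s where "frame (ext_pow V U p) N h (\<lambda>i x. T (wedge V (s i) x))"
    "\<And>i. i < N \<Longrightarrow> h i \<in> ep p" "\<And>i. i < N \<Longrightarrow> s i \<in> ep (n - p)"
proof -
  let ?P = "{S. S \<subseteq> {..<n} \<and> card S = p}"
  have fP: "finite ?P" by (rule finite_subset[of _ "Pow {..<n}"]) auto
  obtain g where g: "bij_betw g {..<card ?P} ?P" using ex_bij_betw_nat_finite[OF fP] by (auto simp: atLeast0LessThan)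
  have gi: "g i \<subseteq> {..<n}" "card (g i) = p" if "i < card ?P" for i using g that by (auto simp: bij_betw_def)
  define sg :: "nat set \<Rightarrow> 'k" where
    "sg S = (SOME s. (s = 1 \<or> s = - 1) \<and> wedge V (eS ({..<n} - S)) (eS S) = s \<odot>\<^bsub>E\<^esub> eS {..<n})" for S
  have sg: "(sg S = 1 \<or> sg S = - 1) \<and> wedge V (eS ({..<n} - S)) (eS S) = sg S \<odot>\<^bsub>E\<^esub> eS {..<n}" if "S \<in> ?P" for S
    unfolding sg_def by (rule someI_ex, rule wedge_eS_compl) (use that in blast)
  define h where "h i = eS (g i)" for i
  \<comment> \<open>The complementary monomial, multiplied by its own sign so that its product with
    \<open>h i\<close> is exactly the top monomial; a sign is its own inverse.\<close>
  define s where "s i = sg (g i) \<odot>\<^bsub>E\<^esub> eS ({..<n} - g i)" for i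
  have OE: "eS {..<n} \<in> carrier E" using eS_pow[of "{..<n}"] pow_le_E by auto
  have h: "h i \<in> ep p" if "i < card ?P" for i using eS_pow[OF gi(1)[OF that]] gi(2)[OF that] by (simp add: h_def)
  have s: "s i \<in> ep (n - p)" if "i < card ?P" for i
  proof -
    have "card ({..<n} - g i) = n - p" using gi[OF that] finite_subset[OF gi(1)[OF that]] by (simp add: card_Diff_subset)
    then show ?thesis unfolding s_def using eS_pow[of "{..<n} - g i"] by (intro pow_smult) auto
  qed
  interpret P: kspace "ext_pow V U p" by (rule kspace_pow[OF UV])
  have "frame (ext_pow V U p) (card ?P) h (\<lambda>i x. T (wedge V (s i) x))"
  proof (rule frameI[OF P.kspace_axioms])
    show "\<forall>i<card ?P. h i \<in> carrier (ext_pow V U p) \<and> functional (ext_pow V U p) (\<lambda>x. T (wedge V (s i) x))"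
    proof (intro allI impI conjI)
      fix i assume i: "i < card ?P"
      show "h i \<in> carrier (ext_pow V U p)" using h[OF i] by (simp add: ext_pow_carrier)
      show "functional (ext_pow V U p) (\<lambda>x. T (wedge V (s i) x))"
        using functional_comp[OF lin_wedge_left[OF pow_le_E[OF s[OF i]]] T(1)] pow_le_E
        unfolding functional_def by (simp add: ext_pow_carrier)
    qed
    show "\<forall>i<card ?P. \<forall>j<card ?P. T (wedge V (s i) (h j)) = (if i = j then 1 else 0)"
    proof (intro allI impI)
      fix i j assume ij: "i < card ?P" "j < card ?P"
      have c: "eS ({..<n} - g i) \<in> carrier E" "eS (g j) \<in> carrier E"
        using eS_pow[of "{..<n} - g i"] eS_pow[OF gi(1)[OF ij(2)]] pow_le_E by auto
      show "T (wedge V (s i) (h j)) = (if i = j then 1 else 0)"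
      proof (cases "i = j")
        case True
        have gP: "g i \<in> ?P" using gi[OF ij(1)] by simp
        have "wedge V (s i) (h i) = sg (g i) \<odot>\<^bsub>E\<^esub> wedge V (eS ({..<n} - g i)) (eS (g i))"
          using c True by (simp only: s_def h_def wedge_smult_left)
        also have "\<dots> = sg (g i) \<odot>\<^bsub>E\<^esub> (sg (g i) \<odot>\<^bsub>E\<^esub> eS {..<n})" using sg[OF gP] by simp
        also have "\<dots> = eS {..<n}" using sg[OF gP] OE by auto
        finally show ?thesis using T True by simp
      next
        case False
        then have ne: "g i \<noteq> g j" using g ij unfolding bij_betw_def inj_on_def by blast
        have "({..<n} - g i) \<inter> g j \<noteq> {}"
        proof
          assume "({..<n} - g i) \<inter> g j = {}"
          then have "g j \<subseteq> g i" using gi[OF ij(2)] by auto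
          moreover have "finite (g i)" using finite_subset[OF gi(1)[OF ij(1)]] by blast
          ultimately show False using ne card_subset_eq[of "g i" "g j"] gi(2)[OF ij(1)] gi(2)[OF ij(2)] by metis
        qed
        then have "wedge V (s i) (h j) = \<zero>\<^bsub>E\<^esub>"
          using wedge_eS_inter[of "{..<n} - g i" "g j"] gi[OF ij(2)] c by (simp add: s_def h_def wedge_smult_left)
        then show ?thesis using False functional_zero[OF T(1) kspace_ext] by simp
      qed
    qed
    fix W assume W: "subsp W (ext_pow V U p)" "\<forall>i<card ?P. h i \<in> W"
    have "subsp W E" using W(1) pow_le_E unfolding X.subspace_iff P.subspace_iff by (auto simp: ext_pow_carrier)
    moreover have "eS S \<in> W" if S: "S \<subseteq> {..<n}" "card S = p" for S
    proof -
      have "S \<in> g ` {..<card ?P}" using g S unfolding bij_betw_def by blast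
      then show ?thesis using W(2) by (auto simp: h_def)
    qed
    ultimately show "carrier (ext_pow V U p) \<subseteq> W" unfolding ext_pow_carrier by (rule pow_span)
  qed
  then show ?thesis using that h s by blast
qed

text \<open>Each letter is split into a part in \<open>U\<close> and a multiple of
  \<open>v0\<close>, and \<open>v0\<close> is moved to the front; two factors \<open>v0\<close>
  annihilate each other. The induction on the degree amounts to the stability of this shape under
  left multiplication by a vector.\<close>

lemma pow_V_decomp:
  assumes "x \<in> ext_part V (words (carrier V) (Suc p))"
  obtains \<xi> \<eta> where "\<xi> \<in> ep (Suc p)" "\<eta> \<in> ep p" "x = \<xi> \<oplus>\<^bsub>E\<^esub> wedge V (ext_vec V v0) \<eta>"
proof -
  let ?D = "\<lambda>p. {\<xi> \<oplus>\<^bsub>E\<^esub> wedge V (ext_vec V v0) \<eta> | \<xi> \<eta>. \<xi> \<in> ep (Suc p) \<and> \<eta> \<in> ep p}"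
  have v0: "v0 \<in> carrier V" by (simp add: eV)
  note ev0 = ext_vec_closed[OF v0]
  have sD: "subsp (?D p) E" for p
    unfolding X.subspace_iff
  proof (intro conjI ballI allI)
    show "?D p \<subseteq> carrier E" using ev0 by (auto simp: pow_le_E)
    have "\<zero>\<^bsub>E\<^esub> = \<zero>\<^bsub>E\<^esub> \<oplus>\<^bsub>E\<^esub> wedge V (ext_vec V v0) \<zero>\<^bsub>E\<^esub>" using ev0 by simp
    then show "\<zero>\<^bsub>E\<^esub> \<in> ?D p" using pow_zero by blast
    fix x y assume "x \<in> ?D p" "y \<in> ?D p"
    then obtain a b c d where *: "a \<in> ep (Suc p)" "b \<in> ep p" "x = a \<oplus>\<^bsub>E\<^esub> wedge V (ext_vec V v0) b"
      "c \<in> ep (Suc p)" "d \<in> ep p" "y = c \<oplus>\<^bsub>E\<^esub> wedge V (ext_vec V v0) d" by auto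
    then have "x \<oplus>\<^bsub>E\<^esub> y = (a \<oplus>\<^bsub>E\<^esub> c) \<oplus>\<^bsub>E\<^esub> wedge V (ext_vec V v0) (b \<oplus>\<^bsub>E\<^esub> d)"
      using ev0 by (simp add: wedge_add_right pow_le_E X.ac)
    then show "x \<oplus>\<^bsub>E\<^esub> y \<in> ?D p" using * pow_add by blast
  next
    fix k x assume "x \<in> ?D p"
    then obtain a b where *: "a \<in> ep (Suc p)" "b \<in> ep p" "x = a \<oplus>\<^bsub>E\<^esub> wedge V (ext_vec V v0) b" by auto
    then have "k \<odot>\<^bsub>E\<^esub> x = k \<odot>\<^bsub>E\<^esub> a \<oplus>\<^bsub>E\<^esub> wedge V (ext_vec V v0) (k \<odot>\<^bsub>E\<^esub> b)"
      using ev0 by (simp add: wedge_smult_right pow_le_E X.smult_add)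
    then show "k \<odot>\<^bsub>E\<^esub> x \<in> ?D p" using * pow_smult by blast
  qed
  \<comment> \<open>With v = u + c v0, the product of v and a + v0 b is u a + v0 (c a - u b): the
    sign comes from moving u past v0, and v0 v0 b vanishes.\<close>
  have key: "wedge V (ext_vec V v) y \<in> ?D (Suc p)" if v: "v \<in> carrier V" and y: "y \<in> ?D p" for v y p
  proof -
    obtain u where u: "u \<in> U" "v = u \<oplus> \<phi> n v \<odot> v0" using decomp[OF v] .
    obtain a b where ab: "a \<in> ep (Suc p)" "b \<in> ep p" "y = a \<oplus>\<^bsub>E\<^esub> wedge V (ext_vec V v0) b" using y by auto
    have uV: "u \<in> carrier V" using u UV by auto
    have abE: "a \<in> carrier E" "b \<in> carrier E" using ab pow_le_E by auto
    have up: "ext_vec V u \<in> ep 1" using ext_vec_pow[OF u(1)] .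
    have uE: "ext_vec V u \<in> carrier E" using uV by simp
    have evv: "ext_vec V v = ext_vec V u \<oplus>\<^bsub>E\<^esub> \<phi> n v \<odot>\<^bsub>E\<^esub> ext_vec V v0"
      using linear_map_add[OF lin_ext_vec uV, of "\<phi> n v \<odot> v0"] linear_map_smult[OF lin_ext_vec v0] u(2) v0 by simp
    have "wedge V (ext_vec V u) (wedge V (ext_vec V v0) b) = wedge V (wedge V (ext_vec V u) (ext_vec V v0)) b"
      using uE ev0 abE by (simp add: wedge_assoc)
    also have "wedge V (ext_vec V u) (ext_vec V v0) = (- 1) \<odot>\<^bsub>E\<^esub> wedge V (ext_vec V v0) (ext_vec V u)"
      using wedge_comm[OF ext_vec_pow[OF uV] ext_vec_pow[OF v0]] by simp
    also have "wedge V ((- 1) \<odot>\<^bsub>E\<^esub> wedge V (ext_vec V v0) (ext_vec V u)) b = wedge V (ext_vec V v0) ((- 1) \<odot>\<^bsub>E\<^esub> wedge V (ext_vec V u) b)"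
      using uE ev0 abE by (simp add: wedge_assoc wedge_smult_left wedge_smult_right)
    finally have sw: "wedge V (ext_vec V u) (wedge V (ext_vec V v0) b) = wedge V (ext_vec V v0) ((- 1) \<odot>\<^bsub>E\<^esub> wedge V (ext_vec V u) b)" .
    have "wedge V (ext_vec V v) y = wedge V (ext_vec V u) a \<oplus>\<^bsub>E\<^esub> wedge V (ext_vec V u) (wedge V (ext_vec V v0) b)
       \<oplus>\<^bsub>E\<^esub> \<phi> n v \<odot>\<^bsub>E\<^esub> wedge V (ext_vec V v0) a"
      unfolding evv ab(3) using uE ev0 abE ext_vec_sq[OF v0 abE(2)]
      by (simp add: wedge_add_left wedge_add_right wedge_smult_left X.smult_add X.ac)
    also have "\<dots> = wedge V (ext_vec V u) a \<oplus>\<^bsub>E\<^esub>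
        wedge V (ext_vec V v0) ((- 1) \<odot>\<^bsub>E\<^esub> wedge V (ext_vec V u) b \<oplus>\<^bsub>E\<^esub> \<phi> n v \<odot>\<^bsub>E\<^esub> a)"
      unfolding sw using uE ev0 abE by (simp add: wedge_add_right wedge_smult_right X.ac)
    finally have eq: "wedge V (ext_vec V v) y = wedge V (ext_vec V u) a \<oplus>\<^bsub>E\<^esub>
        wedge V (ext_vec V v0) ((- 1) \<odot>\<^bsub>E\<^esub> wedge V (ext_vec V u) b \<oplus>\<^bsub>E\<^esub> \<phi> n v \<odot>\<^bsub>E\<^esub> a)" .
    moreover have "wedge V (ext_vec V u) a \<in> ep (Suc (Suc p))" using wedge_pow[OF UV up ab(1)] by simp
    moreover have "(- 1) \<odot>\<^bsub>E\<^esub> wedge V (ext_vec V u) b \<oplus>\<^bsub>E\<^esub> \<phi> n v \<odot>\<^bsub>E\<^esub> a \<in> ep (Suc p)"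
      using wedge_pow[OF UV up ab(2)] ab(1) by (intro pow_add pow_smult) auto
    ultimately show ?thesis by blast
  qed
  have w: "word_class V xs \<in> ?D p" if "xs \<in> words (carrier V) (Suc p)" for xs p
    using that
  proof (induct p arbitrary: xs)
    case 0
    then obtain v where xs: "xs = [v]" "v \<in> carrier V" by (auto simp: words_def length_Suc_conv)
    obtain u where u: "u \<in> U" "v = u \<oplus> \<phi> n v \<odot> v0" using decomp[OF xs(2)] .
    have uV: "u \<in> carrier V" using u UV by auto
    \<comment> \<open>The empty word is the unit, so in degree one the multiple of \<open>v0\<close>
      is \<open>v0\<close> times an element of degree zero.\<close>
    have one: "word_class V [] \<in> ep 0" by (rule word_class_part) (simp add: words_def)
    have "ext_vec V v = ext_vec V u \<oplus>\<^bsub>E\<^esub> \<phi> n v \<odot>\<^bsub>E\<^esub> ext_vec V v0"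
      using linear_map_add[OF lin_ext_vec uV, of "\<phi> n v \<odot> v0"] linear_map_smult[OF lin_ext_vec v0] u(2) v0 by simp
    also have "\<phi> n v \<odot>\<^bsub>E\<^esub> ext_vec V v0 = wedge V (ext_vec V v0) (\<phi> n v \<odot>\<^bsub>E\<^esub> word_class V [])"
      using ev0 v0 ext_vec_wedge_word[OF v0, of "[]"] by (simp add: wedge_smult_right ext_vec_word)
    finally show ?case using ext_vec_pow[OF u(1)] pow_smult[OF one] unfolding xs ext_vec_word[symmetric] by force
  next
    case (Suc p)
    then obtain v ys where xs: "xs = v # ys" "v \<in> carrier V" "ys \<in> words (carrier V) (Suc p)"
      by (auto simp: words_def length_Suc_conv)
    moreover from this have "ys \<in> lists (carrier V)" using words_lists[of "carrier V" "carrier V"] by blast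
    ultimately show ?case using key[OF xs(2) Suc(1)[OF xs(3)]] by (simp add: ext_vec_wedge_word)
  qed
  have "ext_part V (words (carrier V) (Suc p)) \<subseteq> ?D p"
    by (rule ext_part_least[OF sD words_lists[OF subset_refl] w])
  then show ?thesis using assms that by auto
qed

end

lemma adapted_exists:
  assumes "hyperplane U V" "has_dim V (Suc n)" "v0 \<in> carrier V" "v0 \<notin> U"
  obtains e \<phi> where "adapted V U n e \<phi>" "e n = v0"
proof -
  from hyperplane_frame[OF assms] obtain e \<phi> where *: "frame V (Suc n) e \<phi>" "e n = v0" "\<And>i. i < n \<Longrightarrow> e i \<in> U"
    "\<And>x. x \<in> carrier V \<Longrightarrow> x \<in> U \<longleftrightarrow> \<phi> n x = 0" by metis
  have k: "kspace V" using assms(2) by (rule has_dim_kspace)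
  have "U \<subseteq> carrier V" using assms(1) kspace.subspace_iff[OF k] by (auto simp: hyperplane_def)
  with * k have "adapted V U n e \<phi>"
    by (intro adapted.intro adapted_axioms.intro) auto
  then show ?thesis using that *(2) by blast
qed

section \<open>Lagrangian subspaces and quadratic forms\<close>

text \<open>A hyperplane with a scalar volume form on its top exterior power. For GM data
  \<open>eps\<close> is \<epsilon> read in the basis l \<otimes> l; for Lagrangian data, which carry
  no \<epsilon>, some volume form is chosen.\<close>

locale volume_hyperplane = kspace V for V :: "('k::field, 'v) module" (structure) +
  fixes U :: "'v set" and v0 :: 'v and eps :: "('v list \<Rightarrow> 'k) set \<Rightarrow> 'k"
  assumes hyp: "hyperplane U V" and dim: "has_dim V 6" and v0: "v0 \<in> carrier V" "v0 \<notin> U"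
    and eps: "functional (ext_pow V U 5) eps"
    and eps_inj: "\<And>x. x \<in> ext_part V (words U 5) \<Longrightarrow> eps x = 0 \<Longrightarrow> x = \<zero>\<^bsub>ext_alg V\<^esub>"
    and eps_nz: "\<exists>x\<in>ext_part V (words U 5). eps x \<noteq> 0"
begin

abbreviation "E \<equiv> ext_alg V"
abbreviation "ep p \<equiv> ext_part V (words U p)"

interpretation X: kspace "ext_alg V" by (rule kspace_ext)

lemma adapted: obtains e \<phi> where "adapted V U 5 e \<phi>" "e 5 = v0"
  using adapted_exists[OF hyp _ v0, of 5] dim by auto

lemma UV: "U \<subseteq> carrier V"
  using hyp by (simp add: hyperplane_def subspace_iff)

lemma U_sub: "subsp U V"
  using hyp by (simp add: hyperplane_def)

lemma ep_E[simp]: "x \<in> ep p \<Longrightarrow> x \<in> carrier E"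
  using pow_closed[OF UV] .

lemma ep_V: "x \<in> ep p \<Longrightarrow> x \<in> ext_part V (words (carrier V) p)"
  using ext_part_mono[of "words U p" "words (carrier V) p"] UV by (auto simp: words_def)

lemma ep_add[simp]: "x \<in> ep p \<Longrightarrow> y \<in> ep p \<Longrightarrow> x \<oplus>\<^bsub>E\<^esub> y \<in> ep p"
  and ep_smult[simp]: "x \<in> ep p \<Longrightarrow> c \<odot>\<^bsub>E\<^esub> x \<in> ep p"
  and ep_zero[simp]: "\<zero>\<^bsub>E\<^esub> \<in> ep p"
  using pow_subsp[OF UV, of p] unfolding X.subspace_iff by auto

lemma ev0[simp]: "ext_vec V v0 \<in> carrier E"
  using v0 by simp

lemma wedge_ep: "x \<in> ep p \<Longrightarrow> y \<in> ep q \<Longrightarrow> wedge V x y \<in> ep (p + q)"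
  using wedge_pow[OF UV] .

lemma wedge32[simp]: "x \<in> ep 3 \<Longrightarrow> y \<in> ep 2 \<Longrightarrow> wedge V x y \<in> ep 5"
  using wedge_ep[of x 3 y 2] by simp

lemma wedge23: "x \<in> ep 3 \<Longrightarrow> y \<in> ep 2 \<Longrightarrow> wedge V y x = wedge V x y"
  using wedge_comm[OF ep_V ep_V, of x 3 y 2] by simp

lemma eps_add: "x \<in> ep 5 \<Longrightarrow> y \<in> ep 5 \<Longrightarrow> eps (x \<oplus>\<^bsub>E\<^esub> y) = eps x + eps y"
  and eps_smult: "x \<in> ep 5 \<Longrightarrow> eps (c \<odot>\<^bsub>E\<^esub> x) = c * eps x"
  using eps unfolding functional_def by (simp_all add: ext_pow_carrier)

lemma eps_zero[simp]: "eps \<zero>\<^bsub>E\<^esub> = 0"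
  using eps_smult[of "\<zero>\<^bsub>E\<^esub>" 0] by simp

lemma eps_eq: "x \<in> ep 5 \<Longrightarrow> y \<in> ep 5 \<Longrightarrow> eps x = eps y \<Longrightarrow> x = y"
  using eps_inj[of "x \<oplus>\<^bsub>E\<^esub> (- 1) \<odot>\<^bsub>E\<^esub> y"] X.eq_iff_diff[of x y] by (simp add: eps_add eps_smult)

lemma pair_add_left: "x \<in> ep 3 \<Longrightarrow> y \<in> ep 3 \<Longrightarrow> z \<in> ep 2 \<Longrightarrow> eps (wedge V (x \<oplus>\<^bsub>E\<^esub> y) z) = eps (wedge V x z) + eps (wedge V y z)"
  and pair_add_right: "z \<in> ep 3 \<Longrightarrow> x' \<in> ep 2 \<Longrightarrow> y' \<in> ep 2 \<Longrightarrow> eps (wedge V z (x' \<oplus>\<^bsub>E\<^esub> y')) = eps (wedge V z x') + eps (wedge V z y')"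
  and pair_smult_left: "x \<in> ep 3 \<Longrightarrow> z' \<in> ep 2 \<Longrightarrow> eps (wedge V (c \<odot>\<^bsub>E\<^esub> x) z') = c * eps (wedge V x z')"
  and pair_smult_right: "x \<in> ep 3 \<Longrightarrow> z' \<in> ep 2 \<Longrightarrow> eps (wedge V x (c \<odot>\<^bsub>E\<^esub> z')) = c * eps (wedge V x z')"
  by (simp_all add: wedge_add_left wedge_add_right wedge_smult_left wedge_smult_right eps_add eps_smult)

lemma kspace_ep: "kspace (ext_pow V U p)"
  by (rule kspace_pow[OF UV])

lemma subsp_ep: "subsp M (ext_pow V U p) \<longleftrightarrow> subsp M E \<and> M \<subseteq> ep p"
  unfolding kspace.subspace_iff[OF kspace_ep] X.subspace_iff by (auto simp: ext_pow_carrier)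

lemma wedge_v0_eq_zero:
  assumes "x \<in> ep 5" "wedge V (ext_vec V v0) x = \<zero>\<^bsub>E\<^esub>"
  shows "x = \<zero>\<^bsub>E\<^esub>"
proof -
  obtain e \<phi> where A: "adapted V U 5 e \<phi>" "e 5 = v0" by (rule adapted)
  then interpret A: adapted V U 5 e \<phi> by simp
  obtain T where T: "\<And>x. x \<in> ep 5 \<Longrightarrow> x = T x \<odot>\<^bsub>E\<^esub> A.eS {..<5}"
    "\<And>x. x \<in> carrier E \<Longrightarrow> wedge V (ext_vec V v0) x = \<zero>\<^bsub>E\<^esub> \<Longrightarrow> T x = 0"
    using A.top_functional A(2) by metis
  have "A.eS {..<5} \<in> carrier E" using A.eS_pow[of "{..<5}"] by simp
  then show ?thesis using T(1)[OF assms(1)] T(2)[of x] assms by simp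
qed

lemma decomp3:
  assumes "x \<in> ext_part V (words (carrier V) 3)"
  obtains \<xi> \<eta> where "\<xi> \<in> ep 3" "\<eta> \<in> ep 2" "x = \<xi> \<oplus>\<^bsub>E\<^esub> wedge V (ext_vec V v0) \<eta>"
proof -
  obtain e \<phi> where A: "adapted V U 5 e \<phi>" "e 5 = v0" by (rule adapted)
  then interpret A: adapted V U 5 e \<phi> by simp
  show ?thesis using A.pow_V_decomp[of x 2] assms that A(2) by (auto simp: numeral_eq_Suc)
qed

lemma comp3: "\<xi> \<in> ep 3 \<Longrightarrow> \<eta> \<in> ep 2 \<Longrightarrow> \<xi> \<oplus>\<^bsub>E\<^esub> wedge V (ext_vec V v0) \<eta> \<in> ext_part V (words (carrier V) 3)"
  using wedge_pow[OF subset_refl ext_vec_pow[OF v0(1)] ep_V, of \<eta> 2] ep_V[of \<xi> 3] pow_subsp[OF subset_refl, of 3]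
  unfolding X.subspace_iff by (simp add: numeral_eq_Suc)

lemma wedge33: "x \<in> ep 3 \<Longrightarrow> y \<in> ep 3 \<Longrightarrow> wedge V x y = \<zero>\<^bsub>E\<^esub>"
proof -
  obtain e \<phi> where A: "adapted V U 5 e \<phi>" "e 5 = v0" by (rule adapted)
  then interpret A: adapted V U 5 e \<phi> by simp
  assume "x \<in> ep 3" "y \<in> ep 3"
  then show ?thesis using A.pow_large[of 6 "wedge V x y"] wedge_ep[of x 3 y 3] by simp
qed

text \<open>The frame of \<open>pairing_frame\<close> is dual for the functional \<open>T\<close> of
  an adapted basis. On the line of top degree \<open>T\<close> and \<open>eps\<close> are
  proportional, so dividing the dual vectors by \<open>eps ?O\<close> makes them dual for
  \<open>eps\<close>.\<close>

lemma pairing: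
  obtains N h s where "frame (ext_pow V U 2) N h (\<lambda>i x. eps (wedge V (s i) x))"
    "\<And>i. i < N \<Longrightarrow> h i \<in> ep 2" "\<And>i. i < N \<Longrightarrow> s i \<in> ep 3"
proof -
  obtain e \<phi> where A: "adapted V U 5 e \<phi>" "e 5 = v0" by (rule adapted)
  then interpret A: adapted V U 5 e \<phi> by simp
  obtain T where T: "functional E T" "T (A.eS {..<5}) = 1" "\<And>x. x \<in> ep 5 \<Longrightarrow> x = T x \<odot>\<^bsub>E\<^esub> A.eS {..<5}"
    using A.top_functional by metis
  obtain N h s where f: "frame (ext_pow V U 2) N h (\<lambda>i x. T (wedge V (s i) x))"
    and h: "\<And>i. i < N \<Longrightarrow> h i \<in> ep 2" and s: "\<And>i. i < N \<Longrightarrow> s i \<in> ep 3"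
    using A.pairing_frame[OF T(1,2), of 2] by auto
  let ?O = "A.eS {..<5}"
  have O: "?O \<in> ep 5" using A.eS_pow[of "{..<5}"] by simp
  have eT: "eps x = T x * eps ?O" if "x \<in> ep 5" for x
    using T(3)[OF that] eps_smult[OF O, of "T x"] by simp
  have nz: "eps ?O \<noteq> 0" using eps_nz eT by auto
  define s' where "s' i = inverse (eps ?O) \<odot>\<^bsub>E\<^esub> s i" for i
  have s': "s' i \<in> ep 3" if "i < N" for i using s[OF that] by (simp add: s'_def)
  have eq: "eps (wedge V (s' i) x) = T (wedge V (s i) x)" if "i < N" "x \<in> ep 2" for i x
  proof -
    have "eps (wedge V (s' i) x) = inverse (eps ?O) * eps (wedge V (s i) x)"
      unfolding s'_def by (rule pair_smult_left[OF s[OF that(1)] that(2)])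
    then show ?thesis using eT[OF wedge32[OF s[OF that(1)] that(2)]] nz by simp
  qed
  have "frame (ext_pow V U 2) N h (\<lambda>i x. eps (wedge V (s' i) x))"
    using f eq h unfolding frame_def functional_def
    by (simp add: ext_pow_carrier)
  then show ?thesis using that h s' by blast
qed

lemma pair_functional: "\<eta> \<in> ep 2 \<Longrightarrow> functional (ext_pow V U 3) (\<lambda>\<xi>. eps (wedge V \<xi> \<eta>))"
  unfolding functional_def by (simp add: ext_pow_carrier pair_add_left pair_smult_left)

text \<open>The vectors \<open>s i\<close> represent the coordinates in the frame \<open>h\<close>,
  so \<open>g\<close> is represented by their combination with coefficients
  \<open>g (h i)\<close>.\<close>

lemma represent_all:
  assumes g: "functional (ext_pow V U 2) g"
  obtains \<xi> where "\<xi> \<in> ep 3" "\<And>\<eta>. \<eta> \<in> ep 2 \<Longrightarrow> eps (wedge V \<xi> \<eta>) = g \<eta>"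
proof -
  obtain N h s where f: "frame (ext_pow V U 2) N h (\<lambda>i x. eps (wedge V (s i) x))"
    and h: "\<And>i. i < N \<Longrightarrow> h i \<in> ep 2" and s: "\<And>i. i < N \<Longrightarrow> s i \<in> ep 3"
    using pairing by metis
  let ?\<xi> = "comb (ext_pow V U 3) s (\<lambda>i. g (h i)) N"
  have "?\<xi> \<in> ep 3" using comb_closed[OF kspace_ep[of 3], of N s] s by (simp add: ext_pow_carrier)
  moreover have "eps (wedge V ?\<xi> \<eta>) = g \<eta>" if "\<eta> \<in> ep 2" for \<eta>
    using functional_comb[OF kspace_ep pair_functional[OF that], of N s "\<lambda>i. g (h i)"] s
      frame_functional_eq[OF f g, of \<eta>] that by (simp add: ext_pow_carrier mult.commute)
  ultimately show ?thesis using that by blast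
qed

lemma ep2_frame: obtains N h \<psi> where "frame (ext_pow V U 2) N h \<psi>"
  using pairing by metis

lemma represent:
  assumes M: "subsp M (ext_pow V U 2)" and f: "functional (E\<lparr>carrier := M\<rparr>) f"
  obtains \<xi> where "\<xi> \<in> ep 3" "\<And>\<eta>. \<eta> \<in> M \<Longrightarrow> eps (wedge V \<xi> \<eta>) = f \<eta>"
proof -
  obtain N h \<psi> where fr: "frame (ext_pow V U 2) N h \<psi>" by (rule ep2_frame)
  have "functional ((ext_pow V U 2)\<lparr>carrier := M\<rparr>) f" using f by (simp add: functional_def)
  from functional_extend[OF fr M this] obtain g where "functional (ext_pow V U 2) g" "\<And>x. x \<in> M \<Longrightarrow> g x = f x" by metis
  moreover have "M \<subseteq> ep 2" using M by (simp add: subsp_ep)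
  ultimately show ?thesis using represent_all[of g] that by (metis subsetD)
qed

lemma separate:
  assumes M: "subsp M (ext_pow V U 2)" and \<eta>: "\<eta> \<in> ep 2" "\<eta> \<notin> M"
  obtains \<xi> where "\<xi> \<in> ep 3" "\<And>\<eta>'. \<eta>' \<in> M \<Longrightarrow> eps (wedge V \<xi> \<eta>') = 0" "eps (wedge V \<xi> \<eta>) = 1"
proof -
  obtain N h \<psi> where fr: "frame (ext_pow V U 2) N h \<psi>" by (rule ep2_frame)
  from functional_separate[OF fr M] \<eta> obtain g where "functional (ext_pow V U 2) g" "\<And>x. x \<in> M \<Longrightarrow> g x = 0" "g \<eta> = 1"
    by (metis ext_pow_carrier)
  moreover have "M \<subseteq> ep 2" using M by (simp add: subsp_ep)
  ultimately show ?thesis using represent_all[of g] that \<eta> by (metis subsetD)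
qed

lemma pair_nondeg:
  assumes "\<eta> \<in> ep 2" "\<And>\<xi>. \<xi> \<in> ep 3 \<Longrightarrow> eps (wedge V \<xi> \<eta>) = 0"
  shows "\<eta> = \<zero>\<^bsub>E\<^esub>"
proof (rule ccontr)
  assume "\<eta> \<noteq> \<zero>\<^bsub>E\<^esub>"
  then show False using separate[of "{\<zero>\<^bsub>E\<^esub>}" \<eta>] assms X.zero_subspace
    by (metis ep_zero empty_subsetI insert_subset singletonD subsp_ep zero_neq_one)
qed

text \<open>Of the four products one is zero because it has degree six in \<open>U\<close>, and one
  because \<open>v0\<close> occurs twice. One remaining product gets a sign, since \<open>v0\<close>
  has to pass the odd element \<open>\<xi>\<close>; the other gets none, \<open>\<eta>\<close> being
  even.\<close>

lemma wedge_decomp: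
  assumes x: "\<xi> \<in> ep 3" "\<eta> \<in> ep 2" and y: "\<xi>' \<in> ep 3" "\<eta>' \<in> ep 2"
  shows "wedge V (\<xi> \<oplus>\<^bsub>E\<^esub> wedge V (ext_vec V v0) \<eta>) (\<xi>' \<oplus>\<^bsub>E\<^esub> wedge V (ext_vec V v0) \<eta>')
    = wedge V (ext_vec V v0) (wedge V \<xi>' \<eta> \<oplus>\<^bsub>E\<^esub> (- 1) \<odot>\<^bsub>E\<^esub> wedge V \<xi> \<eta>')"
proof -
  let ?v = "ext_vec V v0"
  have vV: "?v \<in> ext_part V (words (carrier V) 1)" by (rule ext_vec_pow[OF v0(1)])
  have c3: "wedge V \<xi> ?v = (- 1) \<odot>\<^bsub>E\<^esub> wedge V ?v \<xi>" using wedge_comm[OF ep_V[OF x(1)] vV] by simp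
  have c2: "wedge V \<eta> ?v = wedge V ?v \<eta>" using wedge_comm[OF ep_V[OF x(2)] vV] x by simp
  have 1: "wedge V \<xi> (wedge V ?v \<eta>') = (- 1) \<odot>\<^bsub>E\<^esub> wedge V ?v (wedge V \<xi> \<eta>')"
    using x y c3 by (simp add: wedge_assoc[symmetric]) (simp add: wedge_smult_left)
  have 2: "wedge V (wedge V ?v \<eta>) (wedge V ?v \<eta>') = \<zero>\<^bsub>E\<^esub>"
  proof -
    have "wedge V (wedge V ?v \<eta>) (wedge V ?v \<eta>') = wedge V ?v (wedge V (wedge V \<eta> ?v) \<eta>')"
      using x y by (simp add: wedge_assoc)
    also have "\<dots> = wedge V ?v (wedge V ?v (wedge V \<eta> \<eta>'))" unfolding c2 using x y by (simp add: wedge_assoc)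
    finally show ?thesis using ext_vec_sq[OF v0(1), of "wedge V \<eta> \<eta>'"] x y by simp
  qed
  have 3: "wedge V (wedge V ?v \<eta>) \<xi>' = wedge V ?v (wedge V \<xi>' \<eta>)"
    using x y wedge23[OF y(1) x(2)] by (simp add: wedge_assoc)
  have E: "\<xi> \<in> carrier E" "\<eta> \<in> carrier E" "\<xi>' \<in> carrier E" "\<eta>' \<in> carrier E" using x y by auto
  have "wedge V (\<xi> \<oplus>\<^bsub>E\<^esub> wedge V ?v \<eta>) (\<xi>' \<oplus>\<^bsub>E\<^esub> wedge V ?v \<eta>')
    = (wedge V \<xi> \<xi>' \<oplus>\<^bsub>E\<^esub> wedge V \<xi> (wedge V ?v \<eta>')) \<oplus>\<^bsub>E\<^esub> (wedge V (wedge V ?v \<eta>) \<xi>' \<oplus>\<^bsub>E\<^esub> wedge V (wedge V ?v \<eta>) (wedge V ?v \<eta>'))"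
    using E by (simp add: wedge_add_left wedge_add_right X.ac)
  also have "\<dots> = wedge V ?v (wedge V \<xi>' \<eta>) \<oplus>\<^bsub>E\<^esub> (- 1) \<odot>\<^bsub>E\<^esub> wedge V ?v (wedge V \<xi> \<eta>')"
    unfolding 1 2 3 wedge33[OF x(1) y(1)] using E by (simp add: X.comm)
  also have "\<dots> = wedge V ?v (wedge V \<xi>' \<eta> \<oplus>\<^bsub>E\<^esub> (- 1) \<odot>\<^bsub>E\<^esub> wedge V \<xi> \<eta>')"
    using E by (simp add: wedge_add_right wedge_smult_right)
  finally show ?thesis .
qed

text \<open>In the coordinates \<open>\<xi>\<close> and \<open>\<eta>\<close> the wedge product on
  the third exterior power is the standard symplectic form attached to the pairing of the third and
  second exterior powers of \<open>U\<close>. Injectivity of wedging with \<open>v0\<close> turns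
  its vanishing into an equation of scalars.\<close>

lemma symplectic_decomp:
  assumes x: "\<xi> \<in> ep 3" "\<eta> \<in> ep 2" and y: "\<xi>' \<in> ep 3" "\<eta>' \<in> ep 2"
  shows "wedge V (\<xi> \<oplus>\<^bsub>E\<^esub> wedge V (ext_vec V v0) \<eta>) (\<xi>' \<oplus>\<^bsub>E\<^esub> wedge V (ext_vec V v0) \<eta>') = \<zero>\<^bsub>E\<^esub>
    \<longleftrightarrow> eps (wedge V \<xi>' \<eta>) = eps (wedge V \<xi> \<eta>')"
proof -
  let ?z = "wedge V \<xi>' \<eta> \<oplus>\<^bsub>E\<^esub> (- 1) \<odot>\<^bsub>E\<^esub> wedge V \<xi> \<eta>'"
  have z: "?z \<in> ep 5" using x y by simp
  have "eps ?z = eps (wedge V \<xi>' \<eta>) - eps (wedge V \<xi> \<eta>')" using x y by (simp add: eps_add eps_smult)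
  moreover have "wedge V (ext_vec V v0) ?z = \<zero>\<^bsub>E\<^esub> \<longleftrightarrow> ?z = \<zero>\<^bsub>E\<^esub>"
    using wedge_v0_eq_zero[OF z] wedge_zero_right[OF ev0] by metis
  moreover have "?z = \<zero>\<^bsub>E\<^esub> \<longleftrightarrow> eps ?z = 0" using eps_inj[OF z] eps_zero by metis
  ultimately show ?thesis unfolding wedge_decomp[OF assms] by simp
qed

lemma decomp_zero:
  assumes x: "\<xi> \<in> ep 3" "\<eta> \<in> ep 2" and z: "\<xi> \<oplus>\<^bsub>E\<^esub> wedge V (ext_vec V v0) \<eta> = \<zero>\<^bsub>E\<^esub>"
  shows "\<eta> = \<zero>\<^bsub>E\<^esub> \<and> \<xi> = \<zero>\<^bsub>E\<^esub>"
proof -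
  have "eps (wedge V \<xi>' \<eta>) = 0" if "\<xi>' \<in> ep 3" for \<xi>'
    using symplectic_decomp[OF x that ep_zero[of 2]] x that z by simp
  then have "\<eta> = \<zero>\<^bsub>E\<^esub>" using pair_nondeg x by blast
  then show ?thesis using z x by simp
qed

lemma decomp_unique:
  assumes x: "\<xi> \<in> ep 3" "\<eta> \<in> ep 2" and y: "\<xi>' \<in> ep 3" "\<eta>' \<in> ep 2"
    and eq: "\<xi> \<oplus>\<^bsub>E\<^esub> wedge V (ext_vec V v0) \<eta> = \<xi>' \<oplus>\<^bsub>E\<^esub> wedge V (ext_vec V v0) \<eta>'"
  shows "\<xi> = \<xi>' \<and> \<eta> = \<eta>'"
proof -
  have E: "\<xi> \<in> carrier E" "\<eta> \<in> carrier E" "\<xi>' \<in> carrier E" "\<eta>' \<in> carrier E" using x y by auto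
  have "(\<xi> \<oplus>\<^bsub>E\<^esub> (- 1) \<odot>\<^bsub>E\<^esub> \<xi>') \<oplus>\<^bsub>E\<^esub> wedge V (ext_vec V v0) (\<eta> \<oplus>\<^bsub>E\<^esub> (- 1) \<odot>\<^bsub>E\<^esub> \<eta>')
     = (\<xi> \<oplus>\<^bsub>E\<^esub> wedge V (ext_vec V v0) \<eta>) \<oplus>\<^bsub>E\<^esub> (- 1) \<odot>\<^bsub>E\<^esub> (\<xi>' \<oplus>\<^bsub>E\<^esub> wedge V (ext_vec V v0) \<eta>')"
    using E by (simp add: wedge_add_right wedge_smult_right X.smult_add X.ac)
  also have "\<dots> = \<zero>\<^bsub>E\<^esub>" unfolding eq using E by simp
  finally have "\<eta> \<oplus>\<^bsub>E\<^esub> (- 1) \<odot>\<^bsub>E\<^esub> \<eta>' = \<zero>\<^bsub>E\<^esub> \<and> \<xi> \<oplus>\<^bsub>E\<^esub> (- 1) \<odot>\<^bsub>E\<^esub> \<xi>' = \<zero>\<^bsub>E\<^esub>"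
    using x y by (intro decomp_zero) auto
  then show ?thesis using X.eq_iff_diff[of \<xi> \<xi>'] X.eq_iff_diff[of \<eta> \<eta>'] E by simp
qed

text \<open>The scalar form of \<open>gm_A_of\<close>. The parameter \<open>m\<close> lets it cover
  both sides: for GM data it is \<mu>(l \<otimes> w) on W0, for a Lagrangian subspace the identity
  of its projection \<open>lag_base A\<close>.\<close>

definition graph_lag :: "'w set \<Rightarrow> ('w \<Rightarrow> ('v list \<Rightarrow> 'k) set) \<Rightarrow> ('w \<Rightarrow> 'w \<Rightarrow> 'k) \<Rightarrow> ('v list \<Rightarrow> 'k) set set" where
  "graph_lag W m q = {\<xi> \<oplus>\<^bsub>E\<^esub> wedge V (ext_vec V v0) (m w) | \<xi> w. \<xi> \<in> ep 3 \<and> w \<in> W \<and>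
     (\<forall>w'\<in>W. eps (wedge V \<xi> (m w')) + q w w' = 0)}"

lemma graph_lagI: "\<xi> \<in> ep 3 \<Longrightarrow> w \<in> W \<Longrightarrow> (\<And>w'. w' \<in> W \<Longrightarrow> eps (wedge V \<xi> (m w')) + q w w' = 0) \<Longrightarrow>
  \<xi> \<oplus>\<^bsub>E\<^esub> wedge V (ext_vec V v0) (m w) \<in> graph_lag W m q"
  unfolding graph_lag_def by blast

text \<open>The orthogonal of a set is always a subspace, here by linearity of \<open>wedge\<close>
  in its first argument.\<close>

lemma lagrangian_eq:
  "lagrangian (ext_pow V (carrier V) 3) (wedge V) \<zero>\<^bsub>E\<^esub> A \<longleftrightarrow>
    A = {x \<in> ext_part V (words (carrier V) 3). \<forall>a\<in>A. wedge V x a = \<zero>\<^bsub>E\<^esub>}"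
proof -
  interpret P: kspace "ext_pow V (carrier V) 3" by (rule kspace_pow) simp
  have "subsp A (ext_pow V (carrier V) 3)" if A: "A = {x \<in> ext_part V (words (carrier V) 3). \<forall>a\<in>A. wedge V x a = \<zero>\<^bsub>E\<^esub>}"
  proof -
    let ?A = "{x \<in> ext_part V (words (carrier V) 3). \<forall>a\<in>A. wedge V x a = \<zero>\<^bsub>E\<^esub>}"
    have S: "subsp (ext_part V (words (carrier V) 3)) E" by (rule pow_subsp) simp
    have cl: "x \<in> carrier E" if "x \<in> ext_part V (words (carrier V) 3)" for x using pow_closed[OF subset_refl that] .
    have AE: "a \<in> carrier E" if "a \<in> A" for a using that A cl by blast
    have "subsp ?A (ext_pow V (carrier V) 3)"
      using S unfolding P.subspace_iff X.subspace_iff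
      by (auto simp: ext_pow_carrier cl AE wedge_add_left wedge_smult_left)
    then show ?thesis using A by simp
  qed
  then show ?thesis unfolding lagrangian_def by (auto simp: ext_pow_carrier)
qed

text \<open>Since \<open>m\<close> is injective, \<open>- q w\<close> is a functional on the image
  of \<open>m\<close>, and the perfect pairing represents it. Hence every \<open>w\<close> occurs in
  the graph.\<close>

lemma graph_lag_lift:
  assumes W: "kspace W" and m: "lin W (ext_pow V U 2) m" "inj_on m (carrier W)"
    and q: "\<forall>w\<in>carrier W. functional W (q w)" and w: "w \<in> carrier W"
  obtains \<xi> where "\<xi> \<in> ep 3" "\<And>w'. w' \<in> carrier W \<Longrightarrow> eps (wedge V \<xi> (m w')) + q w w' = 0"
proof -
  interpret W: kspace W by fact
  let ?M = "m ` carrier W"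
  let ?f = "\<lambda>\<eta>. - q w (inv_into (carrier W) m \<eta>)"
  have M: "subsp ?M (ext_pow V U 2)" by (rule linear_map_image_subspace[OF m(1) W.carrier_subspace])
  have f: "?f (m w') = - q w w'" if "w' \<in> carrier W" for w' using m(2) that by simp
  have "?f (m x \<oplus>\<^bsub>E\<^esub> m y) = ?f (m x) + ?f (m y)" if "x \<in> carrier W" "y \<in> carrier W" for x y
    using linear_map_add[OF m(1) that] f[OF W.addC[OF that]] f[OF that(1)] f[OF that(2)] functional_add[OF bspec[OF q w] that] by simp
  moreover have "?f (c \<odot>\<^bsub>E\<^esub> m x) = c * ?f (m x)" if "x \<in> carrier W" for c x
    using linear_map_smult[OF m(1) that, of c] f[OF W.smultC[OF that, of c]] f[OF that] functional_smult[OF bspec[OF q w] that] by simp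
  ultimately have "functional (E\<lparr>carrier := ?M\<rparr>) ?f"
    by (auto simp: functional_def)
  from represent[OF M this] obtain \<xi> where "\<xi> \<in> ep 3" "\<And>\<eta>. \<eta> \<in> ?M \<Longrightarrow> eps (wedge V \<xi> \<eta>) = ?f \<eta>" by metis
  then show ?thesis using that[of \<xi>] f by simp
qed

text \<open>Isotropy is the symmetry of \<open>q\<close>. For maximality, let x be orthogonal to the
  graph: testing against the points over 0, which form the annihilator of the image of
  \<open>m\<close>, puts the component \<open>\<eta>\<close> of x into that image, and testing
  against lifts of all \<open>w'\<close> gives the equation of the graph.\<close>

lemma graph_lag_lagrangian:
  assumes W: "kspace W" and m: "lin W (ext_pow V U 2) m" "inj_on m (carrier W)"
    and q: "\<forall>w\<in>carrier W. functional W (q w)"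
    and sym: "\<And>w w'. w \<in> carrier W \<Longrightarrow> w' \<in> carrier W \<Longrightarrow> q w w' = q w' w"
  shows "lagrangian (ext_pow V (carrier V) 3) (wedge V) \<zero>\<^bsub>E\<^esub> (graph_lag (carrier W) m q)" (is "lagrangian _ _ _ ?A")
  unfolding lagrangian_eq
proof (rule Set.set_eqI)
  interpret W: kspace W by fact
  have m2: "m w \<in> ep 2" if "w \<in> carrier W" for w using linear_map_closed[OF m(1) that] by (simp add: ext_pow_carrier)
  have m0: "m \<zero>\<^bsub>W\<^esub> = \<zero>\<^bsub>E\<^esub>" using linear_map_zero[OF m(1)] by simp
  fix x
  show "x \<in> ?A \<longleftrightarrow> x \<in> {x \<in> ext_part V (words (carrier V) 3). \<forall>a\<in>?A. wedge V x a = \<zero>\<^bsub>E\<^esub>}"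
  proof
    assume "x \<in> ?A"
    then obtain \<xi> w where x: "\<xi> \<in> ep 3" "w \<in> carrier W" "\<And>w'. w' \<in> carrier W \<Longrightarrow> eps (wedge V \<xi> (m w')) + q w w' = 0"
      "x = \<xi> \<oplus>\<^bsub>E\<^esub> wedge V (ext_vec V v0) (m w)" unfolding graph_lag_def by blast
    have "wedge V x a = \<zero>\<^bsub>E\<^esub>" if a: "a \<in> ?A" for a
    proof -
      obtain \<xi>' w' where y: "\<xi>' \<in> ep 3" "w' \<in> carrier W" "\<And>w. w \<in> carrier W \<Longrightarrow> eps (wedge V \<xi>' (m w)) + q w' w = 0"
        "a = \<xi>' \<oplus>\<^bsub>E\<^esub> wedge V (ext_vec V v0) (m w')" using a unfolding graph_lag_def by blast
      show ?thesis unfolding x(4) y(4) symplectic_decomp[OF x(1) m2[OF x(2)] y(1) m2[OF y(2)]]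
        using x(3)[OF y(2)] y(3)[OF x(2)] sym[OF x(2) y(2)] by (simp add: add_eq_0_iff2)
    qed
    then show "x \<in> {x \<in> ext_part V (words (carrier V) 3). \<forall>a\<in>?A. wedge V x a = \<zero>\<^bsub>E\<^esub>}"
      using comp3[OF x(1) m2[OF x(2)]] x(4) by simp
  next
    assume "x \<in> {x \<in> ext_part V (words (carrier V) 3). \<forall>a\<in>?A. wedge V x a = \<zero>\<^bsub>E\<^esub>}"
    then have x: "x \<in> ext_part V (words (carrier V) 3)" and perp: "\<And>a. a \<in> ?A \<Longrightarrow> wedge V x a = \<zero>\<^bsub>E\<^esub>" by auto
    obtain \<xi> \<eta> where d: "\<xi> \<in> ep 3" "\<eta> \<in> ep 2" "x = \<xi> \<oplus>\<^bsub>E\<^esub> wedge V (ext_vec V v0) \<eta>" using decomp3[OF x] .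
    have M: "subsp (m ` carrier W) (ext_pow V U 2)" by (rule linear_map_image_subspace[OF m(1) W.carrier_subspace])
    have "\<eta> \<in> m ` carrier W"
    proof (rule ccontr)
      assume "\<eta> \<notin> m ` carrier W"
      from separate[OF M d(2) this] obtain \<xi>' where s: "\<xi>' \<in> ep 3" "\<And>\<eta>'. \<eta>' \<in> m ` carrier W \<Longrightarrow> eps (wedge V \<xi>' \<eta>') = 0" "eps (wedge V \<xi>' \<eta>) = 1" by metis
      have "\<xi>' \<oplus>\<^bsub>E\<^esub> wedge V (ext_vec V v0) (m \<zero>\<^bsub>W\<^esub>) \<in> ?A"
      proof (rule graph_lagI[OF s(1) W.zeroC])
        fix w' assume w': "w' \<in> carrier W"
        have "q \<zero>\<^bsub>W\<^esub> w' = q w' \<zero>\<^bsub>W\<^esub>" by (rule sym[OF W.zeroC w'])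
        then have "q \<zero>\<^bsub>W\<^esub> w' = 0" using functional_zero[OF bspec[OF q w'] W] by simp
        then show "eps (wedge V \<xi>' (m w')) + q \<zero>\<^bsub>W\<^esub> w' = 0" using s(2) w' by simp
      qed
      from perp[OF this] have "eps (wedge V \<xi>' \<eta>) = eps (wedge V \<xi> (m \<zero>\<^bsub>W\<^esub>))"
        unfolding d(3) using symplectic_decomp[OF d(1,2) s(1) m2] by simp
      then show False using s(3) d(1) by (simp add: m0)
    qed
    then obtain w where w: "w \<in> carrier W" "\<eta> = m w" by auto
    have "eps (wedge V \<xi> (m w')) + q w w' = 0" if w': "w' \<in> carrier W" for w'
    proof -
      obtain \<xi>' where l: "\<xi>' \<in> ep 3" "\<And>w''. w'' \<in> carrier W \<Longrightarrow> eps (wedge V \<xi>' (m w'')) + q w' w'' = 0"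
        using graph_lag_lift[OF W m q w'] by metis
      from graph_lagI[where m=m and q=q, OF l(1) w' l(2)] have "\<xi>' \<oplus>\<^bsub>E\<^esub> wedge V (ext_vec V v0) (m w') \<in> ?A" by simp
      from perp[OF this] have "eps (wedge V \<xi>' (m w)) = eps (wedge V \<xi> (m w'))"
        unfolding d(3) w(2) using symplectic_decomp[OF d(1) m2[OF w(1)] l(1) m2[OF w']] by simp
      then show ?thesis using l(2)[OF w(1)] sym[OF w(1) w'] by simp
    qed
    from graph_lagI[where m=m and q=q, OF d(1) w(1) this] show "x \<in> ?A" unfolding d(3) w(2) by simp
  qed
qed

text \<open>\<open>A\<close> is the graph of \<open>lag_form A\<close> over \<open>lag_base A\<close>; the choice of \<open>\<xi>\<close> does not matter on
  \<open>lag_base A\<close> because \<open>A\<close> is isotropic.\<close>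

definition lag_base :: "('v list \<Rightarrow> 'k) set set \<Rightarrow> ('v list \<Rightarrow> 'k) set set" where
  "lag_base A = {\<eta> \<in> ep 2. \<exists>\<xi>\<in>ep 3. \<xi> \<oplus>\<^bsub>E\<^esub> wedge V (ext_vec V v0) \<eta> \<in> A}"

definition lag_form :: "('v list \<Rightarrow> 'k) set set \<Rightarrow> ('v list \<Rightarrow> 'k) set \<Rightarrow> ('v list \<Rightarrow> 'k) set \<Rightarrow> 'k" where
  "lag_form A \<eta> \<eta>' = - eps (wedge V (SOME \<xi>. \<xi> \<in> ep 3 \<and> \<xi> \<oplus>\<^bsub>E\<^esub> wedge V (ext_vec V v0) \<eta> \<in> A) \<eta>')"

context
  fixes A
  assumes A: "lagrangian (ext_pow V (carrier V) 3) (wedge V) \<zero>\<^bsub>E\<^esub> A"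
begin

lemma A_add: "x \<in> A \<Longrightarrow> y \<in> A \<Longrightarrow> x \<oplus>\<^bsub>E\<^esub> y \<in> A" and A_smult: "x \<in> A \<Longrightarrow> c \<odot>\<^bsub>E\<^esub> x \<in> A" and A_zero: "\<zero>\<^bsub>E\<^esub> \<in> A"
  and A_pow: "x \<in> A \<Longrightarrow> x \<in> ext_part V (words (carrier V) 3)"
  and A_perp: "x \<in> ext_part V (words (carrier V) 3) \<Longrightarrow> (\<And>a. a \<in> A \<Longrightarrow> wedge V x a = \<zero>\<^bsub>E\<^esub>) \<Longrightarrow> x \<in> A"
  and A_iso: "x \<in> A \<Longrightarrow> y \<in> A \<Longrightarrow> wedge V x y = \<zero>\<^bsub>E\<^esub>"
proof -
  interpret P: kspace "ext_pow V (carrier V) 3" by (rule kspace_pow) simp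
  have s: "subsp A (ext_pow V (carrier V) 3)" using A by (simp add: lagrangian_def)
  show "x \<in> A \<Longrightarrow> y \<in> A \<Longrightarrow> x \<oplus>\<^bsub>E\<^esub> y \<in> A" "x \<in> A \<Longrightarrow> c \<odot>\<^bsub>E\<^esub> x \<in> A" "\<zero>\<^bsub>E\<^esub> \<in> A"
    "x \<in> A \<Longrightarrow> x \<in> ext_part V (words (carrier V) 3)"
    using s unfolding P.subspace_iff by (auto simp: ext_pow_carrier)
  show "x \<in> ext_part V (words (carrier V) 3) \<Longrightarrow> (\<And>a. a \<in> A \<Longrightarrow> wedge V x a = \<zero>\<^bsub>E\<^esub>) \<Longrightarrow> x \<in> A"
    "x \<in> A \<Longrightarrow> y \<in> A \<Longrightarrow> wedge V x y = \<zero>\<^bsub>E\<^esub>"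
    using A unfolding lagrangian_eq by blast+
qed

lemma lag_base_sub: "subsp (lag_base A) (ext_pow V U 2)"
  unfolding kspace.subspace_iff[OF kspace_ep]
proof (intro conjI ballI allI)
  show "lag_base A \<subseteq> carrier (ext_pow V U 2)" by (auto simp: lag_base_def ext_pow_carrier)
  have "\<zero>\<^bsub>E\<^esub> \<oplus>\<^bsub>E\<^esub> wedge V (ext_vec V v0) \<zero>\<^bsub>E\<^esub> \<in> A" using A_zero by simp
  then show "\<zero>\<^bsub>ext_pow V U 2\<^esub> \<in> lag_base A" using ep_zero by (force simp: lag_base_def)
  fix x y assume "x \<in> lag_base A" "y \<in> lag_base A"
  then obtain a b where *: "x \<in> ep 2" "y \<in> ep 2" "a \<in> ep 3" "b \<in> ep 3"
     "a \<oplus>\<^bsub>E\<^esub> wedge V (ext_vec V v0) x \<in> A" "b \<oplus>\<^bsub>E\<^esub> wedge V (ext_vec V v0) y \<in> A" by (auto simp: lag_base_def)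
  have E: "x \<in> carrier E" "y \<in> carrier E" "a \<in> carrier E" "b \<in> carrier E" using * by auto
  have "(a \<oplus>\<^bsub>E\<^esub> b) \<oplus>\<^bsub>E\<^esub> wedge V (ext_vec V v0) (x \<oplus>\<^bsub>E\<^esub> y) = (a \<oplus>\<^bsub>E\<^esub> wedge V (ext_vec V v0) x) \<oplus>\<^bsub>E\<^esub> (b \<oplus>\<^bsub>E\<^esub> wedge V (ext_vec V v0) y)"
    using E by (simp add: wedge_add_right X.ac)
  then have "(a \<oplus>\<^bsub>E\<^esub> b) \<oplus>\<^bsub>E\<^esub> wedge V (ext_vec V v0) (x \<oplus>\<^bsub>E\<^esub> y) \<in> A" using A_add[OF *(5,6)] by simp
  then show "x \<oplus>\<^bsub>ext_pow V U 2\<^esub> y \<in> lag_base A" using * by (auto simp: lag_base_def)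
next
  fix c x assume "x \<in> lag_base A"
  then obtain a where *: "x \<in> ep 2" "a \<in> ep 3" "a \<oplus>\<^bsub>E\<^esub> wedge V (ext_vec V v0) x \<in> A" by (auto simp: lag_base_def)
  have "(c \<odot>\<^bsub>E\<^esub> a) \<oplus>\<^bsub>E\<^esub> wedge V (ext_vec V v0) (c \<odot>\<^bsub>E\<^esub> x) = c \<odot>\<^bsub>E\<^esub> (a \<oplus>\<^bsub>E\<^esub> wedge V (ext_vec V v0) x)"
    using * by (simp add: wedge_smult_right X.smult_add)
  then have "(c \<odot>\<^bsub>E\<^esub> a) \<oplus>\<^bsub>E\<^esub> wedge V (ext_vec V v0) (c \<odot>\<^bsub>E\<^esub> x) \<in> A" using A_smult[OF *(3)] by simp
  then show "c \<odot>\<^bsub>ext_pow V U 2\<^esub> x \<in> lag_base A" using * by (auto simp: lag_base_def)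
qed

lemma lag_base_ep: "\<eta> \<in> lag_base A \<Longrightarrow> \<eta> \<in> ep 2"
  by (simp add: lag_base_def)

lemma lag_form_eq:
  assumes a: "\<xi> \<in> ep 3" "\<eta> \<in> ep 2" "\<xi> \<oplus>\<^bsub>E\<^esub> wedge V (ext_vec V v0) \<eta> \<in> A" and \<eta>': "\<eta>' \<in> lag_base A"
  shows "lag_form A \<eta> \<eta>' = - eps (wedge V \<xi> \<eta>')"
proof -
  let ?x = "SOME \<xi>. \<xi> \<in> ep 3 \<and> \<xi> \<oplus>\<^bsub>E\<^esub> wedge V (ext_vec V v0) \<eta> \<in> A"
  have x: "?x \<in> ep 3 \<and> ?x \<oplus>\<^bsub>E\<^esub> wedge V (ext_vec V v0) \<eta> \<in> A"
    by (rule someI[where P="\<lambda>\<xi>. \<xi> \<in> ep 3 \<and> \<xi> \<oplus>\<^bsub>E\<^esub> wedge V (ext_vec V v0) \<eta> \<in> A"]) (use a in blast)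
  obtain \<xi>' where b: "\<xi>' \<in> ep 3" "\<eta>' \<in> ep 2" "\<xi>' \<oplus>\<^bsub>E\<^esub> wedge V (ext_vec V v0) \<eta>' \<in> A" using \<eta>' by (auto simp: lag_base_def)
  have "eps (wedge V \<xi>' \<eta>) = eps (wedge V z \<eta>')" if "z \<in> ep 3" "z \<oplus>\<^bsub>E\<^esub> wedge V (ext_vec V v0) \<eta> \<in> A" for z
    using symplectic_decomp[OF that(1) a(2) b(1,2)] A_iso[OF that(2) b(3)] by simp
  from this[of ?x] this[OF a(1,3)] x show ?thesis unfolding lag_form_def by simp
qed

lemma lag_form_sym:
  assumes "\<eta> \<in> lag_base A" "\<eta>' \<in> lag_base A"
  shows "lag_form A \<eta> \<eta>' = lag_form A \<eta>' \<eta>"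
proof -
  obtain \<xi> where a: "\<xi> \<in> ep 3" "\<eta> \<in> ep 2" "\<xi> \<oplus>\<^bsub>E\<^esub> wedge V (ext_vec V v0) \<eta> \<in> A" using assms by (auto simp: lag_base_def)
  obtain \<xi>' where b: "\<xi>' \<in> ep 3" "\<eta>' \<in> ep 2" "\<xi>' \<oplus>\<^bsub>E\<^esub> wedge V (ext_vec V v0) \<eta>' \<in> A" using assms by (auto simp: lag_base_def)
  show ?thesis using symplectic_decomp[OF a(1,2) b(1,2)] A_iso[OF a(3) b(3)]
    by (simp add: lag_form_eq[OF a assms(2)] lag_form_eq[OF b assms(1)])
qed

lemma lag_form_functional:
  assumes "\<eta> \<in> lag_base A"
  shows "functional (E\<lparr>carrier := lag_base A\<rparr>) (lag_form A \<eta>)"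
proof -
  obtain \<xi> where a: "\<xi> \<in> ep 3" "\<eta> \<in> ep 2" "\<xi> \<oplus>\<^bsub>E\<^esub> wedge V (ext_vec V v0) \<eta> \<in> A" using assms by (auto simp: lag_base_def)
  have c: "x \<oplus>\<^bsub>E\<^esub> y \<in> lag_base A" "k \<odot>\<^bsub>E\<^esub> x \<in> lag_base A" if "x \<in> lag_base A" "y \<in> lag_base A" for x y k
    using lag_base_sub that unfolding kspace.subspace_iff[OF kspace_ep] by auto
  show ?thesis
    unfolding functional_def using c a(1)
    by (auto simp: lag_form_eq[OF a] pair_add_right pair_smult_right lag_base_ep)
qed

text \<open>One inclusion is the definition of the form. Conversely a point of the graph is
  orthogonal to all of \<open>A\<close>, by symmetry of the form, and \<open>A\<close> is its own
  orthogonal.\<close>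

lemma lag_eq_graph: "A = graph_lag (lag_base A) (\<lambda>\<eta>. \<eta>) (lag_form A)"
proof (rule Set.set_eqI)
  fix x
  show "x \<in> A \<longleftrightarrow> x \<in> graph_lag (lag_base A) (\<lambda>\<eta>. \<eta>) (lag_form A)"
  proof
    assume x: "x \<in> A"
    obtain \<xi> \<eta> where d: "\<xi> \<in> ep 3" "\<eta> \<in> ep 2" "x = \<xi> \<oplus>\<^bsub>E\<^esub> wedge V (ext_vec V v0) \<eta>" using decomp3[OF A_pow[OF x]] .
    then have "\<eta> \<in> lag_base A" using x by (auto simp: lag_base_def)
    then show "x \<in> graph_lag (lag_base A) (\<lambda>\<eta>. \<eta>) (lag_form A)"
      using graph_lagI[OF d(1), where m="\<lambda>\<eta>. \<eta>"] lag_form_eq[OF d(1,2)] x d(3) by simp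
  next
    assume "x \<in> graph_lag (lag_base A) (\<lambda>\<eta>. \<eta>) (lag_form A)"
    then obtain \<xi> \<eta> where d: "\<xi> \<in> ep 3" "\<eta> \<in> lag_base A" "x = \<xi> \<oplus>\<^bsub>E\<^esub> wedge V (ext_vec V v0) \<eta>"
      "\<And>\<eta>'. \<eta>' \<in> lag_base A \<Longrightarrow> eps (wedge V \<xi> \<eta>') + lag_form A \<eta> \<eta>' = 0" unfolding graph_lag_def by blast
    have \<eta>: "\<eta> \<in> ep 2" by (rule lag_base_ep[OF d(2)])
    show "x \<in> A"
    proof (rule A_perp)
      show "x \<in> ext_part V (words (carrier V) 3)" unfolding d(3) by (rule comp3[OF d(1) \<eta>])
      fix a assume a: "a \<in> A"
      obtain \<xi>' \<eta>' where b: "\<xi>' \<in> ep 3" "\<eta>' \<in> ep 2" "a = \<xi>' \<oplus>\<^bsub>E\<^esub> wedge V (ext_vec V v0) \<eta>'" using decomp3[OF A_pow[OF a]] .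
      then have \<eta>': "\<eta>' \<in> lag_base A" using a by (auto simp: lag_base_def)
      have "lag_form A \<eta> \<eta>' = - eps (wedge V \<xi>' \<eta>)"
        using lag_form_sym[OF d(2) \<eta>'] lag_form_eq[OF b(1,2) _ d(2)] a b(3) by simp
      then show "wedge V x a = \<zero>\<^bsub>E\<^esub>"
        unfolding d(3) b(3) symplectic_decomp[OF d(1) \<eta> b(1,2)] using d(4)[OF \<eta>'] by simp
    qed
  qed
qed

end

text \<open>By uniqueness of the decomposition the graph remembers the image of \<open>m\<close>;
  for GM data this is the image of W0 under \<mu>.\<close>

lemma lag_base_graph:
  assumes W: "kspace W" and m: "lin W (ext_pow V U 2) m" "inj_on m (carrier W)"
    and q: "\<forall>w\<in>carrier W. functional W (q w)"
  shows "lag_base (graph_lag (carrier W) m q) = m ` carrier W"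
proof (intro Set.set_eqI iffI)
  have m2: "m w \<in> ep 2" if "w \<in> carrier W" for w using linear_map_closed[OF m(1) that] by (simp add: ext_pow_carrier)
  fix \<eta>
  {
    assume "\<eta> \<in> lag_base (graph_lag (carrier W) m q)"
    then obtain \<xi> \<xi>' w where *: "\<eta> \<in> ep 2" "\<xi> \<in> ep 3" "\<xi>' \<in> ep 3" "w \<in> carrier W"
      "\<xi> \<oplus>\<^bsub>E\<^esub> wedge V (ext_vec V v0) \<eta> = \<xi>' \<oplus>\<^bsub>E\<^esub> wedge V (ext_vec V v0) (m w)"
      unfolding lag_base_def graph_lag_def by blast
    show "\<eta> \<in> m ` carrier W" using decomp_unique[OF *(2,1,3) m2[OF *(4)] *(5)] *(4) by simp
  }
  assume "\<eta> \<in> m ` carrier W"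
  then obtain w where w: "w \<in> carrier W" "\<eta> = m w" by auto
  obtain \<xi> where l: "\<xi> \<in> ep 3" "\<And>w'. w' \<in> carrier W \<Longrightarrow> eps (wedge V \<xi> (m w')) + q w w' = 0"
    using graph_lag_lift[OF W m q w(1)] by metis
  from graph_lagI[where m=m and q=q, OF l(1) w(1) l(2)] show "\<eta> \<in> lag_base (graph_lag (carrier W) m q)" using w m2 l by (auto simp: lag_base_def)
qed

end

section \<open>GM data in terms of scalars\<close>

lemma scalar_simps[simp]: "carrier scalar_vs = UNIV" "zero scalar_vs = 0" "a \<oplus>\<^bsub>scalar_vs\<^esub> b = a + b" "c \<odot>\<^bsub>scalar_vs\<^esub> a = c * a"
  by (simp_all add: scalar_vs_def)

lemma kspace_scalar: "kspace scalar_vs"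
  by (rule kspaceI) (auto simp: algebra_simps)

lemma dual_iff: "f \<in> carrier (dual_vs V) \<longleftrightarrow> functional V f \<and> (\<forall>v. v \<notin> carrier V \<longrightarrow> f v = 0)"
  by (auto simp: dual_vs_def LinearCombinations.module_hom_def functional_def)

lemma dual_simps[simp]: "zero (dual_vs V) = (\<lambda>v. 0)" "f \<oplus>\<^bsub>dual_vs V\<^esub> g = (\<lambda>v. f v + g v)" "c \<odot>\<^bsub>dual_vs V\<^esub> f = (\<lambda>v. c * f v)"
  by (simp_all add: dual_vs_def)

lemma kspace_dual: "kspace (dual_vs V)"
  by (rule kspaceI) (auto simp: dual_iff functional_def algebra_simps)

lemma sym_forms_iff: "b \<in> carrier (sym_forms W) \<longleftrightarrow>
    (\<forall>w. functional W (b w)) \<and> (\<forall>w w'. w' \<notin> carrier W \<longrightarrow> b w w' = 0) \<and> (\<forall>w w'. b w w' = b w' w)"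
  by (auto simp: sym_forms_def dual_iff)

lemma sym_forms_simps[simp]: "zero (sym_forms W) = (\<lambda>v w. 0)" "b \<oplus>\<^bsub>sym_forms W\<^esub> c = (\<lambda>v w. b v w + c v w)"
   "a \<odot>\<^bsub>sym_forms W\<^esub> b = (\<lambda>v w. a * b v w)"
  by (simp_all add: sym_forms_def)

lemma kspace_sym_forms: "kspace (sym_forms W)"
  by (rule kspaceI) (auto simp: sym_forms_iff functional_def algebra_simps)

text \<open>The coordinate of \<epsilon> in the basis l \<otimes> l of the line L \<otimes> L; it
  exists and is unique on the fifth exterior power of V5 when l is nonzero.\<close>

definition gm_coef :: "('k::field, 'w, 'v, 'l) gm_data \<Rightarrow> 'l \<Rightarrow> ('v list \<Rightarrow> 'k) set \<Rightarrow> 'k" where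
  "gm_coef D l x = (THE c. gm_eps D x = c \<odot>\<^bsub>tensor_vs (gm_L D) (gm_L D)\<^esub> pure_tensor (gm_L D) (gm_L D) l l)"

section \<open>GM data with a chosen generator of L\<close>

locale gm =
  fixes D :: "('k::field, 'w, 'v, 'l) gm_data"
  assumes D: "is_gm_data D"
begin

abbreviation "W \<equiv> gm_W D"
abbreviation "V \<equiv> gm_V6 D"
abbreviation "U \<equiv> gm_V5 D"
abbreviation "L \<equiv> gm_L D"
abbreviation "LL \<equiv> tensor_vs L L"
abbreviation "ep p \<equiv> ext_part V (words U p)"

lemma gmD: "\<exists>d. has_dim W d" "has_dim V 6" "hyperplane U V" "has_dim L 1"
    "lin (tensor_vs L W) (ext_pow V U 2) (gm_mu D)" "lin V (sym_forms W) (gm_q D)"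
    "lin_iso (ext_pow V U 5) LL (gm_eps D)"
    "\<And>v w1 w2 l1 l2. v \<in> U \<Longrightarrow> w1 \<in> carrier W \<Longrightarrow> w2 \<in> carrier W \<Longrightarrow> l1 \<in> carrier L \<Longrightarrow> l2 \<in> carrier L \<Longrightarrow>
      gm_q D v w1 w2 \<odot>\<^bsub>LL\<^esub> pure_tensor L L l1 l2
      = gm_eps D (wedge V (ext_vec V v) (wedge V (gm_mu_pure D l1 w1) (gm_mu_pure D l2 w2)))"
  using D unfolding is_gm_data_def is_gm_data_of_dim_def by blast+

sublocale W: kspace W using gmD(1) has_dim_kspace by blast
sublocale V: kspace V using gmD(2) has_dim_kspace by blast
sublocale L: kspace L using gmD(4) has_dim_kspace by blast

lemma UV: "U \<subseteq> carrier V"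
  using gmD(3) by (simp add: hyperplane_def V.subspace_iff)

lemma q_mem: "v \<in> carrier V \<Longrightarrow> gm_q D v \<in> carrier (sym_forms W)"
  using linear_map_closed[OF gmD(6)] .

lemma q_sym: "v \<in> carrier V \<Longrightarrow> gm_q D v w w' = gm_q D v w' w"
  using q_mem by (simp add: sym_forms_iff)

lemma q_functional: "v \<in> carrier V \<Longrightarrow> functional W (gm_q D v w)"
  using q_mem by (simp add: sym_forms_iff)

lemma q_add: "v \<in> carrier V \<Longrightarrow> v' \<in> carrier V \<Longrightarrow> gm_q D (v \<oplus>\<^bsub>V\<^esub> v') w w' = gm_q D v w w' + gm_q D v' w w'"
  using linear_map_add[OF gmD(6)] by simp

lemma q_smult: "v \<in> carrier V \<Longrightarrow> gm_q D (c \<odot>\<^bsub>V\<^esub> v) w w' = c * gm_q D v w w'"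
  using linear_map_smult[OF gmD(6)] by simp

lemma q_add_right: "v \<in> carrier V \<Longrightarrow> w' \<in> carrier W \<Longrightarrow> w'' \<in> carrier W \<Longrightarrow> gm_q D v w (w' \<oplus>\<^bsub>W\<^esub> w'') = gm_q D v w w' + gm_q D v w w''"
  using functional_add[OF q_functional] .

lemma q_smult_right: "v \<in> carrier V \<Longrightarrow> w' \<in> carrier W \<Longrightarrow> gm_q D v w (c \<odot>\<^bsub>W\<^esub> w') = c * gm_q D v w w'"
  using functional_smult[OF q_functional] .

lemma q_add_left: "v \<in> carrier V \<Longrightarrow> w' \<in> carrier W \<Longrightarrow> w'' \<in> carrier W \<Longrightarrow> gm_q D v (w' \<oplus>\<^bsub>W\<^esub> w'') w = gm_q D v w' w + gm_q D v w'' w"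
  using q_add_right[of v w' w'' w] by (simp add: q_sym)

lemma q_smult_left: "v \<in> carrier V \<Longrightarrow> w' \<in> carrier W \<Longrightarrow> gm_q D v (c \<odot>\<^bsub>W\<^esub> w') w = c * gm_q D v w' w"
  using q_smult_right[of v w' w c] by (simp add: q_sym)

lemma q_zero_right: "v \<in> carrier V \<Longrightarrow> gm_q D v w \<zero>\<^bsub>W\<^esub> = 0"
  using functional_zero[OF q_functional] W.kspace_axioms by blast

lemma tensor_LW: "tensor L W"
  by (rule tensorI) (rule L.kspace_axioms W.kspace_axioms)+

lemma mu_closed: "l \<in> carrier L \<Longrightarrow> w \<in> carrier W \<Longrightarrow> gm_mu_pure D l w \<in> ep 2"
  unfolding gm_mu_pure_def using linear_map_closed[OF gmD(5) tensor.pure_closed[OF tensor_LW]]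
  by (simp add: ext_pow_carrier)

lemma mu_smult_L: "l \<in> carrier L \<Longrightarrow> w \<in> carrier W \<Longrightarrow> gm_mu_pure D (c \<odot>\<^bsub>L\<^esub> l) w = gm_mu_pure D l (c \<odot>\<^bsub>W\<^esub> w)"
  unfolding gm_mu_pure_def using tensor.pure_smult_left[OF tensor_LW] tensor.pure_smult_right[OF tensor_LW] by simp

lemma lin_mu: "l \<in> carrier L \<Longrightarrow> lin W (ext_pow V U 2) (gm_mu_pure D l)"
  unfolding gm_mu_pure_def linear_map_iff using V.kspace_pow[OF UV] W.kspace_axioms
    linear_map_add[OF gmD(5)] linear_map_smult[OF gmD(5)] linear_map_closed[OF gmD(5)]
  by (auto simp: tensor.pure_add_right[OF tensor_LW] tensor.pure_smult_right[OF tensor_LW] tensor.pure_closed[OF tensor_LW])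

end

locale gm_line = gm +
  fixes l
  assumes l: "l \<in> carrier L" "l \<noteq> \<zero>\<^bsub>L\<^esub>"
begin

abbreviation "ll \<equiv> pure_tensor L L l l"
abbreviation "mu \<equiv> gm_mu_pure D l"
abbreviation "cf \<equiv> gm_coef D l"

lemma LL_iso: "lin_iso L LL (pure_tensor L L l)"
  by (rule pure_iso[OF gmD(4) l gmD(4)])

sublocale LL: kspace LL
  using lin_iso_linear[OF LL_iso] by (rule linear_map_cod)

lemma ll: "ll \<in> carrier LL" "ll \<noteq> \<zero>\<^bsub>LL\<^esub>"
proof -
  note f = lin_iso_linear[OF LL_iso]
  show "ll \<in> carrier LL" by (rule linear_map_closed[OF f l(1)])
  show "ll \<noteq> \<zero>\<^bsub>LL\<^esub>"
    using lin_iso_bij[OF LL_iso] linear_map_zero[OF f] l L.zeroC unfolding bij_betw_def inj_on_def by metis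
qed

lemma LL_span:
  assumes "z \<in> carrier LL"
  obtains c where "z = c \<odot>\<^bsub>LL\<^esub> ll"
proof -
  obtain l' where l': "l' \<in> carrier L" "z = pure_tensor L L l l'" using lin_iso_bij[OF LL_iso] assms by (auto simp: bij_betw_def)
  obtain c where "l' = c \<odot>\<^bsub>L\<^esub> l" using has_dim_1_span[OF gmD(4) l l'(1)] by auto
  then have "z = c \<odot>\<^bsub>LL\<^esub> ll" using l' linear_map_smult[OF lin_iso_linear[OF LL_iso] l(1)] by simp
  then show ?thesis by (rule that)
qed

lemma ll_cancel: "c \<odot>\<^bsub>LL\<^esub> ll = d \<odot>\<^bsub>LL\<^esub> ll \<longleftrightarrow> c = d"
  by (rule LL.smult_cancel[OF ll])

lemma coef_eqI: "gm_eps D x = c \<odot>\<^bsub>LL\<^esub> ll \<Longrightarrow> cf x = c"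
  unfolding gm_coef_def by (rule the_equality) (auto simp: ll_cancel)

lemma eps_coef: "x \<in> ep 5 \<Longrightarrow> gm_eps D x = cf x \<odot>\<^bsub>LL\<^esub> ll"
  using linear_map_closed[OF lin_iso_linear[OF gmD(7)], of x] LL_span[of "gm_eps D x"] coef_eqI[of x]
  by (metis ext_pow_carrier)

lemma coef_functional: "functional (ext_pow V U 5) cf"
proof -
  note e = lin_iso_linear[OF gmD(7)]
  interpret P: kspace "ext_pow V U 5" using e by (rule linear_map_dom)
  have c: "carrier (ext_pow V U 5) = ep 5" by (simp add: ext_pow_carrier)
  show ?thesis
    unfolding functional_def
  proof (intro conjI ballI allI; rule coef_eqI)
    fix x y assume xy: "x \<in> carrier (ext_pow V U 5)" "y \<in> carrier (ext_pow V U 5)"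
    then show "gm_eps D (x \<oplus>\<^bsub>ext_pow V U 5\<^esub> y) = (cf x + cf y) \<odot>\<^bsub>LL\<^esub> ll"
      using linear_map_add[OF e xy] ll by (simp add: eps_coef c LL.add_smult)
  next
    fix a x assume x: "x \<in> carrier (ext_pow V U 5)"
    then show "gm_eps D (a \<odot>\<^bsub>ext_pow V U 5\<^esub> x) = (a * cf x) \<odot>\<^bsub>LL\<^esub> ll"
      using linear_map_smult[OF e x] ll by (simp add: eps_coef c)
  qed
qed

lemma coef_inj:
  assumes "x \<in> ep 5" "cf x = 0"
  shows "x = \<zero>\<^bsub>ext_alg V\<^esub>"
proof -
  note e = lin_iso_linear[OF gmD(7)]
  interpret P: kspace "ext_pow V U 5" using e by (rule linear_map_dom)
  have "gm_eps D x = gm_eps D \<zero>\<^bsub>ext_pow V U 5\<^esub>" using eps_coef[OF assms(1)] assms(2) ll linear_map_zero[OF e] by simp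
  then have "x = \<zero>\<^bsub>ext_pow V U 5\<^esub>"
    using lin_iso_bij[OF gmD(7)] assms(1) P.zeroC unfolding bij_betw_def inj_on_def ext_pow_carrier by blast
  then show ?thesis by simp
qed

lemma coef_nz: "\<exists>x\<in>ep 5. cf x \<noteq> 0"
proof -
  obtain x where x: "x \<in> ep 5" "gm_eps D x = ll"
    using lin_iso_bij[OF gmD(7)] ll(1) unfolding bij_betw_def ext_pow_carrier by (metis imageE)
  then have "cf x = 1" using ll by (intro coef_eqI) simp
  then show ?thesis using x by force
qed

lemma q_U: 
  assumes "v \<in> U" "w \<in> carrier W" "w' \<in> carrier W"
  shows "gm_q D v w w' = cf (wedge V (ext_vec V v) (wedge V (mu w) (mu w')))"
  using gmD(8)[OF assms l(1) l(1)] by (intro coef_eqI[symmetric]) simp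

text \<open>Every element of L is a multiple of l, so the kernel of \<mu> is visible at the single
  vector l.\<close>

lemma W1_eq: "gm_W1 D = {w \<in> carrier W. mu w = \<zero>\<^bsub>ext_alg V\<^esub>}"
proof -
  have "gm_mu_pure D l' w = \<zero>\<^bsub>ext_alg V\<^esub>" if w: "w \<in> carrier W" "mu w = \<zero>\<^bsub>ext_alg V\<^esub>" and l': "l' \<in> carrier L" for w l'
  proof -
    interpret P: kspace "ext_pow V U 2" by (rule V.kspace_pow[OF UV])
    obtain c where "l' = c \<odot>\<^bsub>L\<^esub> l" using has_dim_1_span[OF gmD(4) l l'] by auto
    then have "gm_mu_pure D l' w = c \<odot>\<^bsub>ext_pow V U 2\<^esub> mu w"
      using mu_smult_L[OF l(1) w(1)] linear_map_smult[OF lin_mu[OF l(1)] w(1)] by simp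
    then show ?thesis using w P.smult_zero by simp
  qed
  then show ?thesis using l by (auto simp: gm_W1_def)
qed

lemma W1_sub: "subsp (gm_W1 D) W"
proof -
  interpret P: kspace "ext_pow V U 2" by (rule V.kspace_pow[OF UV])
  show ?thesis using linear_map_preimage_subspace[OF lin_mu[OF l(1)] P.zero_subspace] by (simp add: W1_eq)
qed

lemma W1W: "b \<in> gm_W1 D \<Longrightarrow> b \<in> carrier W"
  by (simp add: gm_W1_def)

text \<open>On V5 the form q is computed from \<mu>, which vanishes on W1.\<close>

lemma q_U_W1:
  assumes "v \<in> U" "w \<in> carrier W" "b \<in> gm_W1 D"
  shows "gm_q D v w b = 0"
proof -
  have mu: "mu w \<in> carrier (ext_alg V)" using mu_closed[OF l(1) assms(2)] V.pow_closed[OF UV] by blast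
  have v: "v \<in> carrier V" using assms UV by auto
  have "gm_q D v w b = cf \<zero>\<^bsub>ext_alg V\<^esub>"
    using q_U[OF assms(1,2) W1W[OF assms(3)]] assms(3) mu v by (simp add: W1_eq)
  also have "\<dots> = 0" using functional_zero[OF coef_functional V.kspace_pow[OF UV]] by simp
  finally show ?thesis .
qed

end

section \<open>The complement of W1\<close>

locale gm_chosen = gm_line +
  fixes v0
  assumes v0: "v0 \<in> carrier V" "v0 \<notin> U"
begin

sublocale VH: volume_hyperplane V U v0 cf
  using gmD(3,2) v0 coef_functional coef_inj coef_nz V.kspace_axioms
  by (intro volume_hyperplane.intro volume_hyperplane_axioms.intro) auto

lemma decomp: 
  assumes "v \<in> carrier V"
  obtains c u where "u \<in> U" "v = u \<oplus>\<^bsub>V\<^esub> c \<odot>\<^bsub>V\<^esub> v0"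
proof -
  obtain e \<phi> where A: "adapted V U 5 e \<phi>" "e 5 = v0" by (rule VH.adapted)
  then interpret A: adapted V U 5 e \<phi> by simp
  show ?thesis using A.decomp[OF assms] A(2) that by metis
qed

text \<open>Modulo V5, whose vectors pair W with W1 to zero, every v is a multiple of v0.
  Orthogonality to W1 at v0 therefore gives orthogonality at every v.\<close>

lemma q_W1:
  assumes "v \<in> carrier V"
  obtains c where "\<And>w b. w \<in> carrier W \<Longrightarrow> b \<in> gm_W1 D \<Longrightarrow> gm_q D v w b = c * gm_q D v0 w b"
proof -
  obtain c u where u: "u \<in> U" "v = u \<oplus>\<^bsub>V\<^esub> c \<odot>\<^bsub>V\<^esub> v0" using decomp[OF assms] .
  have "gm_q D v w b = c * gm_q D v0 w b" if "w \<in> carrier W" "b \<in> gm_W1 D" for w b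
  proof -
    have "gm_q D v w b = gm_q D u w b + c * gm_q D v0 w b"
      unfolding u(2) using u(1) UV v0 by (subst q_add) (auto simp: q_smult)
    then show ?thesis using q_U_W1[OF u(1) that] by simp
  qed
  then show ?thesis using that by blast
qed

text \<open>The candidate for W0. For lci data it is W0 (\<open>W0_eq\<close>), and so it is the
  same for every choice of \<open>v0\<close>.\<close>

definition perp where
  "perp = {w \<in> carrier W. \<forall>b\<in>gm_W1 D. gm_q D v0 w b = 0}"

lemma perp_sub: "subsp perp W"
  unfolding W.subspace_iff perp_def using v0(1)
  by (auto simp: q_add_left q_smult_left W1W q_sym[OF v0(1), of "\<zero>\<^bsub>W\<^esub>"] q_zero_right)

lemma perpW: "w \<in> perp \<Longrightarrow> w \<in> carrier W"
  by (simp add: perp_def)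

lemma q_perp_W1:
  assumes "v \<in> carrier V" "a \<in> perp" "b \<in> gm_W1 D"
  shows "gm_q D v a b = 0"
proof -
  obtain c where "\<And>w b. w \<in> carrier W \<Longrightarrow> b \<in> gm_W1 D \<Longrightarrow> gm_q D v w b = c * gm_q D v0 w b"
    using q_W1[OF assms(1)] by blast
  then show ?thesis using assms(2,3) by (simp add: perp_def)
qed

end

locale gm_lci_chosen = gm_chosen +
  assumes lci: "gm_lci D"
begin

lemma special_vector:
  assumes "gm_special D"
  obtains b where "b \<in> gm_W1 D" "b \<noteq> \<zero>\<^bsub>W\<^esub>" "gm_q D v0 b b \<noteq> 0" "\<And>y. y \<in> gm_W1 D \<Longrightarrow> \<exists>c. y = c \<odot>\<^bsub>W\<^esub> b"
proof -
  have h: "has_dim (W\<lparr>carrier := gm_W1 D\<rparr>) 1" and "\<not> (\<forall>w\<in>gm_W1 D. gm_q D v0 w w = 0)"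
    using assms v0 by (auto simp: gm_special_def)
  then obtain b where b: "b \<in> gm_W1 D" "gm_q D v0 b b \<noteq> 0" by auto
  then have "b \<noteq> \<zero>\<^bsub>W\<^esub>" using q_zero_right[OF v0(1)] by auto
  then show ?thesis using that[of b] b has_dim_1_span[OF h, of b] by simp
qed

lemma perp_inter: "w \<in> perp \<Longrightarrow> w \<in> gm_W1 D \<Longrightarrow> w = \<zero>\<^bsub>W\<^esub>"
proof (cases "gm_ordinary D")
  case True
  then show "w \<in> gm_W1 D \<Longrightarrow> w = \<zero>\<^bsub>W\<^esub>" by (simp add: gm_ordinary_def)
next
  case False
  then have "gm_special D" using lci by (simp add: gm_lci_def)
  then obtain b where b: "b \<in> gm_W1 D" "gm_q D v0 b b \<noteq> 0" "\<And>y. y \<in> gm_W1 D \<Longrightarrow> \<exists>c. y = c \<odot>\<^bsub>W\<^esub> b"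
    using special_vector by blast
  assume w: "w \<in> perp" "w \<in> gm_W1 D"
  obtain c where c: "w = c \<odot>\<^bsub>W\<^esub> b" using b(3)[OF w(2)] by auto
  have "c * gm_q D v0 b b = 0" using w(1) b(1) W1W[OF b(1)] v0 by (auto simp: perp_def c q_smult_left)
  then show "w = \<zero>\<^bsub>W\<^esub>" using b(2) W1W[OF b(1)] c by simp
qed

lemma perp_decomp:
  assumes w: "w \<in> carrier W"
  obtains a b where "a \<in> perp" "b \<in> gm_W1 D" "w = a \<oplus>\<^bsub>W\<^esub> b"
proof (cases "gm_ordinary D")
  case True
  then have "w \<in> perp" "w = w \<oplus>\<^bsub>W\<^esub> \<zero>\<^bsub>W\<^esub>" using w q_zero_right[OF v0(1)] by (auto simp: perp_def gm_ordinary_def)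
  then show ?thesis using that[of w "\<zero>\<^bsub>W\<^esub>"] True by (simp add: gm_ordinary_def)
next
  case False
  then have "gm_special D" using lci by (simp add: gm_lci_def)
  then obtain b where b: "b \<in> gm_W1 D" "gm_q D v0 b b \<noteq> 0" "\<And>y. y \<in> gm_W1 D \<Longrightarrow> \<exists>c. y = c \<odot>\<^bsub>W\<^esub> b"
    using special_vector by blast
  have bW: "b \<in> carrier W" using W1W[OF b(1)] .
  \<comment> \<open>Orthogonal projection along \<open>b\<close>, possible because the form is
    nonzero at \<open>b\<close> for special data.\<close>
  define t where "t = gm_q D v0 w b / gm_q D v0 b b"
  let ?a = "w \<oplus>\<^bsub>W\<^esub> (- t) \<odot>\<^bsub>W\<^esub> b"
  have "gm_q D v0 ?a y = 0" if y: "y \<in> gm_W1 D" for y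
  proof -
    obtain c where c: "y = c \<odot>\<^bsub>W\<^esub> b" using b(3)[OF y] by auto
    have "gm_q D v0 ?a b = gm_q D v0 w b - t * gm_q D v0 b b"
      using w bW v0 by (simp add: q_add_left q_smult_left)
    then have "gm_q D v0 ?a b = 0" using b(2) by (simp add: t_def)
    then show ?thesis using bW v0 by (simp add: c q_smult_right)
  qed
  then have "?a \<in> perp" using w bW by (simp add: perp_def)
  moreover have "t \<odot>\<^bsub>W\<^esub> b \<in> gm_W1 D" using W1_sub b(1) by (simp add: W.subspace_iff)
  moreover have "w = ?a \<oplus>\<^bsub>W\<^esub> t \<odot>\<^bsub>W\<^esub> b"
    using w bW by (simp add: W.assoc W.add_smult[OF bW, symmetric])
  ultimately show ?thesis by (rule that)
qed

text \<open>Forms are cut off outside \<open>S\<close>, since the elements of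
  \<open>sym_forms\<close> vanish off the carrier.\<close>

lemma restrict_form:
  assumes S: "S \<subseteq> carrier W" "subsp S W"
  shows "lin V (sym_forms (W\<lparr>carrier := S\<rparr>)) (\<lambda>v a b. if a \<in> S \<and> b \<in> S then gm_q D v a b else 0)"
  using V.kspace_axioms kspace_sym_forms S unfolding W.subspace_iff
  by (auto simp: linear_map_iff sym_forms_iff functional_def q_add q_smult q_add_right q_smult_right q_sym subset_iff fun_eq_iff)

text \<open>A splitting makes \<open>S\<close> orthogonal to W1, so \<open>S\<close> is contained in
  \<open>perp\<close>. Both are complements of W1, which forces equality. This is the uniqueness
  that the definite description in \<open>gm_W0\<close> relies on.\<close>

lemma splitting_iff: "gm_splitting D S \<longleftrightarrow> S = perp"
proof
  assume "S = perp"
  moreover have "gm_splitting D perp"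
    unfolding gm_splitting_def
  proof (intro conjI)
    show "subsp perp W" by (rule perp_sub)
    show "perp \<inter> gm_W1 D = {\<zero>\<^bsub>W\<^esub>}"
      using perp_inter perp_sub W1_sub unfolding W.subspace_iff by auto
    show "perp <+>\<^bsub>W\<^esub> gm_W1 D = carrier W"
      using perp_decomp perpW W1W by (auto simp: set_add_def') metis
    show "\<exists>q0 q1. lin V (sym_forms (W\<lparr>carrier := perp\<rparr>)) q0 \<and> lin V (sym_forms (W\<lparr>carrier := gm_W1 D\<rparr>)) q1 \<and>
      (\<forall>v\<in>carrier V. \<forall>a\<in>perp. \<forall>b\<in>gm_W1 D. \<forall>a'\<in>perp. \<forall>b'\<in>gm_W1 D.
        gm_q D v (a \<oplus>\<^bsub>W\<^esub> b) (a' \<oplus>\<^bsub>W\<^esub> b') = q0 v a a' + q1 v b b')"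
    proof (intro exI conjI)
      show "lin V (sym_forms (W\<lparr>carrier := perp\<rparr>)) (\<lambda>v a b. if a \<in> perp \<and> b \<in> perp then gm_q D v a b else 0)"
        using perpW perp_sub by (intro restrict_form) auto
      show "lin V (sym_forms (W\<lparr>carrier := gm_W1 D\<rparr>)) (\<lambda>v a b. if a \<in> gm_W1 D \<and> b \<in> gm_W1 D then gm_q D v a b else 0)"
        using W1W W1_sub by (intro restrict_form) auto
      show "\<forall>v\<in>carrier V. \<forall>a\<in>perp. \<forall>b\<in>gm_W1 D. \<forall>a'\<in>perp. \<forall>b'\<in>gm_W1 D.
        gm_q D v (a \<oplus>\<^bsub>W\<^esub> b) (a' \<oplus>\<^bsub>W\<^esub> b') =
          (if a \<in> perp \<and> a' \<in> perp then gm_q D v a a' else 0) + (if b \<in> gm_W1 D \<and> b' \<in> gm_W1 D then gm_q D v b b' else 0)"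
      proof (intro ballI)
        fix v a b a' b' assume *: "v \<in> carrier V" "a \<in> perp" "b \<in> gm_W1 D" "a' \<in> perp" "b' \<in> gm_W1 D"
        have "gm_q D v a b' = 0" "gm_q D v b a' = 0"
          using q_perp_W1[OF *(1,2,5)] q_perp_W1[OF *(1,4,3)] q_sym[OF *(1), of b a'] by auto
        then show "gm_q D v (a \<oplus>\<^bsub>W\<^esub> b) (a' \<oplus>\<^bsub>W\<^esub> b') =
          (if a \<in> perp \<and> a' \<in> perp then gm_q D v a a' else 0) + (if b \<in> gm_W1 D \<and> b' \<in> gm_W1 D then gm_q D v b b' else 0)"
          using * perpW W1W by (simp add: q_add_left q_add_right)
      qed
    qed
  qed
  ultimately show "gm_splitting D S" by simp
next
  assume s: "gm_splitting D S"
  then obtain q0 q1 where S: "subsp S W" and sum: "S <+>\<^bsub>W\<^esub> gm_W1 D = carrier W"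
    and q0: "lin V (sym_forms (W\<lparr>carrier := S\<rparr>)) q0" and q1: "lin V (sym_forms (W\<lparr>carrier := gm_W1 D\<rparr>)) q1"
    and q: "\<And>v a b a' b'. v \<in> carrier V \<Longrightarrow> a \<in> S \<Longrightarrow> b \<in> gm_W1 D \<Longrightarrow> a' \<in> S \<Longrightarrow> b' \<in> gm_W1 D \<Longrightarrow>
      gm_q D v (a \<oplus>\<^bsub>W\<^esub> b) (a' \<oplus>\<^bsub>W\<^esub> b') = q0 v a a' + q1 v b b'"
    unfolding gm_splitting_def by blast
  have z: "\<zero>\<^bsub>W\<^esub> \<in> S" "\<zero>\<^bsub>W\<^esub> \<in> gm_W1 D" "S \<subseteq> carrier W" using S W1_sub by (auto simp: W.subspace_iff)
  have 0: "q0 v0 a \<zero>\<^bsub>W\<^esub> = 0" for a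
    using linear_map_closed[OF q0 v0(1)] functional_zero[OF _ W.subspace_kspace[OF S], of "q0 v0 a"] by (simp add: sym_forms_iff)
  have 1: "q1 v0 \<zero>\<^bsub>W\<^esub> b = 0" for b
    using linear_map_closed[OF q1 v0(1)] functional_zero[OF _ W.subspace_kspace[OF W1_sub], of "q1 v0 b"] by (simp add: sym_forms_iff)
  have SP: "S \<subseteq> perp"
  proof
    fix a assume a: "a \<in> S"
    have "gm_q D v0 a b = 0" if b: "b \<in> gm_W1 D" for b
      using q[OF v0(1) a z(2) z(1) b] 0 1 a b z W1W by auto
    then show "a \<in> perp" using a z by (auto simp: perp_def)
  qed
  show "S = perp"
  proof
    show "perp \<subseteq> S"
    proof
      fix w assume w: "w \<in> perp"
      then have "w \<in> S <+>\<^bsub>W\<^esub> gm_W1 D" using sum perpW by simp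
      then obtain a b where ab: "a \<in> S" "b \<in> gm_W1 D" "w = a \<oplus>\<^bsub>W\<^esub> b" by (auto simp: set_add_def')
      have aW: "a \<in> carrier W" "b \<in> carrier W" using ab z W1W by auto
      have "(- 1) \<odot>\<^bsub>W\<^esub> a \<oplus>\<^bsub>W\<^esub> w \<in> perp" using perp_sub w SP ab(1) by (auto simp: W.subspace_iff)
      moreover have "(- 1) \<odot>\<^bsub>W\<^esub> a \<oplus>\<^bsub>W\<^esub> w = b"
      proof -
        have "(- 1) \<odot>\<^bsub>W\<^esub> a \<oplus>\<^bsub>W\<^esub> w = (a \<oplus>\<^bsub>W\<^esub> (- 1) \<odot>\<^bsub>W\<^esub> a) \<oplus>\<^bsub>W\<^esub> b"
          unfolding ab(3) using aW by (simp only: W.ac W.addC W.smultC)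
        then show ?thesis using aW by simp
      qed
      ultimately have "b = \<zero>\<^bsub>W\<^esub>" using perp_inter ab(2) by simp
      then show "w \<in> S" using ab aW by simp
    qed
  qed (rule SP)
qed

lemma W0_eq: "gm_W0 D = perp"
  unfolding gm_W0_def splitting_iff by simp

abbreviation "W0m \<equiv> W\<lparr>carrier := perp\<rparr>"

lemma W0m: "kspace W0m"
  by (rule W.subspace_kspace[OF perp_sub])

lemma mu_W0: "lin W0m (ext_pow V U 2) mu" "inj_on mu (carrier W0m)"
proof -
  show 1: "lin W0m (ext_pow V U 2) mu"
    using lin_mu[OF l(1)] perpW W0m unfolding linear_map_iff by auto
  have "inj_on mu (carrier W0m)"
    by (rule linear_map_injI[OF 1]) (use perp_inter perpW in \<open>auto simp: W1_eq\<close>)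
  then show "inj_on mu (carrier W0m)" .
qed

lemma q_W0: "\<forall>w\<in>carrier W0m. functional W0m (gm_q D v0 w)"
  using functional_subspace[OF q_functional[OF v0(1)]] perpW by auto

lemma A_of_eq: "gm_A_of D v0 l = VH.graph_lag perp mu (gm_q D v0)"
proof -
  have "gm_eps D (wedge V \<xi> (mu w')) \<oplus>\<^bsub>LL\<^esub> c \<odot>\<^bsub>LL\<^esub> ll = \<zero>\<^bsub>LL\<^esub> \<longleftrightarrow> cf (wedge V \<xi> (mu w')) + c = 0"
    if "\<xi> \<in> ep 3" "w' \<in> perp" for \<xi> w' c
  proof -
    have "wedge V \<xi> (mu w') \<in> ep 5" using VH.wedge32[OF that(1) mu_closed[OF l(1) perpW[OF that(2)]]] .
    then have "gm_eps D (wedge V \<xi> (mu w')) \<oplus>\<^bsub>LL\<^esub> c \<odot>\<^bsub>LL\<^esub> ll = (cf (wedge V \<xi> (mu w')) + c) \<odot>\<^bsub>LL\<^esub> ll"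
      using eps_coef ll by (simp add: LL.add_smult)
    then show ?thesis using ll LL.smult_eq_0_iff by simp
  qed
  then show ?thesis
    unfolding gm_A_of_def VH.graph_lag_def W0_eq ext_pow_carrier by (intro Collect_cong) blast
qed

lemma A_of_lagrangian: "lagrangian (ext_pow V (carrier V) 3) (wedge V) \<zero>\<^bsub>ext_alg V\<^esub> (gm_A_of D v0 l)"
  unfolding A_of_eq
  using VH.graph_lag_lagrangian[OF W0m mu_W0 q_W0] q_sym[OF v0(1)] by simp

lemma lag_base_A: "VH.lag_base (gm_A_of D v0 l) = mu ` perp"
  unfolding A_of_eq using VH.lag_base_graph[OF W0m mu_W0 q_W0] by simp

end

text \<open>Passing from \<open>(v\<^sub>0, l)\<close> to \<open>(u + c v\<^sub>0, d l)\<close> replaces \<open>\<xi>\<close> by \<open>\<xi> + u \<and> \<mu>(dl \<otimes> w)\<close> and \<open>w\<close> by \<open>c d w\<close>;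
  the compatibility of \<open>q\<close> and \<open>\<mu>\<close> on \<open>V\<^sub>5\<close> makes the two conditions agree.\<close>

lemma gm_A_of_subset:
  assumes D: "is_gm_data D" and lci: "gm_lci D" and c1: "gm_choice D v0 l" and c2: "gm_choice D v1 l1"
  shows "gm_A_of D v1 l1 \<subseteq> gm_A_of D v0 l"
proof
  interpret A: gm_lci_chosen D l v0
    using assms by unfold_locales (auto simp: gm_choice_def)
  interpret B: gm_lci_chosen D l1 v1
    using assms by unfold_locales (auto simp: gm_choice_def)
  interpret X: kspace "ext_alg A.V" by (rule A.V.kspace_ext)
  obtain d where d: "l1 = d \<odot>\<^bsub>A.L\<^esub> l" using has_dim_1_span[OF A.gmD(4) A.l B.l(1)] by auto
  have d0: "d \<noteq> 0" using d B.l A.l by auto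
  obtain c u where u: "u \<in> A.U" "v1 = u \<oplus>\<^bsub>A.V\<^esub> c \<odot>\<^bsub>A.V\<^esub> v0" using A.decomp[OF B.v0(1)] .
  have uV: "u \<in> carrier A.V" using u A.UV by auto
  have W0: "A.perp = B.perp" using A.W0_eq B.W0_eq by simp
  have mu: "B.mu w = d \<odot>\<^bsub>ext_alg A.V\<^esub> A.mu w" if "w \<in> carrier A.W" for w
    using A.mu_smult_L[OF A.l(1) that, of d] linear_map_smult[OF A.lin_mu[OF A.l(1)] that, of d] d by simp
  have cf: "A.cf x = d * d * B.cf x" if "x \<in> A.ep 5" for x
  proof (rule A.coef_eqI)
    have "B.ll = d \<odot>\<^bsub>A.LL\<^esub> pure_tensor A.L A.L l (d \<odot>\<^bsub>A.L\<^esub> l)"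
      using tensor.pure_smult_left[OF tensorI[OF A.L.kspace_axioms A.L.kspace_axioms] A.l(1), of "d \<odot>\<^bsub>A.L\<^esub> l" d] A.l d by simp
    also have "pure_tensor A.L A.L l (d \<odot>\<^bsub>A.L\<^esub> l) = d \<odot>\<^bsub>A.LL\<^esub> A.ll"
      using tensor.pure_smult_right[OF tensorI[OF A.L.kspace_axioms A.L.kspace_axioms] A.l(1) A.l(1), of d] .
    finally have "B.ll = (d * d) \<odot>\<^bsub>A.LL\<^esub> A.ll" using A.ll by simp
    then show "gm_eps D x = (d * d * B.cf x) \<odot>\<^bsub>A.LL\<^esub> A.ll" using B.eps_coef[OF that] A.ll by (simp add: mult_ac)
  qed
  fix x assume "x \<in> gm_A_of D v1 l1"
  then obtain \<xi> w where x: "\<xi> \<in> A.ep 3" "w \<in> A.perp" "x = \<xi> \<oplus>\<^bsub>ext_alg A.V\<^esub> wedge A.V (ext_vec A.V v1) (B.mu w)"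
    "\<And>w'. w' \<in> A.perp \<Longrightarrow> B.cf (wedge A.V \<xi> (B.mu w')) + gm_q D v1 w w' = 0"
    unfolding B.A_of_eq B.VH.graph_lag_def W0 by blast
  have wW: "w \<in> carrier A.W" using x A.perpW by simp
  have m: "A.mu w' \<in> A.ep 2" if "w' \<in> carrier A.W" for w' using A.mu_closed[OF A.l(1) that] .
  let ?um = "wedge A.V (ext_vec A.V u) (B.mu w)"
  have um: "?um \<in> A.ep 3"
    using A.V.wedge_pow[OF A.UV A.V.ext_vec_pow[OF u(1)] A.mu_closed[OF B.l(1) wW]] by (simp add: numeral_3_eq_3)
  let ?w = "(c * d) \<odot>\<^bsub>A.W\<^esub> w"
  have wp: "?w \<in> A.perp" using A.perp_sub x(2) by (simp add: A.W.subspace_iff)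
  have muw: "A.mu ?w = (c * d) \<odot>\<^bsub>ext_alg A.V\<^esub> A.mu w"
    using linear_map_smult[OF A.lin_mu[OF A.l(1)] wW, of "c * d"] by simp
  have ev: "ext_vec A.V v1 = ext_vec A.V u \<oplus>\<^bsub>ext_alg A.V\<^esub> c \<odot>\<^bsub>ext_alg A.V\<^esub> ext_vec A.V v0"
    using linear_map_add[OF A.V.lin_ext_vec uV, of "c \<odot>\<^bsub>A.V\<^esub> v0"] linear_map_smult[OF A.V.lin_ext_vec A.v0(1)] u(2) A.v0 by simp
  have E: "\<xi> \<in> carrier (ext_alg A.V)" "A.mu w \<in> carrier (ext_alg A.V)" "ext_vec A.V u \<in> carrier (ext_alg A.V)"
    using A.VH.ep_E[OF x(1)] A.VH.ep_E[OF m[OF wW]] A.V.ext_vec_closed[OF uV] by auto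
  have "x = (\<xi> \<oplus>\<^bsub>ext_alg A.V\<^esub> ?um) \<oplus>\<^bsub>ext_alg A.V\<^esub> wedge A.V (ext_vec A.V v0) (A.mu ?w)"
    unfolding x(3) ev muw mu[OF wW] using E
    by (simp add: A.V.wedge_add_left A.V.wedge_smult_left A.V.wedge_smult_right X.assoc X.smult_add mult_ac)
  moreover have "(\<xi> \<oplus>\<^bsub>ext_alg A.V\<^esub> ?um) \<oplus>\<^bsub>ext_alg A.V\<^esub> wedge A.V (ext_vec A.V v0) (A.mu ?w) \<in> gm_A_of D v0 l"
    unfolding A.A_of_eq
  proof (rule A.VH.graph_lagI)
    show "\<xi> \<oplus>\<^bsub>ext_alg A.V\<^esub> ?um \<in> A.ep 3" using x um by simp
    show "?w \<in> A.perp" by (rule wp)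
    fix w' assume w': "w' \<in> A.perp"
    then have w'W: "w' \<in> carrier A.W" by (rule A.perpW)
    have 1: "A.cf (wedge A.V \<xi> (A.mu w')) = d * B.cf (wedge A.V \<xi> (B.mu w'))"
    proof -
      have "B.cf (wedge A.V \<xi> (B.mu w')) = d * B.cf (wedge A.V \<xi> (A.mu w'))"
        unfolding mu[OF w'W] by (rule B.VH.pair_smult_right[OF x(1) m[OF w'W]])
      then show ?thesis using cf[OF A.VH.wedge32[OF x(1) m[OF w'W]]] by simp
    qed
    have 2: "A.cf (wedge A.V ?um (A.mu w')) = d * gm_q D u w w'"
    proof -
      have e: "wedge A.V ?um (A.mu w') = d \<odot>\<^bsub>ext_alg A.V\<^esub> wedge A.V (ext_vec A.V u) (wedge A.V (A.mu w) (A.mu w'))"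
        unfolding mu[OF wW] using E m[OF w'W] by (simp add: A.V.wedge_smult_left A.V.wedge_smult_right A.V.wedge_assoc)
      have p: "wedge A.V (ext_vec A.V u) (wedge A.V (A.mu w) (A.mu w')) \<in> A.ep 5"
        using A.VH.wedge_ep[OF A.V.ext_vec_pow[OF u(1)] A.VH.wedge_ep[OF m[OF wW] m[OF w'W]]] by simp
      show ?thesis unfolding e A.VH.eps_smult[OF p] A.q_U[OF u(1) wW w'W] ..
    qed
    have 3: "gm_q D v1 w w' = gm_q D u w w' + c * gm_q D v0 w w'"
      unfolding u(2) using uV A.v0 by (simp add: A.q_add A.q_smult)
    have 4: "gm_q D v0 ?w w' = c * d * gm_q D v0 w w'" using A.v0(1) wW by (simp add: A.q_smult_left)
    \<comment> \<open>Replacing l by l1 = d l divides the coordinate of \<epsilon> by the square of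
      d and multiplies \<mu> by d; the left side is therefore d times the condition for (v1,
      l1).\<close>
    have "A.cf (wedge A.V (\<xi> \<oplus>\<^bsub>ext_alg A.V\<^esub> ?um) (A.mu w')) + gm_q D v0 ?w w'
       = d * (B.cf (wedge A.V \<xi> (B.mu w')) + gm_q D v1 w w')"
      unfolding A.VH.pair_add_left[OF x(1) um m[OF w'W]] 1 2 3 4 by (simp add: algebra_simps)
    then show "A.cf (wedge A.V (\<xi> \<oplus>\<^bsub>ext_alg A.V\<^esub> ?um) (A.mu w')) + gm_q D v0 ?w w' = 0" using x(4)[OF w'] by simp
  qed
  ultimately show "x \<in> gm_A_of D v0 l" by simp
qed

lemma gm_A_of_indep:
  "is_gm_data D \<Longrightarrow> gm_lci D \<Longrightarrow> gm_choice D v0 l \<Longrightarrow> gm_choice D v1 l1 \<Longrightarrow> gm_A_of D v1 l1 = gm_A_of D v0 l"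
  by (intro subset_antisym gm_A_of_subset)

lemma gm_choice_exists:
  assumes D: "is_gm_data D"
  shows "\<exists>v0 l. gm_choice D v0 l"
proof -
  interpret gm D by unfold_locales (rule D)
  have "\<exists>l\<in>carrier L. l \<noteq> \<zero>\<^bsub>L\<^esub>" using gmD(4) has_dim_1_iff[OF L.kspace_axioms] by auto
  moreover obtain v0 where "v0 \<in> carrier V" "v0 \<notin> U" using hyperplane_proper[OF gmD(3)] .
  ultimately show ?thesis by (auto simp: gm_choice_def)
qed

lemma gm_A_eq:
  assumes "is_gm_data D" "gm_lci D" "gm_choice D v0 l"
  shows "gm_A D = gm_A_of D v0 l"
proof -
  obtain v1 l1 where *: "(SOME (v0, l). gm_choice D v0 l) = (v1, l1)" by fastforce
  have "case (SOME (v0, l). gm_choice D v0 l) of (v0, l) \<Rightarrow> gm_choice D v0 l"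
    by (rule someI[of _ "(v0, l)"]) (use assms in simp)
  then have "gm_choice D v1 l1" unfolding * by simp
  then show ?thesis unfolding gm_A_def * using gm_A_of_indep[OF assms] by simp
qed

lemma gm_to_lag_data:
  assumes "is_gm_data D" "gm_lci D"
  shows "is_lag_data (gm_to_lag D)"
proof -
  obtain v0 l where c: "gm_choice D v0 l" using gm_choice_exists[OF assms(1)] by blast
  interpret gm_lci_chosen D l v0
    using assms c by unfold_locales (auto simp: gm_choice_def)
  show ?thesis using A_of_lagrangian gmD(2,3) gm_A_eq[OF assms c] by (simp add: is_lag_data_def gm_to_lag_def)
qed

section \<open>Groupoids of GM data and of Lagrangian data\<close>

lemma ext_map_inverse:
  assumes g: "lin_iso V V' g"
  shows "x \<in> carrier (ext_alg V) \<Longrightarrow> ext_map V (inv_into (carrier V) g) (ext_map V' g x) = x"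
    and "y \<in> carrier (ext_alg V') \<Longrightarrow> ext_map V' g (ext_map V (inv_into (carrier V) g) y) = y"
proof -
  note l = lin_iso_linear[OF g] lin_iso_linear[OF lin_iso_inv[OF g]]
  have k: "kspace V" "kspace V'" using l(1) by (auto intro: linear_map_dom linear_map_cod)
  have b: "inv_into (carrier V) g (g v) = v" if "v \<in> carrier V" for v
    using that lin_iso_bij[OF g] by (auto simp: bij_betw_def inv_into_f_f)
  have b': "g (inv_into (carrier V) g v) = v" if "v \<in> carrier V'" for v
    using that lin_iso_bij[OF g] by (auto simp: bij_betw_def f_inv_into_f)
  show "ext_map V (inv_into (carrier V) g) (ext_map V' g x) = x" if x: "x \<in> carrier (ext_alg V)"
    using ext_map_compose[OF l(1,2) _ x, of "\<lambda>v. v"] ext_map_ident[OF k(1) _ x, of "\<lambda>v. v"] b by simp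
  show "ext_map V' g (ext_map V (inv_into (carrier V) g) y) = y" if y: "y \<in> carrier (ext_alg V')"
    using ext_map_compose[OF l(2,1) _ y, of "\<lambda>v. v"] ext_map_ident[OF k(2) _ y, of "\<lambda>v. v"] b' by simp
qed

text \<open>Morphisms are cut off outside the carriers, so maps that agree on the carrier must
  induce the same map on the exterior algebra, although \<open>pushforward\<close> takes the
  function as a whole.\<close>

lemma ext_map_cong:
  assumes g: "lin V V' g" and "\<And>v. v \<in> carrier V \<Longrightarrow> h v = g v" and x: "x \<in> carrier (ext_alg V)"
  shows "ext_map V' h x = ext_map V' g x"
  using ext_map_compose[OF g lin_iso_linear[OF lin_iso_ident[OF linear_map_cod[OF g]]] assms(2) x]
    ext_map_ident[OF linear_map_cod[OF g] _ linear_map_closed[OF lin_ext_map[OF g] x], of "\<lambda>x. x"] by simp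

text \<open>\<open>gm_iso\<close> with the conditions on \<epsilon> and \<mu> tested at one
  generator l of L. Extensionality is left out, so composites and inverses are ordinary functions
  and are cut off only at the end, by \<open>gm_scalar_iso_cong\<close>.\<close>

definition gm_scalar_iso :: "('k::field, 'w, 'v, 'l) gm_data \<Rightarrow> ('k, 'w, 'v, 'l) gm_data \<Rightarrow> 'l
    \<Rightarrow> ('w \<Rightarrow> 'w) \<Rightarrow> ('v \<Rightarrow> 'v) \<Rightarrow> ('l \<Rightarrow> 'l) \<Rightarrow> bool" where
  "gm_scalar_iso D D' l f g h \<longleftrightarrow>
     lin_iso (gm_W D) (gm_W D') f \<and> lin_iso (gm_V6 D) (gm_V6 D') g \<and> lin_iso (gm_L D) (gm_L D') h
   \<and> g ` gm_V5 D = gm_V5 D'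
   \<and> (\<forall>x\<in>ext_part (gm_V6 D) (words (gm_V5 D) 5). gm_coef D' (h l) (ext_map (gm_V6 D') g x) = gm_coef D l x)
   \<and> (\<forall>v\<in>carrier (gm_V6 D). \<forall>w\<in>carrier (gm_W D). \<forall>w'\<in>carrier (gm_W D).
        gm_q D' (g v) (f w) (f w') = gm_q D v w w')
   \<and> (\<forall>w\<in>carrier (gm_W D). ext_map (gm_V6 D') g (gm_mu_pure D l w) = gm_mu_pure D' (h l) (f w))"

lemma lin_iso_nonzero:
  assumes h: "lin_iso L L' h" and l: "l \<in> carrier L" "l \<noteq> \<zero>\<^bsub>L\<^esub>"
  shows "h l \<in> carrier L'" "h l \<noteq> \<zero>\<^bsub>L'\<^esub>"
proof -
  show "h l \<in> carrier L'" using linear_map_closed[OF lin_iso_linear[OF h] l(1)] .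
  show "h l \<noteq> \<zero>\<^bsub>L'\<^esub>"
    using lin_iso_bij[OF h] l linear_map_zero[OF lin_iso_linear[OF h]]
      kspace.zeroC[OF linear_map_dom[OF lin_iso_linear[OF h]]]
    unfolding bij_betw_def inj_on_def by metis
qed

text \<open>The map h \<otimes> h sends l \<otimes> l to h l \<otimes> h l, so compatibility with
  \<epsilon> is equality of the two coordinates; and every element of L \<otimes> W is some l
  \<otimes> w, so compatibility with \<mu> can be tested at l.\<close>

lemma gm_iso_iff:
  assumes D: "is_gm_data D" and D': "is_gm_data D'" and l: "l \<in> carrier (gm_L D)" "l \<noteq> \<zero>\<^bsub>gm_L D\<^esub>"
  shows "(f, g, h) \<in> gm_iso D D' \<longleftrightarrow> f \<in> extensional (carrier (gm_W D)) \<and> g \<in> extensional (carrier (gm_V6 D))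
    \<and> h \<in> extensional (carrier (gm_L D)) \<and> gm_scalar_iso D D' l f g h"
proof (cases "lin_iso (gm_W D) (gm_W D') f \<and> lin_iso (gm_V6 D) (gm_V6 D') g \<and> lin_iso (gm_L D) (gm_L D') h
    \<and> g ` gm_V5 D = gm_V5 D'")
  case True
  then have f: "lin_iso (gm_W D) (gm_W D') f" and g: "lin_iso (gm_V6 D) (gm_V6 D') g" and h: "lin_iso (gm_L D) (gm_L D') h"
    and gU: "g ` gm_V5 D = gm_V5 D'" by auto
  interpret A: gm_line D l using D l by unfold_locales
  interpret B: gm_line D' "h l" using D' lin_iso_nonzero[OF h l] by unfold_locales
  have e: "(\<forall>x\<in>carrier (ext_pow A.V A.U 5). gm_eps D' (ext_map B.V g x) = tensor_map B.L B.L h h (gm_eps D x))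
    \<longleftrightarrow> (\<forall>x\<in>A.ep 5. B.cf (ext_map B.V g x) = A.cf x)"
    unfolding ext_pow_carrier
  proof (rule ball_cong[OF refl])
    fix x assume x: "x \<in> A.ep 5"
    have y: "ext_map B.V g x \<in> B.ep 5" using ext_map_pow[OF lin_iso_linear[OF g] A.UV x] gU by simp
    have "gm_eps D x = pure_tensor A.L A.L l (A.cf x \<odot>\<^bsub>A.L\<^esub> l)"
      using A.eps_coef[OF x] linear_map_smult[OF lin_iso_linear[OF A.LL_iso] l(1)] by simp
    then have "tensor_map B.L B.L h h (gm_eps D x) = pure_tensor B.L B.L (h l) (h (A.cf x \<odot>\<^bsub>A.L\<^esub> l))"
      using tensor_map_pure[OF lin_iso_linear[OF h] lin_iso_linear[OF h] l(1), of "A.cf x \<odot>\<^bsub>A.L\<^esub> l"] l by simp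
    also have "\<dots> = A.cf x \<odot>\<^bsub>B.LL\<^esub> B.ll"
      using linear_map_smult[OF lin_iso_linear[OF h] l(1)] linear_map_smult[OF lin_iso_linear[OF B.LL_iso] B.l(1)] by simp
    finally show "(gm_eps D' (ext_map B.V g x) = tensor_map B.L B.L h h (gm_eps D x)) = (B.cf (ext_map B.V g x) = A.cf x)"
      using B.eps_coef[OF y] B.ll_cancel by simp
  qed
  obtain d where W: "has_dim A.W d" using A.gmD(1) by blast
  note p = lin_iso_bij[OF pure_iso[OF A.gmD(4) l W]]
  have c: "carrier (tensor_vs A.L A.W) = pure_tensor A.L A.W l ` carrier A.W" using p by (simp add: bij_betw_def)
  have m: "(\<forall>x\<in>carrier (tensor_vs A.L A.W). ext_map B.V g (gm_mu D x) = gm_mu D' (tensor_map B.L B.W h f x))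
    \<longleftrightarrow> (\<forall>w\<in>carrier A.W. ext_map B.V g (A.mu w) = B.mu (f w))"
    unfolding c using tensor_map_pure[OF lin_iso_linear[OF h] lin_iso_linear[OF f] l(1)]
    by (simp add: gm_mu_pure_def)
  show ?thesis unfolding gm_iso_def gm_scalar_iso_def using True e m by auto
next
  case False
  then show ?thesis unfolding gm_iso_def gm_scalar_iso_def by auto
qed

lemma gm_scalar_iso_cong:
  assumes D: "is_gm_data D" and s: "gm_scalar_iso D D' l f g h" and l: "l \<in> carrier (gm_L D)"
    and f: "\<And>x. x \<in> carrier (gm_W D) \<Longrightarrow> f' x = f x" and g: "\<And>x. x \<in> carrier (gm_V6 D) \<Longrightarrow> g' x = g x"
    and h: "\<And>x. x \<in> carrier (gm_L D) \<Longrightarrow> h' x = h x"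
  shows "gm_scalar_iso D D' l f' g' h'"
proof -
  interpret gm D by unfold_locales (rule D)
  have gl: "lin V (gm_V6 D') g" using s by (simp add: gm_scalar_iso_def lin_iso_linear)
  have e: "ext_map (gm_V6 D') g' x = ext_map (gm_V6 D') g x" if "x \<in> carrier (ext_alg V)" for x
    using ext_map_cong[OF gl g that] .
  have "g' ` U = g ` U" using g UV by (intro image_cong) auto
  moreover have "lin_iso W (gm_W D') f'" "lin_iso V (gm_V6 D') g'" "lin_iso L (gm_L D') h'"
    using s f g h lin_iso_cong[of W "gm_W D'" f f'] lin_iso_cong[of V "gm_V6 D'" g g'] lin_iso_cong[of L "gm_L D'" h h']
    by (auto simp: gm_scalar_iso_def)
  ultimately show ?thesis
    using s unfolding gm_scalar_iso_def
    by (simp add: f g h l e V.pow_closed[OF UV] V.pow_closed[OF UV mu_closed])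
qed

lemma gm_scalar_iso_ident:
  assumes D: "is_gm_data D" and l: "l \<in> carrier (gm_L D)"
  shows "gm_scalar_iso D D l (\<lambda>x. x) (\<lambda>x. x) (\<lambda>x. x)"
proof -
  interpret gm D by unfold_locales (rule D)
  have e: "ext_map V (\<lambda>x. x) x = x" if "x \<in> carrier (ext_alg V)" for x
    using ext_map_ident[OF V.kspace_axioms _ that, of "\<lambda>x. x"] by simp
  show ?thesis unfolding gm_scalar_iso_def
    by (simp add: lin_iso_ident W.kspace_axioms V.kspace_axioms L.kspace_axioms e V.pow_closed[OF UV] V.pow_closed[OF UV mu_closed] l)
qed

lemma gm_scalar_iso_compose:
  assumes D: "is_gm_data D" and l: "l \<in> carrier (gm_L D)"
    and s: "gm_scalar_iso D D' l f g h" and s': "gm_scalar_iso D' D'' (h l) f' g' h'"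
  shows "gm_scalar_iso D D'' l (\<lambda>x. f' (f x)) (\<lambda>x. g' (g x)) (\<lambda>x. h' (h x))"
proof -
  interpret gm D by unfold_locales (rule D)
  note S = s[unfolded gm_scalar_iso_def] and S' = s'[unfolded gm_scalar_iso_def]
  have gl: "lin V (gm_V6 D') g" "lin (gm_V6 D') (gm_V6 D'') g'" "lin W (gm_W D') f" using S S' by (auto simp: lin_iso_linear)
  have e: "ext_map (gm_V6 D'') (\<lambda>x. g' (g x)) x = ext_map (gm_V6 D'') g' (ext_map (gm_V6 D') g x)" if "x \<in> carrier (ext_alg V)" for x
    by (rule ext_map_compose[OF gl(1,2) _ that]) simp
  have p: "ext_map (gm_V6 D') g x \<in> ext_part (gm_V6 D') (words (gm_V5 D') 5)" if "x \<in> ep 5" for x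
    using ext_map_pow[OF gl(1) UV that] S by simp
  have c: "g v \<in> carrier (gm_V6 D')" if "v \<in> carrier V" for v using linear_map_closed[OF gl(1) that] .
  have c': "f v \<in> carrier (gm_W D')" if "v \<in> carrier W" for v using linear_map_closed[OF gl(3) that] .
  have "(\<lambda>x. g' (g x)) ` U = gm_V5 D''" using S S' by (metis image_image)
  then show ?thesis
    using S S' unfolding gm_scalar_iso_def
    by (auto simp: e p c c' V.pow_closed[OF UV] V.pow_closed[OF UV mu_closed] l
        intro: lin_iso_compose[of W "gm_W D'"] lin_iso_compose[of V "gm_V6 D'"] lin_iso_compose[of L "gm_L D'"])
qed

lemma gm_scalar_iso_inverse:
  assumes D: "is_gm_data D" and D': "is_gm_data D'" and l: "l \<in> carrier (gm_L D)"
    and s: "gm_scalar_iso D D' l f g h"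
  shows "gm_scalar_iso D' D (h l) (inv_into (carrier (gm_W D)) f) (inv_into (carrier (gm_V6 D)) g) (inv_into (carrier (gm_L D)) h)"
proof -
  interpret gm D by unfold_locales (rule D)
  interpret B: gm D' by unfold_locales (rule D')
  note S = s[unfolded gm_scalar_iso_def]
  have fi: "lin_iso W B.W f" "lin_iso V B.V g" "lin_iso L B.L h" using S by auto
  let ?f = "inv_into (carrier W) f" and ?g = "inv_into (carrier V) g" and ?h = "inv_into (carrier L) h"
  have b: "?f w' \<in> carrier W \<and> f (?f w') = w'" if "w' \<in> carrier B.W" for w'
    using that lin_iso_bij[OF fi(1)] by (metis bij_betw_def f_inv_into_f inv_into_into)
  have bg: "?g v' \<in> carrier V \<and> g (?g v') = v'" if "v' \<in> carrier B.V" for v'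
    using that lin_iso_bij[OF fi(2)] by (metis bij_betw_def f_inv_into_f inv_into_into)
  have bh: "?h (h l) = l" using lin_iso_bij[OF fi(3)] l by (auto simp: bij_betw_def inv_into_f_f)
  have gU: "?g ` B.U = U"
    using S UV lin_iso_bij[OF fi(2)] by (metis bij_betw_def inv_into_image_cancel)
  have E: "ext_map V ?g x' \<in> ep 5" "ext_map B.V g (ext_map V ?g x') = x'" if "x' \<in> B.ep 5" for x'
    using ext_map_pow[OF lin_iso_linear[OF lin_iso_inv[OF fi(2)]] B.UV that] gU
      ext_map_inverse(2)[OF fi(2) B.V.pow_closed[OF B.UV that]] by auto
  have hl: "h l \<in> carrier B.L" using linear_map_closed[OF lin_iso_linear[OF fi(3)] l] .
  have M: "ext_map V ?g (gm_mu_pure D' (h l) w') = gm_mu_pure D l (?f w')" if w': "w' \<in> carrier B.W" for w'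
  proof -
    have "gm_mu_pure D' (h l) w' = ext_map B.V g (gm_mu_pure D l (?f w'))" using S b[OF w'] by simp
    then show ?thesis
      using ext_map_inverse(1)[OF fi(2) V.pow_closed[OF UV mu_closed[OF l]]] b[OF w'] by simp
  qed
  show ?thesis
    unfolding gm_scalar_iso_def
  proof (intro conjI ballI)
    show "lin_iso B.W W ?f" "lin_iso B.V V ?g" "lin_iso B.L L ?h" by (rule lin_iso_inv fi)+
    show "?g ` B.U = U" by (rule gU)
    fix x' assume "x' \<in> B.ep 5"
    then show "gm_coef D (?h (h l)) (ext_map V ?g x') = gm_coef D' (h l) x'"
      using S E unfolding bh by metis
  next
    fix v w w' assume "v \<in> carrier B.V" "w \<in> carrier B.W" "w' \<in> carrier B.W"
    then show "gm_q D (?g v) (?f w) (?f w') = gm_q D' v w w'" using S b bg by metis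
  next
    fix w' assume "w' \<in> carrier B.W"
    then show "ext_map V ?g (gm_mu_pure D' (h l) w') = gm_mu_pure D (?h (h l)) (?f w')" using M bh by simp
  qed
qed

section \<open>GM data form a groupoid\<close>

lemma compose_ident: "f \<in> extensional A \<Longrightarrow> compose A f (\<lambda>x\<in>A. x) = f"
  "f \<in> extensional A \<Longrightarrow> f ` A \<subseteq> B \<Longrightarrow> compose A (\<lambda>x\<in>B. x) f = f"
  by (auto simp: compose_def extensional_def fun_eq_iff)

lemma lin_iso_image: "lin_iso V W f \<Longrightarrow> f ` carrier V = carrier W"
  by (simp add: lin_iso_def bij_betw_def)

lemma compose_inverse:
  assumes "bij_betw f A B"
  shows "compose A (restrict (inv_into A f) B) f = (\<lambda>x\<in>A. x)" "compose B f (restrict (inv_into A f) B) = (\<lambda>x\<in>B. x)"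
  using assms by (auto simp: compose_def fun_eq_iff bij_betw_def f_inv_into_f)

lemma gm_isoD:
  assumes "(f, g, h) \<in> gm_iso D D'"
  shows "lin_iso (gm_W D) (gm_W D') f" "lin_iso (gm_V6 D) (gm_V6 D') g" "lin_iso (gm_L D) (gm_L D') h"
    "f \<in> extensional (carrier (gm_W D))" "g \<in> extensional (carrier (gm_V6 D))" "h \<in> extensional (carrier (gm_L D))"
  using assms by (auto simp: gm_iso_def)

lemma gm_groupoid_groupoid: "groupoid (gm_groupoid P)"
proof
  fix X assume "X \<in> gpd_obj (gm_groupoid P)"
  then have X: "is_gm_data X" by (simp add: gm_groupoid_def)
  obtain v0 l where "gm_choice X v0 l" using gm_choice_exists[OF X] by blast
  then have l: "l \<in> carrier (gm_L X)" "l \<noteq> \<zero>\<^bsub>gm_L X\<^esub>" by (auto simp: gm_choice_def)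
  have "gm_scalar_iso X X l (id_on (gm_W X)) (id_on (gm_V6 X)) (id_on (gm_L X))"
    by (rule gm_scalar_iso_cong[OF X gm_scalar_iso_ident[OF X l(1)] l(1)]) (auto simp: id_on_def)
  then show "gpd_id (gm_groupoid P) X \<in> gpd_hom (gm_groupoid P) X X"
    using gm_iso_iff[OF X X l] by (simp add: gm_groupoid_def id_on_def)
next
  fix X Y Z a b
  assume *: "X \<in> gpd_obj (gm_groupoid P)" "Y \<in> gpd_obj (gm_groupoid P)" "Z \<in> gpd_obj (gm_groupoid P)"
    "a \<in> gpd_hom (gm_groupoid P) X Y" "b \<in> gpd_hom (gm_groupoid P) Y Z"
  then have X: "is_gm_data X" and Y: "is_gm_data Y" and Z: "is_gm_data Z" by (auto simp: gm_groupoid_def)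
  obtain f g h where a: "a = (f, g, h)" by (cases a)
  obtain f' g' h' where b: "b = (f', g', h')" by (cases b)
  obtain v0 l where "gm_choice X v0 l" using gm_choice_exists[OF X] by blast
  then have l: "l \<in> carrier (gm_L X)" "l \<noteq> \<zero>\<^bsub>gm_L X\<^esub>" by (auto simp: gm_choice_def)
  have s: "gm_scalar_iso X Y l f g h" using * a gm_iso_iff[OF X Y l] by (simp add: gm_groupoid_def)
  then have h: "lin_iso (gm_L X) (gm_L Y) h" by (simp add: gm_scalar_iso_def)
  have s': "gm_scalar_iso Y Z (h l) f' g' h'" using * b gm_iso_iff[OF Y Z lin_iso_nonzero[OF h l]] by (simp add: gm_groupoid_def)
  have "gm_scalar_iso X Z l (compose (carrier (gm_W X)) f' f) (compose (carrier (gm_V6 X)) g' g) (compose (carrier (gm_L X)) h' h)"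
    by (rule gm_scalar_iso_cong[OF X gm_scalar_iso_compose[OF X l(1) s s'] l(1)]) (auto simp: compose_def)
  then show "gpd_comp (gm_groupoid P) X Y Z b a \<in> gpd_hom (gm_groupoid P) X Z"
    using gm_iso_iff[OF X Z l] by (simp add: gm_groupoid_def a b)
next
  fix X Y a
  assume *: "X \<in> gpd_obj (gm_groupoid P)" "Y \<in> gpd_obj (gm_groupoid P)" "a \<in> gpd_hom (gm_groupoid P) X Y"
  obtain f g h where a: "a = (f, g, h)" by (cases a)
  with * have "(f, g, h) \<in> gm_iso X Y" by (simp add: gm_groupoid_def)
  note i = gm_isoD[OF this]
  show "gpd_comp (gm_groupoid P) X X Y a (gpd_id (gm_groupoid P) X) = a"
    "gpd_comp (gm_groupoid P) X Y Y (gpd_id (gm_groupoid P) Y) a = a"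
    using i lin_iso_image[OF i(1)] lin_iso_image[OF i(2)] lin_iso_image[OF i(3)]
    by (simp_all add: gm_groupoid_def a id_on_def compose_ident)
next
  fix X Y Z T a b c
  assume *: "X \<in> gpd_obj (gm_groupoid P)" "Y \<in> gpd_obj (gm_groupoid P)" "Z \<in> gpd_obj (gm_groupoid P)" "T \<in> gpd_obj (gm_groupoid P)"
    "a \<in> gpd_hom (gm_groupoid P) X Y" "b \<in> gpd_hom (gm_groupoid P) Y Z" "c \<in> gpd_hom (gm_groupoid P) Z T"
  obtain f g h where a: "a = (f, g, h)" by (cases a)
  with * have "(f, g, h) \<in> gm_iso X Y" by (simp add: gm_groupoid_def)
  note i = gm_isoD[OF this]
  have "f x \<in> carrier (gm_W Y)" if "x \<in> carrier (gm_W X)" for x using lin_iso_image[OF i(1)] that by auto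
  moreover have "g x \<in> carrier (gm_V6 Y)" if "x \<in> carrier (gm_V6 X)" for x using lin_iso_image[OF i(2)] that by auto
  moreover have "h x \<in> carrier (gm_L Y)" if "x \<in> carrier (gm_L X)" for x using lin_iso_image[OF i(3)] that by auto
  ultimately show "gpd_comp (gm_groupoid P) X Z T c (gpd_comp (gm_groupoid P) X Y Z b a)
      = gpd_comp (gm_groupoid P) X Y T (gpd_comp (gm_groupoid P) Y Z T c b) a"
    by (cases b, cases c) (auto simp: gm_groupoid_def a compose_def fun_eq_iff)
next
  fix X Y a
  assume *: "X \<in> gpd_obj (gm_groupoid P)" "Y \<in> gpd_obj (gm_groupoid P)" "a \<in> gpd_hom (gm_groupoid P) X Y"
  then have X: "is_gm_data X" and Y: "is_gm_data Y" by (auto simp: gm_groupoid_def)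
  obtain f g h where a: "a = (f, g, h)" by (cases a)
  with * have m: "(f, g, h) \<in> gm_iso X Y" by (simp add: gm_groupoid_def)
  note i = gm_isoD[OF m]
  obtain v0 l where "gm_choice X v0 l" using gm_choice_exists[OF X] by blast
  then have l: "l \<in> carrier (gm_L X)" "l \<noteq> \<zero>\<^bsub>gm_L X\<^esub>" by (auto simp: gm_choice_def)
  have s: "gm_scalar_iso X Y l f g h" using m gm_iso_iff[OF X Y l] by simp
  let ?f = "restrict (inv_into (carrier (gm_W X)) f) (carrier (gm_W Y))"
  let ?g = "restrict (inv_into (carrier (gm_V6 X)) g) (carrier (gm_V6 Y))"
  let ?h = "restrict (inv_into (carrier (gm_L X)) h) (carrier (gm_L Y))"
  note hl = lin_iso_nonzero[OF i(3) l]
  have "gm_scalar_iso Y X (h l) ?f ?g ?h"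
    by (rule gm_scalar_iso_cong[OF Y gm_scalar_iso_inverse[OF X Y l(1) s] hl(1)]) auto
  then have "(?f, ?g, ?h) \<in> gm_iso Y X" using gm_iso_iff[OF Y X hl] by simp
  then show "\<exists>b\<in>gpd_hom (gm_groupoid P) Y X. gpd_comp (gm_groupoid P) X Y X b a = gpd_id (gm_groupoid P) X
      \<and> gpd_comp (gm_groupoid P) Y X Y a b = gpd_id (gm_groupoid P) Y"
    by (intro bexI[of _ "(?f, ?g, ?h)"])
      (simp_all add: gm_groupoid_def a id_on_def compose_inverse lin_iso_bij[OF i(1)] lin_iso_bij[OF i(2)] lin_iso_bij[OF i(3)])
qed

section \<open>Lagrangian data form a groupoid\<close>

lemma lag_A_ext:
  assumes "is_lag_data \<Lambda>" "x \<in> lag_A \<Lambda>"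
  shows "x \<in> ext_part (lag_V6 \<Lambda>) (words (carrier (lag_V6 \<Lambda>)) 3)" "x \<in> carrier (ext_alg (lag_V6 \<Lambda>))"
proof -
  have k: "kspace (lag_V6 \<Lambda>)" using assms has_dim_kspace by (auto simp: is_lag_data_def)
  show "x \<in> ext_part (lag_V6 \<Lambda>) (words (carrier (lag_V6 \<Lambda>)) 3)"
    using assms unfolding is_lag_data_def lagrangian_def by (auto simp: ext_pow_carrier)
  then show "x \<in> carrier (ext_alg (lag_V6 \<Lambda>))" using kspace.pow_closed[OF k subset_refl] by blast
qed

lemma lag_iso_iff:
  "g \<in> lag_iso \<Lambda> \<Lambda>' \<longleftrightarrow> g \<in> extensional (carrier (lag_V6 \<Lambda>)) \<and> lin_iso (lag_V6 \<Lambda>) (lag_V6 \<Lambda>') g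
     \<and> g ` lag_V5 \<Lambda> = lag_V5 \<Lambda>' \<and> ext_map (lag_V6 \<Lambda>') g ` lag_A \<Lambda> = lag_A \<Lambda>'"
  by (auto simp: lag_iso_def)

lemma hyperplane_subset: "hyperplane U V \<Longrightarrow> kspace V \<Longrightarrow> U \<subseteq> carrier V"
  by (simp add: hyperplane_def kspace.subspace_iff)

lemma lag_data_basics:
  assumes "is_lag_data \<Lambda>"
  shows "kspace (lag_V6 \<Lambda>)" "lag_V5 \<Lambda> \<subseteq> carrier (lag_V6 \<Lambda>)"
  using assms has_dim_kspace hyperplane_subset unfolding is_lag_data_def by blast+

lemma lag_iso_cong:
  assumes X: "is_lag_data X" and g: "lin_iso (lag_V6 X) (lag_V6 Y) g" "g ` lag_V5 X = lag_V5 Y" "ext_map (lag_V6 Y) g ` lag_A X = lag_A Y"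
    and g': "\<And>x. x \<in> carrier (lag_V6 X) \<Longrightarrow> g' x = g x" "g' \<in> extensional (carrier (lag_V6 X))"
  shows "g' \<in> lag_iso X Y"
proof -
  note b = lag_data_basics[OF X]
  have "g' ` lag_V5 X = g ` lag_V5 X" using g'(1) b by (intro image_cong) auto
  moreover have "ext_map (lag_V6 Y) g' ` lag_A X = ext_map (lag_V6 Y) g ` lag_A X"
    using ext_map_cong[OF lin_iso_linear[OF g(1)] g'(1)] lag_A_ext(2)[OF X] by (intro image_cong) auto
  moreover have "lin_iso (lag_V6 X) (lag_V6 Y) g'" by (rule lin_iso_cong[OF g(1)]) (simp add: g')
  ultimately show ?thesis using g g' by (simp add: lag_iso_iff)
qed

lemma lag_iso_id:
  assumes X: "is_lag_data X"
  shows "id_on (lag_V6 X) \<in> lag_iso X X"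
proof (rule lag_iso_cong[OF X, of X "\<lambda>x. x"])
  note b = lag_data_basics[OF X]
  show "lin_iso (lag_V6 X) (lag_V6 X) (\<lambda>x. x)" by (rule lin_iso_ident[OF b(1)])
  have "ext_map (lag_V6 X) (\<lambda>x. x) x = x" if "x \<in> lag_A X" for x
    by (rule ext_map_ident[OF b(1) _ lag_A_ext(2)[OF X that]]) simp
  then show "ext_map (lag_V6 X) (\<lambda>x. x) ` lag_A X = lag_A X" by simp
qed (auto simp: id_on_def)

lemma lag_iso_compose:
  assumes X: "is_lag_data X" and a: "a \<in> lag_iso X Y" and b: "b \<in> lag_iso Y Z"
  shows "compose (carrier (lag_V6 X)) b a \<in> lag_iso X Z"
proof (rule lag_iso_cong[OF X, of Z "\<lambda>x. b (a x)"])
  note A = a[unfolded lag_iso_iff] and B = b[unfolded lag_iso_iff]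
  show "lin_iso (lag_V6 X) (lag_V6 Z) (\<lambda>x. b (a x))" using lin_iso_compose[of "lag_V6 X" "lag_V6 Y" a "lag_V6 Z" b] A B by simp
  have "(\<lambda>x. b (a x)) ` lag_V5 X = b ` (a ` lag_V5 X)" by (simp add: image_image)
  then show "(\<lambda>x. b (a x)) ` lag_V5 X = lag_V5 Z" using A B by simp
  have "ext_map (lag_V6 Z) (\<lambda>x. b (a x)) x = ext_map (lag_V6 Z) b (ext_map (lag_V6 Y) a x)" if "x \<in> lag_A X" for x
    using A B lag_A_ext(2)[OF X that] by (intro ext_map_compose[OF _ _ refl]) (auto simp: lin_iso_linear)
  then have "ext_map (lag_V6 Z) (\<lambda>x. b (a x)) ` lag_A X = ext_map (lag_V6 Z) b ` ext_map (lag_V6 Y) a ` lag_A X"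
    by (simp add: image_image)
  then show "ext_map (lag_V6 Z) (\<lambda>x. b (a x)) ` lag_A X = lag_A Z" using A B by simp
qed (auto simp: compose_def)

lemma lag_iso_inverse:
  assumes X: "is_lag_data X" and Y: "is_lag_data Y" and a: "a \<in> lag_iso X Y"
  shows "restrict (inv_into (carrier (lag_V6 X)) a) (carrier (lag_V6 Y)) \<in> lag_iso Y X"
proof (rule lag_iso_cong[OF Y, of X "inv_into (carrier (lag_V6 X)) a"])
  note A = a[unfolded lag_iso_iff]
  then have i: "lin_iso (lag_V6 X) (lag_V6 Y) a" by simp
  show "lin_iso (lag_V6 Y) (lag_V6 X) (inv_into (carrier (lag_V6 X)) a)" by (rule lin_iso_inv[OF i])
  show "inv_into (carrier (lag_V6 X)) a ` lag_V5 Y = lag_V5 X"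
    using A lin_iso_bij[OF i] lag_data_basics(2)[OF X] by (metis bij_betw_def inv_into_image_cancel)
  have "ext_map (lag_V6 X) (inv_into (carrier (lag_V6 X)) a) ` ext_map (lag_V6 Y) a ` lag_A X = lag_A X"
    using ext_map_inverse(1)[OF i] lag_A_ext(2)[OF X] by (simp add: image_image)
  then show "ext_map (lag_V6 X) (inv_into (carrier (lag_V6 X)) a) ` lag_A Y = lag_A X" using A by simp
qed auto

lemma lag_groupoid_groupoid: "groupoid lag_groupoid"
proof
  fix X assume "X \<in> gpd_obj lag_groupoid"
  then show "gpd_id lag_groupoid X \<in> gpd_hom lag_groupoid X X" by (simp add: lag_groupoid_def lag_iso_id)
next
  fix X Y Z a b
  assume "X \<in> gpd_obj lag_groupoid" "a \<in> gpd_hom lag_groupoid X Y" "b \<in> gpd_hom lag_groupoid Y Z"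
  then show "gpd_comp lag_groupoid X Y Z b a \<in> gpd_hom lag_groupoid X Z" by (simp add: lag_groupoid_def lag_iso_compose)
next
  fix X Y a
  assume "a \<in> gpd_hom lag_groupoid X Y"
  then have a: "a \<in> extensional (carrier (lag_V6 X))" "lin_iso (lag_V6 X) (lag_V6 Y) a" by (auto simp: lag_groupoid_def lag_iso_iff)
  then show "gpd_comp lag_groupoid X X Y a (gpd_id lag_groupoid X) = a"
    "gpd_comp lag_groupoid X Y Y (gpd_id lag_groupoid Y) a = a"
    using lin_iso_image[OF a(2)] by (simp_all add: lag_groupoid_def id_on_def compose_ident)
next
  fix X Y Z T a b c
  assume "a \<in> gpd_hom lag_groupoid X Y"
  then have "lin_iso (lag_V6 X) (lag_V6 Y) a" by (auto simp: lag_groupoid_def lag_iso_iff)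
  then have "a x \<in> carrier (lag_V6 Y)" if "x \<in> carrier (lag_V6 X)" for x using lin_iso_image that by blast
  then show "gpd_comp lag_groupoid X Z T c (gpd_comp lag_groupoid X Y Z b a)
      = gpd_comp lag_groupoid X Y T (gpd_comp lag_groupoid Y Z T c b) a"
    by (auto simp: lag_groupoid_def compose_def fun_eq_iff)
next
  fix X Y a
  assume *: "X \<in> gpd_obj lag_groupoid" "Y \<in> gpd_obj lag_groupoid" "a \<in> gpd_hom lag_groupoid X Y"
  then have i: "lin_iso (lag_V6 X) (lag_V6 Y) a" by (auto simp: lag_groupoid_def lag_iso_iff)
  show "\<exists>b\<in>gpd_hom lag_groupoid Y X. gpd_comp lag_groupoid X Y X b a = gpd_id lag_groupoid X
      \<and> gpd_comp lag_groupoid Y X Y a b = gpd_id lag_groupoid Y"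
    using * by (intro bexI[of _ "restrict (inv_into (carrier (lag_V6 X)) a) (carrier (lag_V6 Y))"])
      (simp_all add: lag_groupoid_def id_on_def compose_inverse lin_iso_bij[OF i] lag_iso_inverse)
qed

text \<open>An isomorphism matches the kernels of \<mu>, hence their orthogonals
  \<open>perp\<close>, and carries every ingredient of the graph to the corresponding one. The image
  is described with the transported choice \<open>g v0\<close> and \<open>h l\<close>, which is
  admissible because g is injective and maps V5 onto the other hyperplane.\<close>

lemma gm_iso_A_subset:
  assumes D: "is_gm_data D" "gm_lci D" and D': "is_gm_data D'" "gm_lci D'" and c: "gm_choice D v0 l"
    and s: "gm_scalar_iso D D' l f g h"
  shows "ext_map (gm_V6 D') g ` gm_A_of D v0 l \<subseteq> gm_A_of D' (g v0) (h l)" "gm_choice D' (g v0) (h l)"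
proof -
  interpret A: gm_lci_chosen D l v0 using D c by unfold_locales (auto simp: gm_choice_def)
  note S = s[unfolded gm_scalar_iso_def]
  have fi: "lin_iso A.W (gm_W D') f" "lin_iso A.V (gm_V6 D') g" "lin_iso A.L (gm_L D') h" using S by auto
  have gv0: "g v0 \<in> carrier (gm_V6 D')" "g v0 \<notin> gm_V5 D'"
  proof -
    show "g v0 \<in> carrier (gm_V6 D')" using linear_map_closed[OF lin_iso_linear[OF fi(2)] A.v0(1)] .
    show "g v0 \<notin> gm_V5 D'"
    proof
      assume "g v0 \<in> gm_V5 D'"
      then obtain u where "u \<in> A.U" "g v0 = g u" using S by blast
      then have "v0 = u" using lin_iso_bij[OF fi(2)] A.v0(1) A.UV unfolding bij_betw_def inj_on_def by blast
      then show False using \<open>u \<in> A.U\<close> A.v0 by simp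
    qed
  qed
  show "gm_choice D' (g v0) (h l)" using gv0 lin_iso_nonzero[OF fi(3) A.l] by (simp add: gm_choice_def)
  interpret B: gm_lci_chosen D' "h l" "g v0" using D' gv0 lin_iso_nonzero[OF fi(3) A.l] by unfold_locales
  note E = lin_ext_map[OF lin_iso_linear[OF fi(2)]]
  have W1: "f b \<in> gm_W1 D' \<longleftrightarrow> b \<in> gm_W1 D" if b: "b \<in> carrier A.W" for b
  proof -
    have "B.mu (f b) = ext_map B.V g (A.mu b)" using S b by simp
    moreover have "ext_map B.V g (A.mu b) = \<zero>\<^bsub>ext_alg B.V\<^esub> \<longleftrightarrow> A.mu b = \<zero>\<^bsub>ext_alg A.V\<^esub>"
      using ext_map_inverse(1)[OF fi(2), of "A.mu b"] ext_map_inverse(1)[OF fi(2), of "\<zero>\<^bsub>ext_alg A.V\<^esub>"] linear_map_zero[OF E]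
        A.V.pow_closed[OF A.UV A.mu_closed[OF A.l(1) b]] kspace.zeroC[OF A.V.kspace_ext] by metis
    ultimately show ?thesis using b linear_map_closed[OF lin_iso_linear[OF fi(1)] b] by (simp add: A.W1_eq B.W1_eq)
  qed
  have sur: "\<exists>w\<in>carrier A.W. w' = f w" if "w' \<in> carrier B.W" for w' using lin_iso_image[OF fi(1)] that by blast
  have fW: "f w \<in> carrier B.W" if "w \<in> carrier A.W" for w using linear_map_closed[OF lin_iso_linear[OF fi(1)] that] .
  have qf: "gm_q D' (g v0) (f w) (f w') = gm_q D v0 w w'" if "w \<in> carrier A.W" "w' \<in> carrier A.W" for w w'
    using S A.v0(1) that by blast
  have perp: "f w \<in> B.perp \<longleftrightarrow> w \<in> A.perp" if w: "w \<in> carrier A.W" for w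
  proof
    assume fw: "f w \<in> B.perp"
    have "gm_q D v0 w b = 0" if b: "b \<in> gm_W1 D" for b
    proof -
      have "f b \<in> gm_W1 D'" using W1[OF A.W1W[OF b]] b by simp
      then show ?thesis using fw qf[OF w A.W1W[OF b]] by (simp add: B.perp_def)
    qed
    then show "w \<in> A.perp" using w by (simp add: A.perp_def)
  next
    assume wp: "w \<in> A.perp"
    have "gm_q D' (g v0) (f w) b' = 0" if b': "b' \<in> gm_W1 D'" for b'
    proof -
      obtain b where b: "b \<in> carrier A.W" "b' = f b" using sur[OF B.W1W[OF b']] by auto
      then show ?thesis using wp W1[OF b(1)] b' qf[OF w b(1)] by (simp add: A.perp_def)
    qed
    then show "f w \<in> B.perp" using fW[OF w] by (simp add: B.perp_def)
  qed
  show "ext_map B.V g ` gm_A_of D v0 l \<subseteq> gm_A_of D' (g v0) (h l)"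
  proof
    fix y assume "y \<in> ext_map B.V g ` gm_A_of D v0 l"
    then obtain \<xi> w where x: "\<xi> \<in> A.ep 3" "w \<in> A.perp" "y = ext_map B.V g (\<xi> \<oplus>\<^bsub>ext_alg A.V\<^esub> wedge A.V (ext_vec A.V v0) (A.mu w))"
      "\<And>w'. w' \<in> A.perp \<Longrightarrow> A.cf (wedge A.V \<xi> (A.mu w')) + gm_q D v0 w w' = 0"
      unfolding A.A_of_eq A.VH.graph_lag_def by blast
    have wW: "w \<in> carrier A.W" using A.perpW[OF x(2)] .
    have xE: "\<xi> \<in> carrier (ext_alg A.V)" using A.VH.ep_E[OF x(1)] .
    have mE: "A.mu w' \<in> carrier (ext_alg A.V)" if "w' \<in> carrier A.W" for w' using A.VH.ep_E[OF A.mu_closed[OF A.l(1) that]] .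
    have mf: "ext_map B.V g (A.mu w') = B.mu (f w')" if "w' \<in> carrier A.W" for w' using S that by blast
    have "y = ext_map B.V g \<xi> \<oplus>\<^bsub>ext_alg B.V\<^esub> ext_map B.V g (wedge A.V (ext_vec A.V v0) (A.mu w))"
      unfolding x(3) by (rule linear_map_add[OF E xE A.V.wedge_closed[OF A.VH.ev0 mE[OF wW]]])
    also have "ext_map B.V g (wedge A.V (ext_vec A.V v0) (A.mu w)) = wedge B.V (ext_vec B.V (g v0)) (B.mu (f w))"
      using ext_map_wedge[OF lin_iso_linear[OF fi(2)] A.VH.ev0 mE[OF wW]] ext_map_vec[OF lin_iso_linear[OF fi(2)] A.v0(1)] mf[OF wW] by simp
    finally have y: "y = ext_map B.V g \<xi> \<oplus>\<^bsub>ext_alg B.V\<^esub> wedge B.V (ext_vec B.V (g v0)) (B.mu (f w))" .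
    show "y \<in> gm_A_of D' (g v0) (h l)"
      unfolding y B.A_of_eq
    proof (rule B.VH.graph_lagI)
      show "ext_map B.V g \<xi> \<in> B.ep 3" using ext_map_pow[OF lin_iso_linear[OF fi(2)] A.UV x(1)] S by simp
      show "f w \<in> B.perp" using perp[OF wW] x(2) by simp
      fix w'' assume w'': "w'' \<in> B.perp"
      then obtain w' where w': "w' \<in> carrier A.W" "w'' = f w'" using sur B.perpW by blast
      then have w'p: "w' \<in> A.perp" using perp w'' by simp
      have "wedge B.V (ext_map B.V g \<xi>) (B.mu w'') = ext_map B.V g (wedge A.V \<xi> (A.mu w'))"
        using ext_map_wedge[OF lin_iso_linear[OF fi(2)] xE mE[OF w'(1)]] mf[OF w'(1)] w'(2) by simp
      moreover have "B.cf (ext_map B.V g (wedge A.V \<xi> (A.mu w'))) = A.cf (wedge A.V \<xi> (A.mu w'))"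
        using S A.VH.wedge32[OF x(1) A.mu_closed[OF A.l(1) w'(1)]] by blast
      ultimately show "B.cf (wedge B.V (ext_map B.V g \<xi>) (B.mu w'')) + gm_q D' (g v0) (f w) w'' = 0"
        using x(4)[OF w'p] qf[OF wW w'(1)] w'(2) by simp
    qed
  qed
qed

text \<open>The reverse inclusion is the preceding one for the inverse isomorphism.\<close>

lemma gm_iso_A:
  assumes D: "is_gm_data D" "gm_lci D" and D': "is_gm_data D'" "gm_lci D'" and c: "gm_choice D v0 l"
    and s: "gm_scalar_iso D D' l f g h"
  shows "ext_map (gm_V6 D') g ` gm_A_of D v0 l = gm_A_of D' (g v0) (h l)"
proof
  show "ext_map (gm_V6 D') g ` gm_A_of D v0 l \<subseteq> gm_A_of D' (g v0) (h l)" by (rule gm_iso_A_subset[OF assms])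
  let ?g = "inv_into (carrier (gm_V6 D)) g" and ?h = "inv_into (carrier (gm_L D)) h"
  have l: "l \<in> carrier (gm_L D)" and v0: "v0 \<in> carrier (gm_V6 D)" using c by (auto simp: gm_choice_def)
  have i: "lin_iso (gm_V6 D) (gm_V6 D') g" "lin_iso (gm_L D) (gm_L D') h" using s by (auto simp: gm_scalar_iso_def)
  have b: "?g (g v0) = v0" "?h (h l) = l"
    using lin_iso_bij[OF i(1)] lin_iso_bij[OF i(2)] l v0 by (auto simp: bij_betw_def inv_into_f_f)
  note c' = gm_iso_A_subset(2)[OF assms]
  have sub: "ext_map (gm_V6 D) ?g ` gm_A_of D' (g v0) (h l) \<subseteq> gm_A_of D v0 l"
    using gm_iso_A_subset(1)[OF D' D c' gm_scalar_iso_inverse[OF D(1) D'(1) l s]] unfolding b .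
  show "gm_A_of D' (g v0) (h l) \<subseteq> ext_map (gm_V6 D') g ` gm_A_of D v0 l"
  proof
    fix y assume y: "y \<in> gm_A_of D' (g v0) (h l)"
    then have "y \<in> lag_A (gm_to_lag D')" using gm_A_eq[OF D' c'] by (simp add: gm_to_lag_def)
    then have "y \<in> carrier (ext_alg (gm_V6 D'))" using lag_A_ext(2)[OF gm_to_lag_data[OF D']] by (simp add: gm_to_lag_def)
    then have "y = ext_map (gm_V6 D') g (ext_map (gm_V6 D) ?g y)" using ext_map_inverse(2)[OF i(1)] by simp
    then show "y \<in> ext_map (gm_V6 D') g ` gm_A_of D v0 l" using sub y by blast
  qed
qed

lemma gm_functor:
  "groupoid_functor (gm_groupoid gm_lci) lag_groupoid gm_to_lag gm_iso_to_lag"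
proof (intro groupoid_functor.intro groupoid_functor_axioms.intro gm_groupoid_groupoid lag_groupoid_groupoid)
  fix X assume X: "X \<in> gpd_obj (gm_groupoid gm_lci)"
  show "gm_to_lag X \<in> gpd_obj lag_groupoid" using X by (simp add: gm_groupoid_def lag_groupoid_def gm_to_lag_data)
  show "gm_iso_to_lag X X (gpd_id (gm_groupoid gm_lci) X) = gpd_id lag_groupoid (gm_to_lag X)"
    by (simp add: gm_groupoid_def lag_groupoid_def gm_iso_to_lag_def gm_to_lag_def)
next
  fix X Y a assume *: "X \<in> gpd_obj (gm_groupoid gm_lci)" "Y \<in> gpd_obj (gm_groupoid gm_lci)" "a \<in> gpd_hom (gm_groupoid gm_lci) X Y"
  then have X: "is_gm_data X" "gm_lci X" and Y: "is_gm_data Y" "gm_lci Y" by (auto simp: gm_groupoid_def)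
  obtain f g h where a: "a = (f, g, h)" by (cases a)
  with * have m: "(f, g, h) \<in> gm_iso X Y" by (simp add: gm_groupoid_def)
  obtain v0 l where c: "gm_choice X v0 l" using gm_choice_exists[OF X(1)] by blast
  then have l: "l \<in> carrier (gm_L X)" "l \<noteq> \<zero>\<^bsub>gm_L X\<^esub>" by (auto simp: gm_choice_def)
  have s: "gm_scalar_iso X Y l f g h" using m gm_iso_iff[OF X(1) Y(1) l] by simp
  \<comment> \<open>Independence of the choice allows \<open>gm_A Y\<close> to be computed with the
    transported choice.\<close>
  have "ext_map (gm_V6 Y) g ` gm_A X = gm_A Y"
    using gm_iso_A[OF X Y c s] gm_A_eq[OF X c] gm_A_eq[OF Y gm_iso_A_subset(2)[OF X Y c s]] by simp
  then show "gm_iso_to_lag X Y a \<in> gpd_hom lag_groupoid (gm_to_lag X) (gm_to_lag Y)"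
    using m by (simp add: lag_groupoid_def lag_iso_def gm_to_lag_def gm_iso_to_lag_def a gm_iso_def)
next
  fix X Y Z a b
  show "gm_iso_to_lag X Z (gpd_comp (gm_groupoid gm_lci) X Y Z b a) =
    gpd_comp lag_groupoid (gm_to_lag X) (gm_to_lag Y) (gm_to_lag Z) (gm_iso_to_lag Y Z b) (gm_iso_to_lag X Y a)"
    by (cases a, cases b) (simp add: gm_groupoid_def lag_groupoid_def gm_iso_to_lag_def gm_to_lag_def)
qed

section \<open>Lifting isomorphisms of Lagrangian data\<close>

text \<open>Used to assemble an isomorphism of W from its parts on W0 and W1; uniqueness of
  components makes it well defined.\<close>

lemma direct_sum_iso:
  assumes W: "kspace W" and P: "subsp P W" and Q: "subsp Q W"
    and PQ: "\<And>x. x \<in> P \<Longrightarrow> x \<in> Q \<Longrightarrow> x = \<zero>\<^bsub>W\<^esub>" "\<And>x. x \<in> carrier W \<Longrightarrow> \<exists>a\<in>P. \<exists>b\<in>Q. x = a \<oplus>\<^bsub>W\<^esub> b"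
    and W': "kspace W'" and P': "subsp P' W'" and Q': "subsp Q' W'"
    and PQ': "\<And>x. x \<in> P' \<Longrightarrow> x \<in> Q' \<Longrightarrow> x = \<zero>\<^bsub>W'\<^esub>" "\<And>x. x \<in> carrier W' \<Longrightarrow> \<exists>a\<in>P'. \<exists>b\<in>Q'. x = a \<oplus>\<^bsub>W'\<^esub> b"
    and f: "lin_iso (W\<lparr>carrier := P\<rparr>) (W'\<lparr>carrier := P'\<rparr>) f" and g: "lin_iso (W\<lparr>carrier := Q\<rparr>) (W'\<lparr>carrier := Q'\<rparr>) g"
  obtains h where "lin_iso W W' h" "\<And>a b. a \<in> P \<Longrightarrow> b \<in> Q \<Longrightarrow> h (a \<oplus>\<^bsub>W\<^esub> b) = f a \<oplus>\<^bsub>W'\<^esub> g b"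
proof -
  interpret W: kspace W by fact
  interpret W': kspace W' by fact
  have PD: "x \<in> carrier W" "\<zero>\<^bsub>W\<^esub> \<in> P" "x \<oplus>\<^bsub>W\<^esub> y \<in> P" "c \<odot>\<^bsub>W\<^esub> x \<in> P" if "x \<in> P" "y \<in> P" for x y c
    using P that by (auto simp: W.subspace_iff)
  have QD: "x \<in> carrier W" "\<zero>\<^bsub>W\<^esub> \<in> Q" "x \<oplus>\<^bsub>W\<^esub> y \<in> Q" "c \<odot>\<^bsub>W\<^esub> x \<in> Q" if "x \<in> Q" "y \<in> Q" for x y c
    using Q that by (auto simp: W.subspace_iff)
  have PD': "x \<in> carrier W'" if "x \<in> P'" for x using P' that by (auto simp: W'.subspace_iff)
  have QD': "x \<in> carrier W'" "c \<odot>\<^bsub>W'\<^esub> x \<in> Q'" if "x \<in> Q'" for x c using Q' that by (auto simp: W'.subspace_iff)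
  note fl = lin_iso_linear[OF f, unfolded linear_map_iff, simplified] and gl = lin_iso_linear[OF g, unfolded linear_map_iff, simplified]
  have zz: "a = \<zero>\<^bsub>W\<^esub> \<and> b = \<zero>\<^bsub>W\<^esub>" if "a \<in> P" "b \<in> Q" "a \<oplus>\<^bsub>W\<^esub> b = \<zero>\<^bsub>W\<^esub>" for a b
  proof -
    have "a = (-1) \<odot>\<^bsub>W\<^esub> b" using that PD(1) QD(1) W.eq_iff_diff[of a "(-1) \<odot>\<^bsub>W\<^esub> b"] by simp
    then have "a \<in> Q" using QD(4) that by simp
    then have a0: "a = \<zero>\<^bsub>W\<^esub>" using PQ(1) that(1) by blast
    then have "b = \<zero>\<^bsub>W\<^esub>" using that(3) QD(1)[OF that(2) that(2)] by simp
    with a0 show ?thesis by simp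
  qed
  have zz': "a = \<zero>\<^bsub>W'\<^esub> \<and> b = \<zero>\<^bsub>W'\<^esub>" if "a \<in> P'" "b \<in> Q'" "a \<oplus>\<^bsub>W'\<^esub> b = \<zero>\<^bsub>W'\<^esub>" for a b
  proof -
    have "a = (-1) \<odot>\<^bsub>W'\<^esub> b" using that PD'(1) QD'(1) W'.eq_iff_diff[of a "(-1) \<odot>\<^bsub>W'\<^esub> b"] by simp
    then have "a \<in> Q'" using QD'(2) that by simp
    then have a0: "a = \<zero>\<^bsub>W'\<^esub>" using PQ'(1) that(1) by blast
    then have "b = \<zero>\<^bsub>W'\<^esub>" using that(3) QD'(1)[OF that(2)] by simp
    with a0 show ?thesis by simp
  qed
  have ex: "\<exists>y. \<forall>a\<in>P. \<forall>b\<in>Q. x = a \<oplus>\<^bsub>W\<^esub> b \<longrightarrow> y = f a \<oplus>\<^bsub>W'\<^esub> g b" if x: "x \<in> carrier W" for x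
  proof -
    obtain a b where ab: "a \<in> P" "b \<in> Q" "x = a \<oplus>\<^bsub>W\<^esub> b" using PQ(2)[OF x] by blast
    have "a' = a \<and> b' = b" if "a' \<in> P" "b' \<in> Q" "x = a' \<oplus>\<^bsub>W\<^esub> b'" for a' b'
    proof -
      have c: "a \<in> carrier W" "b \<in> carrier W" "a' \<in> carrier W" "b' \<in> carrier W" using ab that PD(1) QD(1) by auto
      have "(a' \<oplus>\<^bsub>W\<^esub> (-1) \<odot>\<^bsub>W\<^esub> a) \<oplus>\<^bsub>W\<^esub> (b' \<oplus>\<^bsub>W\<^esub> (-1) \<odot>\<^bsub>W\<^esub> b) = (a' \<oplus>\<^bsub>W\<^esub> b') \<oplus>\<^bsub>W\<^esub> (-1) \<odot>\<^bsub>W\<^esub> (a \<oplus>\<^bsub>W\<^esub> b)"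
        using c by (simp add: W.smult_add W.ac)
      also have "\<dots> = \<zero>\<^bsub>W\<^esub>" using ab(3) that(3) c by (metis W.add_neg W.addC)
      finally have "(a' \<oplus>\<^bsub>W\<^esub> (-1) \<odot>\<^bsub>W\<^esub> a) = \<zero>\<^bsub>W\<^esub> \<and> (b' \<oplus>\<^bsub>W\<^esub> (-1) \<odot>\<^bsub>W\<^esub> b) = \<zero>\<^bsub>W\<^esub>"
        using ab that PD QD by (intro zz) auto
      then show ?thesis using c W.eq_iff_diff[of a' a] W.eq_iff_diff[of b' b] by simp
    qed
    then show ?thesis by metis
  qed
  define h where "h x = (SOME y. \<forall>a\<in>P. \<forall>b\<in>Q. x = a \<oplus>\<^bsub>W\<^esub> b \<longrightarrow> y = f a \<oplus>\<^bsub>W'\<^esub> g b)" for x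
  have h: "h (a \<oplus>\<^bsub>W\<^esub> b) = f a \<oplus>\<^bsub>W'\<^esub> g b" if "a \<in> P" "b \<in> Q" for a b
    using someI_ex[OF ex[of "a \<oplus>\<^bsub>W\<^esub> b"]] that PD(1) QD(1) unfolding h_def by auto
  have hl: "lin W W' h"
    unfolding linear_map_iff
  proof (intro conjI ballI allI W.kspace_axioms W'.kspace_axioms)
    fix x assume "x \<in> carrier W"
    then obtain a b where ab: "a \<in> P" "b \<in> Q" "x = a \<oplus>\<^bsub>W\<^esub> b" using PQ(2) by blast
    then show "h x \<in> carrier W'" using h fl gl PD' QD' by simp
    fix y assume "y \<in> carrier W"
    then obtain a' b' where ab': "a' \<in> P" "b' \<in> Q" "y = a' \<oplus>\<^bsub>W\<^esub> b'" using PQ(2) by blast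
    have "x \<oplus>\<^bsub>W\<^esub> y = (a \<oplus>\<^bsub>W\<^esub> a') \<oplus>\<^bsub>W\<^esub> (b \<oplus>\<^bsub>W\<^esub> b')" using ab ab' PD(1) QD(1) by (simp add: W.ac)
    then have "h (x \<oplus>\<^bsub>W\<^esub> y) = f (a \<oplus>\<^bsub>W\<^esub> a') \<oplus>\<^bsub>W'\<^esub> g (b \<oplus>\<^bsub>W\<^esub> b')" using h ab ab' PD(3) QD(3) by simp
    then show "h (x \<oplus>\<^bsub>W\<^esub> y) = h x \<oplus>\<^bsub>W'\<^esub> h y" using h ab ab' fl gl PD' QD' by (simp add: W'.ac)
  next
    fix c x assume "x \<in> carrier W"
    then obtain a b where ab: "a \<in> P" "b \<in> Q" "x = a \<oplus>\<^bsub>W\<^esub> b" using PQ(2) by blast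
    have "c \<odot>\<^bsub>W\<^esub> x = c \<odot>\<^bsub>W\<^esub> a \<oplus>\<^bsub>W\<^esub> c \<odot>\<^bsub>W\<^esub> b" using ab PD(1) QD(1) by (simp add: W.smult_add)
    then have "h (c \<odot>\<^bsub>W\<^esub> x) = f (c \<odot>\<^bsub>W\<^esub> a) \<oplus>\<^bsub>W'\<^esub> g (c \<odot>\<^bsub>W\<^esub> b)" using h ab PD(4) QD(4) by simp
    then show "h (c \<odot>\<^bsub>W\<^esub> x) = c \<odot>\<^bsub>W'\<^esub> h x" using h ab fl gl PD' QD' by (simp add: W'.smult_add)
  qed
  have "inj_on h (carrier W)"
  proof (rule linear_map_injI[OF hl])
    fix x assume x: "x \<in> carrier W" "h x = \<zero>\<^bsub>W'\<^esub>"
    then obtain a b where ab: "a \<in> P" "b \<in> Q" "x = a \<oplus>\<^bsub>W\<^esub> b" using PQ(2) by blast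
    have "f a = \<zero>\<^bsub>W'\<^esub> \<and> g b = \<zero>\<^bsub>W'\<^esub>" using zz'[of "f a" "g b"] x ab h fl gl by simp
    moreover have "f \<zero>\<^bsub>W\<^esub> = \<zero>\<^bsub>W'\<^esub>" "g \<zero>\<^bsub>W\<^esub> = \<zero>\<^bsub>W'\<^esub>"
      using linear_map_zero[OF lin_iso_linear[OF f]] linear_map_zero[OF lin_iso_linear[OF g]] by auto
    moreover have "inj_on f P" "inj_on g Q" using lin_iso_bij[OF f] lin_iso_bij[OF g] by (auto simp: bij_betw_def)
    ultimately have "a = \<zero>\<^bsub>W\<^esub>" "b = \<zero>\<^bsub>W\<^esub>" using ab PD(2)[OF ab(1) ab(1)] QD(2)[OF ab(2) ab(2)] unfolding inj_on_def by metis+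
    then show "x = \<zero>\<^bsub>W\<^esub>" using ab by simp
  qed
  moreover have "h ` carrier W = carrier W'"
  proof
    show "h ` carrier W \<subseteq> carrier W'" using linear_map_closed[OF hl] by auto
    show "carrier W' \<subseteq> h ` carrier W"
    proof
      fix y assume "y \<in> carrier W'"
      then obtain a' b' where ab': "a' \<in> P'" "b' \<in> Q'" "y = a' \<oplus>\<^bsub>W'\<^esub> b'" using PQ'(2) by blast
      have "P' = f ` P" "Q' = g ` Q" using lin_iso_image[OF f] lin_iso_image[OF g] by auto
      then obtain a b where ab: "a \<in> P" "b \<in> Q" "a' = f a" "b' = g b" using ab' by blast
      then have "y = h (a \<oplus>\<^bsub>W\<^esub> b)" using h ab' by simp
      then show "y \<in> h ` carrier W" using ab PD(1) QD(1) by auto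
    qed
  qed
  ultimately have "lin_iso W W' h" using hl by (simp add: lin_iso_def bij_betw_def)
  then show ?thesis using that h by blast
qed

lemma line_iso:
  assumes L: "has_dim L 1" and l: "l \<in> carrier L" "l \<noteq> \<zero>\<^bsub>L\<^esub>"
    and L': "has_dim L' 1" and l': "l' \<in> carrier L'" "l' \<noteq> \<zero>\<^bsub>L'\<^esub>"
  obtains h where "lin_iso L L' h" "h l = l'"
proof -
  interpret L: kspace L using L by (rule has_dim_kspace)
  interpret L': kspace L' using L' by (rule has_dim_kspace)
  obtain \<chi> where ch: "frame L 1 (\<lambda>i. l) \<chi>" using frame_oneI[OF L.kspace_axioms l] has_dim_1_span[OF L l] by blast
  have fn: "functional L (\<chi> 0)" "\<chi> 0 l = 1" using ch by (auto simp: frame_def)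
  let ?h = "\<lambda>x. \<chi> 0 x \<odot>\<^bsub>L'\<^esub> l'"
  have hl: "lin L L' ?h"
    using L.kspace_axioms L'.kspace_axioms l' by (auto simp: linear_map_iff functional_add[OF fn(1)] functional_smult[OF fn(1)] L'.add_smult)
  have "inj_on ?h (carrier L)"
    by (rule linear_map_injI[OF hl], rule frame_ext[OF ch])
      (use l' L'.smult_eq_0_iff functional_zero[OF fn(1) L.kspace_axioms] in auto)
  moreover have "?h ` carrier L = carrier L'"
  proof
    show "?h ` carrier L \<subseteq> carrier L'" using l' by auto
    show "carrier L' \<subseteq> ?h ` carrier L"
    proof
      fix y assume "y \<in> carrier L'"
      then obtain c where "y = c \<odot>\<^bsub>L'\<^esub> l'" using has_dim_1_span[OF L' l'] by blast
      then have "y = ?h (c \<odot>\<^bsub>L\<^esub> l)" using l by (simp add: functional_smult[OF fn(1)] fn)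
      then show "y \<in> ?h ` carrier L" using l by auto
    qed
  qed
  ultimately show ?thesis using that[of ?h] hl fn l' by (auto simp: lin_iso_def bij_betw_def)
qed

lemma (in gm_line) coef_scale:
  assumes d: "d \<noteq> 0" and x: "x \<in> ep 5"
  shows "cf x = d * d * gm_coef D (d \<odot>\<^bsub>L\<^esub> l) x"
proof (rule coef_eqI)
  interpret B: gm_line D "d \<odot>\<^bsub>L\<^esub> l" using d l L.smult_eq_0_iff by unfold_locales auto
  have t: "tensor L L" by (rule tensorI[OF L.kspace_axioms L.kspace_axioms])
  have "B.ll = d \<odot>\<^bsub>LL\<^esub> pure_tensor L L l (d \<odot>\<^bsub>L\<^esub> l)"
    using tensor.pure_smult_left[OF t l(1), of "d \<odot>\<^bsub>L\<^esub> l" d] l by simp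
  also have "pure_tensor L L l (d \<odot>\<^bsub>L\<^esub> l) = d \<odot>\<^bsub>LL\<^esub> ll"
    using tensor.pure_smult_right[OF t l(1) l(1), of d] .
  finally have "B.ll = (d * d) \<odot>\<^bsub>LL\<^esub> ll" using ll by simp
  then show "gm_eps D x = (d * d * B.cf x) \<odot>\<^bsub>LL\<^esub> ll" using B.eps_coef[OF x] ll by (simp add: mult_ac)
qed

lemma gm_ordinary_not_special: "is_gm_data D \<Longrightarrow> gm_ordinary D \<Longrightarrow> \<not> gm_special D"
proof
  assume D: "is_gm_data D" and o: "gm_ordinary D" and s: "gm_special D"
  interpret gm D by unfold_locales (rule D)
  have "has_dim (W\<lparr>carrier := {\<zero>\<^bsub>W\<^esub>}\<rparr>) 1" using o s by (simp add: gm_ordinary_def gm_special_def)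
  then show False using has_dim_1_iff[OF W.subspace_kspace[OF W.zero_subspace]] by auto
qed

text \<open>Any isomorphism \<open>g\<close> of the Lagrangian data can be rescaled to be compatible with \<open>\<epsilon>\<close>: if \<open>g\<close>
  multiplies \<open>\<epsilon>\<close> by \<open>r\<close>, then \<open>r g\<close> multiplies it by \<open>r\<^sup>6\<close>, a square, which is absorbed by
  \<open>\<phi>\<^sub>L = r\<^sup>3\<close>.\<close>

lemma lag_iso_rescale:
  assumes D: "is_gm_data D" "gm_lci D" and D': "is_gm_data D'" "gm_lci D'" and c: "gm_choice D v0 l"
    and g: "g \<in> lag_iso (gm_to_lag D) (gm_to_lag D')"
  obtains g' l' where "lin_iso (gm_V6 D) (gm_V6 D') g'" "g' ` gm_V5 D = gm_V5 D'" "gm_choice D' (g' v0) l'"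
    "\<And>x. x \<in> ext_part (gm_V6 D) (words (gm_V5 D) 5) \<Longrightarrow> gm_coef D' l' (ext_map (gm_V6 D') g' x) = gm_coef D l x"
    "ext_map (gm_V6 D') g' ` gm_A_of D v0 l = gm_A_of D' (g' v0) l'"
proof -
  interpret A: gm_lci_chosen D l v0 using D c by unfold_locales (auto simp: gm_choice_def)
  obtain v1 l1 where c1: "gm_choice D' v1 l1" using gm_choice_exists[OF D'(1)] by blast
  interpret B: gm_lci_chosen D' l1 v1 using D' c1 by unfold_locales (auto simp: gm_choice_def)
  interpret XA: kspace "ext_alg A.V" by (rule A.V.kspace_ext)
  interpret XB: kspace "ext_alg B.V" by (rule B.V.kspace_ext)
  have gi: "lin_iso A.V B.V g" and gU: "g ` A.U = B.U" and gA: "ext_map B.V g ` gm_A D = gm_A D'"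
    using g by (auto simp: lag_iso_def gm_to_lag_def)
  note gl = lin_iso_linear[OF gi]
  note G = lin_ext_map[OF gl]
  have G5: "ext_map B.V g x \<in> B.ep 5" if "x \<in> A.ep 5" for x using ext_map_pow[OF gl A.UV that] gU by simp
  obtain \<Omega> where \<Omega>: "\<Omega> \<in> A.ep 5" "A.cf \<Omega> \<noteq> 0" using A.coef_nz by blast
  \<comment> \<open>The fifth exterior power of V5 is a line, so g changes the volume by one factor,
    which can be measured at any nonzero \<open>\<Omega>\<close>.\<close>
  define r where "r = B.cf (ext_map B.V g \<Omega>) / A.cf \<Omega>"
  have OE: "\<Omega> \<in> carrier (ext_alg A.V)" using A.VH.ep_E[OF \<Omega>(1)] .
  have r0: "r \<noteq> 0"
  proof
    assume "r = 0"
    then have "ext_map B.V g \<Omega> = \<zero>\<^bsub>ext_alg B.V\<^esub>" using B.coef_inj[OF G5[OF \<Omega>(1)]] \<Omega>(2) by (simp add: r_def)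
    then have "\<Omega> = \<zero>\<^bsub>ext_alg A.V\<^esub>"
      using ext_map_inverse(1)[OF gi OE] ext_map_inverse(1)[OF gi XA.zeroC] linear_map_zero[OF G] by metis
    then show False using \<Omega>(2) A.VH.eps_zero by simp
  qed
  have r: "B.cf (ext_map B.V g x) = r * A.cf x" if x: "x \<in> A.ep 5" for x
  proof -
    have xe: "x = (A.cf x / A.cf \<Omega>) \<odot>\<^bsub>ext_alg A.V\<^esub> \<Omega>"
      using x \<Omega> by (intro A.VH.eps_eq) (auto simp: A.VH.eps_smult)
    have "ext_map B.V g x = (A.cf x / A.cf \<Omega>) \<odot>\<^bsub>ext_alg B.V\<^esub> ext_map B.V g \<Omega>"
      using linear_map_smult[OF G OE] xe by metis
    then show ?thesis using B.VH.eps_smult[OF G5[OF \<Omega>(1)]] by (simp add: r_def)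
  qed
  define g' where "g' v = r \<odot>\<^bsub>B.V\<^esub> g v" for v
  define l' where "l' = (r ^ 3) \<odot>\<^bsub>B.L\<^esub> l1"
  have sc: "lin_iso B.V B.V (\<lambda>v. r \<odot>\<^bsub>B.V\<^esub> v)"
  proof -
    have "lin B.V B.V (\<lambda>v. r \<odot>\<^bsub>B.V\<^esub> v)"
      using B.V.kspace_axioms by (auto simp: linear_map_iff B.V.smult_add mult.commute)
    moreover have "bij_betw (\<lambda>v. r \<odot>\<^bsub>B.V\<^esub> v) (carrier B.V) (carrier B.V)"
      by (rule bij_betwI[where g="\<lambda>v. inverse r \<odot>\<^bsub>B.V\<^esub> v"]) (auto simp: r0)
    ultimately show ?thesis by (simp add: lin_iso_def)
  qed
  have g'i: "lin_iso A.V B.V g'" unfolding g'_def by (rule lin_iso_compose[OF gi sc])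
  have BU: "c \<odot>\<^bsub>B.V\<^esub> u \<in> B.U" if "u \<in> B.U" for c u
    using B.VH.U_sub that by (simp add: B.V.subspace_iff)
  have g'U: "g' ` A.U = B.U"
  proof
    show "g' ` A.U \<subseteq> B.U" using gU BU by (auto simp: g'_def)
    show "B.U \<subseteq> g' ` A.U"
    proof
      fix u assume u: "u \<in> B.U"
      then have "inverse r \<odot>\<^bsub>B.V\<^esub> u \<in> g ` A.U" using BU gU by simp
      then obtain v where v: "v \<in> A.U" "g v = inverse r \<odot>\<^bsub>B.V\<^esub> u" by auto
      then have "g' v = u" using u B.UV r0 by (auto simp: g'_def)
      then show "u \<in> g' ` A.U" using v by auto
    qed
  qed
  have gs: "ext_map B.V g' x = r ^ p \<odot>\<^bsub>ext_alg B.V\<^esub> ext_map B.V g x" if "x \<in> ext_part A.V (words (carrier A.V) p)" for x p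
    by (rule ext_map_scale[OF gl _ that]) (simp add: g'_def)
  have v0': "g' v0 \<in> carrier B.V" "g' v0 \<notin> B.U"
  proof -
    show "g' v0 \<in> carrier B.V" using linear_map_closed[OF lin_iso_linear[OF g'i] A.v0(1)] .
    show "g' v0 \<notin> B.U"
    proof
      assume "g' v0 \<in> B.U"
      then obtain u where "u \<in> A.U" "g' v0 = g' u" using g'U by blast
      then have "v0 = u" using lin_iso_bij[OF g'i] A.v0(1) A.UV unfolding bij_betw_def inj_on_def by blast
      then show False using \<open>u \<in> A.U\<close> A.v0 by simp
    qed
  qed
  have l': "l' \<in> carrier B.L" "l' \<noteq> \<zero>\<^bsub>B.L\<^esub>" using B.l r0 B.L.smult_eq_0_iff by (auto simp: l'_def)
  have c': "gm_choice D' (g' v0) l'" using v0' l' by (simp add: gm_choice_def)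
  have cf: "gm_coef D' l' (ext_map B.V g' x) = A.cf x" if x: "x \<in> A.ep 5" for x
  proof -
    have y: "ext_map B.V g' x = r ^ 5 \<odot>\<^bsub>ext_alg B.V\<^esub> ext_map B.V g x" by (rule gs[OF A.VH.ep_V[OF x]])
    have "B.cf (ext_map B.V g' x) = r ^ 5 * (r * A.cf x)"
      unfolding y by (simp add: B.VH.eps_smult[OF G5[OF x]] r[OF x])
    moreover have "ext_map B.V g' x \<in> B.ep 5" unfolding y using G5[OF x] by simp
    ultimately have "r ^ 3 * r ^ 3 * gm_coef D' l' (ext_map B.V g' x) = r ^ 5 * (r * A.cf x)"
      using B.coef_scale[of "r ^ 3" "ext_map B.V g' x"] r0 by (simp add: l'_def)
    moreover have "r ^ 5 * (r * A.cf x) = r ^ 3 * r ^ 3 * A.cf x"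
      by (simp add: power_numeral_reduce)
    ultimately show ?thesis using r0 by simp
  qed
  have Aeq: "gm_A_of D v0 l = gm_A D" "gm_A_of D' (g' v0) l' = gm_A D'"
    using gm_A_eq[OF D c] gm_A_eq[OF D' c'] by auto
  have AV: "x \<in> ext_part A.V (words (carrier A.V) 3)" if "x \<in> gm_A D" for x
    using lag_A_ext(1)[OF gm_to_lag_data[OF D]] that by (simp add: gm_to_lag_def)
  have smA: "c \<odot>\<^bsub>ext_alg A.V\<^esub> x \<in> gm_A D" if "x \<in> gm_A D" for c x
    using A.VH.A_smult[OF A.A_of_lagrangian] that Aeq(1) by simp
  have smB: "c \<odot>\<^bsub>ext_alg B.V\<^esub> x \<in> gm_A D'" if "x \<in> gm_A D'" for c x
    using B.VH.A_smult[OF B.A_of_lagrangian] that gm_A_eq[OF D' c1] by simp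
  \<comment> \<open>In degree three the rescaling is multiplication by \<open>r ^ 3\<close>, under
    which the subspaces \<open>gm_A D\<close> and \<open>gm_A D'\<close> are stable.\<close>
  have "ext_map B.V g' ` gm_A D = gm_A D'"
  proof
    show "ext_map B.V g' ` gm_A D \<subseteq> gm_A D'"
    proof
      fix y assume "y \<in> ext_map B.V g' ` gm_A D"
      then obtain x where x: "x \<in> gm_A D" "y = ext_map B.V g' x" by blast
      have "ext_map B.V g x \<in> gm_A D'" using gA x(1) by blast
      then show "y \<in> gm_A D'" unfolding x(2) gs[OF AV[OF x(1)]] by (rule smB)
    qed
    show "gm_A D' \<subseteq> ext_map B.V g' ` gm_A D"
    proof
      fix y assume "y \<in> gm_A D'"
      then obtain x where x: "x \<in> gm_A D" "y = ext_map B.V g x" using gA by auto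
      let ?x = "inverse (r ^ 3) \<odot>\<^bsub>ext_alg A.V\<^esub> x"
      have xE: "x \<in> carrier (ext_alg A.V)" using A.V.pow_closed[OF subset_refl AV[OF x(1)]] .
      have "ext_map B.V g' ?x = r ^ 3 \<odot>\<^bsub>ext_alg B.V\<^esub> (inverse (r ^ 3) \<odot>\<^bsub>ext_alg B.V\<^esub> y)"
        using gs[OF AV[OF smA[OF x(1)]]] linear_map_smult[OF G xE] x(2) by simp
      also have "\<dots> = y" using linear_map_closed[OF G xE] x(2) r0 by simp
      finally show "y \<in> ext_map B.V g' ` gm_A D" using smA[OF x(1)] by (metis imageI)
    qed
  qed
  then show ?thesis using that[OF g'i g'U c' cf] Aeq by simp
qed

text \<open>On W0 the lift is forced: \<mu> is injective there and its image is the projection of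
  the Lagrangian subspace. On W1 it is a choice: the zero map for ordinary data, and for special
  data a map of lines matching two nonzero forms, which exists once their ratio is a square.\<close>

lemma gm_iso_lift:
  assumes D: "is_gm_data D" "gm_lci D" and D': "is_gm_data D'" "gm_lci D'"
    and g: "g \<in> lag_iso (gm_to_lag D) (gm_to_lag D')"
    and t: "gm_ordinary D \<and> gm_ordinary D' \<or> gm_special D \<and> gm_special D' \<and> (\<forall>a::'k. \<exists>b. b\<^sup>2 = a)"
  shows "gm_iso D (D' :: ('k::field, 'w, 'v, 'l) gm_data) \<noteq> {}"
proof -
  obtain v0 l where c: "gm_choice D v0 l" using gm_choice_exists[OF D(1)] by blast
  interpret A: gm_lci_chosen D l v0 using D c by unfold_locales (auto simp: gm_choice_def)
  from lag_iso_rescale[OF D D' c g] obtain g' l' where g'i: "lin_iso A.V (gm_V6 D') g'" and g'U: "g' ` A.U = gm_V5 D'"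
    and c': "gm_choice D' (g' v0) l'" and cf: "\<And>x. x \<in> A.ep 5 \<Longrightarrow> gm_coef D' l' (ext_map (gm_V6 D') g' x) = A.cf x"
    and gA: "ext_map (gm_V6 D') g' ` gm_A_of D v0 l = gm_A_of D' (g' v0) l'" by metis
  interpret B: gm_lci_chosen D' l' "g' v0" using D' c' by unfold_locales (auto simp: gm_choice_def)
  interpret XA: kspace "ext_alg A.V" by (rule A.V.kspace_ext)
  interpret XB: kspace "ext_alg B.V" by (rule B.V.kspace_ext)
  note gl = lin_iso_linear[OF g'i]
  define G where "G = ext_map B.V g'"
  have G: "lin (ext_alg A.V) (ext_alg B.V) G" unfolding G_def by (rule lin_ext_map[OF gl])
  have Gp: "G x \<in> B.ep p" if "x \<in> A.ep p" for x p using ext_map_pow[OF gl A.UV that] g'U by (simp add: G_def)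
  have Gw: "G (wedge A.V x y) = wedge B.V (G x) (G y)" if "x \<in> carrier (ext_alg A.V)" "y \<in> carrier (ext_alg A.V)" for x y
    unfolding G_def by (rule ext_map_wedge[OF gl that])
  have Gv: "G (ext_vec A.V v) = ext_vec B.V (g' v)" if "v \<in> carrier A.V" for v
    unfolding G_def by (rule ext_map_vec[OF gl that])
  have Gcf: "B.cf (G x) = A.cf x" if "x \<in> A.ep 5" for x using cf[OF that] by (simp add: G_def)
  have Gd: "G (\<xi> \<oplus>\<^bsub>ext_alg A.V\<^esub> wedge A.V (ext_vec A.V v0) \<eta>) = G \<xi> \<oplus>\<^bsub>ext_alg B.V\<^esub> wedge B.V (ext_vec B.V (g' v0)) (G \<eta>)"
    if "\<xi> \<in> A.ep 3" "\<eta> \<in> A.ep 2" for \<xi> \<eta>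
    using linear_map_add[OF G A.VH.ep_E[OF that(1)] A.V.wedge_closed[OF A.VH.ev0 A.VH.ep_E[OF that(2)]]]
      Gw[OF A.VH.ev0 A.VH.ep_E[OF that(2)]] Gv[OF A.v0(1)] by simp
  have mA: "A.mu w \<in> A.ep 2" if "w \<in> carrier A.W" for w using A.mu_closed[OF A.l(1) that] .
  have mB: "B.mu w \<in> B.ep 2" if "w \<in> carrier B.W" for w using B.mu_closed[OF B.l(1) that] .
  \<comment> \<open>Both sides are projections of Lagrangian subspaces to second exterior powers,
    and \<open>G\<close> carries one subspace, with its decomposition along v0, to the
    other.\<close>
  have base: "B.mu ` B.perp = G ` A.mu ` A.perp"
  proof
    show "G ` A.mu ` A.perp \<subseteq> B.mu ` B.perp"
    proof
      fix y assume "y \<in> G ` A.mu ` A.perp"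
      then obtain \<eta> where \<eta>: "\<eta> \<in> A.VH.lag_base (gm_A_of D v0 l)" "y = G \<eta>" unfolding A.lag_base_A by blast
      then obtain \<xi> where \<xi>: "\<xi> \<in> A.ep 3" "\<eta> \<in> A.ep 2" "\<xi> \<oplus>\<^bsub>ext_alg A.V\<^esub> wedge A.V (ext_vec A.V v0) \<eta> \<in> gm_A_of D v0 l"
        by (auto simp: A.VH.lag_base_def)
      then have "G (\<xi> \<oplus>\<^bsub>ext_alg A.V\<^esub> wedge A.V (ext_vec A.V v0) \<eta>) \<in> gm_A_of D' (g' v0) l'" using gA by (auto simp: G_def)
      then have "y \<in> B.VH.lag_base (gm_A_of D' (g' v0) l')"
        unfolding Gd[OF \<xi>(1,2)] B.VH.lag_base_def using Gp[OF \<xi>(1)] Gp[OF \<xi>(2)] \<eta>(2) by auto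
      then show "y \<in> B.mu ` B.perp" unfolding B.lag_base_A .
    qed
    show "B.mu ` B.perp \<subseteq> G ` A.mu ` A.perp"
    proof
      fix y assume "y \<in> B.mu ` B.perp"
      then have "y \<in> B.VH.lag_base (gm_A_of D' (g' v0) l')" unfolding B.lag_base_A .
      then obtain \<xi>' where \<xi>': "\<xi>' \<in> B.ep 3" "y \<in> B.ep 2" "\<xi>' \<oplus>\<^bsub>ext_alg B.V\<^esub> wedge B.V (ext_vec B.V (g' v0)) y \<in> gm_A_of D' (g' v0) l'"
        by (auto simp: B.VH.lag_base_def)
      then obtain x where x: "x \<in> gm_A_of D v0 l" "\<xi>' \<oplus>\<^bsub>ext_alg B.V\<^esub> wedge B.V (ext_vec B.V (g' v0)) y = G x"
        using gA unfolding G_def by blast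
      obtain \<xi> \<eta> where d: "\<xi> \<in> A.ep 3" "\<eta> \<in> A.ep 2" "x = \<xi> \<oplus>\<^bsub>ext_alg A.V\<^esub> wedge A.V (ext_vec A.V v0) \<eta>"
        using A.VH.decomp3[OF A.VH.A_pow[OF A.A_of_lagrangian x(1)]] .
      have "y = G \<eta>" using B.VH.decomp_unique[OF \<xi>'(1,2) Gp[OF d(1)] Gp[OF d(2)]] x(2) Gd[OF d(1,2)] d(3) by simp
      moreover have "\<eta> \<in> A.VH.lag_base (gm_A_of D v0 l)" using d x(1) by (auto simp: A.VH.lag_base_def)
      ultimately show "y \<in> G ` A.mu ` A.perp" unfolding A.lag_base_A by blast
    qed
  qed
  define f0 where "f0 a = inv_into B.perp B.mu (G (A.mu a))" for a
  have f0: "f0 a \<in> B.perp" "B.mu (f0 a) = G (A.mu a)" if "a \<in> A.perp" for a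
    using that base unfolding f0_def by (auto intro!: inv_into_into f_inv_into_f)
  have injB: "a = b" if "a \<in> B.perp" "b \<in> B.perp" "B.mu a = B.mu b" for a b
    using B.mu_W0(2) that by (auto simp: inj_on_def)
  have perpA: "x \<oplus>\<^bsub>A.W\<^esub> y \<in> A.perp" "k \<odot>\<^bsub>A.W\<^esub> x \<in> A.perp" if "x \<in> A.perp" "y \<in> A.perp" for x y k
    using A.perp_sub that by (auto simp: A.W.subspace_iff)
  have perpB: "x \<oplus>\<^bsub>B.W\<^esub> y \<in> B.perp" "k \<odot>\<^bsub>B.W\<^esub> x \<in> B.perp" if "x \<in> B.perp" "y \<in> B.perp" for x y k
    using B.perp_sub that by (auto simp: B.W.subspace_iff)
  have GA: "G (A.mu (x \<oplus>\<^bsub>A.W\<^esub> y)) = G (A.mu x) \<oplus>\<^bsub>ext_alg B.V\<^esub> G (A.mu y)" "G (A.mu (k \<odot>\<^bsub>A.W\<^esub> x)) = k \<odot>\<^bsub>ext_alg B.V\<^esub> G (A.mu x)"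
    if "x \<in> carrier A.W" "y \<in> carrier A.W" for x y k
    using linear_map_add[OF A.lin_mu[OF A.l(1)] that] linear_map_smult[OF A.lin_mu[OF A.l(1)] that(1), of k]
      linear_map_add[OF G A.VH.ep_E[OF mA[OF that(1)]] A.VH.ep_E[OF mA[OF that(2)]]] linear_map_smult[OF G A.VH.ep_E[OF mA[OF that(1)]], of k] by auto
  have Bmu: "B.mu (x \<oplus>\<^bsub>B.W\<^esub> y) = B.mu x \<oplus>\<^bsub>ext_alg B.V\<^esub> B.mu y" "B.mu (k \<odot>\<^bsub>B.W\<^esub> x) = k \<odot>\<^bsub>ext_alg B.V\<^esub> B.mu x"
    if "x \<in> carrier B.W" "y \<in> carrier B.W" for x y k
    using linear_map_add[OF B.lin_mu[OF B.l(1)] that] linear_map_smult[OF B.lin_mu[OF B.l(1)] that(1), of k] by auto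
  have f0l: "lin A.W0m B.W0m f0"
    unfolding linear_map_iff
  proof (intro conjI ballI allI A.W0m B.W0m; simp)
    show "f0 x \<in> B.perp" if "x \<in> A.perp" for x using f0(1)[OF that] .
    show "f0 (x \<oplus>\<^bsub>A.W\<^esub> y) = f0 x \<oplus>\<^bsub>B.W\<^esub> f0 y" if "x \<in> A.perp" "y \<in> A.perp" for x y
      using that perpA f0 perpB by (intro injB) (simp_all add: GA Bmu A.perpW B.perpW)
    show "f0 (k \<odot>\<^bsub>A.W\<^esub> x) = k \<odot>\<^bsub>B.W\<^esub> f0 x" if x: "x \<in> A.perp" for x k
    proof (rule injB)
      show "f0 (k \<odot>\<^bsub>A.W\<^esub> x) \<in> B.perp" "k \<odot>\<^bsub>B.W\<^esub> f0 x \<in> B.perp"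
        using f0(1)[OF perpA(2)[OF x x]] perpB(2)[OF f0(1)[OF x] f0(1)[OF x]] by auto
      show "B.mu (f0 (k \<odot>\<^bsub>A.W\<^esub> x)) = B.mu (k \<odot>\<^bsub>B.W\<^esub> f0 x)"
        unfolding f0(2)[OF perpA(2)[OF x x]] GA(2)[OF A.perpW[OF x] A.perpW[OF x]]
          Bmu(2)[OF B.perpW[OF f0(1)[OF x]] B.perpW[OF f0(1)[OF x]]] f0(2)[OF x] ..
    qed
  qed
  have GE0: "x = \<zero>\<^bsub>ext_alg A.V\<^esub>" if "G x = \<zero>\<^bsub>ext_alg B.V\<^esub>" "x \<in> carrier (ext_alg A.V)" for x
    using ext_map_inverse(1)[OF g'i that(2)] ext_map_inverse(1)[OF g'i XA.zeroC] linear_map_zero[OF G] that(1) unfolding G_def by metis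
  have f0i: "lin_iso A.W0m B.W0m f0"
    unfolding lin_iso_def bij_betw_def
  proof (intro conjI f0l)
    show "inj_on f0 (carrier A.W0m)"
    proof (rule linear_map_injI[OF f0l]; simp)
      fix x assume x: "x \<in> A.perp" "f0 x = \<zero>\<^bsub>B.W\<^esub>"
      have "G (A.mu x) = B.mu \<zero>\<^bsub>B.W\<^esub>" using f0(2)[OF x(1)] x(2) by simp
      also have "\<dots> = \<zero>\<^bsub>ext_alg B.V\<^esub>" using linear_map_zero[OF B.lin_mu[OF B.l(1)]] by simp
      finally have "A.mu x = \<zero>\<^bsub>ext_alg A.V\<^esub>" using GE0 A.VH.ep_E[OF mA[OF A.perpW[OF x(1)]]] by simp
      then show "x = \<zero>\<^bsub>A.W\<^esub>" using A.perp_inter[OF x(1)] A.perpW[OF x(1)] by (simp add: A.W1_eq)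
    qed
    show "f0 ` carrier A.W0m = carrier B.W0m"
    proof
      show "f0 ` carrier A.W0m \<subseteq> carrier B.W0m" using f0 by auto
      show "carrier B.W0m \<subseteq> f0 ` carrier A.W0m"
      proof
        fix b assume b: "b \<in> carrier B.W0m"
        have "B.mu b \<in> B.mu ` B.perp" using b by simp
        then obtain a where a: "a \<in> A.perp" "B.mu b = G (A.mu a)" using base by (metis (no_types, lifting) imageE)
        then have "b = f0 a" using b f0 by (intro injB) auto
        then show "b \<in> f0 ` carrier A.W0m" using a by simp
      qed
    qed
  qed
  have q0U: "gm_q D' (g' v) (f0 a) (f0 b) = gm_q D v a b" if v: "v \<in> A.U" and a: "a \<in> A.perp" and b: "b \<in> A.perp" for v a b
  proof -
    have vV: "v \<in> carrier A.V" using v A.UV by auto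
    have e: "A.mu a \<in> carrier (ext_alg A.V)" "A.mu b \<in> carrier (ext_alg A.V)" using A.VH.ep_E mA A.perpW a b by blast+
    have g'v: "g' v \<in> B.U" using v g'U by auto
    have p: "wedge A.V (ext_vec A.V v) (wedge A.V (A.mu a) (A.mu b)) \<in> A.ep 5"
      using A.VH.wedge_ep[OF A.V.ext_vec_pow[OF v] A.VH.wedge_ep[OF mA[OF A.perpW[OF a]] mA[OF A.perpW[OF b]]]] by simp
    have "gm_q D' (g' v) (f0 a) (f0 b) = B.cf (wedge B.V (ext_vec B.V (g' v)) (wedge B.V (G (A.mu a)) (G (A.mu b))))"
      using B.q_U[OF g'v B.perpW[OF f0(1)[OF a]] B.perpW[OF f0(1)[OF b]]] f0(2) a b by simp
    also have "\<dots> = B.cf (G (wedge A.V (ext_vec A.V v) (wedge A.V (A.mu a) (A.mu b))))"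
      using e vV by (simp add: Gw Gv)
    also have "\<dots> = A.cf (wedge A.V (ext_vec A.V v) (wedge A.V (A.mu a) (A.mu b)))" by (rule Gcf[OF p])
    finally show ?thesis using A.q_U[OF v A.perpW[OF a] A.perpW[OF b]] by simp
  qed
  \<comment> \<open>Lift \<open>a\<close> to a point of the first Lagrangian subspace. The image of
    this point lies in the second and has a unique decomposition, so it lies over
    \<open>f0 a\<close>; comparing the equations of the two graphs at \<open>b\<close> gives the
    equality of the forms.\<close>
  have q0v0: "gm_q D' (g' v0) (f0 a) (f0 b) = gm_q D v0 a b" if a: "a \<in> A.perp" and b: "b \<in> A.perp" for a b
  proof -
    obtain \<xi> where \<xi>: "\<xi> \<in> A.ep 3" "\<And>w'. w' \<in> A.perp \<Longrightarrow> A.cf (wedge A.V \<xi> (A.mu w')) + gm_q D v0 a w' = 0"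
      using A.VH.graph_lag_lift[OF A.W0m A.mu_W0 A.q_W0, of a] a by auto
    have "\<xi> \<oplus>\<^bsub>ext_alg A.V\<^esub> wedge A.V (ext_vec A.V v0) (A.mu a) \<in> gm_A_of D v0 l"
      unfolding A.A_of_eq by (rule A.VH.graph_lagI[where W=A.perp and m=A.mu and q="gm_q D v0", OF \<xi>(1) a \<xi>(2)])
    then have "G (\<xi> \<oplus>\<^bsub>ext_alg A.V\<^esub> wedge A.V (ext_vec A.V v0) (A.mu a)) \<in> B.VH.graph_lag B.perp B.mu (gm_q D' (g' v0))"
      using gA unfolding B.A_of_eq G_def by blast
    then obtain \<xi>' w where w: "\<xi>' \<in> B.ep 3" "w \<in> B.perp" "\<And>w'. w' \<in> B.perp \<Longrightarrow> B.cf (wedge B.V \<xi>' (B.mu w')) + gm_q D' (g' v0) w w' = 0"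
      "G \<xi> \<oplus>\<^bsub>ext_alg B.V\<^esub> wedge B.V (ext_vec B.V (g' v0)) (G (A.mu a)) = \<xi>' \<oplus>\<^bsub>ext_alg B.V\<^esub> wedge B.V (ext_vec B.V (g' v0)) (B.mu w)"
      unfolding Gd[OF \<xi>(1) mA[OF A.perpW[OF a]]] B.VH.graph_lag_def by blast
    have u: "G \<xi> = \<xi>' \<and> G (A.mu a) = B.mu w"
      by (rule B.VH.decomp_unique[OF Gp[OF \<xi>(1)] Gp[OF mA[OF A.perpW[OF a]]] w(1) mB[OF B.perpW[OF w(2)]] w(4)])
    then have wf: "w = f0 a" using f0[OF a] w(2) by (intro injB) auto
    have "B.cf (wedge B.V (G \<xi>) (G (A.mu b))) = A.cf (wedge A.V \<xi> (A.mu b))"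
      using Gcf[OF A.VH.wedge32[OF \<xi>(1) mA[OF A.perpW[OF b]]]] Gw[OF A.VH.ep_E[OF \<xi>(1)] A.VH.ep_E[OF mA[OF A.perpW[OF b]]]] by simp
    then have "A.cf (wedge A.V \<xi> (A.mu b)) + gm_q D' (g' v0) (f0 a) (f0 b) = 0"
      using w(3)[OF f0(1)[OF b]] f0(2)[OF b] wf u by simp
    then show ?thesis using \<xi>(2)[OF b] by (metis add_left_cancel)
  qed
  have "\<exists>f1. lin_iso (A.W\<lparr>carrier := gm_W1 D\<rparr>) (B.W\<lparr>carrier := gm_W1 D'\<rparr>) f1
      \<and> (\<forall>b\<in>gm_W1 D. \<forall>b'\<in>gm_W1 D. gm_q D' (g' v0) (f1 b) (f1 b') = gm_q D v0 b b')"
  proof (cases "gm_ordinary D")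
    case True
    then have "gm_ordinary D'" using t gm_ordinary_not_special[OF D(1)] by blast
    then have W1: "gm_W1 D = {\<zero>\<^bsub>A.W\<^esub>}" "gm_W1 D' = {\<zero>\<^bsub>B.W\<^esub>}" using True by (auto simp: gm_ordinary_def)
    have "lin_iso (A.W\<lparr>carrier := gm_W1 D\<rparr>) (B.W\<lparr>carrier := gm_W1 D'\<rparr>) (\<lambda>x. \<zero>\<^bsub>B.W\<^esub>)"
      using A.W.subspace_kspace[OF A.W1_sub] B.W.subspace_kspace[OF B.W1_sub]
      by (auto simp: lin_iso_def linear_map_iff bij_betw_def W1)
    then show ?thesis by (intro exI[of _ "\<lambda>x. \<zero>\<^bsub>B.W\<^esub>"]) (auto simp: W1 A.q_zero_right[OF A.v0(1)] B.q_zero_right[OF B.v0(1)])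
  next
    case False
    then have s: "gm_special D" "gm_special D'" and sq: "\<forall>a::'k. \<exists>b. b\<^sup>2 = a" using t by auto
    obtain b where b: "b \<in> gm_W1 D" "b \<noteq> \<zero>\<^bsub>A.W\<^esub>" "gm_q D v0 b b \<noteq> 0" "\<And>y. y \<in> gm_W1 D \<Longrightarrow> \<exists>c. y = c \<odot>\<^bsub>A.W\<^esub> b"
      using A.special_vector[OF s(1)] by blast
    obtain b' where b': "b' \<in> gm_W1 D'" "b' \<noteq> \<zero>\<^bsub>B.W\<^esub>" "gm_q D' (g' v0) b' b' \<noteq> 0"
      using B.special_vector[OF s(2)] by blast
    obtain k where k: "k\<^sup>2 = gm_q D v0 b b / gm_q D' (g' v0) b' b'" using sq by blast
    then have k0: "k \<noteq> 0" using b(3) b'(3) by auto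
    have bW: "b \<in> carrier A.W" "b' \<in> carrier B.W" using b(1) b'(1) A.W1W B.W1W by auto
    let ?b = "k \<odot>\<^bsub>B.W\<^esub> b'"
    have qb: "gm_q D' (g' v0) ?b ?b = gm_q D v0 b b"
      using bW B.v0(1) k b'(3) by (simp add: B.q_smult_left B.q_smult_right power2_eq_square flip: mult.assoc)
    have d: "has_dim (A.W\<lparr>carrier := gm_W1 D\<rparr>) 1" "has_dim (B.W\<lparr>carrier := gm_W1 D'\<rparr>) 1" using s by (auto simp: gm_special_def)
    have "?b \<in> gm_W1 D'" using B.W1_sub b'(1) by (simp add: B.W.subspace_iff)
    moreover have "?b \<noteq> \<zero>\<^bsub>B.W\<^esub>" using k0 b'(2) bW B.W.smult_eq_0_iff by simp
    ultimately obtain f1 where f1: "lin_iso (A.W\<lparr>carrier := gm_W1 D\<rparr>) (B.W\<lparr>carrier := gm_W1 D'\<rparr>) f1" "f1 b = ?b"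
      using line_iso[OF d(1), of b, OF _ _ d(2), of ?b] b by auto
    have "gm_q D' (g' v0) (f1 y) (f1 z) = gm_q D v0 y z" if yz: "y \<in> gm_W1 D" "z \<in> gm_W1 D" for y z
    proof -
      obtain c d where cd: "y = c \<odot>\<^bsub>A.W\<^esub> b" "z = d \<odot>\<^bsub>A.W\<^esub> b" using b(4) yz by metis
      have "f1 y = c \<odot>\<^bsub>B.W\<^esub> ?b" "f1 z = d \<odot>\<^bsub>B.W\<^esub> ?b"
        using linear_map_smult[OF lin_iso_linear[OF f1(1)], of b] b(1) f1(2) cd by simp_all
      moreover have "gm_q D' (g' v0) (c \<odot>\<^bsub>B.W\<^esub> ?b) (d \<odot>\<^bsub>B.W\<^esub> ?b) = c * (d * gm_q D' (g' v0) ?b ?b)"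
        using B.W.smultC[OF bW(2), of k] B.v0(1) by (simp only: B.q_smult_left B.q_smult_right B.W.smultC mult.left_commute)
      moreover have "gm_q D v0 y z = c * (d * gm_q D v0 b b)"
        unfolding cd using bW A.v0(1) by (simp only: A.q_smult_left A.q_smult_right A.W.smultC mult.left_commute)
      ultimately show ?thesis using qb by simp
    qed
    then show ?thesis using f1 by blast
  qed
  then obtain f1 where f1: "lin_iso (A.W\<lparr>carrier := gm_W1 D\<rparr>) (B.W\<lparr>carrier := gm_W1 D'\<rparr>) f1"
    and qf1: "\<And>b b'. b \<in> gm_W1 D \<Longrightarrow> b' \<in> gm_W1 D \<Longrightarrow> gm_q D' (g' v0) (f1 b) (f1 b') = gm_q D v0 b b'" by blast
  have f1W: "f1 b \<in> gm_W1 D'" if "b \<in> gm_W1 D" for b using linear_map_closed[OF lin_iso_linear[OF f1]] that by simp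
  obtain f where f: "lin_iso A.W B.W f" "\<And>a b. a \<in> A.perp \<Longrightarrow> b \<in> gm_W1 D \<Longrightarrow> f (a \<oplus>\<^bsub>A.W\<^esub> b) = f0 a \<oplus>\<^bsub>B.W\<^esub> f1 b"
  proof (rule direct_sum_iso[OF A.W.kspace_axioms A.perp_sub A.W1_sub _ _ B.W.kspace_axioms B.perp_sub B.W1_sub _ _ f0i f1])
    show "\<exists>a\<in>A.perp. \<exists>b\<in>gm_W1 D. x = a \<oplus>\<^bsub>A.W\<^esub> b" if "x \<in> carrier A.W" for x using A.perp_decomp[OF that] by metis
    show "\<exists>a\<in>B.perp. \<exists>b\<in>gm_W1 D'. x = a \<oplus>\<^bsub>B.W\<^esub> b" if "x \<in> carrier B.W" for x using B.perp_decomp[OF that] by metis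
  qed (use A.perp_inter B.perp_inter in auto)
  obtain h where h: "lin_iso A.L B.L h" "h l = l'" using line_iso[OF A.gmD(4) A.l B.gmD(4) B.l] .
  \<comment> \<open>Split w and w' along W0 and W1, and v along V5 and v0. The diagonal blocks have
    been compared, those on W1 being zero for vectors of V5, and the mixed blocks vanish on both
    sides.\<close>
  have q: "gm_q D' (g' v) (f w) (f w') = gm_q D v w w'" if v: "v \<in> carrier A.V" and w: "w \<in> carrier A.W" and w': "w' \<in> carrier A.W" for v w w'
  proof -
    obtain a b where ab: "a \<in> A.perp" "b \<in> gm_W1 D" "w = a \<oplus>\<^bsub>A.W\<^esub> b" using A.perp_decomp[OF w] .
    obtain a' b' where ab': "a' \<in> A.perp" "b' \<in> gm_W1 D" "w' = a' \<oplus>\<^bsub>A.W\<^esub> b'" using A.perp_decomp[OF w'] .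
    obtain c u where u: "u \<in> A.U" "v = u \<oplus>\<^bsub>A.V\<^esub> c \<odot>\<^bsub>A.V\<^esub> v0" using A.decomp[OF v] .
    have uV: "u \<in> carrier A.V" using u A.UV by auto
    have g'u: "g' u \<in> B.U" "g' u \<in> carrier B.V" using u g'U B.UV by auto
    have g'v: "g' v = g' u \<oplus>\<^bsub>B.V\<^esub> c \<odot>\<^bsub>B.V\<^esub> g' v0"
      using linear_map_add[OF gl uV, of "c \<odot>\<^bsub>A.V\<^esub> v0"] linear_map_smult[OF gl A.v0(1)] u(2) A.v0(1) by simp
    have g'vV: "g' v \<in> carrier B.V" using linear_map_closed[OF gl v] .
    have cA: "a \<in> carrier A.W" "b \<in> carrier A.W" "a' \<in> carrier A.W" "b' \<in> carrier A.W" using ab ab' A.perpW A.W1W by auto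
    have fB: "f0 a \<in> B.perp" "f0 a' \<in> B.perp" "f1 b \<in> gm_W1 D'" "f1 b' \<in> gm_W1 D'" using ab ab' f0 f1W by auto
    have cB: "f0 a \<in> carrier B.W" "f0 a' \<in> carrier B.W" "f1 b \<in> carrier B.W" "f1 b' \<in> carrier B.W" using fB B.perpW B.W1W by auto
    have 1: "gm_q D' (g' v) (f0 a) (f0 a') = gm_q D v a a'"
      unfolding g'v unfolding u(2) using uV A.v0(1) B.v0(1) g'u q0U[OF u(1) ab(1) ab'(1)] q0v0[OF ab(1) ab'(1)]
      by (simp add: A.q_add A.q_smult B.q_add B.q_smult)
    have 2: "gm_q D' (g' v) (f1 b) (f1 b') = gm_q D v b b'"
      unfolding g'v unfolding u(2) using uV A.v0(1) B.v0(1) g'u A.q_U_W1[OF u(1) cA(2) ab'(2)] B.q_U_W1[OF g'u(1) cB(3) fB(4)] qf1[OF ab(2) ab'(2)]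
      by (simp add: A.q_add A.q_smult B.q_add B.q_smult)
    have 3: "gm_q D v a b' = 0" "gm_q D v b a' = 0"
      using A.q_perp_W1[OF v ab(1) ab'(2)] A.q_perp_W1[OF v ab'(1) ab(2)] A.q_sym[OF v, of b a'] by auto
    have 4: "gm_q D' (g' v) (f0 a) (f1 b') = 0" "gm_q D' (g' v) (f1 b) (f0 a') = 0"
      using B.q_perp_W1[OF g'vV fB(1) fB(4)] B.q_perp_W1[OF g'vV fB(2) fB(3)] B.q_sym[OF g'vV, of "f1 b" "f0 a'"] by auto
    show ?thesis unfolding ab(3) ab'(3) f(2)[OF ab(1,2)] f(2)[OF ab'(1,2)]
      using cA cB v g'vV by (simp add: A.q_add_left A.q_add_right B.q_add_left B.q_add_right 1 2 3 4)
  qed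
  have m: "G (A.mu w) = B.mu (f w)" if w: "w \<in> carrier A.W" for w
  proof -
    obtain a b where ab: "a \<in> A.perp" "b \<in> gm_W1 D" "w = a \<oplus>\<^bsub>A.W\<^esub> b" using A.perp_decomp[OF w] .
    have z: "A.mu b = \<zero>\<^bsub>ext_alg A.V\<^esub>" "B.mu (f1 b) = \<zero>\<^bsub>ext_alg B.V\<^esub>" using ab(2) f1W[OF ab(2)] by (simp_all add: A.W1_eq B.W1_eq)
    show ?thesis
      unfolding ab(3) f(2)[OF ab(1,2)]
      using GA(1)[OF A.perpW[OF ab(1)] A.W1W[OF ab(2)]] Bmu(1)[OF B.perpW[OF f0(1)[OF ab(1)]] B.W1W[OF f1W[OF ab(2)]]]
        f0(2)[OF ab(1)] z linear_map_zero[OF G] by simp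
  qed
  have "gm_scalar_iso D D' l f g' h"
    unfolding gm_scalar_iso_def using f(1) g'i h g'U cf q m by (simp add: G_def)
  then have "gm_scalar_iso D D' l (restrict f (carrier A.W)) (restrict g' (carrier A.V)) (restrict h (carrier A.L))"
    using gm_scalar_iso_cong[OF D(1) _ A.l(1), of D' f g' h] by simp
  then show ?thesis using gm_iso_iff[OF D(1) D'(1) A.l] by (metis empty_iff restrict_extensional)
qed

section \<open>Constructing GM data from Lagrangian data\<close>

text \<open>The structure is carried over along an injection into an arbitrary type; this is how
  spaces enter the fixed types of W and L.\<close>

lemma transport_kspace:
  assumes V: "kspace V" and J: "inj_on J (carrier V)"
  obtains W where "lin_iso V W J"
proof -
  interpret V: kspace V by fact
  let ?i = "inv_into (carrier V) J"
  let ?W = "\<lparr>carrier = J ` carrier V, mult = \<lambda>x y. J \<zero>\<^bsub>V\<^esub>, one = J \<zero>\<^bsub>V\<^esub>, zero = J \<zero>\<^bsub>V\<^esub>,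
    add = \<lambda>x y. J (?i x \<oplus>\<^bsub>V\<^esub> ?i y), smult = \<lambda>c x. J (c \<odot>\<^bsub>V\<^esub> ?i x)\<rparr>"
  have i: "?i (J x) = x" if "x \<in> carrier V" for x using J that by simp
  have "kspace ?W"
    by (rule kspaceI) (auto simp: i V.ac V.smult_add V.add_smult)
  then have "lin_iso V ?W J"
    using J V by (auto simp: lin_iso_def linear_map_iff bij_betw_def i)
  then show ?thesis by (rule that)
qed

text \<open>An infinite set is in bijection with its square, so by iteration n-tuples of scalars are
  coded by one scalar. Functions on nat play the part of tuples, and their first n values are what
  the code recovers.\<close>

lemma infinite_tuple_code:
  assumes "infinite (UNIV :: 'k set)"
  shows "\<exists>p :: (nat \<Rightarrow> 'k) \<Rightarrow> 'k. \<forall>f g. p f = p g \<longrightarrow> (\<forall>i<n. f i = g i)"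
proof (induction n)
  case (Suc n)
  then obtain p :: "(nat \<Rightarrow> 'k) \<Rightarrow> 'k" where p: "\<And>f g. p f = p g \<Longrightarrow> \<forall>i<n. f i = g i" by blast
  obtain h :: "'k \<times> 'k \<Rightarrow> 'k" where h: "bij_betw h (UNIV \<times> UNIV) UNIV"
    using iffD2[OF card_of_ordIso card_of_Times_same_infinite[OF assms]] by (rule exE)
  have hi: "x = y" if "h x = h y" for x y
    using inj_onD[OF bij_betw_imp_inj_on[OF h] that] by simp
  have "\<forall>i<Suc n. f i = g i" if "h (p f, f n) = h (p g, g n)" for f g
    using hi[OF that] p[of f g] by (auto simp: less_Suc_eq)
  then show ?case by (intro exI[of _ "\<lambda>f. h (p f, f n)"]) blast
qed simp

text \<open>A vector is sent to the code of its coordinates and then, by \<open>j\<close>, into the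
  target type.\<close>

lemma fin_dim_copy:
  fixes V :: "('k::field, 'v) module"
  assumes V: "has_dim V n" and k: "infinite (UNIV :: 'k set)" and j: "inj (j :: 'k \<Rightarrow> 'w)"
  obtains J and W :: "('k, 'w) module" where "lin_iso V W J"
proof -
  obtain e \<phi> where fr: "frame V n e \<phi>" using has_dim_frame[OF V] .
  obtain p :: "(nat \<Rightarrow> 'k) \<Rightarrow> 'k" where p: "\<And>f g. p f = p g \<Longrightarrow> \<forall>i<n. f i = g i"
    using infinite_tuple_code[OF k, of n] by blast
  have "inj_on (\<lambda>x. j (p (\<lambda>i. \<phi> i x))) (carrier V)"
  proof (rule inj_onI)
    fix x y assume x: "x \<in> carrier V" "y \<in> carrier V" "j (p (\<lambda>i. \<phi> i x)) = j (p (\<lambda>i. \<phi> i y))"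
    then have "p (\<lambda>i. \<phi> i x) = p (\<lambda>i. \<phi> i y)" using j by (simp add: inj_eq)
    from p[OF this] show "x = y" using frame_ext[OF fr x(1,2)] by blast
  qed
  then show ?thesis using transport_kspace[OF has_dim_kspace[OF V]] that by blast
qed

section \<open>Adding a summand of dimension one\<close>

lemma direct_sum_simps[simp]:
  "carrier (direct_sum V W) = carrier V \<times> carrier W" "zero (direct_sum V W) = (zero V, zero W)"
  "x \<oplus>\<^bsub>direct_sum V W\<^esub> y = (fst x \<oplus>\<^bsub>V\<^esub> fst y, snd x \<oplus>\<^bsub>W\<^esub> snd y)"
  "c \<odot>\<^bsub>direct_sum V W\<^esub> x = (c \<odot>\<^bsub>V\<^esub> fst x, c \<odot>\<^bsub>W\<^esub> snd x)"
  by (simp_all add: direct_sum_def)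

lemma kspace_direct_sum:
  assumes V: "kspace V" and W: "kspace W"
  shows "kspace (direct_sum V W)"
proof -
  interpret V: kspace V by fact
  interpret W: kspace W by fact
  show ?thesis by (rule kspaceI) (auto simp: V.ac W.ac V.smult_add W.smult_add V.add_smult W.add_smult)
qed

text \<open>The scalar summand is the room for W1 in \<open>gm_construct\<close>.\<close>

lemma frame_sum_scalar:
  assumes fr: "frame V n e \<phi>"
  shows "has_dim (direct_sum V scalar_vs) (Suc n)"
proof (rule frame_has_dim)
  have V: "kspace V" and e: "\<And>i. i < n \<Longrightarrow> e i \<in> carrier V" "\<And>i. i < n \<Longrightarrow> functional V (\<phi> i)"
    and d: "\<And>i j. i < n \<Longrightarrow> j < n \<Longrightarrow> \<phi> i (e j) = (if i = j then 1 else 0)"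
    using fr by (auto simp: frame_def)
  interpret V: kspace V by fact
  let ?e = "\<lambda>i. if i < n then (e i, 0) else (\<zero>\<^bsub>V\<^esub>, 1)"
  let ?p = "\<lambda>i x. if i < n then \<phi> i (fst x) else snd x"
  show "frame (direct_sum V scalar_vs) (Suc n) ?e ?p"
    unfolding frame_def
  proof (intro conjI allI impI ballI kspace_direct_sum V kspace_scalar)
    fix i assume i: "i < Suc n"
    show "?e i \<in> carrier (direct_sum V scalar_vs)" using e by auto
    show "functional (direct_sum V scalar_vs) (?p i)"
      using e(2)[of i] by (auto simp: functional_def)
    fix j assume j: "j < Suc n"
    show "?p i (?e j) = (if i = j then 1 else 0)"
      using i j d functional_zero[OF e(2) V] by auto
  next
    fix x y assume xy: "x \<in> carrier (direct_sum V scalar_vs)" "y \<in> carrier (direct_sum V scalar_vs)"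
      and eq: "\<forall>i<Suc n. ?p i x = ?p i y"
    have "snd x = snd y" using eq[rule_format, of n] by simp
    moreover have "fst x = fst y"
      using xy eq by (intro frame_ext[OF fr]) (auto simp: less_Suc_eq)
    ultimately show "x = y" by (simp add: prod_eq_iff)
  qed
qed

text \<open>The value of \<open>q\<close> on \<open>V\<^sub>5\<close> is forced by \<open>\<mu>\<close> and \<open>\<epsilon>\<close>, and its value at \<open>v\<^sub>0\<close> is arbitrary.\<close>

lemma (in volume_hyperplane) gm_build:
  fixes W :: "('k, 'w) module" and L :: "('k, 'l) module"
  assumes W: "has_dim W d" and m: "lin W (ext_pow V U 2) m"
    and b: "\<And>w. w \<in> carrier W \<Longrightarrow> functional W (b w)" "\<And>w w'. w \<in> carrier W \<Longrightarrow> w' \<in> carrier W \<Longrightarrow> b w w' = b w' w"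
    and L: "has_dim L 1" and l: "l \<in> carrier L" "l \<noteq> \<zero>\<^bsub>L\<^esub>"
  obtains D where "is_gm_data D" "gm_W D = W" "gm_V6 D = V" "gm_V5 D = U" "gm_L D = L"
    "\<And>w. w \<in> carrier W \<Longrightarrow> gm_mu_pure D l w = m w" "\<And>x. x \<in> ep 5 \<Longrightarrow> gm_coef D l x = eps x"
    "\<And>w w'. w \<in> carrier W \<Longrightarrow> w' \<in> carrier W \<Longrightarrow> gm_q D v0 w w' = b w w'"
proof -
  interpret W: kspace W using W by (rule has_dim_kspace)
  interpret L: kspace L using L by (rule has_dim_kspace)
  interpret X: kspace "ext_alg V" by (rule kspace_ext)
  obtain e \<phi> where ad: "adapted V U 5 e \<phi>" "e 5 = v0" using adapted .
  interpret A: adapted V U 5 e \<phi> by (rule ad)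
  define \<chi> where "\<chi> = \<phi> 5"
  have \<chi>: "functional V \<chi>" "\<chi> v0 = 1" "\<And>x. x \<in> carrier V \<Longrightarrow> x \<in> U \<longleftrightarrow> \<chi> x = 0"
    using A.phi_n A.fr ad(2) A.U_iff by (auto simp: \<chi>_def frame_def)
  \<comment> \<open>The projection of \<open>V\<close> onto \<open>U\<close> along
    \<open>v0\<close>.\<close>
  define p where "p v = v \<oplus> (- \<chi> v) \<odot> v0" for v
  have pU: "p v \<in> U" if "v \<in> carrier V" for v
    using that v0 \<chi> by (simp add: p_def functional_add[OF \<chi>(1)] functional_smult[OF \<chi>(1)])
  have pV: "p v \<in> carrier V" if "v \<in> carrier V" for v using pU[OF that] UV by auto
  have p_id: "p v = v" if "v \<in> U" for v using that \<chi>(3) UV v0 by (auto simp: p_def)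
  have p_v0: "p v0 = \<zero>" using v0 \<chi>(2) by (simp add: p_def)
  have p_add: "p (v \<oplus> v') = p v \<oplus> p v'" if "v \<in> carrier V" "v' \<in> carrier V" for v v'
  proof -
    have "p (v \<oplus> v') = v \<oplus> v' \<oplus> ((- \<chi> v) \<odot> v0 \<oplus> (- \<chi> v') \<odot> v0)"
      using that v0 functional_add[OF \<chi>(1) that] by (simp add: p_def add_smult[symmetric])
    then show ?thesis using that v0 by (simp add: p_def ac)
  qed
  have p_smult: "p (c \<odot> v) = c \<odot> p v" if "v \<in> carrier V" for v c
    using that v0 by (simp add: p_def functional_smult[OF \<chi>(1)] smult_add)
  have mep: "m w \<in> ep 2" if "w \<in> carrier W" for w
    using linear_map_closed[OF m that] by (simp add: ext_pow_carrier)
  have mE: "m w \<in> carrier E" if "w \<in> carrier W" for w using ep_E[OF mep[OF that]] .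
  define t where "t v w w' = eps (wedge V (ext_vec V v) (wedge V (m w) (m w')))" for v w w'
  have wep: "wedge V (ext_vec V v) (wedge V (m w) (m w')) \<in> ep 5" if "v \<in> U" "w \<in> carrier W" "w' \<in> carrier W" for v w w'
    using wedge_ep[OF ext_vec_pow[OF that(1)] wedge_ep[OF mep[OF that(2)] mep[OF that(3)]]] by simp
  have m_add: "m (w \<oplus>\<^bsub>W\<^esub> w') = m w \<oplus>\<^bsub>E\<^esub> m w'" if "w \<in> carrier W" "w' \<in> carrier W" for w w'
    using linear_map_add[OF m that] by simp
  have m_smult: "m (c \<odot>\<^bsub>W\<^esub> w) = c \<odot>\<^bsub>E\<^esub> m w" if "w \<in> carrier W" for c w
    using linear_map_smult[OF m that] by simp
  \<comment> \<open>Elements of degree two commute, so the form forced on V5 by \<mu> and \<epsilon>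
    is symmetric.\<close>
  have t_sym: "t v w w' = t v w' w" if "w \<in> carrier W" "w' \<in> carrier W" for v w w'
    using wedge_comm[OF ep_V[OF mep[OF that(1)]] ep_V[OF mep[OF that(2)]]] mE that by (simp add: t_def)
  have t_add: "t (v \<oplus> v') w w' = t v w w' + t v' w w'" and t_smult: "t (c \<odot> v) w w' = c * t v w w'"
    if v: "v \<in> U" "v' \<in> U" and w: "w \<in> carrier W" "w' \<in> carrier W" for v v' w w' c
  proof -
    have vV: "v \<in> carrier V" "v' \<in> carrier V" using v UV by auto
    have o: "wedge V (m w) (m w') \<in> carrier E" using mE w by simp
    show "t (v \<oplus> v') w w' = t v w w' + t v' w w'"
      unfolding t_def using linear_map_add[OF lin_ext_vec vV] wedge_add_left[OF ext_vec_closed[OF vV(1)] ext_vec_closed[OF vV(2)] o]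
        eps_add[OF wep[OF v(1) w] wep[OF v(2) w]] by simp
    show "t (c \<odot> v) w w' = c * t v w w'"
      unfolding t_def using linear_map_smult[OF lin_ext_vec vV(1)] wedge_smult_left[OF ext_vec_closed[OF vV(1)] o]
        eps_smult[OF wep[OF v(1) w]] by simp
  qed
  have t_add_right: "t v w (w' \<oplus>\<^bsub>W\<^esub> w'') = t v w w' + t v w w''" and t_smult_right: "t v w (c \<odot>\<^bsub>W\<^esub> w') = c * t v w w'"
    if v: "v \<in> U" and w: "w \<in> carrier W" "w' \<in> carrier W" "w'' \<in> carrier W" for v w w' w'' c
  proof -
    have vE: "ext_vec V v \<in> carrier E" using v UV by auto
    have o: "wedge V (m w) (m w') \<in> carrier E" "wedge V (m w) (m w'') \<in> carrier E" using mE w by auto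
    show "t v w (w' \<oplus>\<^bsub>W\<^esub> w'') = t v w w' + t v w w''"
      unfolding t_def m_add[OF w(2,3)] wedge_add_right[OF mE[OF w(2)] mE[OF w(3)] mE[OF w(1)]] wedge_add_right[OF o vE]
      by (rule eps_add[OF wep[OF v w(1,2)] wep[OF v w(1,3)]])
    show "t v w (c \<odot>\<^bsub>W\<^esub> w') = c * t v w w'"
      unfolding t_def m_smult[OF w(2)] wedge_smult_right[OF mE[OF w(1)] mE[OF w(2)]] wedge_smult_right[OF vE o(1)]
      by (rule eps_smult[OF wep[OF v w(1,2)]])
  qed
  define q where "q v w w' = (if w \<in> carrier W \<and> w' \<in> carrier W then t (p v) w w' + \<chi> v * b w w' else 0)" for v w w'
  have q: "lin V (sym_forms W) q"
    unfolding linear_map_iff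
  proof (intro conjI ballI allI kspace_axioms kspace_sym_forms)
    fix v assume v: "v \<in> carrier V"
    show "q v \<in> carrier (sym_forms W)"
      unfolding sym_forms_iff
      using b t_sym t_add_right[OF pU[OF v]] t_smult_right[OF pU[OF v]]
      by (auto simp: q_def functional_def algebra_simps)
    show "q (c \<odot> v) = c \<odot>\<^bsub>sym_forms W\<^esub> q v" for c
      using t_smult[OF pU[OF v] pU[OF v]] p_smult[OF v] functional_smult[OF \<chi>(1) v] by (auto simp: q_def fun_eq_iff algebra_simps)
    show "q (v \<oplus> v') = q v \<oplus>\<^bsub>sym_forms W\<^esub> q v'" if v': "v' \<in> carrier V" for v'
      using t_add[OF pU[OF v] pU[OF v']] p_add[OF v v'] functional_add[OF \<chi>(1) v v'] by (auto simp: q_def fun_eq_iff algebra_simps)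
  qed
  let ?LL = "tensor_vs L L" and ?ll = "pure_tensor L L l l" and ?LW = "tensor_vs L W"
  have iLL: "lin_iso L ?LL (pure_tensor L L l)" by (rule pure_iso[OF L l L])
  have LL1: "has_dim ?LL 1" by (rule has_dim_iso[OF L iLL])
  interpret LL: kspace ?LL using LL1 by (rule has_dim_kspace)
  have ll: "?ll \<in> carrier ?LL" "?ll \<noteq> \<zero>\<^bsub>?LL\<^esub>" using lin_iso_nonzero[OF iLL l] .
  have iLW: "lin_iso W ?LW (pure_tensor L W l)" by (rule pure_iso[OF L l W])
  define mu where "mu X = m (inv_into (carrier W) (pure_tensor L W l) X)" for X
  have mu: "lin ?LW (ext_pow V U 2) mu"
    unfolding mu_def by (rule linear_map_compose[OF lin_iso_linear[OF lin_iso_inv[OF iLW]] m])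
  have mu_l: "mu (pure_tensor L W l w) = m w" if "w \<in> carrier W" for w
    using lin_iso_bij[OF iLW] that by (simp add: mu_def bij_betw_def)
  define ee where "ee x = eps x \<odot>\<^bsub>?LL\<^esub> ?ll" for x
  interpret P5: kspace "ext_pow V U 5" by (rule kspace_ep)
  have eel: "lin (ext_pow V U 5) ?LL ee"
    using P5.kspace_axioms LL.kspace_axioms ll by (auto simp: linear_map_iff ext_pow_carrier ee_def eps_add eps_smult LL.add_smult)
  have "inj_on ee (carrier (ext_pow V U 5))"
    by (rule linear_map_injI[OF eel]) (use ll LL.smult_eq_0_iff eps_inj in \<open>auto simp: ee_def ext_pow_carrier\<close>)
  moreover have "ee ` carrier (ext_pow V U 5) = carrier ?LL"
  proof
    show "ee ` carrier (ext_pow V U 5) \<subseteq> carrier ?LL" using ll by (auto simp: ee_def)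
    show "carrier ?LL \<subseteq> ee ` carrier (ext_pow V U 5)"
    proof
      fix z assume "z \<in> carrier ?LL"
      then obtain c where c: "z = c \<odot>\<^bsub>?LL\<^esub> ?ll" using has_dim_1_span[OF LL1 ll] by blast
      obtain x where x: "x \<in> ep 5" "eps x \<noteq> 0" using eps_nz by blast
      then have "z = ee ((c / eps x) \<odot>\<^bsub>E\<^esub> x)" by (simp add: c ee_def eps_smult)
      then show "z \<in> ee ` carrier (ext_pow V U 5)" using ep_smult[OF x(1)] by (auto simp: ext_pow_carrier)
    qed
  qed
  ultimately have ee: "lin_iso (ext_pow V U 5) ?LL ee" using eel by (simp add: lin_iso_def bij_betw_def)
  define D where "D = \<lparr>gm_W = W, gm_V6 = V, gm_V5 = U, gm_L = L, gm_mu = mu, gm_q = q, gm_eps = ee\<rparr>"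
  have Ds: "gm_W D = W" "gm_V6 D = V" "gm_V5 D = U" "gm_L D = L" "gm_mu D = mu" "gm_q D = q" "gm_eps D = ee"
    by (simp_all add: D_def)
  have tLW: "tensor L W" "tensor L L" using L.kspace_axioms W.kspace_axioms by (auto intro: tensorI)
  have mup: "gm_mu_pure D (a \<odot>\<^bsub>L\<^esub> l) w = a \<odot>\<^bsub>E\<^esub> m w" if w: "w \<in> carrier W" for a w
    using tensor.pure_smult_left[OF tLW(1) l(1) w, of a] linear_map_smult[OF mu tensor.pure_closed[OF tLW(1) l(1) w], of a] mu_l[OF w]
    by (simp add: gm_mu_pure_def Ds)
  have compat: "q v w1 w2 \<odot>\<^bsub>?LL\<^esub> pure_tensor L L l1 l2
        = ee (wedge V (ext_vec V v) (wedge V (gm_mu_pure D l1 w1) (gm_mu_pure D l2 w2)))"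
    if v: "v \<in> U" and w: "w1 \<in> carrier W" "w2 \<in> carrier W" and l12: "l1 \<in> carrier L" "l2 \<in> carrier L" for v w1 w2 l1 l2
  proof -
    obtain a where a: "l1 = a \<odot>\<^bsub>L\<^esub> l" using has_dim_1_span[OF L l l12(1)] by blast
    obtain c where c: "l2 = c \<odot>\<^bsub>L\<^esub> l" using has_dim_1_span[OF L l l12(2)] by blast
    have q1: "q v w1 w2 = t v w1 w2" using w v p_id[OF v] \<chi>(3) UV by (auto simp: q_def)
    have pl: "pure_tensor L L l1 l2 = (a * c) \<odot>\<^bsub>?LL\<^esub> ?ll"
      using tensor.pure_smult_left[OF tLW(2) l(1) l12(2), of a] tensor.pure_smult_right[OF tLW(2) l(1) l(1), of c] ll a c by simp
    have vE: "ext_vec V v \<in> carrier E" using v UV by auto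
    have m1: "m w1 \<in> carrier E" "m w2 \<in> carrier E" "wedge V (m w1) (m w2) \<in> carrier E" using mE w by auto
    have "wedge V (ext_vec V v) (wedge V (gm_mu_pure D l1 w1) (gm_mu_pure D l2 w2))
      = (a * c) \<odot>\<^bsub>E\<^esub> wedge V (ext_vec V v) (wedge V (m w1) (m w2))"
      unfolding a c mup[OF w(1)] mup[OF w(2)]
      using m1 vE by (simp add: wedge_smult_left wedge_smult_right mult.commute)
    then have "ee (wedge V (ext_vec V v) (wedge V (gm_mu_pure D l1 w1) (gm_mu_pure D l2 w2))) = (a * c * t v w1 w2) \<odot>\<^bsub>?LL\<^esub> ?ll"
      using eps_smult[OF wep[OF v w]] by (simp add: ee_def t_def)
    then show ?thesis using q1 pl ll by (simp add: mult_ac)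
  qed
  \<comment> \<open>With \<open>W\<close> of dimension d the GM data has dimension d - 5, an integer
    that can be negative.\<close>
  have "is_gm_data_of_dim (int d - 5) D"
    unfolding is_gm_data_of_dim_def Ds
    using W dim hyp L mu q ee compat by auto
  then have D: "is_gm_data D" by (auto simp: is_gm_data_def)
  interpret G: gm_line D l using D l by unfold_locales (auto simp: Ds)
  show ?thesis
  proof (rule that[OF D Ds(1-4)])
    show "gm_mu_pure D l w = m w" if "w \<in> carrier W" for w using mup[OF that, of 1] l(1) mE[OF that] by simp
    show "gm_coef D l x = eps x" for x by (rule G.coef_eqI) (simp add: Ds ee_def)
    show "gm_q D v0 w w' = b w w'" if w: "w \<in> carrier W" "w' \<in> carrier W" for w w'
    proof -
      have "t \<zero> w w' = 0" using t_smult[of \<zero> \<zero> w w' 0] U_sub w by (simp add: subspace_iff)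
      then show ?thesis using w \<chi>(2) p_v0 by (simp add: Ds q_def)
    qed
  qed
qed

text \<open>A Lagrangian data has no \<epsilon>. The functional that is 1 on the top monomial of an
  adapted basis serves as one.\<close>

lemma (in adapted) volume:
  assumes n: "n = 5" and hyp: "hyperplane U V"
  obtains T where "volume_hyperplane V U v0 T"
proof -
  interpret X: kspace "ext_alg V" by (rule kspace_ext)
  obtain T where T: "functional E T" "T (eS {..<n}) = 1" "\<And>x. x \<in> ep n \<Longrightarrow> x = T x \<odot>\<^bsub>E\<^esub> eS {..<n}"
    using top_functional by metis
  have top: "eS {..<n} \<in> ep 5" using eS_pow[of "{..<n}"] n by simp
  have "volume_hyperplane V U v0 T"
  proof (unfold_locales)
    show "hyperplane U V" by (rule hyp)
    show "has_dim V 6" using frame_has_dim[OF fr] n by simp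
    show "v0 \<in> carrier V" using eV by simp
    show "v0 \<notin> U" using fr by (auto simp: U_iff frame_def)
    show "functional (ext_pow V U 5) T"
      using functional_add[OF T(1) pow_le_E pow_le_E] functional_smult[OF T(1) pow_le_E]
      unfolding functional_def ext_pow_carrier ext_pow_ops by blast
    show "x = \<zero>\<^bsub>E\<^esub>" if "x \<in> ep 5" "T x = 0" for x
      using T(3)[of x] that n pow_le_E[OF top] by simp
    show "\<exists>x\<in>ep 5. T x \<noteq> 0" using top T(2) by (metis zero_neq_one)
  qed
  then show ?thesis by (rule that)
qed

text \<open>The space \<open>W\<close> is a copy of the projection of \<open>A\<close> to \<open>\<And>\<^sup>2V\<^sub>5\<close>, plus a line in the special
  case.\<close>

lemma gm_construct:
  fixes \<Lambda> :: "('k::field, 'v) lag_data" and jw :: "'k \<Rightarrow> 'w" and jl :: "'k \<Rightarrow> 'l"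
  assumes \<Lambda>: "is_lag_data \<Lambda>" and k: "infinite (UNIV :: 'k set)" and j: "inj jw" "inj jl"
  obtains D :: "('k, 'w, 'v, 'l) gm_data" where "is_gm_data D" "gm_to_lag D = \<Lambda>" "if sp then gm_special D else gm_ordinary D"
proof -
  define V where "V = lag_V6 \<Lambda>"
  define U where "U = lag_V5 \<Lambda>"
  define A where "A = lag_A \<Lambda>"
  have \<Lambda>D: "has_dim V 6" "hyperplane U V" "lagrangian (ext_pow V (carrier V) 3) (wedge V) \<zero>\<^bsub>ext_alg V\<^esub> A"
    using \<Lambda> by (auto simp: is_lag_data_def V_def U_def A_def)
  obtain v0 where v0: "v0 \<in> carrier V" "v0 \<notin> U" using hyperplane_proper[OF \<Lambda>D(2)] .
  obtain e \<phi> where ad: "adapted V U 5 e \<phi>" "e 5 = v0" using adapted_exists[of U V 5 v0] \<Lambda>D(1,2) v0 by auto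
  obtain T where "volume_hyperplane V U v0 T" using adapted.volume[OF ad(1) refl \<Lambda>D(2)] ad(2) by auto
  then interpret VH: volume_hyperplane V U v0 T .
  define M where "M = VH.lag_base A"
  define \<beta> where "\<beta> = VH.lag_form A"
  have M: "subsp M (ext_pow V U 2)" unfolding M_def by (rule VH.lag_base_sub[OF \<Lambda>D(3)])
  interpret P: kspace "ext_pow V U 2" by (rule VH.kspace_ep)
  have MD: "M \<subseteq> VH.ep 2" "\<zero>\<^bsub>ext_alg V\<^esub> \<in> M" "\<And>x y. x \<in> M \<Longrightarrow> y \<in> M \<Longrightarrow> x \<oplus>\<^bsub>ext_alg V\<^esub> y \<in> M" "\<And>c x. x \<in> M \<Longrightarrow> c \<odot>\<^bsub>ext_alg V\<^esub> x \<in> M"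
    using M by (auto simp: P.subspace_iff ext_pow_carrier)
  have \<beta>: "functional ((ext_alg V)\<lparr>carrier := M\<rparr>) (\<beta> \<eta>)" if "\<eta> \<in> M" for \<eta>
    unfolding M_def \<beta>_def by (rule VH.lag_form_functional[OF \<Lambda>D(3)]) (use that M_def in simp)
  have \<beta>_sym: "\<beta> \<eta> \<eta>' = \<beta> \<eta>' \<eta>" if "\<eta> \<in> M" "\<eta>' \<in> M" for \<eta> \<eta>'
    unfolding \<beta>_def by (rule VH.lag_form_sym[OF \<Lambda>D(3)]) (use that M_def in auto)
  have \<beta>0: "\<beta> \<eta> \<zero>\<^bsub>ext_alg V\<^esub> = 0" if "\<eta> \<in> M" for \<eta>
    using functional_smult[OF \<beta>[OF that], of "\<zero>\<^bsub>ext_alg V\<^esub>" 0] MD(1,2) VH.ep_E kspace.zero_smult[OF VH.kspace_ext] by auto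
  \<comment> \<open>The factor for W1: the whole field for special data and 0 for ordinary data, so
    that both cases share one construction.\<close>
  define K where "K = (if sp then UNIV else {0 :: 'k})"
  let ?B = "direct_sum (ext_pow V U 2) (scalar_vs :: ('k, 'k) module)"
  obtain N h \<psi> where "frame (ext_pow V U 2) N h \<psi>" using VH.ep2_frame .
  from frame_sum_scalar[OF this] have B: "has_dim ?B (Suc N)" .
  interpret B: kspace ?B using B by (rule has_dim_kspace)
  have S: "subsp (M \<times> K) ?B"
    using MD by (auto simp: B.subspace_iff ext_pow_carrier K_def)
  obtain d where d: "has_dim (?B\<lparr>carrier := M \<times> K\<rparr>) d" using subspace_has_dim[OF B S] by blast
  \<comment> \<open>\<open>W\<close> is a copy of \<open>M \<times> K\<close> in the prescribed
    type; \<open>m\<close> and \<open>s\<close> below are its two projections.\<close>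
  obtain J and W :: "('k, 'w) module" where J: "lin_iso (?B\<lparr>carrier := M \<times> K\<rparr>) W J"
    using fin_dim_copy[OF d k j(1)] .
  have W: "has_dim W d" by (rule has_dim_iso[OF d J])
  interpret W: kspace W using W by (rule has_dim_kspace)
  define \<iota> where "\<iota> = inv_into (M \<times> K) J"
  have \<iota>: "lin_iso W (?B\<lparr>carrier := M \<times> K\<rparr>) \<iota>" using lin_iso_inv[OF J] by (simp add: \<iota>_def)
  define m where "m w = fst (\<iota> w)" for w
  define s where "s w = snd (\<iota> w)" for w
  have ms: "m w \<in> M" "s w \<in> K" if "w \<in> carrier W" for w
    using linear_map_closed[OF lin_iso_linear[OF \<iota>] that] by (auto simp: m_def s_def)
  have m_add: "m (x \<oplus>\<^bsub>W\<^esub> y) = m x \<oplus>\<^bsub>ext_alg V\<^esub> m y" and s_add: "s (x \<oplus>\<^bsub>W\<^esub> y) = s x + s y"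
    if "x \<in> carrier W" "y \<in> carrier W" for x y
    using linear_map_add[OF lin_iso_linear[OF \<iota>] that] by (auto simp: m_def s_def)
  have m_smult: "m (c \<odot>\<^bsub>W\<^esub> x) = c \<odot>\<^bsub>ext_alg V\<^esub> m x" and s_smult: "s (c \<odot>\<^bsub>W\<^esub> x) = c * s x"
    if "x \<in> carrier W" for x c
    using linear_map_smult[OF lin_iso_linear[OF \<iota>] that] by (auto simp: m_def s_def)
  have ms_zero: "m \<zero>\<^bsub>W\<^esub> = \<zero>\<^bsub>ext_alg V\<^esub>" "s \<zero>\<^bsub>W\<^esub> = 0"
    using linear_map_zero[OF lin_iso_linear[OF \<iota>]] by (auto simp: m_def s_def)
  have ms_inj: "x = y" if "x \<in> carrier W" "y \<in> carrier W" "m x = m y" "s x = s y" for x y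
    using lin_iso_bij[OF \<iota>] that unfolding bij_betw_def inj_on_def m_def s_def by (metis prod_eqI)
  have ms_surj: "\<exists>w\<in>carrier W. m w = \<eta> \<and> s w = a" if "\<eta> \<in> M" "a \<in> K" for \<eta> a
  proof -
    have "(\<eta>, a) \<in> \<iota> ` carrier W" using lin_iso_image[OF \<iota>] that by simp
    then show ?thesis by (auto simp: m_def s_def) (metis fst_conv snd_conv)
  qed
  have ml: "lin W (ext_pow V U 2) m"
    using W.kspace_axioms P.kspace_axioms ms MD(1) m_add m_smult by (auto simp: linear_map_iff ext_pow_carrier)
  \<comment> \<open>The orthogonal sum of the form on \<open>M\<close> read off from the Lagrangian
    subspace and the square form on \<open>K\<close>; the latter makes the form nonzero on W1 in the
    special case.\<close>
  define b where "b w w' = \<beta> (m w) (m w') + s w * s w'" for w w'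
  have bf: "functional W (b w)" if w: "w \<in> carrier W" for w
    unfolding functional_def
  proof (intro conjI ballI allI)
    fix x y c assume x: "x \<in> carrier W"
    show "b w (c \<odot>\<^bsub>W\<^esub> x) = c * b w x"
      using functional_smult[OF \<beta>[OF ms(1)[OF w]], of "m x" c] ms(1)[OF x] m_smult[OF x] s_smult[OF x] by (simp add: b_def algebra_simps)
    assume y: "y \<in> carrier W"
    show "b w (x \<oplus>\<^bsub>W\<^esub> y) = b w x + b w y"
      using functional_add[OF \<beta>[OF ms(1)[OF w]], of "m x" "m y"] ms(1)[OF x] ms(1)[OF y] m_add[OF x y] s_add[OF x y]
      by (simp add: b_def algebra_simps)
  qed
  have bs: "b w w' = b w' w" if "w \<in> carrier W" "w' \<in> carrier W" for w w'
    using \<beta>_sym[OF ms(1)[OF that(1)] ms(1)[OF that(2)]] by (simp add: b_def)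
  have sc: "has_dim (scalar_vs :: ('k, 'k) module) 1"
    unfolding has_dim_1_iff[OF kspace_scalar] by (intro bexI[of _ 1]) auto
  obtain JL and L :: "('k, 'l) module" where "lin_iso scalar_vs L JL" using fin_dim_copy[OF sc k j(2)] .
  from has_dim_iso[OF sc this] have L: "has_dim L 1" .
  then obtain l where l: "l \<in> carrier L" "l \<noteq> \<zero>\<^bsub>L\<^esub>" using has_dim_1_iff[OF has_dim_kspace[OF L]] by blast
  obtain D where D: "is_gm_data D" "gm_W D = W" "gm_V6 D = V" "gm_V5 D = U" "gm_L D = L"
    and Dm: "\<And>w. w \<in> carrier W \<Longrightarrow> gm_mu_pure D l w = m w" and De: "\<And>x. x \<in> VH.ep 5 \<Longrightarrow> gm_coef D l x = T x"
    and Dq: "\<And>w w'. w \<in> carrier W \<Longrightarrow> w' \<in> carrier W \<Longrightarrow> gm_q D v0 w w' = b w w'"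
    using VH.gm_build[OF W ml bf bs L l] by metis
  interpret G: gm_chosen D l v0 using D v0 l by unfold_locales auto
  have W1: "gm_W1 D = {w \<in> carrier W. m w = \<zero>\<^bsub>ext_alg V\<^esub>}"
    using G.W1_eq Dm D by auto
  have type: "if sp then gm_special D else gm_ordinary D"
  proof (cases sp)
    case False
    have "w = \<zero>\<^bsub>W\<^esub>" if "w \<in> carrier W" "m w = \<zero>\<^bsub>ext_alg V\<^esub>" for w
      using ms_inj[OF that(1) W.zeroC] ms(2)[OF that(1)] ms_zero that(2) False by (simp add: K_def)
    then have "gm_W1 D = {\<zero>\<^bsub>W\<^esub>}" unfolding W1 using ms_zero W.zeroC by blast
    then show ?thesis using False D by (simp add: gm_ordinary_def)
  next
    case True
    obtain w1 where w1: "w1 \<in> carrier W" "m w1 = \<zero>\<^bsub>ext_alg V\<^esub>" "s w1 = 1" using ms_surj[OF MD(2), of 1] True by (auto simp: K_def)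
    have w1W1: "w1 \<in> gm_W1 D" using w1 W1 by simp
    have "\<exists>c. w = c \<odot>\<^bsub>W\<^esub> w1" if w: "w \<in> gm_W1 D" for w
    proof -
      have "w = s w \<odot>\<^bsub>W\<^esub> w1"
        using w w1 W1 m_smult s_smult kspace.smult_zero[OF VH.kspace_ext] by (intro ms_inj) auto
      then show ?thesis ..
    qed
    moreover have "w1 \<noteq> \<zero>\<^bsub>W\<^esub>" using w1(3) ms_zero(2) by auto
    ultimately have dim1: "has_dim (W\<lparr>carrier := gm_W1 D\<rparr>) 1"
      using has_dim_1_iff[OF W.subspace_kspace[of "gm_W1 D"]] G.W1_sub D(2) w1W1 by auto
    have q1: "gm_q D v0 w1 w1 = 1" using Dq[OF w1(1) w1(1)] w1 \<beta>0[OF MD(2)] by (simp add: b_def)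
    \<comment> \<open>At v = u + c v0 the form has the value c at \<open>w1\<close>, because vectors
      of V5 contribute nothing on W1; and c is nonzero outside V5.\<close>
    have "\<exists>w\<in>gm_W1 D. gm_q D v w w \<noteq> 0" if v: "v \<in> carrier V - U" for v
    proof -
      have vG: "v \<in> carrier G.V" using v D(3) by simp
      obtain c u where "u \<in> G.U" "v = u \<oplus>\<^bsub>G.V\<^esub> c \<odot>\<^bsub>G.V\<^esub> v0" using G.decomp[OF vG] .
      then have u: "u \<in> U" "v = u \<oplus>\<^bsub>V\<^esub> c \<odot>\<^bsub>V\<^esub> v0" using D(3,4) by simp_all
      have c: "c \<noteq> 0" using u v v0 VH.UV by auto
      have "gm_q D v w1 w1 = c"
        using G.q_add[of u "c \<odot>\<^bsub>V\<^esub> v0" w1 w1] G.q_smult[of v0 c w1 w1] G.q_U_W1[of u w1 w1] u v0 w1 w1W1 q1 D VH.UV by auto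
      then show ?thesis using c w1W1 by blast
    qed
    then show ?thesis using True dim1 D by (auto simp: gm_special_def)
  qed
  then have lci: "gm_lci D" by (auto simp: gm_lci_def split: if_splits)
  interpret G: gm_lci_chosen D l v0 using lci by unfold_locales
  \<comment> \<open>W0 is the copy of \<open>M\<close>: on W1 the projection \<open>m\<close>
    vanishes, so orthogonality to W1 constrains \<open>s\<close> alone.\<close>
  have perp: "G.perp = {w \<in> carrier W. s w = 0}"
  proof (cases sp)
    case True
    obtain w1 where w1: "w1 \<in> carrier W" "m w1 = \<zero>\<^bsub>ext_alg V\<^esub>" "s w1 = 1" using ms_surj[OF MD(2), of 1] True by (auto simp: K_def)
    have "gm_q D v0 w x = s w * s x" if "w \<in> carrier W" "x \<in> gm_W1 D" for w x
      using Dq[OF that(1)] that \<beta>0[OF ms(1)[OF that(1)]] by (simp add: W1 b_def)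
    then have "(\<forall>x\<in>gm_W1 D. gm_q D v0 w x = 0) \<longleftrightarrow> s w = 0" if "w \<in> carrier W" for w
      using w1 that by (auto simp: W1 dest: bspec[of _ _ w1])
    then show ?thesis by (auto simp: G.perp_def D)
  next
    case False
    have "gm_q D v0 w x = 0" if "w \<in> carrier W" "x \<in> gm_W1 D" for w x
      using Dq[OF that(1)] that \<beta>0[OF ms(1)[OF that(1)]] ms(2)[OF that(1)] False by (simp add: W1 b_def K_def)
    then show ?thesis using ms(2) False by (auto simp: G.perp_def D K_def)
  qed
  have "gm_A D = gm_A_of D v0 l"
    by (rule gm_A_eq[OF D(1) lci]) (use v0 l D in \<open>simp add: gm_choice_def\<close>)
  also have "\<dots> = VH.graph_lag M (\<lambda>\<eta>. \<eta>) \<beta>"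
  proof -
    have K0: "0 \<in> K" by (simp add: K_def)
    have mM: "M = m ` {w \<in> carrier W. s w = 0}" using ms_surj[OF _ K0] ms(1) by blast
    have cond: "(G.cf (wedge V \<xi> (gm_mu_pure D l w')) + gm_q D v0 w w' = 0) \<longleftrightarrow> (T (wedge V \<xi> (m w')) + \<beta> (m w) (m w') = 0)"
      if "\<xi> \<in> VH.ep 3" "w \<in> carrier W" "s w = 0" "w' \<in> carrier W" for \<xi> w w'
      using that Dm[OF that(4)] De[OF VH.wedge32[OF that(1)], of "m w'"] Dq[OF that(2,4)] ms(1)[OF that(4)] MD(1) by (auto simp: b_def)
    show ?thesis
    proof (rule Set.set_eqI)
      fix x
      have "x \<in> gm_A_of D v0 l \<longleftrightarrow> (\<exists>\<xi> w. x = \<xi> \<oplus>\<^bsub>ext_alg V\<^esub> wedge V (ext_vec V v0) (gm_mu_pure D l w) \<and> \<xi> \<in> VH.ep 3 \<and> (w \<in> carrier W \<and> s w = 0) \<and>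
         (\<forall>w'. w' \<in> carrier W \<and> s w' = 0 \<longrightarrow> G.cf (wedge V \<xi> (gm_mu_pure D l w')) + gm_q D v0 w w' = 0))"
        unfolding G.A_of_eq G.VH.graph_lag_def perp by (auto simp: D)
      also have "\<dots> \<longleftrightarrow> (\<exists>\<xi> w. x = \<xi> \<oplus>\<^bsub>ext_alg V\<^esub> wedge V (ext_vec V v0) (m w) \<and> \<xi> \<in> VH.ep 3 \<and> (w \<in> carrier W \<and> s w = 0) \<and>
         (\<forall>w'. w' \<in> carrier W \<and> s w' = 0 \<longrightarrow> T (wedge V \<xi> (m w')) + \<beta> (m w) (m w') = 0))"
        by (intro ex_cong1) (use Dm cond in auto)
      also have "\<dots> \<longleftrightarrow> x \<in> VH.graph_lag M (\<lambda>\<eta>. \<eta>) \<beta>"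
        unfolding VH.graph_lag_def by (auto simp: mM)
      finally show "x \<in> gm_A_of D v0 l \<longleftrightarrow> x \<in> VH.graph_lag M (\<lambda>\<eta>. \<eta>) \<beta>" .
    qed
  qed
  also have "\<dots> = A" using VH.lag_eq_graph[OF \<Lambda>D(3)] by (simp add: M_def \<beta>_def)
  finally have "gm_to_lag D = \<Lambda>" using D by (simp add: gm_to_lag_def V_def U_def A_def)
  then show ?thesis using that D(1) type by blast
qed

section \<open>Isomorphism classes\<close>

lemma (in groupoid) iso_rel_equiv: "equiv (gpd_obj G) (gpd_iso_rel G)"
proof (rule equivI)
  show "gpd_iso_rel G \<subseteq> gpd_obj G \<times> gpd_obj G" by (auto simp: gpd_iso_rel_def)
  show "refl_on (gpd_obj G) (gpd_iso_rel G)" using id_hom by (auto simp: refl_on_def gpd_iso_rel_def)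
  show "sym (gpd_iso_rel G)" using inverse by (fastforce simp: sym_def gpd_iso_rel_def)
  show "trans (gpd_iso_rel G)"
  proof (rule transI)
    fix X Y Z assume "(X, Y) \<in> gpd_iso_rel G" "(Y, Z) \<in> gpd_iso_rel G"
    then show "(X, Z) \<in> gpd_iso_rel G" using comp_hom[of X Y Z] by (fastforce simp: gpd_iso_rel_def)
  qed
qed

text \<open>The assignment is a relation \<open>R\<close>, since A1 is determined only up to
  isomorphism in the special case. Saturation uses \<open>s'\<close>, which may live on a larger set
  than \<open>B\<close>: \<open>gm_ext_on_classes\<close> saturates among all extended Lagrangian
  data.\<close>

lemma bij_betw_quotients:
  assumes A: "equiv A r" and B: "equiv B s"
    and B_mem: "\<And>D E. D \<in> A \<Longrightarrow> R D E \<Longrightarrow> E \<in> B" and total: "\<And>D. D \<in> A \<Longrightarrow> \<exists>E. R D E" and surj: "\<And>E. E \<in> B \<Longrightarrow> \<exists>D\<in>A. R D E"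
    and iff: "\<And>D D' E E'. D \<in> A \<Longrightarrow> D' \<in> A \<Longrightarrow> R D E \<Longrightarrow> R D' E' \<Longrightarrow> (D, D') \<in> r \<longleftrightarrow> (E, E') \<in> s"
    and s': "\<And>E. E \<in> B \<Longrightarrow> s' `` {E} = s `` {E}"
  shows "bij_betw (\<lambda>C. \<Union>D\<in>C. s' `` {E. R D E}) (A // r) (B // s)"
proof -
  let ?F = "\<lambda>C. \<Union>D\<in>C. s' `` {E. R D E}"
  have rA: "r \<subseteq> A \<times> A" and r_refl: "D \<in> A \<Longrightarrow> (D, D) \<in> r" for D using A by (auto simp: equiv_def refl_on_def)
  \<comment> \<open>By \<open>iff\<close>, everything related to a member of the class of
    \<open>D\<close> lies in the one class of \<open>E\<close>.\<close>
  have val: "?F (r `` {D}) = s `` {E}" if D: "D \<in> A" and E: "R D E" for D E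
  proof
    show "?F (r `` {D}) \<subseteq> s `` {E}"
    proof
      fix F assume "F \<in> ?F (r `` {D})"
      then obtain D' E' where D': "(D, D') \<in> r" "R D' E'" "F \<in> s' `` {E'}" by blast
      have A': "D' \<in> A" using rA D'(1) by blast
      have "(E, E') \<in> s" using iff[OF D A' E D'(2)] D'(1) by simp
      moreover have "(E', F) \<in> s" using s'[OF B_mem[OF A' D'(2)]] D'(3) by simp
      ultimately show "F \<in> s `` {E}" using B unfolding equiv_def trans_def by blast
    qed
    show "s `` {E} \<subseteq> ?F (r `` {D})" using s'[OF B_mem[OF D E]] r_refl[OF D] E by blast
  qed
  show ?thesis
    unfolding bij_betw_def
  proof
    show "inj_on ?F (A // r)"
    proof (rule inj_onI)
      fix C C' assume C: "C \<in> A // r" "C' \<in> A // r" and eq: "?F C = ?F C'"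
      obtain D where D: "D \<in> A" "C = r `` {D}" using C(1) by (auto elim: quotientE)
      obtain D' where D': "D' \<in> A" "C' = r `` {D'}" using C(2) by (auto elim: quotientE)
      obtain E where E: "R D E" using total[OF D(1)] by blast
      obtain E' where E': "R D' E'" using total[OF D'(1)] by blast
      have "s `` {E} = s `` {E'}" using eq val[OF D(1) E] val[OF D'(1) E'] D(2) D'(2) by simp
      then have "(E, E') \<in> s" using eq_equiv_class[OF _ B B_mem[OF D'(1) E']] by blast
      then have "(D, D') \<in> r" using iff[OF D(1) D'(1) E E'] by simp
      then show "C = C'" using equiv_class_eq[OF A] D(2) D'(2) by simp
    qed
    show "?F ` (A // r) = B // s"
    proof
      show "?F ` (A // r) \<subseteq> B // s"
      proof
        fix X assume "X \<in> ?F ` (A // r)"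
        then obtain D where D: "D \<in> A" "X = ?F (r `` {D})" by (auto elim!: quotientE)
        obtain E where E: "R D E" using total[OF D(1)] by blast
        show "X \<in> B // s" unfolding D(2) val[OF D(1) E] by (rule quotientI[OF B_mem[OF D(1) E]])
      qed
      show "B // s \<subseteq> ?F ` (A // r)"
      proof
        fix X assume "X \<in> B // s"
        then obtain E where E: "E \<in> B" "X = s `` {E}" by (auto elim: quotientE)
        obtain D where D: "D \<in> A" "R D E" using surj[OF E(1)] by blast
        then have "X = ?F (r `` {D})" using val[OF D] E(2) by simp
        then show "X \<in> ?F ` (A // r)" using quotientI[OF D(1)] by blast
      qed
    qed
  qed
qed

section \<open>Extended Lagrangian data\<close>

locale lag =
  fixes \<Lambda> :: "('k::field, 'v) lag_data"
  assumes data: "is_lag_data \<Lambda>"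
begin

abbreviation "V \<equiv> lag_V6 \<Lambda>"
abbreviation "U \<equiv> lag_V5 \<Lambda>"
abbreviation "L \<equiv> lag_L \<Lambda>"

sublocale kquot V U
  using lag_data_basics(1)[OF data] data by (intro kquot.intro kquot_axioms.intro) (auto simp: is_lag_data_def hyperplane_def)

lemma L_iff: "z \<in> carrier L \<longleftrightarrow> functional Q z \<and> (\<forall>C. C \<notin> carrier Q \<longrightarrow> z C = 0)"
  by (simp add: lag_L_def dual_iff)

lemma L_simps[simp]: "zero L = (\<lambda>C. 0)" "x \<oplus>\<^bsub>L\<^esub> y = (\<lambda>C. x C + y C)" "c \<odot>\<^bsub>L\<^esub> x = (\<lambda>C. c * x C)"
  by (simp_all add: lag_L_def)

lemma kspace_L: "kspace L"
  unfolding lag_L_def by (rule kspace_dual)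

text \<open>The equation \<open>\<phi> 5\<close> of \<open>U\<close> descends to the quotient and is
  extended by 0 to sets that are not cosets, as \<open>dual_vs\<close> requires. The quotient is
  spanned by the class of \<open>v0\<close>, so its dual is spanned by this one functional.\<close>

lemma L_generator:
  obtains z where "z \<in> carrier L" "z \<noteq> (\<lambda>C. 0)" "\<And>x. x \<in> carrier L \<Longrightarrow> \<exists>c. x = (\<lambda>C. c * z C)"
proof -
  have hyp: "hyperplane U V" "has_dim V (Suc 5)" using data by (auto simp: is_lag_data_def)
  obtain v0 where v0: "v0 \<in> carrier V" "v0 \<notin> U" using hyperplane_proper[OF hyp(1)] .
  obtain e \<phi> where fr: "frame V (Suc 5) e \<phi>" "e 5 = v0" "\<And>x. x \<in> carrier V \<Longrightarrow> x \<in> U \<longleftrightarrow> \<phi> 5 x = 0"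
    using hyperplane_frame[OF hyp v0] by metis
  have \<phi>: "functional V (\<phi> 5)" "\<phi> 5 v0 = 1" using fr by (auto simp: frame_def)
  obtain g where g: "functional Q g" "\<And>v. v \<in> carrier V \<Longrightarrow> g (cl v) = \<phi> 5 v"
    using functional_Q[OF \<phi>(1)] fr(3) UD(1) by metis
  define z where "z C = (if C \<in> carrier Q then g C else 0)" for C
  interpret Q: kspace Q by (rule kspace_Q)
  have clQ: "cl v \<in> carrier Q" if "v \<in> carrier V" for v using that carrier_Q by blast
  have z_cl: "z (cl v) = \<phi> 5 v" if "v \<in> carrier V" for v using g(2)[OF that] clQ[OF that] by (simp add: z_def)
  have "z \<in> carrier L"
    unfolding L_iff using g(1) by (simp add: functional_def z_def)
  moreover have "z \<noteq> (\<lambda>C. 0)" using z_cl[OF v0(1)] \<phi>(2) by auto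
  moreover have "\<exists>c. x = (\<lambda>C. c * z C)" if x: "x \<in> carrier L" for x
  proof -
    have xf: "functional Q x" "\<And>C. C \<notin> carrier Q \<Longrightarrow> x C = 0" using x by (auto simp: L_iff)
    have "x C = x (cl v0) * z C" for C
    proof (cases "C \<in> carrier Q")
      case True
      then obtain v where v: "v \<in> carrier V" "C = cl v" using carrier_Q by blast
      have "v \<oplus>\<^bsub>V\<^esub> (-1) \<odot>\<^bsub>V\<^esub> (\<phi> 5 v \<odot>\<^bsub>V\<^esub> v0) \<in> U"
        using v(1) v0(1) \<phi>(2) fr(3) by (simp add: functional_add[OF \<phi>(1)] functional_smult[OF \<phi>(1)])
      then have "C = \<phi> 5 v \<odot>\<^bsub>Q\<^esub> cl v0" using cl_eq[of v "\<phi> 5 v \<odot>\<^bsub>V\<^esub> v0"] v v0(1) smult_Q[OF v0(1)] by simp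
      then show ?thesis using functional_smult[OF xf(1) clQ[OF v0(1)]] z_cl[OF v(1)] v(2) by simp
    qed (simp add: xf z_def)
    then show ?thesis by blast
  qed
  ultimately show ?thesis by (rule that)
qed

lemma kL_simps: "carrier (lag_kL \<Lambda>) = UNIV \<times> carrier L" "zero (lag_kL \<Lambda>) = (0, \<lambda>C. 0)"
  "(a, x) \<oplus>\<^bsub>lag_kL \<Lambda>\<^esub> (b, y) = (a + b, \<lambda>C. x C + y C)" "c \<odot>\<^bsub>lag_kL \<Lambda>\<^esub> (a, x) = (c * a, \<lambda>C. c * x C)"
  by (simp_all add: lag_kL_def)

lemma kspace_kL: "kspace (lag_kL \<Lambda>)"
  unfolding lag_kL_def by (rule kspace_direct_sum[OF kspace_scalar kspace_L])

text \<open>The line spanned by (1, z). Every Lagrangian line other than L is of this form, and z =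
  0 gives the line k, so z locates A1 among the lines different from L.\<close>

definition slope :: "('v set \<Rightarrow> 'k) \<Rightarrow> ('k \<times> ('v set \<Rightarrow> 'k)) set" where
  "slope z = (\<lambda>b. (b, \<lambda>C. b * z C)) ` UNIV"

lemma slope_mem: "(b, y) \<in> slope z \<longleftrightarrow> y = (\<lambda>C. b * z C)"
  by (auto simp: slope_def)

lemma L_closed: "(\<lambda>C. 0) \<in> carrier L" "x \<in> carrier L \<Longrightarrow> y \<in> carrier L \<Longrightarrow> (\<lambda>C. x C + y C) \<in> carrier L"
  "x \<in> carrier L \<Longrightarrow> (\<lambda>C. c * x C) \<in> carrier L"
  using kspace.zeroC[OF kspace_L] kspace.addC[OF kspace_L] kspace.smultC[OF kspace_L] by auto

lemma lagrangian_slope: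
  assumes z: "z \<in> carrier L"
  shows "lagrangian (lag_kL \<Lambda>) kL_form \<zero>\<^bsub>L\<^esub> (slope z)"
  unfolding lagrangian_def
proof
  show "subsp (slope z) (lag_kL \<Lambda>)"
    unfolding kspace.subspace_iff[OF kspace_kL]
    using L_closed(3)[OF z] by (auto simp: kL_simps slope_def algebra_simps)
  show "slope z = {x \<in> carrier (lag_kL \<Lambda>). \<forall>a\<in>slope z. kL_form x a = \<zero>\<^bsub>L\<^esub>}" (is "_ = ?P")
  proof (intro Set.set_eqI iffI)
    fix p assume "p \<in> slope z"
    then show "p \<in> ?P" using L_closed(3)[OF z] by (auto simp: slope_def kL_simps kL_form_def)
  next
    fix p assume P: "p \<in> ?P"
    have "(1, z) \<in> slope z" by (simp add: slope_mem)
    then have "kL_form p (1, z) = \<zero>\<^bsub>L\<^esub>" using P by blast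
    then show "p \<in> slope z" by (cases p) (simp add: kL_form_def slope_mem fun_eq_iff)
  qed
qed

lemma lagrangian_zero: "lagrangian (lag_kL \<Lambda>) kL_form \<zero>\<^bsub>L\<^esub> ({0} \<times> carrier L)"
  unfolding lagrangian_def
proof
  show "subsp ({0} \<times> carrier L) (lag_kL \<Lambda>)"
    unfolding kspace.subspace_iff[OF kspace_kL] using L_closed by (auto simp: kL_simps)
  obtain z where z: "z \<in> carrier L" "z \<noteq> (\<lambda>C. 0)" using L_generator by blast
  then obtain C where C: "z C \<noteq> 0" by auto
  show "{0} \<times> carrier L = {x \<in> carrier (lag_kL \<Lambda>). \<forall>a\<in>{0} \<times> carrier L. kL_form x a = \<zero>\<^bsub>L\<^esub>}" (is "_ = ?P")
  proof (intro Set.set_eqI iffI)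
    fix p :: "'k \<times> ('v set \<Rightarrow> 'k)" assume "p \<in> {0} \<times> carrier L"
    then show "p \<in> ?P" by (auto simp: kL_simps kL_form_def)
  next
    fix p assume "p \<in> ?P"
    then have p: "snd p \<in> carrier L" "kL_form p (0, z) = \<zero>\<^bsub>L\<^esub>" using z(1) by (auto simp: kL_simps)
    have "fst p * z C = 0" using fun_cong[OF p(2), of C] by (simp add: kL_form_def case_prod_beta)
    then show "p \<in> {0} \<times> carrier L" using C p(1) by (cases p) simp
  qed
qed

text \<open>If all first components vanish, \<open>S\<close> is contained in L, which is isotropic,
  so maximality gives equality. Otherwise \<open>S\<close> contains some (1, z) after scaling, and
  isotropy against this vector puts \<open>S\<close> inside its slope.\<close>

lemma lagrangian_cases:
  assumes S: "lagrangian (lag_kL \<Lambda>) kL_form \<zero>\<^bsub>L\<^esub> S"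
  obtains "S = {0} \<times> carrier L" | z where "z \<in> carrier L" "S = slope z"
proof -
  have sub: "S \<subseteq> UNIV \<times> carrier L" "\<And>c p. p \<in> S \<Longrightarrow> c \<odot>\<^bsub>lag_kL \<Lambda>\<^esub> p \<in> S"
    using S unfolding lagrangian_def kspace.subspace_iff[OF kspace_kL] kL_simps by blast+
  have iso: "kL_form p p' = (\<lambda>C. 0)" if "p \<in> S" "p' \<in> S" for p p'
    using S that unfolding lagrangian_def L_simps by blast
  have max: "p \<in> S" if "p \<in> UNIV \<times> carrier L" "\<forall>p'\<in>S. kL_form p p' = (\<lambda>C. 0)" for p
    using S that unfolding lagrangian_def L_simps kL_simps by blast
  show ?thesis
  proof (cases "\<forall>p\<in>S. fst p = 0")
    case True
    have "S = {0} \<times> carrier L"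
    proof
      show "S \<subseteq> {0} \<times> carrier L" using True sub(1) by fastforce
      show "{0} \<times> carrier L \<subseteq> S"
      proof
        fix p :: "'k \<times> ('v set \<Rightarrow> 'k)" assume "p \<in> {0} \<times> carrier L"
        then show "p \<in> S" using True by (intro max) (auto simp: kL_form_def)
      qed
    qed
    then show ?thesis by (rule that(1))
  next
    case False
    then obtain a x where p: "(a, x) \<in> S" "a \<noteq> 0" by auto
    define z where "z = (\<lambda>C. inverse a * x C)"
    have z1: "(1, z) \<in> S" using sub(2)[OF p(1), of "inverse a"] p(2) by (simp add: kL_simps z_def)
    then have z: "z \<in> carrier L" using sub(1) by blast
    have "S = slope z"
    proof (intro Set.set_eqI iffI)
      fix p assume "p \<in> S"
      from iso[OF this z1] show "p \<in> slope z" by (cases p) (simp add: kL_form_def slope_mem fun_eq_iff)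
    next
      fix p assume "p \<in> slope z"
      then show "p \<in> S" using sub(2)[OF z1, of "fst p"] by (cases p) (simp add: kL_simps slope_mem)
    qed
    with z show ?thesis by (rule that(2))
  qed
qed

lemma slope_infinity: "slope z = UNIV \<times> {\<zero>\<^bsub>L\<^esub>} \<longleftrightarrow> z = (\<lambda>C. 0)"
proof
  assume "slope z = UNIV \<times> {\<zero>\<^bsub>L\<^esub>}"
  moreover have "(1, z) \<in> slope z" by (simp add: slope_mem)
  ultimately show "z = (\<lambda>C. 0)" by simp
qed (auto simp: slope_def)

lemma slope_not_zero: "slope z \<noteq> {0} \<times> X"
proof -
  have "(1, z) \<in> slope z" "(1, z) \<notin> {0 :: 'k} \<times> X" by (simp_all add: slope_mem)
  then show ?thesis by blast
qed

lemma zero_not_infinity: "{0 :: 'k} \<times> X \<noteq> UNIV \<times> Y" if "y \<in> (Y :: ('v set \<Rightarrow> 'k) set)"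
proof -
  have "(1, y) \<in> UNIV \<times> Y" "(1, y) \<notin> {0 :: 'k} \<times> X" using that by simp_all
  then show ?thesis by blast
qed

end

lemma ext_lag_cases:
  assumes E: "is_ext_lag_data E"
  obtains (zero) "snd E = {0} \<times> carrier (lag_L (fst E))" "A1_zero E" "\<not> A1_infinity E" "\<not> A1_one E"
    | (slope) z where "z \<in> carrier (lag_L (fst E))" "snd E = lag.slope z" "\<not> A1_zero E" "A1_infinity E \<longleftrightarrow> z = (\<lambda>C. 0)"
        "A1_one E \<longleftrightarrow> z \<noteq> (\<lambda>C. 0)"
proof -
  interpret lag "fst E" using E by unfold_locales (simp add: is_ext_lag_data_def)
  have "lagrangian (lag_kL (fst E)) kL_form \<zero>\<^bsub>L\<^esub> (snd E)" using E by (simp add: is_ext_lag_data_def)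
  then show ?thesis
  proof (rule lagrangian_cases)
    assume S: "snd E = {0} \<times> carrier L"
    show ?thesis
      by (rule zero) (use S zero_not_infinity[of "\<zero>\<^bsub>L\<^esub>" "{\<zero>\<^bsub>L\<^esub>}"] in \<open>auto simp: A1_zero_def A1_infinity_def A1_one_def\<close>)
  next
    fix z assume z: "z \<in> carrier L" "snd E = slope z"
    show ?thesis
      by (rule slope[OF z]) (use z slope_not_zero slope_infinity in \<open>auto simp: A1_zero_def A1_infinity_def A1_one_def\<close>)
  qed
qed

section \<open>Transport of L along an isomorphism of Lagrangian data\<close>

context
  fixes \<Lambda> \<Lambda>' :: "('k::field, 'v) lag_data" and g
  assumes data: "is_lag_data \<Lambda>" "is_lag_data \<Lambda>'" and g: "g \<in> lag_iso \<Lambda> \<Lambda>'"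
begin

interpretation A: lag \<Lambda> using data(1) by unfold_locales
interpretation B: lag \<Lambda>' using data(2) by unfold_locales

abbreviation "lmap \<equiv> lag_L_map \<Lambda> \<Lambda>' g"

text \<open>The preimage of the coset of \<open>g v\<close> is the coset of \<open>v\<close>, since
  g is injective and maps one hyperplane onto the other. This rule determines \<open>lmap x\<close>
  on all cosets, as g is surjective.\<close>

lemma lag_L_map_cl:
  assumes v: "v \<in> carrier A.V"
  shows "lmap x (B.cl (g v)) = x (A.cl v)"
proof -
  have gi: "lin_iso A.V B.V g" "g ` A.U = B.U" using g by (auto simp: lag_iso_def)
  note gl = lin_iso_linear[OF gi(1)]
  have gv: "g v \<in> carrier B.V" using linear_map_closed[OF gl v] .
  have "g u \<oplus>\<^bsub>B.V\<^esub> (-1) \<odot>\<^bsub>B.V\<^esub> g v \<in> B.U \<longleftrightarrow> u \<oplus>\<^bsub>A.V\<^esub> (-1) \<odot>\<^bsub>A.V\<^esub> v \<in> A.U" if u: "u \<in> carrier A.V" for u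
  proof -
    have d: "u \<oplus>\<^bsub>A.V\<^esub> (-1) \<odot>\<^bsub>A.V\<^esub> v \<in> carrier A.V" using u v by simp
    have "g u \<oplus>\<^bsub>B.V\<^esub> (-1) \<odot>\<^bsub>B.V\<^esub> g v = g (u \<oplus>\<^bsub>A.V\<^esub> (-1) \<odot>\<^bsub>A.V\<^esub> v)"
      using linear_map_add[OF gl u, of "(-1) \<odot>\<^bsub>A.V\<^esub> v"] linear_map_smult[OF gl v] v by simp
    moreover have "g x \<in> g ` A.U \<longleftrightarrow> x \<in> A.U" if "x \<in> carrier A.V" for x
      using inj_on_image_mem_iff[OF bij_betw_imp_inj_on[OF lin_iso_bij[OF gi(1)]] that] A.UD(1) by blast
    ultimately show ?thesis using d gi(2) by simp
  qed
  then have "{u \<in> carrier A.V. g u \<in> B.cl (g v)} = A.cl v"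
    using A.cl_mem[OF v] B.cl_mem[OF gv] linear_map_closed[OF gl] by auto
  moreover have "B.cl (g v) \<in> carrier B.Q" using gv B.carrier_Q by blast
  ultimately show ?thesis by (simp add: lag_L_map_def)
qed

lemma lag_L_map_cosets:
  assumes "C \<in> carrier B.Q"
  shows "\<exists>v\<in>carrier A.V. C = B.cl (g v)"
proof -
  obtain v' where "v' \<in> carrier B.V" "C = B.cl v'" using assms B.carrier_Q by blast
  moreover have "lin_iso A.V B.V g" using g by (simp add: lag_iso_def)
  then have "g ` carrier A.V = carrier B.V" by (rule lin_iso_image)
  ultimately show ?thesis by (metis imageE)
qed

lemma lag_L_map_closed:
  assumes x: "x \<in> carrier A.L"
  shows "lmap x \<in> carrier B.L"
proof -
  have gl: "lin A.V B.V g" using g lin_iso_linear by (auto simp: lag_iso_def)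
  have xf: "functional A.Q x" using x by (simp add: A.L_iff)
  have clQ: "A.cl v \<in> carrier A.Q" if "v \<in> carrier A.V" for v using that A.carrier_Q by blast
  have "functional B.Q (lmap x)"
    unfolding functional_def
  proof (intro conjI ballI allI)
    fix C D c assume C: "C \<in> carrier B.Q"
    obtain u where u: "u \<in> carrier A.V" "C = B.cl (g u)" using lag_L_map_cosets[OF C] by blast
    note gu = linear_map_closed[OF gl u(1)]
    have "c \<odot>\<^bsub>B.Q\<^esub> C = B.cl (g (c \<odot>\<^bsub>A.V\<^esub> u))"
      using B.smult_Q[OF gu] linear_map_smult[OF gl u(1)] u(2) by simp
    then show "lmap x (c \<odot>\<^bsub>B.Q\<^esub> C) = c * lmap x C"
      using lag_L_map_cl[of "c \<odot>\<^bsub>A.V\<^esub> u" x] lag_L_map_cl[OF u(1), of x] u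
        A.smult_Q[OF u(1), of c] functional_smult[OF xf clQ[OF u(1)], of c] by simp
    assume D: "D \<in> carrier B.Q"
    obtain v where v: "v \<in> carrier A.V" "D = B.cl (g v)" using lag_L_map_cosets[OF D] by blast
    note gv = linear_map_closed[OF gl v(1)]
    have "C \<oplus>\<^bsub>B.Q\<^esub> D = B.cl (g (u \<oplus>\<^bsub>A.V\<^esub> v))"
      using B.add_Q[OF gu gv] linear_map_add[OF gl u(1) v(1)] u(2) v(2) by simp
    then show "lmap x (C \<oplus>\<^bsub>B.Q\<^esub> D) = lmap x C + lmap x D"
      using lag_L_map_cl[of "u \<oplus>\<^bsub>A.V\<^esub> v" x] lag_L_map_cl[OF u(1), of x] lag_L_map_cl[OF v(1), of x] u v
        A.add_Q[OF u(1) v(1)] functional_add[OF xf clQ[OF u(1)] clQ[OF v(1)]] by simp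
  qed
  then show ?thesis by (simp add: B.L_iff lag_L_map_def)
qed

lemma lag_L_map_eq_zero:
  assumes x: "x \<in> carrier A.L"
  shows "lmap x = (\<lambda>C. 0) \<longleftrightarrow> x = (\<lambda>C. 0)"
proof
  assume z: "lmap x = (\<lambda>C. 0)"
  have "x C = 0" for C
  proof (cases "C \<in> carrier A.Q")
    case True
    then obtain v where "v \<in> carrier A.V" "C = A.cl v" using A.carrier_Q by blast
    then show ?thesis using lag_L_map_cl[of v x] z by simp
  qed (use x in \<open>simp add: A.L_iff\<close>)
  then show "x = (\<lambda>C. 0)" by blast
qed (simp add: lag_L_map_def)

lemma lag_L_map_smult: "lmap (\<lambda>C. c * x C) = (\<lambda>C. c * lmap x C)"
  by (auto simp: lag_L_map_def)

lemma lag_L_map_span: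
  assumes x: "x \<in> carrier A.L" "x \<noteq> (\<lambda>C. 0)" and y: "y \<in> carrier B.L"
  obtains c where "y = (\<lambda>C. c * lmap x C)"
proof -
  obtain z where z: "z \<in> carrier B.L" "z \<noteq> (\<lambda>C. 0)" "\<And>x. x \<in> carrier B.L \<Longrightarrow> \<exists>c. x = (\<lambda>C. c * z C)"
    using B.L_generator by metis
  obtain a where a: "lmap x = (\<lambda>C. a * z C)" using z(3)[OF lag_L_map_closed[OF x(1)]] by blast
  have "a \<noteq> 0" using a lag_L_map_eq_zero[OF x(1)] x(2) by auto
  moreover obtain b where "y = (\<lambda>C. b * z C)" using z(3)[OF y] by blast
  ultimately have "y = (\<lambda>C. (b / a) * lmap x C)" using a by simp
  then show ?thesis by (rule that)
qed

end

text \<open>The scalars t fix the lines k and L and permute the other lines transitively, L having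
  dimension one. So over a given isomorphism of Lagrangian data the type of A1 is the only
  obstruction.\<close>

lemma ext_lag_iso_iff:
  assumes E: "is_ext_lag_data E" and E': "is_ext_lag_data E'"
  shows "ext_lag_iso E E' \<noteq> {} \<longleftrightarrow> lag_iso (fst E) (fst E') \<noteq> {} \<and> (A1_zero E \<longleftrightarrow> A1_zero E') \<and> (A1_infinity E \<longleftrightarrow> A1_infinity E')"
proof -
  have d: "is_lag_data (fst E)" "is_lag_data (fst E')" using E E' by (auto simp: is_ext_lag_data_def)
  interpret A: lag "fst E" using d by unfold_locales
  interpret B: lag "fst E'" using d by unfold_locales
  let ?P = "\<lambda>g t. (\<lambda>(a, x). (a, t \<odot>\<^bsub>B.L\<^esub> lag_L_map (fst E) (fst E') g x)) ` snd E = snd E'"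
  have iff: "(\<exists>t. t \<noteq> 0 \<and> ?P g t) \<longleftrightarrow> (A1_zero E \<longleftrightarrow> A1_zero E') \<and> (A1_infinity E \<longleftrightarrow> A1_infinity E')"
    if g: "g \<in> lag_iso (fst E) (fst E')" for g
  proof -
    note closed = lag_L_map_closed[OF d g] and eq0 = lag_L_map_eq_zero[OF d g] and span = lag_L_map_span[OF d g]
      and smult = lag_L_map_smult[OF d g]
    let ?l = "lag_L_map (fst E) (fst E') g"
    have img: "(\<lambda>(a, x). (a, t \<odot>\<^bsub>B.L\<^esub> ?l x)) ` A.slope z = A.slope (\<lambda>C. t * ?l z C)" for t z
      by (auto simp: A.slope_def image_image smult mult_ac)
    have inj: "z = z'" if "A.slope z = A.slope z'" for z z' :: "'b set \<Rightarrow> 'a"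
    proof -
      have "(1, z) \<in> A.slope z'" using that A.slope_mem[of 1 z z] by simp
      then show ?thesis by (simp add: A.slope_mem)
    qed
    show ?thesis
      using E
    proof (cases rule: ext_lag_cases)
      case zero
      have "(\<lambda>(a, x). (a, t \<odot>\<^bsub>B.L\<^esub> ?l x)) ` ({0} \<times> carrier A.L) = {0} \<times> carrier B.L" if t: "t \<noteq> 0" for t
      proof
        show "(\<lambda>(a, x). (a, t \<odot>\<^bsub>B.L\<^esub> ?l x)) ` ({0} \<times> carrier A.L) \<subseteq> {0} \<times> carrier B.L"
          using closed B.L_closed(3) by auto
        show "{0} \<times> carrier B.L \<subseteq> (\<lambda>(a, x). (a, t \<odot>\<^bsub>B.L\<^esub> ?l x)) ` ({0} \<times> carrier A.L)"
        proof clarify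
          fix y assume y: "y \<in> carrier B.L"
          obtain z where z: "z \<in> carrier A.L" "z \<noteq> (\<lambda>C. 0)" using A.L_generator by blast
          obtain c where c: "y = (\<lambda>C. c * ?l z C)" using span[OF z y] .
          have "?l (\<lambda>C. (c / t) * z C) = (\<lambda>C. (c / t) * ?l z C)" by (rule smult)
          then have "(0, y) = (\<lambda>(a, x). (a, t \<odot>\<^bsub>B.L\<^esub> ?l x)) (0, \<lambda>C. (c / t) * z C)"
            using t by (simp only: c prod.case B.L_simps) simp
          then show "(0, y) \<in> (\<lambda>(a, x). (a, t \<odot>\<^bsub>B.L\<^esub> ?l x)) ` ({0} \<times> carrier A.L)"
            using A.L_closed(3)[OF z(1), of "c / t"] by (intro image_eqI) auto
        qed
      qed
      then have "?P g t \<longleftrightarrow> snd E' = {0} \<times> carrier B.L" if "t \<noteq> 0" for t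
        unfolding zero(1) using that by metis
      then have "(\<exists>t. t \<noteq> 0 \<and> ?P g t) \<longleftrightarrow> snd E' = {0} \<times> carrier B.L"
        using zero_neq_one by metis
      also have "\<dots> \<longleftrightarrow> A1_zero E'" by (simp add: A1_zero_def)
      also have "\<dots> \<longleftrightarrow> (A1_zero E \<longleftrightarrow> A1_zero E') \<and> (A1_infinity E \<longleftrightarrow> A1_infinity E')"
        using E' by (cases rule: ext_lag_cases) (use zero in auto)
      finally show ?thesis .
    next
      case z: (slope z)
      show ?thesis
        using E'
      proof (cases rule: ext_lag_cases)
        case zero
        then show ?thesis using z A.slope_not_zero by (metis img)
      next
        case z': (slope z')
        have "?P g t \<longleftrightarrow> z' = (\<lambda>C. t * ?l z C)" for t
          unfolding z(2) z'(2) img using inj by auto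
        moreover have "(\<exists>t. t \<noteq> 0 \<and> z' = (\<lambda>C. t * ?l z C)) \<longleftrightarrow> (z = (\<lambda>C. 0) \<longleftrightarrow> z' = (\<lambda>C. 0))"
        proof
          assume "\<exists>t. t \<noteq> 0 \<and> z' = (\<lambda>C. t * ?l z C)"
          then obtain t where t: "t \<noteq> 0" "z' = (\<lambda>C. t * ?l z C)" by blast
          then have "z' = (\<lambda>C. 0) \<longleftrightarrow> ?l z = (\<lambda>C. 0)" by (simp add: fun_eq_iff)
          then show "z = (\<lambda>C. 0) \<longleftrightarrow> z' = (\<lambda>C. 0)" using eq0[OF z(1)] by simp
        next
          assume iff: "z = (\<lambda>C. 0) \<longleftrightarrow> z' = (\<lambda>C. 0)"
          show "\<exists>t. t \<noteq> 0 \<and> z' = (\<lambda>C. t * ?l z C)"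
          proof (cases "z = (\<lambda>C. 0)")
            case True
            then have "z' = (\<lambda>C. 1 * ?l z C)" using iff eq0[OF z(1)] by simp
            then show ?thesis by (intro exI[of _ 1]) simp
          next
            case False
            obtain c where c: "z' = (\<lambda>C. c * ?l z C)" using span[OF z(1) False z'(1)] .
            then have "c \<noteq> 0" using False iff by auto
            with c show ?thesis by blast
          qed
        qed
        ultimately show ?thesis using z z' by simp
      qed
    qed
  qed
  have "ext_lag_iso E E' \<noteq> {} \<longleftrightarrow> (\<exists>g\<in>lag_iso (fst E) (fst E'). \<exists>t. t \<noteq> 0 \<and> ?P g t)"
    unfolding ext_lag_iso_def by blast
  then show ?thesis using iff by blast
qed

section \<open>The bijections\<close>

text \<open>An isomorphism carries the kernel of \<mu> onto the kernel of the other \<mu>.\<close>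

lemma gm_iso_ordinary:
  assumes D: "is_gm_data D" and D': "is_gm_data D'" and iso: "gm_iso D D' \<noteq> {}" and o: "gm_ordinary D"
  shows "gm_ordinary D'"
proof -
  obtain v0 l where c: "gm_choice D v0 l" using gm_choice_exists[OF D] by blast
  interpret A: gm_line D l using D c by unfold_locales (auto simp: gm_choice_def)
  obtain f g h where "(f, g, h) \<in> gm_iso D D'" using iso by (metis ex_in_conv prod_cases3)
  then have s: "lin_iso A.W (gm_W D') f" "lin_iso A.V (gm_V6 D') g" "lin_iso A.L (gm_L D') h"
    and m: "\<And>w. w \<in> carrier A.W \<Longrightarrow> ext_map (gm_V6 D') g (A.mu w) = gm_mu_pure D' (h l) (f w)"
    unfolding gm_iso_iff[OF D D' A.l] gm_scalar_iso_def by auto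
  interpret B: gm_line D' "h l" using D' lin_iso_nonzero[OF s(3) A.l] by unfold_locales auto
  have G: "lin (ext_alg A.V) (ext_alg B.V) (ext_map B.V g)" by (rule lin_ext_map[OF lin_iso_linear[OF s(2)]])
  have "w' = \<zero>\<^bsub>B.W\<^esub>" if w': "w' \<in> gm_W1 D'" for w'
  proof -
    have "w' \<in> f ` carrier A.W" using B.W1W[OF w'] lin_iso_image[OF s(1)] by simp
    then obtain w where w: "w \<in> carrier A.W" "w' = f w" by blast
    have mE: "A.mu w \<in> carrier (ext_alg A.V)" using A.V.pow_closed[OF A.UV A.mu_closed[OF A.l(1) w(1)]] .
    have "ext_map B.V g (A.mu w) = ext_map B.V g \<zero>\<^bsub>ext_alg A.V\<^esub>"
      using m[OF w(1)] w' w(2) linear_map_zero[OF G] by (simp add: B.W1_eq)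
    then have "A.mu w = \<zero>\<^bsub>ext_alg A.V\<^esub>"
      using ext_map_inverse(1)[OF s(2) mE] ext_map_inverse(1)[OF s(2) kspace.zeroC[OF A.V.kspace_ext]] by metis
    then have "w \<in> gm_W1 D" using w(1) by (simp add: A.W1_eq)
    then show ?thesis using o w(2) linear_map_zero[OF lin_iso_linear[OF s(1)]] by (simp add: gm_ordinary_def)
  qed
  moreover have "\<zero>\<^bsub>B.W\<^esub> \<in> gm_W1 D'" using B.W1_sub by (simp add: B.W.subspace_iff)
  ultimately show ?thesis unfolding gm_ordinary_def by blast
qed

lemma gm_groupoid_sel: "gpd_obj (gm_groupoid P) = {D. is_gm_data D \<and> P D}" "gpd_hom (gm_groupoid P) = gm_iso"
  by (simp_all add: gm_groupoid_def)

lemma gm_iso_sym: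
  assumes D: "is_gm_data D" "is_gm_data D'" and iso: "gm_iso D D' \<noteq> {}"
  shows "gm_iso D' D \<noteq> {}"
  using groupoid.inverse[OF gm_groupoid_groupoid[of "\<lambda>_. True"], of D D'] D iso by (auto simp: gm_groupoid_sel)

lemma lag_groupoid_sel: "gpd_obj lag_groupoid = {\<Lambda>. is_lag_data \<Lambda>}" "gpd_hom lag_groupoid = lag_iso"
  by (simp_all add: lag_groupoid_def)

lemma ext_lag_groupoid_sel: "gpd_obj (ext_lag_groupoid P) = {E. is_ext_lag_data E \<and> P E}" "gpd_hom (ext_lag_groupoid P) = ext_lag_iso"
  by (simp_all add: ext_lag_groupoid_def)

lemma gm_iso_lag_iso:
  assumes D: "is_gm_data D" "gm_lci D" and D': "is_gm_data D'" "gm_lci D'" and iso: "gm_iso D D' \<noteq> {}"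
  shows "lag_iso (gm_to_lag D) (gm_to_lag D') \<noteq> {}"
proof -
  obtain F where "F \<in> gm_iso D D'" using iso by blast
  then have "gm_iso_to_lag D D' F \<in> gpd_hom lag_groupoid (gm_to_lag D) (gm_to_lag D')"
    using D D' by (intro groupoid_functor.hom[OF gm_functor]) (simp_all add: gm_groupoid_sel)
  then show ?thesis by (auto simp: lag_groupoid_sel)
qed

lemma ordinary_bijection:
  assumes k: "infinite (UNIV :: 'k::field set)" and j: "inj (jw :: 'k \<Rightarrow> 'w)" "inj (jl :: 'k \<Rightarrow> 'l)"
  shows "bij_betw (on_iso_classes lag_groupoid gm_to_lag)
    (iso_classes (gm_groupoid (gm_ordinary :: ('k, 'w, 'v, 'l) gm_data \<Rightarrow> bool))) (iso_classes lag_groupoid)"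
proof -
  let ?G = "gm_groupoid (gm_ordinary :: ('k, 'w, 'v, 'l) gm_data \<Rightarrow> bool)"
  have "bij_betw (\<lambda>C. \<Union>D\<in>C. gpd_iso_rel lag_groupoid `` {E. E = gm_to_lag D})
      (gpd_obj ?G // gpd_iso_rel ?G) (gpd_obj lag_groupoid // gpd_iso_rel lag_groupoid)"
  proof (rule bij_betw_quotients)
    show "equiv (gpd_obj ?G) (gpd_iso_rel ?G)" by (rule groupoid.iso_rel_equiv[OF gm_groupoid_groupoid])
    show "equiv (gpd_obj lag_groupoid) (gpd_iso_rel lag_groupoid)" by (rule groupoid.iso_rel_equiv[OF lag_groupoid_groupoid])
    show "E \<in> gpd_obj lag_groupoid" if "D \<in> gpd_obj ?G" "E = gm_to_lag D" for D E
      using that gm_to_lag_data[of D] by (auto simp: gm_groupoid_sel lag_groupoid_sel gm_lci_def)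
    show "\<exists>D\<in>gpd_obj ?G. E = gm_to_lag D" if E: "E \<in> gpd_obj lag_groupoid" for E
    proof -
      obtain D :: "('k, 'w, 'v, 'l) gm_data" where "is_gm_data D" "gm_to_lag D = E" "gm_ordinary D"
        using gm_construct[of E jw jl False] E k j by (auto simp: lag_groupoid_sel)
      then show ?thesis by (auto simp: gm_groupoid_sel)
    qed
    fix D D' :: "('k, 'w, 'v, 'l) gm_data" and E E'
    assume D: "D \<in> gpd_obj ?G" "D' \<in> gpd_obj ?G" and E: "E = gm_to_lag D" "E' = gm_to_lag D'"
    then have D1: "is_gm_data D" "gm_ordinary D" "gm_lci D" "is_gm_data D'" "gm_ordinary D'" "gm_lci D'"
      by (auto simp: gm_groupoid_sel gm_lci_def)
    have "gm_iso D D' \<noteq> {} \<longleftrightarrow> lag_iso E E' \<noteq> {}"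
      unfolding E using gm_iso_lag_iso[OF D1(1,3,4,6)] gm_iso_lift[OF D1(1,3,4,6)] D1(2,5) by blast
    then show "(D, D') \<in> gpd_iso_rel ?G \<longleftrightarrow> (E, E') \<in> gpd_iso_rel lag_groupoid"
      using D1 gm_to_lag_data[of D] gm_to_lag_data[of D'] E by (auto simp: gpd_iso_rel_def gm_groupoid_sel lag_groupoid_sel)
  qed auto
  then show ?thesis by (simp add: on_iso_classes_def[abs_def] iso_classes_def)
qed

lemma ext_lag_rel: "(E, E') \<in> gpd_iso_rel (ext_lag_groupoid P) \<longleftrightarrow> is_ext_lag_data E \<and> is_ext_lag_data E' \<and> P E \<and> P E'
    \<and> (fst E, fst E') \<in> gpd_iso_rel lag_groupoid \<and> (A1_zero E \<longleftrightarrow> A1_zero E') \<and> (A1_infinity E \<longleftrightarrow> A1_infinity E')"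
proof (cases "is_ext_lag_data E \<and> is_ext_lag_data E'")
  case True
  then have "is_lag_data (fst E)" "is_lag_data (fst E')" by (auto simp: is_ext_lag_data_def)
  with True show ?thesis
    by (auto simp: gpd_iso_rel_def ext_lag_groupoid_sel lag_groupoid_sel ext_lag_iso_iff)
qed (auto simp: gpd_iso_rel_def ext_lag_groupoid_sel)

text \<open>By \<open>ext_lag_rel\<close> the relation is the one for Lagrangian data together with
  equality of types, so its properties are inherited from there and not from a groupoid structure on
  extended data.\<close>

lemma ext_lag_rel_equiv: "equiv (gpd_obj (ext_lag_groupoid P)) (gpd_iso_rel (ext_lag_groupoid P))"
proof (rule equivI)
  note e = groupoid.iso_rel_equiv[OF lag_groupoid_groupoid]
  show "gpd_iso_rel (ext_lag_groupoid P) \<subseteq> gpd_obj (ext_lag_groupoid P) \<times> gpd_obj (ext_lag_groupoid P)"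
    by (auto simp: gpd_iso_rel_def)
  show "refl_on (gpd_obj (ext_lag_groupoid P)) (gpd_iso_rel (ext_lag_groupoid P))"
    using e unfolding refl_on_def equiv_def ext_lag_rel by (auto simp: ext_lag_groupoid_sel lag_groupoid_sel is_ext_lag_data_def)
  show "sym (gpd_iso_rel (ext_lag_groupoid P))"
    unfolding sym_def ext_lag_rel using e by (auto simp: equiv_def dest: symD)
  show "trans (gpd_iso_rel (ext_lag_groupoid P))"
    unfolding trans_def ext_lag_rel using e by (auto simp: equiv_def dest: transD)
qed

lemma gm_ext_lag_types:
  assumes D: "is_gm_data D" "gm_lci D" and E: "gm_ext_lag D E"
  shows "A1_zero E \<longleftrightarrow> gm_ordinary D" "\<not> A1_infinity E"
proof -
  have e: "is_ext_lag_data E" using E by (simp add: gm_ext_lag_def)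
  show "A1_zero E \<longleftrightarrow> gm_ordinary D"
    using E D(2) by (auto simp: gm_ext_lag_def A1_one_def gm_lci_def)
  show "\<not> A1_infinity E"
    using e by (cases rule: ext_lag_cases) (use E D(2) in \<open>auto simp: gm_ext_lag_def A1_one_def gm_lci_def\<close>)
qed

lemma gm_ext_lag_exists:
  assumes D: "is_gm_data D" "gm_lci D"
  shows "\<exists>E. gm_ext_lag D E"
proof -
  interpret lag "gm_to_lag D" using gm_to_lag_data[OF D] by unfold_locales
  show ?thesis
  proof (cases "gm_ordinary D")
    case True
    then have "gm_ext_lag D (gm_to_lag D, {0} \<times> carrier L)"
      using gm_ordinary_not_special[OF D(1)] data lagrangian_zero by (simp add: gm_ext_lag_def is_ext_lag_data_def A1_zero_def)
    then show ?thesis ..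
  next
    case False
    obtain z where z: "z \<in> carrier L" "z \<noteq> (\<lambda>C. 0)" using L_generator by blast
    \<comment> \<open>Any nonzero z gives a line of type A1 = 1.\<close>
    have "gm_ext_lag D (gm_to_lag D, slope z)"
      using False data lagrangian_slope[OF z(1)] slope_not_zero slope_infinity[of z] z(2)
      by (simp add: gm_ext_lag_def is_ext_lag_data_def A1_one_def A1_zero_def A1_infinity_def)
    then show ?thesis ..
  qed
qed

lemma extended_bijection:
  assumes k: "infinite (UNIV :: 'k::field set)" and j: "inj (jw :: 'k \<Rightarrow> 'w)" "inj (jl :: 'k \<Rightarrow> 'l)"
    and sq: "\<forall>a :: 'k. \<exists>b. b\<^sup>2 = a"
  shows "bij_betw gm_ext_on_classes
    (iso_classes (gm_groupoid (gm_lci :: ('k, 'w, 'v, 'l) gm_data \<Rightarrow> bool)))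
    (iso_classes (ext_lag_groupoid (\<lambda>E :: ('k, 'v) ext_lag_data. \<not> A1_infinity E)))"
proof -
  let ?G = "gm_groupoid (gm_lci :: ('k, 'w, 'v, 'l) gm_data \<Rightarrow> bool)"
  let ?H = "ext_lag_groupoid (\<lambda>E :: ('k, 'v) ext_lag_data. \<not> A1_infinity E)"
  have "bij_betw (\<lambda>C. \<Union>D\<in>C. gpd_iso_rel (ext_lag_groupoid (\<lambda>E. True)) `` {E. gm_ext_lag D E})
      (gpd_obj ?G // gpd_iso_rel ?G) (gpd_obj ?H // gpd_iso_rel ?H)"
  proof (rule bij_betw_quotients)
    show "equiv (gpd_obj ?G) (gpd_iso_rel ?G)" by (rule groupoid.iso_rel_equiv[OF gm_groupoid_groupoid])
    show "equiv (gpd_obj ?H) (gpd_iso_rel ?H)" by (rule ext_lag_rel_equiv)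
    show "E \<in> gpd_obj ?H" if "D \<in> gpd_obj ?G" "gm_ext_lag D E" for D E
      using that gm_ext_lag_types(2)[of D E] by (auto simp: gm_groupoid_sel ext_lag_groupoid_sel gm_ext_lag_def)
    show "\<exists>E. gm_ext_lag D E" if "D \<in> gpd_obj ?G" for D
      using that gm_ext_lag_exists by (auto simp: gm_groupoid_sel)
    \<comment> \<open>The type of A1 is an isomorphism invariant, so the class of \<open>E\<close>
      among all extended data stays in the smaller groupoid.\<close>
    show "gpd_iso_rel (ext_lag_groupoid (\<lambda>E. True)) `` {E} = gpd_iso_rel ?H `` {E}" if "E \<in> gpd_obj ?H" for E
      using that by (auto simp: ext_lag_groupoid_sel ext_lag_rel)
    show "\<exists>D\<in>gpd_obj ?G. gm_ext_lag D E" if E: "E \<in> gpd_obj ?H" for E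
    proof -
      have E1: "is_ext_lag_data E" "is_lag_data (fst E)" "\<not> A1_infinity E" using E by (auto simp: ext_lag_groupoid_sel is_ext_lag_data_def)
      obtain D :: "('k, 'w, 'v, 'l) gm_data" where D: "is_gm_data D" "gm_to_lag D = fst E"
        "if \<not> A1_zero E then gm_special D else gm_ordinary D"
        using gm_construct[OF E1(2) k j] by metis
      have "gm_lci D" using D(3) by (auto simp: gm_lci_def split: if_splits)
      moreover have "gm_ext_lag D E"
        using D E1 gm_ordinary_not_special[OF D(1)] by (auto simp: gm_ext_lag_def A1_one_def split: if_splits)
      ultimately show ?thesis using D(1) by (auto simp: gm_groupoid_sel)
    qed
    fix D D' :: "('k, 'w, 'v, 'l) gm_data" and E E'
    assume D: "D \<in> gpd_obj ?G" "D' \<in> gpd_obj ?G" and E: "gm_ext_lag D E" "gm_ext_lag D' E'"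
    then have D1: "is_gm_data D" "gm_lci D" "is_gm_data D'" "gm_lci D'" by (auto simp: gm_groupoid_sel)
    have E1: "fst E = gm_to_lag D" "fst E' = gm_to_lag D'" "is_ext_lag_data E" "is_ext_lag_data E'" using E by (auto simp: gm_ext_lag_def)
    note ty = gm_ext_lag_types[OF D1(1,2) E(1)] gm_ext_lag_types[OF D1(3,4) E(2)]
    \<comment> \<open>An isomorphism preserves being ordinary. Conversely lci data of which neither
      is ordinary are both special, so \<open>gm_iso_lift\<close> applies, with \<open>sq\<close>
      supplying the square root.\<close>
    have "gm_iso D D' \<noteq> {} \<longleftrightarrow> lag_iso (fst E) (fst E') \<noteq> {} \<and> (gm_ordinary D \<longleftrightarrow> gm_ordinary D')"
    proof
      assume iso: "gm_iso D D' \<noteq> {}"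
      then show "lag_iso (fst E) (fst E') \<noteq> {} \<and> (gm_ordinary D \<longleftrightarrow> gm_ordinary D')"
        using gm_iso_lag_iso[OF D1 iso] gm_iso_ordinary[OF D1(1,3) iso] gm_iso_ordinary[OF D1(3,1) gm_iso_sym[OF D1(1,3) iso]] E1
        by auto
    next
      assume "lag_iso (fst E) (fst E') \<noteq> {} \<and> (gm_ordinary D \<longleftrightarrow> gm_ordinary D')"
      then show "gm_iso D D' \<noteq> {}"
        using gm_iso_lift[OF D1] E1 sq D1(2,4) unfolding gm_lci_def by auto
    qed
    then show "(D, D') \<in> gpd_iso_rel ?G \<longleftrightarrow> (E, E') \<in> gpd_iso_rel ?H"
      unfolding ext_lag_rel using ty E1 D1 by (auto simp: gpd_iso_rel_def gm_groupoid_sel lag_groupoid_sel is_ext_lag_data_def)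
  qed
  then show ?thesis by (simp add: gm_ext_on_classes_def[abs_def] iso_classes_def)
qed

text \<open>The two cardinality conditions make the types of W and L large enough for surjectivity:
  the constructed W is a copy of a finite-dimensional space and L a copy of the field. V6 is taken
  over from the Lagrangian data.\<close>

theorem theorem3p6:
  fixes emb :: "'k::field \<Rightarrow> complex"
  assumes "field_hom emb"
    and "(UNIV :: 'k set) \<lesssim> (UNIV :: 'w set)"
    and "(UNIV :: 'k set) \<lesssim> (UNIV :: 'l set)"
  shows
    "(\<forall>D \<in> gpd_obj (gm_groupoid (gm_lci :: ('k, 'w, 'v, 'l) gm_data \<Rightarrow> bool)).
        \<forall>v0 l. gm_choice D v0 l \<longrightarrow> gm_A D = gm_A_of D v0 l)
   \<and> groupoid_functor (gm_groupoid (gm_lci :: ('k, 'w, 'v, 'l) gm_data \<Rightarrow> bool))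
        lag_groupoid gm_to_lag gm_iso_to_lag
   \<and> bij_betw (on_iso_classes lag_groupoid gm_to_lag)
        (iso_classes (gm_groupoid (gm_ordinary :: ('k, 'w, 'v, 'l) gm_data \<Rightarrow> bool)))
        (iso_classes lag_groupoid)
   \<and> ((\<forall>a :: 'k. \<exists>b. b\<^sup>2 = a) \<longrightarrow>
        bij_betw gm_ext_on_classes
          (iso_classes (gm_groupoid (gm_lci :: ('k, 'w, 'v, 'l) gm_data \<Rightarrow> bool)))
          (iso_classes (ext_lag_groupoid (\<lambda>E :: ('k, 'v) ext_lag_data. \<not> A1_infinity E))))"
proof -
  interpret field_hom emb by fact
  \<comment> \<open>A field with a homomorphism to the complex numbers has characteristic zero,
    hence is infinite; copying spaces into the given types relies on this.\<close>
  have inj: "inj (of_nat :: nat \<Rightarrow> 'k)"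
    by (rule injI) (metis hom_of_nat of_nat_eq_iff)
  have k: "infinite (UNIV :: 'k set)" by (rule infinite_super[OF subset_UNIV range_inj_infinite[OF inj]])
  obtain jw :: "'k \<Rightarrow> 'w" and jl :: "'k \<Rightarrow> 'l" where j: "inj jw" "inj jl" using assms(2,3) unfolding lepoll_def by blast
  show ?thesis
  proof (intro conjI ballI allI impI)
    show "gm_A D = gm_A_of D v0 l" if "D \<in> gpd_obj (gm_groupoid gm_lci)" "gm_choice D v0 l"
      for D :: "('k, 'w, 'v, 'l) gm_data" and v0 l
      using that by (simp add: gm_groupoid_sel gm_A_eq)
  qed (rule gm_functor ordinary_bijection[OF k j] extended_bijection[OF k j]; assumption?)+
qed

end
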